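(* Let $\phi_!$ be the functor from dioperads (without empty inputs or empty outputs) to cyclic operads defined in the context, and let $\phi^!$ be its left adjoint. Then $\phi^!(\mathcal Lie)=\mathcal BiLie$, the dioperad encoding Lie bialgebras, and $\phi^!(\mathcal As)=\mathcal Bal$, the dioperad encoding balanced infinitesimal bialgebras.
   Context: $k$ is a field of characteristic $0$; all objects are in $dgVect_k$ and operadic structures are considered without units. A cyclic operad $\mathcal O=\{\mathcal O((n))\}$ has $S_n$-modules $\mathcal O((n))$ and compositions along trees; $\mathcal Lie$ and $\mathcal As$ are the cyclic operads encoding Lie algebras and associative algebras. A dioperad $\mathcal P=\{\mathcal P(r,s)\}$, here with $r,s\ge1$, has $S_r\times S_s$-modules ($r$ outputs, $s$ inputs) and compositions along directed trees, each edge joining an output flag to an input flag. The functor $\phi_!$ is $\phi_!(\mathcal P)((n))=\bigoplus_{r+s=n,\ r,s\ge1}\mathcal P(r,s)\otimes_{k[S_r\times S_s]}k[S_n]$: elements are corollas all of whose flags are directed, decorated by $\mathcal P$; composing two such elements by gluing two flags is given by the composition of $\mathcal P$ if one of the flags is an output and the other an input, and is $0$ otherwise. It has a left adjoint $\phi^!$. A balanced infinitesimal bialgebra (Aguiar) is an associative algebra $A$ with a coassociative comultiplication $\Delta\colon A\to A\otimes A$ such that $\Delta(ab)=a\Delta(b)+\Delta(a)b$ (where $a(x\otimes y)=ax\otimes y$, $(x\otimes y)b=x\otimes yb$) and such that the balanceator vanishes: $ad_a(\tau\Delta(b))+\tau\,ad_b(\tau\Delta(a))=0$ for all $a,b$,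 where $\tau$ is the flip and $ad_a(x\otimes y)=ax\otimes y-x\otimes ya$. *)

theory Defs
  imports "HOL-Algebra.Module"
begin

text \<open>
  Conventions. The ground field is a \<open>field K\<close> of HOL-Algebra; vector spaces are
  \<open>module K M\<close>. A dg vector space is a family of vector spaces indexed by the degree
  \<open>n :: int\<close> with a differential of degree -1; signs follow the Koszul rule.

  Operadic objects are written over finite sets of flags instead of the skeleton: flags are
  natural numbers, the \<open>S\<^sub>n\<close>-module \<open>O((n))\<close> is the value at
  \<open>{1..n}\<close> of a functor on finite sets \<open>I\<close> of flags and bijections, and the
  \<open>S\<^sub>r \<times> S\<^sub>s\<close>-module \<open>P(r,s)\<close> is a value of a functor on pairs
  \<open>(A, B)\<close> of disjoint finite sets (output flags, input flags). Compositions along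
  trees are given by the compositions along trees with one edge, subject to the axioms for trees
  with two edges. There are no units.
\<close>

section \<open>Linear algebra\<close>

definition char_zero :: "('k, 'r) ring_scheme \<Rightarrow> bool" where
  "char_zero K \<longleftrightarrow> (\<forall>n::nat. n > 0 \<longrightarrow> [n] \<cdot>\<^bsub>K\<^esub> \<one>\<^bsub>K\<^esub> \<noteq> \<zero>\<^bsub>K\<^esub>)"

definition ksign :: "('k, 'r) ring_scheme \<Rightarrow> int \<Rightarrow> 'k" where
  "ksign K n = (if even n then \<one>\<^bsub>K\<^esub> else \<ominus>\<^bsub>K\<^esub> \<one>\<^bsub>K\<^esub>)"

definition lin_map ::
  "('k, 'r) ring_scheme \<Rightarrow> ('k, 'v) module \<Rightarrow> ('k, 'w) module \<Rightarrow> ('v \<Rightarrow> 'w) \<Rightarrow> bool" where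
  "lin_map K M N f \<longleftrightarrow>
     f \<in> carrier M \<rightarrow> carrier N \<and>
     (\<forall>x\<in>carrier M. \<forall>y\<in>carrier M. f (x \<oplus>\<^bsub>M\<^esub> y) = f x \<oplus>\<^bsub>N\<^esub> f y) \<and>
     (\<forall>c\<in>carrier K. \<forall>x\<in>carrier M. f (c \<odot>\<^bsub>M\<^esub> x) = c \<odot>\<^bsub>N\<^esub> f x)"

definition bilin_map ::
  "('k, 'r) ring_scheme \<Rightarrow> ('k, 'v) module \<Rightarrow> ('k, 'w) module \<Rightarrow> ('k, 'u) module \<Rightarrow>
   ('v \<Rightarrow> 'w \<Rightarrow> 'u) \<Rightarrow> bool" where
  "bilin_map K M N L f \<longleftrightarrow>
     (\<forall>x\<in>carrier M. lin_map K N L (f x)) \<and>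
     (\<forall>y\<in>carrier N. lin_map K M L (\<lambda>x. f x y))"


section \<open>Cyclic operads\<close>

text \<open>
  \<open>csp Q I n\<close> is the degree \<open>n\<close> part of \<open>Q((I))\<close>, and \<open>cact Q I n \<sigma>\<close> is the map to
  \<open>Q((\<sigma> ` I))\<close> induced by the bijection \<open>\<sigma>\<close> from \<open>I\<close> onto its image. The composition
  \<open>ccomp Q I m i J n j x y\<close> glues the flag \<open>i\<close> of \<open>x \<in> Q((I))\<close> to the flag
  \<open>j\<close> of \<open>y \<in> Q((J))\<close>, where \<open>I\<close> and \<open>J\<close> are disjoint.
\<close>

record ('k, 'v) cyc_data =
  csp :: "nat set \<Rightarrow> int \<Rightarrow> ('k, 'v) module"
  cdiff :: "nat set \<Rightarrow> int \<Rightarrow> 'v \<Rightarrow> 'v"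
  cact :: "nat set \<Rightarrow> int \<Rightarrow> (nat \<Rightarrow> nat) \<Rightarrow> 'v \<Rightarrow> 'v"
  ccomp :: "nat set \<Rightarrow> int \<Rightarrow> nat \<Rightarrow> nat set \<Rightarrow> int \<Rightarrow> nat \<Rightarrow> 'v \<Rightarrow> 'v \<Rightarrow> 'v"

definition cglue :: "nat set \<Rightarrow> nat \<Rightarrow> nat set \<Rightarrow> nat \<Rightarrow> bool" where
  "cglue I i J j \<longleftrightarrow> finite I \<and> finite J \<and> I \<inter> J = {} \<and> i \<in> I \<and> j \<in> J"

locale cyclic_operad = field K
  for K :: "('k, 'r) ring_scheme" (structure) +
  fixes Q :: "('k, 'v) cyc_data"
  assumes csp_module: "finite I \<Longrightarrow> module K (csp Q I n)"
    and cdiff_linear: "finite I \<Longrightarrow> lin_map K (csp Q I n) (csp Q I (n - 1)) (cdiff Q I n)"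
    and cdiff_cdiff:
      "\<lbrakk>finite I; x \<in> carrier (csp Q I n)\<rbrakk> \<Longrightarrow>
       cdiff Q I (n - 1) (cdiff Q I n x) = \<zero>\<^bsub>csp Q I (n - 2)\<^esub>"
    and cact_linear:
      "\<lbrakk>finite I; inj_on \<sigma> I\<rbrakk> \<Longrightarrow> lin_map K (csp Q I n) (csp Q (\<sigma> ` I) n) (cact Q I n \<sigma>)"
    and cact_cong:
      "\<lbrakk>finite I; inj_on \<sigma> I; \<And>i. i \<in> I \<Longrightarrow> \<sigma> i = \<tau> i; x \<in> carrier (csp Q I n)\<rbrakk> \<Longrightarrow>
       cact Q I n \<sigma> x = cact Q I n \<tau> x"
    and cact_id: "\<lbrakk>finite I; x \<in> carrier (csp Q I n)\<rbrakk> \<Longrightarrow> cact Q I n id x = x"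
    and cact_comp:
      "\<lbrakk>finite I; inj_on \<sigma> I; inj_on \<tau> (\<sigma> ` I); x \<in> carrier (csp Q I n)\<rbrakk> \<Longrightarrow>
       cact Q (\<sigma> ` I) n \<tau> (cact Q I n \<sigma> x) = cact Q I n (\<tau> \<circ> \<sigma>) x"
    and cact_cdiff:
      "\<lbrakk>finite I; inj_on \<sigma> I; x \<in> carrier (csp Q I n)\<rbrakk> \<Longrightarrow>
       cdiff Q (\<sigma> ` I) n (cact Q I n \<sigma> x) = cact Q I (n - 1) \<sigma> (cdiff Q I n x)"
    and ccomp_bilinear:
      "cglue I i J j \<Longrightarrow>
       bilin_map K (csp Q I m) (csp Q J n) (csp Q ((I - {i}) \<union> (J - {j})) (m + n))
         (ccomp Q I m i J n j)"
    and ccomp_cdiff: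
      "\<lbrakk>cglue I i J j; x \<in> carrier (csp Q I m); y \<in> carrier (csp Q J n)\<rbrakk> \<Longrightarrow>
       cdiff Q ((I - {i}) \<union> (J - {j})) (m + n) (ccomp Q I m i J n j x y) =
         ccomp Q I (m - 1) i J n j (cdiff Q I m x) y
         \<oplus>\<^bsub>csp Q ((I - {i}) \<union> (J - {j})) (m + n - 1)\<^esub>
         ksign K m \<odot>\<^bsub>csp Q ((I - {i}) \<union> (J - {j})) (m + n - 1)\<^esub>
           ccomp Q I m i J (n - 1) j x (cdiff Q J n y)"
    and ccomp_cact:
      "\<lbrakk>cglue I i J j; inj_on \<sigma> (I \<union> J);
        x \<in> carrier (csp Q I m); y \<in> carrier (csp Q J n)\<rbrakk> \<Longrightarrow>
       cact Q ((I - {i}) \<union> (J - {j})) (m + n) \<sigma> (ccomp Q I m i J n j x y) =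
         ccomp Q (\<sigma> ` I) m (\<sigma> i) (\<sigma> ` J) n (\<sigma> j) (cact Q I m \<sigma> x) (cact Q J n \<sigma> y)"
    and ccomp_commute:
      "\<lbrakk>cglue I i J j; x \<in> carrier (csp Q I m); y \<in> carrier (csp Q J n)\<rbrakk> \<Longrightarrow>
       ccomp Q I m i J n j x y =
         ksign K (m * n) \<odot>\<^bsub>csp Q ((I - {i}) \<union> (J - {j})) (m + n)\<^esub> ccomp Q J n j I m i y x"
    and ccomp_assoc:
      "\<lbrakk>cglue I i J j; cglue J k L l; j \<noteq> k; I \<inter> L = {};
        x \<in> carrier (csp Q I m); y \<in> carrier (csp Q J n); z \<in> carrier (csp Q L p)\<rbrakk> \<Longrightarrow>
       ccomp Q ((I - {i}) \<union> (J - {j})) (m + n) k L p l (ccomp Q I m i J n j x y) z =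
       ccomp Q I m i ((J - {k}) \<union> (L - {l})) (n + p) j x (ccomp Q J n k L p l y z)"

definition cyc_hom ::
  "('k, 'r) ring_scheme \<Rightarrow> ('k, 'v) cyc_data \<Rightarrow> ('k, 'w) cyc_data \<Rightarrow>
   (nat set \<Rightarrow> int \<Rightarrow> 'v \<Rightarrow> 'w) \<Rightarrow> bool" where
  "cyc_hom K Q R f \<longleftrightarrow>
     (\<forall>I n. finite I \<longrightarrow> lin_map K (csp Q I n) (csp R I n) (f I n)) \<and>
     (\<forall>I n. finite I \<longrightarrow> (\<forall>x\<in>carrier (csp Q I n).
        f I (n - 1) (cdiff Q I n x) = cdiff R I n (f I n x))) \<and>
     (\<forall>I n \<sigma>. finite I \<longrightarrow> inj_on \<sigma> I \<longrightarrow> (\<forall>x\<in>carrier (csp Q I n).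
        f (\<sigma> ` I) n (cact Q I n \<sigma> x) = cact R I n \<sigma> (f I n x))) \<and>
     (\<forall>I m i J n j. cglue I i J j \<longrightarrow>
        (\<forall>x\<in>carrier (csp Q I m). \<forall>y\<in>carrier (csp Q J n).
          f ((I - {i}) \<union> (J - {j})) (m + n) (ccomp Q I m i J n j x y) =
          ccomp R I m i J n j (f I m x) (f J n y)))"


section \<open>Dioperads\<close>

text \<open>
  In \<open>dsp P A B n\<close> the set \<open>A\<close> consists of the output flags and \<open>B\<close> of the input flags; both
  are nonempty. The composition \<open>dcomp P A B m a C D n d x y\<close> joins the output \<open>a \<in> A\<close>
  of \<open>x\<close> to the input \<open>d \<in> D\<close> of \<open>y\<close>.
\<close>

record ('k, 'v) dio_data =
  dsp :: "nat set \<Rightarrow> nat set \<Rightarrow> int \<Rightarrow> ('k, 'v) module"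
  ddiff :: "nat set \<Rightarrow> nat set \<Rightarrow> int \<Rightarrow> 'v \<Rightarrow> 'v"
  dact :: "nat set \<Rightarrow> nat set \<Rightarrow> int \<Rightarrow> (nat \<Rightarrow> nat) \<Rightarrow> 'v \<Rightarrow> 'v"
  dcomp :: "nat set \<Rightarrow> nat set \<Rightarrow> int \<Rightarrow> nat \<Rightarrow> nat set \<Rightarrow> nat set \<Rightarrow> int \<Rightarrow> nat \<Rightarrow>
            'v \<Rightarrow> 'v \<Rightarrow> 'v"

definition biflags :: "nat set \<Rightarrow> nat set \<Rightarrow> bool" where
  "biflags A B \<longleftrightarrow> finite A \<and> finite B \<and> A \<noteq> {} \<and> B \<noteq> {} \<and> A \<inter> B = {}"

definition dglue ::
  "nat set \<Rightarrow> nat set \<Rightarrow> nat \<Rightarrow> nat set \<Rightarrow> nat set \<Rightarrow> nat \<Rightarrow> bool" where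
  "dglue A B a C D d \<longleftrightarrow>
     biflags A B \<and> biflags C D \<and> (A \<union> B) \<inter> (C \<union> D) = {} \<and> a \<in> A \<and> d \<in> D"

text \<open>
  A directed tree with three vertices and two edges is a chain, or has two edges leaving one
  vertex, or has two edges entering one vertex; these are the three associativity axioms.
\<close>

locale dioperad = field K
  for K :: "('k, 'r) ring_scheme" (structure) +
  fixes P :: "('k, 'v) dio_data"
  assumes dsp_module: "biflags A B \<Longrightarrow> module K (dsp P A B n)"
    and ddiff_linear:
      "biflags A B \<Longrightarrow> lin_map K (dsp P A B n) (dsp P A B (n - 1)) (ddiff P A B n)"
    and ddiff_ddiff:
      "\<lbrakk>biflags A B; x \<in> carrier (dsp P A B n)\<rbrakk> \<Longrightarrow>
       ddiff P A B (n - 1) (ddiff P A B n x) = \<zero>\<^bsub>dsp P A B (n - 2)\<^esub>"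
    and dact_linear:
      "\<lbrakk>biflags A B; inj_on \<sigma> (A \<union> B)\<rbrakk> \<Longrightarrow>
       lin_map K (dsp P A B n) (dsp P (\<sigma> ` A) (\<sigma> ` B) n) (dact P A B n \<sigma>)"
    and dact_cong:
      "\<lbrakk>biflags A B; inj_on \<sigma> (A \<union> B); \<And>i. i \<in> A \<union> B \<Longrightarrow> \<sigma> i = \<tau> i;
        x \<in> carrier (dsp P A B n)\<rbrakk> \<Longrightarrow>
       dact P A B n \<sigma> x = dact P A B n \<tau> x"
    and dact_id: "\<lbrakk>biflags A B; x \<in> carrier (dsp P A B n)\<rbrakk> \<Longrightarrow> dact P A B n id x = x"
    and dact_comp:
      "\<lbrakk>biflags A B; inj_on \<sigma> (A \<union> B); inj_on \<tau> (\<sigma> ` (A \<union> B)); x \<in> carrier (dsp P A B n)\<rbrakk> \<Longrightarrow>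
       dact P (\<sigma> ` A) (\<sigma> ` B) n \<tau> (dact P A B n \<sigma> x) = dact P A B n (\<tau> \<circ> \<sigma>) x"
    and dact_ddiff:
      "\<lbrakk>biflags A B; inj_on \<sigma> (A \<union> B); x \<in> carrier (dsp P A B n)\<rbrakk> \<Longrightarrow>
       ddiff P (\<sigma> ` A) (\<sigma> ` B) n (dact P A B n \<sigma> x) =
       dact P A B (n - 1) \<sigma> (ddiff P A B n x)"
    and dcomp_bilinear:
      "dglue A B a C D d \<Longrightarrow>
       bilin_map K (dsp P A B m) (dsp P C D n)
         (dsp P ((A - {a}) \<union> C) (B \<union> (D - {d})) (m + n)) (dcomp P A B m a C D n d)"
    and dcomp_ddiff:
      "\<lbrakk>dglue A B a C D d; x \<in> carrier (dsp P A B m); y \<in> carrier (dsp P C D n)\<rbrakk> \<Longrightarrow>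
       ddiff P ((A - {a}) \<union> C) (B \<union> (D - {d})) (m + n) (dcomp P A B m a C D n d x y) =
         dcomp P A B (m - 1) a C D n d (ddiff P A B m x) y
         \<oplus>\<^bsub>dsp P ((A - {a}) \<union> C) (B \<union> (D - {d})) (m + n - 1)\<^esub>
         ksign K m \<odot>\<^bsub>dsp P ((A - {a}) \<union> C) (B \<union> (D - {d})) (m + n - 1)\<^esub>
           dcomp P A B m a C D (n - 1) d x (ddiff P C D n y)"
    and dcomp_dact:
      "\<lbrakk>dglue A B a C D d; inj_on \<sigma> (A \<union> B \<union> C \<union> D);
        x \<in> carrier (dsp P A B m); y \<in> carrier (dsp P C D n)\<rbrakk> \<Longrightarrow>
       dact P ((A - {a}) \<union> C) (B \<union> (D - {d})) (m + n) \<sigma> (dcomp P A B m a C D n d x y) =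
       dcomp P (\<sigma> ` A) (\<sigma> ` B) m (\<sigma> a) (\<sigma> ` C) (\<sigma> ` D) n (\<sigma> d)
         (dact P A B m \<sigma> x) (dact P C D n \<sigma> y)"
    and dcomp_assoc_chain:
      "\<lbrakk>dglue A B a C D d; dglue C D c E F f; (A \<union> B) \<inter> (E \<union> F) = {};
        x \<in> carrier (dsp P A B m); y \<in> carrier (dsp P C D n); z \<in> carrier (dsp P E F p)\<rbrakk> \<Longrightarrow>
       dcomp P ((A - {a}) \<union> C) (B \<union> (D - {d})) (m + n) c E F p f
         (dcomp P A B m a C D n d x y) z =
       dcomp P A B m a ((C - {c}) \<union> E) (D \<union> (F - {f})) (n + p) d
         x (dcomp P C D n c E F p f y z)"
    and dcomp_assoc_out:
      "\<lbrakk>dglue A B a C D d; dglue A B b E F f; a \<noteq> b; (C \<union> D) \<inter> (E \<union> F) = {};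
        x \<in> carrier (dsp P A B m); y \<in> carrier (dsp P C D n); z \<in> carrier (dsp P E F p)\<rbrakk> \<Longrightarrow>
       dcomp P ((A - {a}) \<union> C) (B \<union> (D - {d})) (m + n) b E F p f
         (dcomp P A B m a C D n d x y) z =
       ksign K (n * p)
         \<odot>\<^bsub>dsp P ((((A - {a}) \<union> C) - {b}) \<union> E) ((B \<union> (D - {d})) \<union> (F - {f})) (m + n + p)\<^esub>
       dcomp P ((A - {b}) \<union> E) (B \<union> (F - {f})) (m + p) a C D n d
         (dcomp P A B m b E F p f x z) y"
    and dcomp_assoc_in:
      "\<lbrakk>dglue A B a E F f; dglue C D c E F g; f \<noteq> g; (A \<union> B) \<inter> (C \<union> D) = {};
        x \<in> carrier (dsp P A B m); y \<in> carrier (dsp P C D n); z \<in> carrier (dsp P E F p)\<rbrakk> \<Longrightarrow>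
       dcomp P A B m a ((C - {c}) \<union> E) (D \<union> (F - {g})) (n + p) f
         x (dcomp P C D n c E F p g y z) =
       ksign K (m * n)
         \<odot>\<^bsub>dsp P ((A - {a}) \<union> ((C - {c}) \<union> E)) (B \<union> ((D \<union> (F - {g})) - {f})) (m + (n + p))\<^esub>
       dcomp P C D n c ((A - {a}) \<union> E) (B \<union> (F - {f})) (m + p) g
         y (dcomp P A B m a E F p f x z)"

definition dio_hom ::
  "('k, 'r) ring_scheme \<Rightarrow> ('k, 'v) dio_data \<Rightarrow> ('k, 'w) dio_data \<Rightarrow>
   (nat set \<Rightarrow> nat set \<Rightarrow> int \<Rightarrow> 'v \<Rightarrow> 'w) \<Rightarrow> bool" where
  "dio_hom K P R f \<longleftrightarrow>
     (\<forall>A B n. biflags A B \<longrightarrow> lin_map K (dsp P A B n) (dsp R A B n) (f A B n)) \<and>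
     (\<forall>A B n. biflags A B \<longrightarrow> (\<forall>x\<in>carrier (dsp P A B n).
        f A B (n - 1) (ddiff P A B n x) = ddiff R A B n (f A B n x))) \<and>
     (\<forall>A B n \<sigma>. biflags A B \<longrightarrow> inj_on \<sigma> (A \<union> B) \<longrightarrow> (\<forall>x\<in>carrier (dsp P A B n).
        f (\<sigma> ` A) (\<sigma> ` B) n (dact P A B n \<sigma> x) = dact R A B n \<sigma> (f A B n x))) \<and>
     (\<forall>A B m a C D n d. dglue A B a C D d \<longrightarrow>
        (\<forall>x\<in>carrier (dsp P A B m). \<forall>y\<in>carrier (dsp P C D n).
          f ((A - {a}) \<union> C) (B \<union> (D - {d})) (m + n) (dcomp P A B m a C D n d x y) =
          dcomp R A B m a C D n d (f A B m x) (f C D n y)))"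

definition dio_iso ::
  "('k, 'r) ring_scheme \<Rightarrow> ('k, 'v) dio_data \<Rightarrow> ('k, 'w) dio_data \<Rightarrow> bool" where
  "dio_iso K P R \<longleftrightarrow>
     (\<exists>f. dio_hom K P R f \<and>
       (\<forall>A B n. biflags A B \<longrightarrow>
          bij_betw (f A B n) (carrier (dsp P A B n)) (carrier (dsp R A B n))))"


section \<open>The functor from dioperads to cyclic operads\<close>

text \<open>
  The induced module \<open>P(r,s) \<otimes> k[S\<^sub>n]\<close>, tensored over \<open>k[S\<^sub>r \<times> S\<^sub>s]\<close>, is the direct sum of
  the \<open>P(A, I - A)\<close> over all \<open>A \<subseteq> I\<close> with \<open>r\<close> elements, where \<open>I\<close> has
  \<open>n\<close> elements: \<open>A\<close> is the set of those flags of the corolla that are directed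
  outwards. The (finite) direct sum is realised by extensional functions of \<open>A\<close>.
\<close>

definition splits :: "nat set \<Rightarrow> nat set set" where
  "splits I = {A. A \<subseteq> I \<and> A \<noteq> {} \<and> A \<noteq> I}"

text \<open>
  The \<open>A\<close>-component of a composition along the edge \<open>{i, j}\<close>: the directions of all flags other
  than \<open>i\<close> and \<open>j\<close> are prescribed by \<open>A\<close>, so a pair of components of \<open>f\<close> and \<open>g\<close> contributes
  exactly when the edge is directed from \<open>i\<close> to \<open>j\<close> (first summand) or from \<open>j\<close> to \<open>i\<close> (second
  summand; there the two factors are interchanged, whence the sign). All other pairs of
  components compose to zero.
\<close>

definition phi_lower_comp ::
  "('k, 'r) ring_scheme \<Rightarrow> ('k, 'v) dio_data \<Rightarrow> nat set \<Rightarrow> int \<Rightarrow> nat \<Rightarrow> nat set \<Rightarrow> int \<Rightarrow> nat \<Rightarrow>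
   (nat set \<Rightarrow> 'v) \<Rightarrow> (nat set \<Rightarrow> 'v) \<Rightarrow> nat set \<Rightarrow> 'v" where
  "phi_lower_comp K P I m i J n j f g =
     (\<lambda>A\<in>splits ((I - {i}) \<union> (J - {j})).
        let M = dsp P A (((I - {i}) \<union> (J - {j})) - A) (m + n);
            X = A \<inter> I; Y = A \<inter> J
        in (if insert i X \<in> splits I \<and> Y \<in> splits J
            then dcomp P (insert i X) (I - insert i X) m i Y (J - Y) n j (f (insert i X)) (g Y)
            else \<zero>\<^bsub>M\<^esub>)
           \<oplus>\<^bsub>M\<^esub>
           (if X \<in> splits I \<and> insert j Y \<in> splits J
            then ksign K (m * n) \<odot>\<^bsub>M\<^esub>
                 dcomp P (insert j Y) (J - insert j Y) n j X (I - X) m i (g (insert j Y)) (f X)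
            else \<zero>\<^bsub>M\<^esub>))"

definition phi_lower ::
  "('k, 'r) ring_scheme \<Rightarrow> ('k, 'v) dio_data \<Rightarrow> ('k, nat set \<Rightarrow> 'v) cyc_data" where
  "phi_lower K P =
     \<lparr>csp = (\<lambda>I n.
        \<lparr>carrier = (\<Pi>\<^sub>E A\<in>splits I. carrier (dsp P A (I - A) n)),
         mult = undefined, one = undefined,
         zero = (\<lambda>A\<in>splits I. \<zero>\<^bsub>dsp P A (I - A) n\<^esub>),
         add = (\<lambda>f g. \<lambda>A\<in>splits I. f A \<oplus>\<^bsub>dsp P A (I - A) n\<^esub> g A),
         smult = (\<lambda>c f. \<lambda>A\<in>splits I. c \<odot>\<^bsub>dsp P A (I - A) n\<^esub> f A)\<rparr>),
      cdiff = (\<lambda>I n f. \<lambda>A\<in>splits I. ddiff P A (I - A) n (f A)),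
      cact = (\<lambda>I n \<sigma> f. \<lambda>A'\<in>splits (\<sigma> ` I).
        let A = {i \<in> I. \<sigma> i \<in> A'} in dact P A (I - A) n \<sigma> (f A)),
      ccomp = phi_lower_comp K P\<rparr>"

definition phi_lower_map ::
  "(nat set \<Rightarrow> nat set \<Rightarrow> int \<Rightarrow> 'v \<Rightarrow> 'w) \<Rightarrow>
   nat set \<Rightarrow> int \<Rightarrow> (nat set \<Rightarrow> 'v) \<Rightarrow> (nat set \<Rightarrow> 'w)" where
  "phi_lower_map g I n f = (\<lambda>A\<in>splits I. g A (I - A) n (f A))"


section \<open>Dioperads presented by generators and relations\<close>

text \<open>
  The dg dioperad with given homogeneous generators and relations: the formal expressions in the
  generators modulo the smallest congruence that contains the relations and forces the axioms of
  a dg dioperad. Free means free as a dg object, so that the differential of a generator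
  has to be prescribed by a relation.
\<close>

datatype ('k, 'g) dterm =
    DGen 'g
  | DZero "nat set" "nat set" int
  | DAdd "('k, 'g) dterm" "('k, 'g) dterm"
  | DScale 'k "('k, 'g) dterm"
  | DDiff "('k, 'g) dterm"
  | DAct "nat \<Rightarrow> nat" "('k, 'g) dterm"
  | DComp nat nat "('k, 'g) dterm" "('k, 'g) dterm"

record ('k, 'g) dio_pres =
  dgens :: "'g set"
  darity :: "'g \<Rightarrow> nat set \<times> nat set \<times> int"
  drels :: "(('k, 'g) dterm \<times> ('k, 'g) dterm) set"

inductive dwt ::
  "('k, 'r) ring_scheme \<Rightarrow> ('k, 'g) dio_pres \<Rightarrow> nat set \<Rightarrow> nat set \<Rightarrow> int \<Rightarrow>
   ('k, 'g) dterm \<Rightarrow> bool"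
  for K :: "('k, 'r) ring_scheme" and S :: "('k, 'g) dio_pres" where
  wt_gen: "\<lbrakk>g \<in> dgens S; darity S g = (A, B, n); biflags A B\<rbrakk> \<Longrightarrow> dwt K S A B n (DGen g)"
| wt_zero: "biflags A B \<Longrightarrow> dwt K S A B n (DZero A B n)"
| wt_add: "\<lbrakk>dwt K S A B n s; dwt K S A B n t\<rbrakk> \<Longrightarrow> dwt K S A B n (DAdd s t)"
| wt_scale: "\<lbrakk>c \<in> carrier K; dwt K S A B n s\<rbrakk> \<Longrightarrow> dwt K S A B n (DScale c s)"
| wt_diff: "dwt K S A B n s \<Longrightarrow> dwt K S A B (n - 1) (DDiff s)"
| wt_act: "\<lbrakk>dwt K S A B n s; inj_on \<sigma> (A \<union> B)\<rbrakk> \<Longrightarrow> dwt K S (\<sigma> ` A) (\<sigma> ` B) n (DAct \<sigma> s)"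
| wt_comp: "\<lbrakk>dwt K S A B m s; dwt K S C D n t; dglue A B a C D d\<rbrakk> \<Longrightarrow>
            dwt K S ((A - {a}) \<union> C) (B \<union> (D - {d})) (m + n) (DComp a d s t)"

inductive deq ::
  "('k, 'r) ring_scheme \<Rightarrow> ('k, 'g) dio_pres \<Rightarrow> nat set \<Rightarrow> nat set \<Rightarrow> int \<Rightarrow>
   ('k, 'g) dterm \<Rightarrow> ('k, 'g) dterm \<Rightarrow> bool"
  for K :: "('k, 'r) ring_scheme" (structure) and S :: "('k, 'g) dio_pres" where
  rel: "\<lbrakk>(s, t) \<in> drels S; dwt K S A B n s; dwt K S A B n t\<rbrakk> \<Longrightarrow> deq K S A B n s t"
| refl: "dwt K S A B n s \<Longrightarrow> deq K S A B n s s"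
| sym: "deq K S A B n s t \<Longrightarrow> deq K S A B n t s"
| trans: "\<lbrakk>deq K S A B n s t; deq K S A B n t u\<rbrakk> \<Longrightarrow> deq K S A B n s u"
  \<comment> \<open>congruence\<close>
| cong_add: "\<lbrakk>deq K S A B n s s'; deq K S A B n t t'\<rbrakk> \<Longrightarrow> deq K S A B n (DAdd s t) (DAdd s' t')"
| cong_scale: "\<lbrakk>c \<in> carrier K; deq K S A B n s s'\<rbrakk> \<Longrightarrow>
    deq K S A B n (DScale c s) (DScale c s')"
| cong_diff: "deq K S A B n s s' \<Longrightarrow> deq K S A B (n - 1) (DDiff s) (DDiff s')"
| cong_act: "\<lbrakk>deq K S A B n s s'; inj_on \<sigma> (A \<union> B)\<rbrakk> \<Longrightarrow>
    deq K S (\<sigma> ` A) (\<sigma> ` B) n (DAct \<sigma> s) (DAct \<sigma> s')"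
| cong_comp: "\<lbrakk>deq K S A B m s s'; deq K S C D n t t'; dglue A B a C D d\<rbrakk> \<Longrightarrow>
    deq K S ((A - {a}) \<union> C) (B \<union> (D - {d})) (m + n) (DComp a d s t) (DComp a d s' t')"
  \<comment> \<open>vector space axioms\<close>
| add_assoc: "\<lbrakk>dwt K S A B n s; dwt K S A B n t; dwt K S A B n u\<rbrakk> \<Longrightarrow>
    deq K S A B n (DAdd (DAdd s t) u) (DAdd s (DAdd t u))"
| add_commute: "\<lbrakk>dwt K S A B n s; dwt K S A B n t\<rbrakk> \<Longrightarrow> deq K S A B n (DAdd s t) (DAdd t s)"
| add_zero: "dwt K S A B n s \<Longrightarrow> deq K S A B n (DAdd (DZero A B n) s) s"
| add_inverse: "dwt K S A B n s \<Longrightarrow> deq K S A B n (DAdd (DScale (\<ominus> \<one>) s) s) (DZero A B n)"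
| scale_one: "dwt K S A B n s \<Longrightarrow> deq K S A B n (DScale \<one> s) s"
| scale_scale: "\<lbrakk>c \<in> carrier K; e \<in> carrier K; dwt K S A B n s\<rbrakk> \<Longrightarrow>
    deq K S A B n (DScale (c \<otimes> e) s) (DScale c (DScale e s))"
| scale_add: "\<lbrakk>c \<in> carrier K; dwt K S A B n s; dwt K S A B n t\<rbrakk> \<Longrightarrow>
    deq K S A B n (DScale c (DAdd s t)) (DAdd (DScale c s) (DScale c t))"
| add_scale: "\<lbrakk>c \<in> carrier K; e \<in> carrier K; dwt K S A B n s\<rbrakk> \<Longrightarrow>
    deq K S A B n (DScale (c \<oplus> e) s) (DAdd (DScale c s) (DScale e s))"
  \<comment> \<open>differential\<close>
| diff_add: "\<lbrakk>dwt K S A B n s; dwt K S A B n t\<rbrakk> \<Longrightarrow>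
    deq K S A B (n - 1) (DDiff (DAdd s t)) (DAdd (DDiff s) (DDiff t))"
| diff_scale: "\<lbrakk>c \<in> carrier K; dwt K S A B n s\<rbrakk> \<Longrightarrow>
    deq K S A B (n - 1) (DDiff (DScale c s)) (DScale c (DDiff s))"
| diff_diff: "dwt K S A B n s \<Longrightarrow> deq K S A B (n - 2) (DDiff (DDiff s)) (DZero A B (n - 2))"
  \<comment> \<open>relabelling\<close>
| act_add: "\<lbrakk>dwt K S A B n s; dwt K S A B n t; inj_on \<sigma> (A \<union> B)\<rbrakk> \<Longrightarrow>
    deq K S (\<sigma> ` A) (\<sigma> ` B) n (DAct \<sigma> (DAdd s t)) (DAdd (DAct \<sigma> s) (DAct \<sigma> t))"
| act_scale: "\<lbrakk>c \<in> carrier K; dwt K S A B n s; inj_on \<sigma> (A \<union> B)\<rbrakk> \<Longrightarrow>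
    deq K S (\<sigma> ` A) (\<sigma> ` B) n (DAct \<sigma> (DScale c s)) (DScale c (DAct \<sigma> s))"
| act_cong: "\<lbrakk>dwt K S A B n s; inj_on \<sigma> (A \<union> B); \<forall>i\<in>A \<union> B. \<sigma> i = \<tau> i\<rbrakk> \<Longrightarrow>
    deq K S (\<sigma> ` A) (\<sigma> ` B) n (DAct \<sigma> s) (DAct \<tau> s)"
| act_id: "dwt K S A B n s \<Longrightarrow> deq K S A B n (DAct id s) s"
| act_act: "\<lbrakk>dwt K S A B n s; inj_on \<sigma> (A \<union> B); inj_on \<tau> (\<sigma> ` (A \<union> B))\<rbrakk> \<Longrightarrow>
    deq K S (\<tau> ` \<sigma> ` A) (\<tau> ` \<sigma> ` B) n (DAct \<tau> (DAct \<sigma> s)) (DAct (\<tau> \<circ> \<sigma>) s)"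
| act_diff: "\<lbrakk>dwt K S A B n s; inj_on \<sigma> (A \<union> B)\<rbrakk> \<Longrightarrow>
    deq K S (\<sigma> ` A) (\<sigma> ` B) (n - 1) (DDiff (DAct \<sigma> s)) (DAct \<sigma> (DDiff s))"
  \<comment> \<open>composition\<close>
| comp_add_left: "\<lbrakk>dwt K S A B m s; dwt K S A B m s'; dwt K S C D n t; dglue A B a C D d\<rbrakk> \<Longrightarrow>
    deq K S ((A - {a}) \<union> C) (B \<union> (D - {d})) (m + n)
      (DComp a d (DAdd s s') t) (DAdd (DComp a d s t) (DComp a d s' t))"
| comp_scale_left: "\<lbrakk>c \<in> carrier K; dwt K S A B m s; dwt K S C D n t; dglue A B a C D d\<rbrakk> \<Longrightarrow>
    deq K S ((A - {a}) \<union> C) (B \<union> (D - {d})) (m + n)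
      (DComp a d (DScale c s) t) (DScale c (DComp a d s t))"
| comp_add_right: "\<lbrakk>dwt K S A B m s; dwt K S C D n t; dwt K S C D n t'; dglue A B a C D d\<rbrakk> \<Longrightarrow>
    deq K S ((A - {a}) \<union> C) (B \<union> (D - {d})) (m + n)
      (DComp a d s (DAdd t t')) (DAdd (DComp a d s t) (DComp a d s t'))"
| comp_scale_right: "\<lbrakk>c \<in> carrier K; dwt K S A B m s; dwt K S C D n t; dglue A B a C D d\<rbrakk> \<Longrightarrow>
    deq K S ((A - {a}) \<union> C) (B \<union> (D - {d})) (m + n)
      (DComp a d s (DScale c t)) (DScale c (DComp a d s t))"
| comp_diff: "\<lbrakk>dwt K S A B m s; dwt K S C D n t; dglue A B a C D d\<rbrakk> \<Longrightarrow>
    deq K S ((A - {a}) \<union> C) (B \<union> (D - {d})) (m + n - 1)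
      (DDiff (DComp a d s t))
      (DAdd (DComp a d (DDiff s) t) (DScale (ksign K m) (DComp a d s (DDiff t))))"
| comp_act: "\<lbrakk>dwt K S A B m s; dwt K S C D n t; dglue A B a C D d;
     inj_on \<sigma> (A \<union> B \<union> C \<union> D)\<rbrakk> \<Longrightarrow>
    deq K S (\<sigma> ` ((A - {a}) \<union> C)) (\<sigma> ` (B \<union> (D - {d}))) (m + n)
      (DAct \<sigma> (DComp a d s t)) (DComp (\<sigma> a) (\<sigma> d) (DAct \<sigma> s) (DAct \<sigma> t))"
| comp_assoc_chain:
    "\<lbrakk>dwt K S A B m s; dwt K S C D n t; dwt K S E F p u;
      dglue A B a C D d; dglue C D c E F f; (A \<union> B) \<inter> (E \<union> F) = {}\<rbrakk> \<Longrightarrow>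
    deq K S ((((A - {a}) \<union> C) - {c}) \<union> E) ((B \<union> (D - {d})) \<union> (F - {f})) (m + n + p)
      (DComp c f (DComp a d s t) u) (DComp a d s (DComp c f t u))"
| comp_assoc_out:
    "\<lbrakk>dwt K S A B m s; dwt K S C D n t; dwt K S E F p u;
      dglue A B a C D d; dglue A B b E F f; a \<noteq> b; (C \<union> D) \<inter> (E \<union> F) = {}\<rbrakk> \<Longrightarrow>
    deq K S ((((A - {a}) \<union> C) - {b}) \<union> E) ((B \<union> (D - {d})) \<union> (F - {f})) (m + n + p)
      (DComp b f (DComp a d s t) u)
      (DScale (ksign K (n * p)) (DComp a d (DComp b f s u) t))"
| comp_assoc_in:
    "\<lbrakk>dwt K S A B m s; dwt K S C D n t; dwt K S E F p u;
      dglue A B a E F f; dglue C D c E F g; f \<noteq> g; (A \<union> B) \<inter> (C \<union> D) = {}\<rbrakk> \<Longrightarrow>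
    deq K S ((A - {a}) \<union> ((C - {c}) \<union> E)) (B \<union> ((D \<union> (F - {g})) - {f})) (m + (n + p))
      (DComp a f s (DComp c g t u))
      (DScale (ksign K (m * n)) (DComp c g t (DComp a f s u)))"

definition dio_presented ::
  "('k, 'r) ring_scheme \<Rightarrow> ('k, 'g) dio_pres \<Rightarrow> ('k, ('k, 'g) dterm set) dio_data" where
  "dio_presented K S =
     \<lparr>dsp = (\<lambda>A B n.
        \<lparr>carrier = {{t. deq K S A B n s t} |s. dwt K S A B n s},
         mult = undefined, one = undefined,
         zero = {t. deq K S A B n (DZero A B n) t},
         add = (\<lambda>X Y. {u. \<exists>s\<in>X. \<exists>t\<in>Y. deq K S A B n (DAdd s t) u}),
         smult = (\<lambda>c X. {u. \<exists>s\<in>X. deq K S A B n (DScale c s) u})\<rparr>),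
      ddiff = (\<lambda>A B n X. {u. \<exists>s\<in>X. deq K S A B (n - 1) (DDiff s) u}),
      dact = (\<lambda>A B n \<sigma> X. {u. \<exists>s\<in>X. deq K S (\<sigma> ` A) (\<sigma> ` B) n (DAct \<sigma> s) u}),
      dcomp = (\<lambda>A B m a C D n d X Y. {u. \<exists>s\<in>X. \<exists>t\<in>Y.
        deq K S ((A - {a}) \<union> C) (B \<union> (D - {d})) (m + n) (DComp a d s t) u})\<rparr>"


section \<open>Cyclic operads presented by generators and relations\<close>

datatype ('k, 'g) cterm =
    CGen 'g
  | CZero "nat set" int
  | CAdd "('k, 'g) cterm" "('k, 'g) cterm"
  | CScale 'k "('k, 'g) cterm"
  | CDiff "('k, 'g) cterm"
  | CAct "nat \<Rightarrow> nat" "('k, 'g) cterm"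
  | CComp nat nat "('k, 'g) cterm" "('k, 'g) cterm"

record ('k, 'g) cyc_pres =
  cgens :: "'g set"
  carity :: "'g \<Rightarrow> nat set \<times> int"
  crels :: "(('k, 'g) cterm \<times> ('k, 'g) cterm) set"

inductive cwt ::
  "('k, 'r) ring_scheme \<Rightarrow> ('k, 'g) cyc_pres \<Rightarrow> nat set \<Rightarrow> int \<Rightarrow> ('k, 'g) cterm \<Rightarrow> bool"
  for K :: "('k, 'r) ring_scheme" and S :: "('k, 'g) cyc_pres" where
  wt_gen: "\<lbrakk>g \<in> cgens S; carity S g = (I, n); finite I\<rbrakk> \<Longrightarrow> cwt K S I n (CGen g)"
| wt_zero: "finite I \<Longrightarrow> cwt K S I n (CZero I n)"
| wt_add: "\<lbrakk>cwt K S I n s; cwt K S I n t\<rbrakk> \<Longrightarrow> cwt K S I n (CAdd s t)"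
| wt_scale: "\<lbrakk>c \<in> carrier K; cwt K S I n s\<rbrakk> \<Longrightarrow> cwt K S I n (CScale c s)"
| wt_diff: "cwt K S I n s \<Longrightarrow> cwt K S I (n - 1) (CDiff s)"
| wt_act: "\<lbrakk>cwt K S I n s; inj_on \<sigma> I\<rbrakk> \<Longrightarrow> cwt K S (\<sigma> ` I) n (CAct \<sigma> s)"
| wt_comp: "\<lbrakk>cwt K S I m s; cwt K S J n t; cglue I i J j\<rbrakk> \<Longrightarrow>
            cwt K S ((I - {i}) \<union> (J - {j})) (m + n) (CComp i j s t)"

inductive ceq ::
  "('k, 'r) ring_scheme \<Rightarrow> ('k, 'g) cyc_pres \<Rightarrow> nat set \<Rightarrow> int \<Rightarrow>
   ('k, 'g) cterm \<Rightarrow> ('k, 'g) cterm \<Rightarrow> bool"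
  for K :: "('k, 'r) ring_scheme" (structure) and S :: "('k, 'g) cyc_pres" where
  rel: "\<lbrakk>(s, t) \<in> crels S; cwt K S I n s; cwt K S I n t\<rbrakk> \<Longrightarrow> ceq K S I n s t"
| refl: "cwt K S I n s \<Longrightarrow> ceq K S I n s s"
| sym: "ceq K S I n s t \<Longrightarrow> ceq K S I n t s"
| trans: "\<lbrakk>ceq K S I n s t; ceq K S I n t u\<rbrakk> \<Longrightarrow> ceq K S I n s u"
  \<comment> \<open>congruence\<close>
| cong_add: "\<lbrakk>ceq K S I n s s'; ceq K S I n t t'\<rbrakk> \<Longrightarrow> ceq K S I n (CAdd s t) (CAdd s' t')"
| cong_scale: "\<lbrakk>c \<in> carrier K; ceq K S I n s s'\<rbrakk> \<Longrightarrow> ceq K S I n (CScale c s) (CScale c s')"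
| cong_diff: "ceq K S I n s s' \<Longrightarrow> ceq K S I (n - 1) (CDiff s) (CDiff s')"
| cong_act: "\<lbrakk>ceq K S I n s s'; inj_on \<sigma> I\<rbrakk> \<Longrightarrow> ceq K S (\<sigma> ` I) n (CAct \<sigma> s) (CAct \<sigma> s')"
| cong_comp: "\<lbrakk>ceq K S I m s s'; ceq K S J n t t'; cglue I i J j\<rbrakk> \<Longrightarrow>
    ceq K S ((I - {i}) \<union> (J - {j})) (m + n) (CComp i j s t) (CComp i j s' t')"
  \<comment> \<open>vector space axioms\<close>
| add_assoc: "\<lbrakk>cwt K S I n s; cwt K S I n t; cwt K S I n u\<rbrakk> \<Longrightarrow>
    ceq K S I n (CAdd (CAdd s t) u) (CAdd s (CAdd t u))"
| add_commute: "\<lbrakk>cwt K S I n s; cwt K S I n t\<rbrakk> \<Longrightarrow> ceq K S I n (CAdd s t) (CAdd t s)"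
| add_zero: "cwt K S I n s \<Longrightarrow> ceq K S I n (CAdd (CZero I n) s) s"
| add_inverse: "cwt K S I n s \<Longrightarrow> ceq K S I n (CAdd (CScale (\<ominus> \<one>) s) s) (CZero I n)"
| scale_one: "cwt K S I n s \<Longrightarrow> ceq K S I n (CScale \<one> s) s"
| scale_scale: "\<lbrakk>c \<in> carrier K; e \<in> carrier K; cwt K S I n s\<rbrakk> \<Longrightarrow>
    ceq K S I n (CScale (c \<otimes> e) s) (CScale c (CScale e s))"
| scale_add: "\<lbrakk>c \<in> carrier K; cwt K S I n s; cwt K S I n t\<rbrakk> \<Longrightarrow>
    ceq K S I n (CScale c (CAdd s t)) (CAdd (CScale c s) (CScale c t))"
| add_scale: "\<lbrakk>c \<in> carrier K; e \<in> carrier K; cwt K S I n s\<rbrakk> \<Longrightarrow>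
    ceq K S I n (CScale (c \<oplus> e) s) (CAdd (CScale c s) (CScale e s))"
  \<comment> \<open>differential\<close>
| diff_add: "\<lbrakk>cwt K S I n s; cwt K S I n t\<rbrakk> \<Longrightarrow>
    ceq K S I (n - 1) (CDiff (CAdd s t)) (CAdd (CDiff s) (CDiff t))"
| diff_scale: "\<lbrakk>c \<in> carrier K; cwt K S I n s\<rbrakk> \<Longrightarrow>
    ceq K S I (n - 1) (CDiff (CScale c s)) (CScale c (CDiff s))"
| diff_diff: "cwt K S I n s \<Longrightarrow> ceq K S I (n - 2) (CDiff (CDiff s)) (CZero I (n - 2))"
  \<comment> \<open>relabelling\<close>
| act_add: "\<lbrakk>cwt K S I n s; cwt K S I n t; inj_on \<sigma> I\<rbrakk> \<Longrightarrow>
    ceq K S (\<sigma> ` I) n (CAct \<sigma> (CAdd s t)) (CAdd (CAct \<sigma> s) (CAct \<sigma> t))"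
| act_scale: "\<lbrakk>c \<in> carrier K; cwt K S I n s; inj_on \<sigma> I\<rbrakk> \<Longrightarrow>
    ceq K S (\<sigma> ` I) n (CAct \<sigma> (CScale c s)) (CScale c (CAct \<sigma> s))"
| act_cong: "\<lbrakk>cwt K S I n s; inj_on \<sigma> I; \<forall>i\<in>I. \<sigma> i = \<tau> i\<rbrakk> \<Longrightarrow>
    ceq K S (\<sigma> ` I) n (CAct \<sigma> s) (CAct \<tau> s)"
| act_id: "cwt K S I n s \<Longrightarrow> ceq K S I n (CAct id s) s"
| act_act: "\<lbrakk>cwt K S I n s; inj_on \<sigma> I; inj_on \<tau> (\<sigma> ` I)\<rbrakk> \<Longrightarrow>
    ceq K S (\<tau> ` \<sigma> ` I) n (CAct \<tau> (CAct \<sigma> s)) (CAct (\<tau> \<circ> \<sigma>) s)"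
| act_diff: "\<lbrakk>cwt K S I n s; inj_on \<sigma> I\<rbrakk> \<Longrightarrow>
    ceq K S (\<sigma> ` I) (n - 1) (CDiff (CAct \<sigma> s)) (CAct \<sigma> (CDiff s))"
  \<comment> \<open>composition; linearity in the second argument follows by \<open>comp_commute\<close>\<close>
| comp_add: "\<lbrakk>cwt K S I m s; cwt K S I m s'; cwt K S J n t; cglue I i J j\<rbrakk> \<Longrightarrow>
    ceq K S ((I - {i}) \<union> (J - {j})) (m + n)
      (CComp i j (CAdd s s') t) (CAdd (CComp i j s t) (CComp i j s' t))"
| comp_scale: "\<lbrakk>c \<in> carrier K; cwt K S I m s; cwt K S J n t; cglue I i J j\<rbrakk> \<Longrightarrow>
    ceq K S ((I - {i}) \<union> (J - {j})) (m + n)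
      (CComp i j (CScale c s) t) (CScale c (CComp i j s t))"
| comp_diff: "\<lbrakk>cwt K S I m s; cwt K S J n t; cglue I i J j\<rbrakk> \<Longrightarrow>
    ceq K S ((I - {i}) \<union> (J - {j})) (m + n - 1)
      (CDiff (CComp i j s t))
      (CAdd (CComp i j (CDiff s) t) (CScale (ksign K m) (CComp i j s (CDiff t))))"
| comp_act: "\<lbrakk>cwt K S I m s; cwt K S J n t; cglue I i J j; inj_on \<sigma> (I \<union> J)\<rbrakk> \<Longrightarrow>
    ceq K S (\<sigma> ` ((I - {i}) \<union> (J - {j}))) (m + n)
      (CAct \<sigma> (CComp i j s t)) (CComp (\<sigma> i) (\<sigma> j) (CAct \<sigma> s) (CAct \<sigma> t))"
| comp_commute: "\<lbrakk>cwt K S I m s; cwt K S J n t; cglue I i J j\<rbrakk> \<Longrightarrow>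
    ceq K S ((I - {i}) \<union> (J - {j})) (m + n)
      (CComp i j s t) (CScale (ksign K (m * n)) (CComp j i t s))"
| comp_assoc:
    "\<lbrakk>cwt K S I m s; cwt K S J n t; cwt K S L p u;
      cglue I i J j; cglue J k L l; j \<noteq> k; I \<inter> L = {}\<rbrakk> \<Longrightarrow>
    ceq K S ((((I - {i}) \<union> (J - {j})) - {k}) \<union> (L - {l})) (m + n + p)
      (CComp k l (CComp i j s t) u) (CComp i j s (CComp k l t u))"

definition cyc_presented ::
  "('k, 'r) ring_scheme \<Rightarrow> ('k, 'g) cyc_pres \<Rightarrow> ('k, ('k, 'g) cterm set) cyc_data" where
  "cyc_presented K S =
     \<lparr>csp = (\<lambda>I n.
        \<lparr>carrier = {{t. ceq K S I n s t} |s. cwt K S I n s},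
         mult = undefined, one = undefined,
         zero = {t. ceq K S I n (CZero I n) t},
         add = (\<lambda>X Y. {u. \<exists>s\<in>X. \<exists>t\<in>Y. ceq K S I n (CAdd s t) u}),
         smult = (\<lambda>c X. {u. \<exists>s\<in>X. ceq K S I n (CScale c s) u})\<rparr>),
      cdiff = (\<lambda>I n X. {u. \<exists>s\<in>X. ceq K S I (n - 1) (CDiff s) u}),
      cact = (\<lambda>I n \<sigma> X. {u. \<exists>s\<in>X. ceq K S (\<sigma> ` I) n (CAct \<sigma> s) u}),
      ccomp = (\<lambda>I m i J n j X Y. {u. \<exists>s\<in>X. \<exists>t\<in>Y.
        ceq K S ((I - {i}) \<union> (J - {j})) (m + n) (CComp i j s t) u})\<rparr>"


section \<open>The left adjoint\<close>

text \<open>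
  The left adjoint sends \<open>Q\<close> to the dioperad generated by the directed corollas decorated by
  \<open>Q\<close> (with at least one output and one input). The generator \<open>(A, B, n, x)\<close> is
  \<open>x \<in> Q((A \<union> B))\<close>, of degree \<open>n\<close>, with the flags in \<open>A\<close> directed outwards. The relations say
  that this is linear, compatible with differentials and relabelling, and
  that a corolla decorated by a composite is the sum over the two
  directions of the edge of the composites of directed corollas.
\<close>

inductive_set phi_upper_rels ::
  "('k, 'r) ring_scheme \<Rightarrow> ('k, 'v) cyc_data \<Rightarrow>
   (('k, nat set \<times> nat set \<times> int \<times> 'v) dterm \<times> ('k, nat set \<times> nat set \<times> int \<times> 'v) dterm) set"
  for K :: "('k, 'r) ring_scheme" and Q :: "('k, 'v) cyc_data" where
  rel_add: "\<lbrakk>biflags A B; x \<in> carrier (csp Q (A \<union> B) n); y \<in> carrier (csp Q (A \<union> B) n)\<rbrakk> \<Longrightarrow>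
    (DGen (A, B, n, x \<oplus>\<^bsub>csp Q (A \<union> B) n\<^esub> y), DAdd (DGen (A, B, n, x)) (DGen (A, B, n, y)))
      \<in> phi_upper_rels K Q"
| rel_scale: "\<lbrakk>biflags A B; c \<in> carrier K; x \<in> carrier (csp Q (A \<union> B) n)\<rbrakk> \<Longrightarrow>
    (DGen (A, B, n, c \<odot>\<^bsub>csp Q (A \<union> B) n\<^esub> x), DScale c (DGen (A, B, n, x)))
      \<in> phi_upper_rels K Q"
| rel_diff: "\<lbrakk>biflags A B; x \<in> carrier (csp Q (A \<union> B) n)\<rbrakk> \<Longrightarrow>
    (DGen (A, B, n - 1, cdiff Q (A \<union> B) n x), DDiff (DGen (A, B, n, x))) \<in> phi_upper_rels K Q"
| rel_act: "\<lbrakk>biflags A B; inj_on \<sigma> (A \<union> B); x \<in> carrier (csp Q (A \<union> B) n)\<rbrakk> \<Longrightarrow>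
    (DGen (\<sigma> ` A, \<sigma> ` B, n, cact Q (A \<union> B) n \<sigma> x), DAct \<sigma> (DGen (A, B, n, x)))
      \<in> phi_upper_rels K Q"
| rel_comp: "\<lbrakk>cglue I i J j; x \<in> carrier (csp Q I m); y \<in> carrier (csp Q J n);
     N = (I - {i}) \<union> (J - {j}); A \<in> splits N; X = A \<inter> I; Y = A \<inter> J\<rbrakk> \<Longrightarrow>
    (DGen (A, N - A, m + n, ccomp Q I m i J n j x y),
     DAdd
       (if insert i X \<in> splits I \<and> Y \<in> splits J
        then DComp i j (DGen (insert i X, I - insert i X, m, x)) (DGen (Y, J - Y, n, y))
        else DZero A (N - A) (m + n))
       (if X \<in> splits I \<and> insert j Y \<in> splits J
        then DScale (ksign K (m * n))
               (DComp j i (DGen (insert j Y, J - insert j Y, n, y)) (DGen (X, I - X, m, x)))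
        else DZero A (N - A) (m + n)))
      \<in> phi_upper_rels K Q"

definition phi_upper_pres ::
  "('k, 'r) ring_scheme \<Rightarrow> ('k, 'v) cyc_data \<Rightarrow>
   ('k, nat set \<times> nat set \<times> int \<times> 'v) dio_pres" where
  "phi_upper_pres K Q =
     \<lparr>dgens = {(A, B, n, x). biflags A B \<and> x \<in> carrier (csp Q (A \<union> B) n)},
      darity = (\<lambda>(A, B, n, x). (A, B, n)),
      drels = phi_upper_rels K Q\<rparr>"

definition phi_upper ::
  "('k, 'r) ring_scheme \<Rightarrow> ('k, 'v) cyc_data \<Rightarrow>
   ('k, ('k, nat set \<times> nat set \<times> int \<times> 'v) dterm set) dio_data" where
  "phi_upper K Q = dio_presented K (phi_upper_pres K Q)"

definition phi_unit ::
  "('k, 'r) ring_scheme \<Rightarrow> ('k, 'v) cyc_data \<Rightarrow> nat set \<Rightarrow> int \<Rightarrow> 'v \<Rightarrow>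
   nat set \<Rightarrow> ('k, nat set \<times> nat set \<times> int \<times> 'v) dterm set" where
  "phi_unit K Q I n x =
     (\<lambda>A\<in>splits I. {t. deq K (phi_upper_pres K Q) A (I - A) n (DGen (A, I - A, n, x)) t})"

text \<open>
  The universal property of \<open>u : Q \<rightarrow> phi_lower D\<close>, tested on the dioperad \<open>P\<close>: every
  morphism from \<open>Q\<close> to \<open>phi_lower P\<close> is \<open>phi_lower g \<circ> u\<close> for a unique
  morphism \<open>g\<close> from \<open>D\<close> to \<open>P\<close>. Morphisms are compared on the carriers only.
\<close>

definition universal_for ::
  "('k, 'r) ring_scheme \<Rightarrow> ('k, 'v) cyc_data \<Rightarrow> ('k, 'w) dio_data \<Rightarrow>
   (nat set \<Rightarrow> int \<Rightarrow> 'v \<Rightarrow> nat set \<Rightarrow> 'w) \<Rightarrow> ('k, 'u) dio_data \<Rightarrow> bool" where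
  "universal_for K Q D u P \<longleftrightarrow>
     (\<forall>f. cyc_hom K Q (phi_lower K P) f \<longrightarrow>
       (let factors = (\<lambda>g. dio_hom K D P g \<and>
              (\<forall>I n. finite I \<longrightarrow> (\<forall>x\<in>carrier (csp Q I n).
                 phi_lower_map g I n (u I n x) = f I n x)))
        in (\<exists>g. factors g) \<and>
           (\<forall>g h. factors g \<longrightarrow> factors h \<longrightarrow>
              (\<forall>A B n. biflags A B \<longrightarrow> (\<forall>x\<in>carrier (dsp D A B n). g A B n x = h A B n x)))))"


section \<open>The cyclic operads \<open>Lie\<close> and \<open>As\<close>\<close>

definition lab3 :: "nat \<Rightarrow> nat \<Rightarrow> nat \<Rightarrow> nat \<Rightarrow> nat" where
  "lab3 i j k = (\<lambda>l. if l = 0 then i else if l = 1 then j else k)"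

text \<open>
  Both are generated by one operation with three flags, in degree 0. The term \<open>cop3 i j k\<close> is
  this operation with inputs \<open>i\<close>, \<open>j\<close> (in this order) and output \<open>k\<close>, that is, the cyclic form
  \<open>\<langle>i \<cdot> j, k\<rangle>\<close> of the product. It is totally antisymmetric for Lie algebras and
  invariant under cyclic permutations for associative algebras. In a composite of two operations
  the flags 4 and 5 form the edge.
\<close>

definition cop3 :: "nat \<Rightarrow> nat \<Rightarrow> nat \<Rightarrow> ('k, unit) cterm" where
  "cop3 i j k = CAct (lab3 i j k) (CGen ())"

definition Lie :: "('k, 'r) ring_scheme \<Rightarrow> ('k, ('k, unit) cterm set) cyc_data" where
  "Lie K = cyc_presented K
     \<lparr>cgens = {()},
      carity = (\<lambda>_. ({0, 1, 2}, 0)),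
      crels =
       {(CDiff (CGen ()), CZero {0, 1, 2} (-1)),
        (cop3 1 0 2, CScale (\<ominus>\<^bsub>K\<^esub> \<one>\<^bsub>K\<^esub>) (cop3 0 1 2)),
        (cop3 0 2 1, CScale (\<ominus>\<^bsub>K\<^esub> \<one>\<^bsub>K\<^esub>) (cop3 0 1 2)),
        \<comment> \<open>Jacobi: \<open>[[1,2],3] + [[2,3],1] + [[3,1],2] = 0\<close>, output 0\<close>
        (CAdd (CComp 4 5 (cop3 1 2 4) (cop3 5 3 0))
           (CAdd (CComp 4 5 (cop3 2 3 4) (cop3 5 1 0))
                 (CComp 4 5 (cop3 3 1 4) (cop3 5 2 0))),
         CZero {0, 1, 2, 3} 0)}\<rparr>"

definition As :: "('k, 'r) ring_scheme \<Rightarrow> ('k, ('k, unit) cterm set) cyc_data" where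
  "As K = cyc_presented K
     \<lparr>cgens = {()},
      carity = (\<lambda>_. ({0, 1, 2}, 0)),
      crels =
       {(CDiff (CGen ()), CZero {0, 1, 2} (-1)),
        (cop3 1 2 0, cop3 0 1 2),
        \<comment> \<open>\<open>(1 2) 3 = 1 (2 3)\<close>, output 0\<close>
        (CComp 4 5 (cop3 1 2 4) (cop3 5 3 0), CComp 4 5 (cop3 2 3 4) (cop3 1 5 0))}\<rparr>"


section \<open>The dioperads \<open>BiLie\<close> and \<open>Bal\<close>\<close>

text \<open>
  Both are generated, in degree 0, by a product \<open>dprod o i j\<close> with output \<open>o\<close> and inputs
  \<open>i\<close>, \<open>j\<close> (in this order), and a coproduct \<open>dcoprod i o p\<close> with input \<open>i\<close> and outputs \<open>o\<close>,
  \<open>p\<close> (in this order). The composite \<open>dthen s t\<close> feeds the output 5 of \<open>s\<close> into the input 6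
  of \<open>t\<close>. In the compatibility conditions the inputs are \<open>a = 1\<close>, \<open>b = 2\<close> and the outputs are
  3 (first tensor factor) and 4 (second); the comments write
  \<open>\<Delta> a = a' \<otimes> a''\<close> in Sweedler notation.
\<close>

datatype biop = BProd | BCoprod

definition bi_arity :: "biop \<Rightarrow> nat set \<times> nat set \<times> int" where
  "bi_arity g = (case g of BProd \<Rightarrow> ({0}, {1, 2}, 0) | BCoprod \<Rightarrow> ({1, 2}, {0}, 0))"

definition dprod :: "nat \<Rightarrow> nat \<Rightarrow> nat \<Rightarrow> ('k, biop) dterm" where
  "dprod k i j = DAct (lab3 k i j) (DGen BProd)"

definition dcoprod :: "nat \<Rightarrow> nat \<Rightarrow> nat \<Rightarrow> ('k, biop) dterm" where
  "dcoprod k i j = DAct (lab3 k i j) (DGen BCoprod)"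

definition dthen :: "('k, 'g) dterm \<Rightarrow> ('k, 'g) dterm \<Rightarrow> ('k, 'g) dterm" where
  "dthen s t = DComp 5 6 s t"

definition dneg :: "('k, 'r) ring_scheme \<Rightarrow> ('k, 'g) dterm \<Rightarrow> ('k, 'g) dterm" where
  "dneg K s = DScale (\<ominus>\<^bsub>K\<^esub> \<one>\<^bsub>K\<^esub>) s"

definition bi_diff_rels :: "(('k, biop) dterm \<times> ('k, biop) dterm) set" where
  "bi_diff_rels =
     {(DDiff (DGen BProd), DZero {0} {1, 2} (-1)),
      (DDiff (DGen BCoprod), DZero {1, 2} {0} (-1))}"

definition BiLie :: "('k, 'r) ring_scheme \<Rightarrow> ('k, ('k, biop) dterm set) dio_data" where
  "BiLie K = dio_presented K
     \<lparr>dgens = {BProd, BCoprod},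
      darity = bi_arity,
      drels = bi_diff_rels \<union>
       {(dprod 0 2 1, dneg K (dprod 0 1 2)),
        (dcoprod 0 2 1, dneg K (dcoprod 0 1 2)),
        \<comment> \<open>Jacobi: \<open>[[1,2],3] + [[2,3],1] + [[3,1],2] = 0\<close>, output 0\<close>
        (DAdd (dthen (dprod 5 1 2) (dprod 0 6 3))
           (DAdd (dthen (dprod 5 2 3) (dprod 0 6 1))
                 (dthen (dprod 5 3 1) (dprod 0 6 2))),
         DZero {0} {1, 2, 3} 0),
        \<comment> \<open>co-Jacobi: cyclic sum over the outputs of \<open>(\<Delta> \<otimes> 1) \<Delta>\<close>, input 0\<close>
        (DAdd (dthen (dcoprod 0 5 3) (dcoprod 6 1 2))
           (DAdd (dthen (dcoprod 0 5 1) (dcoprod 6 2 3))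
                 (dthen (dcoprod 0 5 2) (dcoprod 6 3 1))),
         DZero {1, 2, 3} {0} 0),
        \<comment> \<open>cocycle condition:
           \<open>\<Delta>[a,b] = [a,b'] \<otimes> b'' + b' \<otimes> [a,b''] - [b,a'] \<otimes> a'' - a' \<otimes> [b,a'']\<close>\<close>
        (dthen (dprod 5 1 2) (dcoprod 6 3 4),
         DAdd (DAdd (dthen (dcoprod 2 5 4) (dprod 3 1 6))
                    (dthen (dcoprod 2 3 5) (dprod 4 1 6)))
              (DAdd (dneg K (dthen (dcoprod 1 5 4) (dprod 3 2 6)))
                    (dneg K (dthen (dcoprod 1 3 5) (dprod 4 2 6)))))}\<rparr>"

definition Bal :: "('k, 'r) ring_scheme \<Rightarrow> ('k, ('k, biop) dterm set) dio_data" where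
  "Bal K = dio_presented K
     \<lparr>dgens = {BProd, BCoprod},
      darity = bi_arity,
      drels = bi_diff_rels \<union>
       {\<comment> \<open>\<open>(1 2) 3 = 1 (2 3)\<close>, output 0\<close>
        (dthen (dprod 5 1 2) (dprod 0 6 3), dthen (dprod 5 2 3) (dprod 0 1 6)),
        \<comment> \<open>\<open>(\<Delta> \<otimes> 1) \<Delta> = (1 \<otimes> \<Delta>) \<Delta>\<close>, input 0 and outputs 1, 2, 3\<close>
        (dthen (dcoprod 0 5 3) (dcoprod 6 1 2), dthen (dcoprod 0 1 5) (dcoprod 6 2 3)),
        \<comment> \<open>\<open>\<Delta>(ab) = a b' \<otimes> b'' + a' \<otimes> a'' b\<close>\<close>
        (dthen (dprod 5 1 2) (dcoprod 6 3 4),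
         DAdd (dthen (dcoprod 2 5 4) (dprod 3 1 6)) (dthen (dcoprod 1 3 5) (dprod 4 6 2))),
        \<comment> \<open>balanceator:
           \<open>(a b'' \<otimes> b' - b'' \<otimes> b' a) + (a' \<otimes> b a'' - a' b \<otimes> a'') = 0\<close>\<close>
        (DAdd (DAdd (dthen (dcoprod 2 4 5) (dprod 3 1 6))
                    (dneg K (dthen (dcoprod 2 5 3) (dprod 4 6 1))))
              (DAdd (dthen (dcoprod 1 3 5) (dprod 4 2 6))
                    (dneg K (dthen (dcoprod 1 5 4) (dprod 3 6 2)))),
         DZero {3, 4} {1, 2} 0)}\<rparr>"

end

theory Submission
  imports Defs
begin

text \<open>
  A morphism from \<open>Q\<close> to \<open>phi_lower P\<close> picks, for every element of \<open>Q\<close>, a family of elements of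
  \<open>P\<close> indexed by the directions of the flags, and compatibility with composition says that
  a composite is the sum over both directions of the edge. These are the relations of
  \<open>phi_upper Q\<close>, whence the adjunction.

  A cyclically invariant ternary operation has, up to relabelling, only two components: the one
  with one outgoing flag is a product, the one with two outgoing flags is a coproduct. The Jacobi
  identity, a relation in arity four, splits according to the number of outgoing flags into the
  Jacobi identity (one), the cocycle condition (two) and the co-Jacobi identity (three).
  Associativity splits into associativity (one), coassociativity (three) and, with two outgoing
  flags, the derivation property if they are adjacent in the cyclic order and the vanishing of the
  balanceator if they are opposite.
\<close>

section \<open>Linear algebra\<close>

text \<open>All dioperads over all carrier types cannot be quantified over in one HOL formula, so
  the isomorphisms are not read off from representability. The correspondence of relations is used
  at just two dioperads, the presented one \<open>D\<close> and \<open>phi_upper K Q\<close>. It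
  gives morphisms in both directions, and uniqueness on generators makes them mutually inverse. The
  laborious point is that \<open>phi_lower\<close> takes values in cyclic operads. A composite may
  have outputs and inputs although one of its vertices lacks one of the two, so the axioms must also
  hold where some directed composites are set to zero. \<open>dcx\<close> is total for this reason;
  associativity then compares four terms, one for each pair of edge directions, with their Koszul
  signs. An equation in arity four has fourteen components, whereas the relations of a presentation
  name particular flags. Independence of the names, the symmetries of a composite of two ternary
  operations and, for Lie, antisymmetry reduce the fourteen components to those relations.\<close>

lemma ksign_closed [simp]: "field K \<Longrightarrow> ksign K n \<in> carrier K"
proof -
  assume "field K" then interpret field K .
  show ?thesis by (simp add: ksign_def)
qed

lemma ksign_0 [simp]: "ksign K 0 = \<one>\<^bsub>K\<^esub>" by (simp add: ksign_def)

lemma ksign_mult: "field K \<Longrightarrow> ksign K m \<otimes>\<^bsub>K\<^esub> ksign K n = ksign K (m + n)"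
proof -
  assume "field K" then interpret field K .
  show ?thesis by (auto simp: ksign_def l_minus r_minus)
qed

lemma ksign_cong: "even (m + n) \<Longrightarrow> ksign K m = ksign K n"
  by (auto simp: ksign_def)

lemma lin_map_closed: "lin_map K M N f \<Longrightarrow> x \<in> carrier M \<Longrightarrow> f x \<in> carrier N"
  by (auto simp: lin_map_def)

lemma lin_map_add:
  "lin_map K M N f \<Longrightarrow> x \<in> carrier M \<Longrightarrow> y \<in> carrier M \<Longrightarrow> f (x \<oplus>\<^bsub>M\<^esub> y) = f x \<oplus>\<^bsub>N\<^esub> f y"
  by (auto simp: lin_map_def)

lemma lin_map_scale:
  "lin_map K M N f \<Longrightarrow> c \<in> carrier K \<Longrightarrow> x \<in> carrier M \<Longrightarrow> f (c \<odot>\<^bsub>M\<^esub> x) = c \<odot>\<^bsub>N\<^esub> f x"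
  by (auto simp: lin_map_def)

lemma lin_map_zero:
  assumes "lin_map K M N f" "module K M" "module K N"
  shows "f \<zero>\<^bsub>M\<^esub> = \<zero>\<^bsub>N\<^esub>"
proof -
  interpret M: module K M by fact
  interpret N: module K N by fact
  have "f (\<zero>\<^bsub>K\<^esub> \<odot>\<^bsub>M\<^esub> \<zero>\<^bsub>M\<^esub>) = \<zero>\<^bsub>K\<^esub> \<odot>\<^bsub>N\<^esub> f \<zero>\<^bsub>M\<^esub>"
    by (rule lin_map_scale[OF assms(1)]) auto
  then show ?thesis using lin_map_closed[OF assms(1)] by simp
qed

lemma module_minus:
  assumes "module K M" "x \<in> carrier M"
  shows "(\<ominus>\<^bsub>K\<^esub> \<one>\<^bsub>K\<^esub>) \<odot>\<^bsub>M\<^esub> x = \<ominus>\<^bsub>M\<^esub> x"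
proof -
  interpret M: module K M by fact
  show ?thesis using assms(2) M.smult_l_minus[of "\<one>\<^bsub>K\<^esub>" x] by simp
qed

lemma lin_map_comp:
  "lin_map K M N f \<Longrightarrow> lin_map K N L g \<Longrightarrow> lin_map K M L (\<lambda>x. g (f x))"
  by (auto simp: lin_map_def Pi_iff)

lemma bilin_map_left: "bilin_map K M N L f \<Longrightarrow> y \<in> carrier N \<Longrightarrow> lin_map K M L (\<lambda>x. f x y)"
  by (simp add: bilin_map_def)

lemma bilin_map_right: "bilin_map K M N L f \<Longrightarrow> x \<in> carrier M \<Longrightarrow> lin_map K N L (f x)"
  by (simp add: bilin_map_def)

lemma bilin_map_closed:
  "bilin_map K M N L f \<Longrightarrow> x \<in> carrier M \<Longrightarrow> y \<in> carrier N \<Longrightarrow> f x y \<in> carrier L"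
  by (auto simp: bilin_map_def lin_map_def)

section \<open>Presented dioperads\<close>

lemma biflags_image: "biflags A B \<Longrightarrow> inj_on \<sigma> (A \<union> B) \<Longrightarrow> biflags (\<sigma> ` A) (\<sigma> ` B)"
  unfolding biflags_def inj_on_def by blast

lemma biflags_glue: "dglue A B a C D d \<Longrightarrow> biflags ((A - {a}) \<union> C) (B \<union> (D - {d}))"
  unfolding dglue_def biflags_def by blast

lemma dglue_image:
  "dglue A B a C D d \<Longrightarrow> inj_on \<sigma> (A \<union> B \<union> C \<union> D) \<Longrightarrow>
   dglue (\<sigma> ` A) (\<sigma> ` B) (\<sigma> a) (\<sigma> ` C) (\<sigma> ` D) (\<sigma> d)"
proof -
  assume g: "dglue A B a C D d" and i: "inj_on \<sigma> (A \<union> B \<union> C \<union> D)"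
  have "biflags (\<sigma> ` A) (\<sigma> ` B)" "biflags (\<sigma> ` C) (\<sigma> ` D)"
    using g i by (auto simp: dglue_def intro!: biflags_image elim: inj_on_subset)
  moreover have "(\<sigma> ` A \<union> \<sigma> ` B) \<inter> (\<sigma> ` C \<union> \<sigma> ` D) = {}"
    using g i unfolding dglue_def inj_on_def by blast
  ultimately show ?thesis using g by (auto simp: dglue_def)
qed

lemma dglue_image_sets:
  assumes "dglue A B a C D d" "inj_on \<sigma> (A \<union> B \<union> C \<union> D)"
  shows "\<sigma> ` A - {\<sigma> a} \<union> \<sigma> ` C = \<sigma> ` ((A - {a}) \<union> C)"
    and "\<sigma> ` B \<union> (\<sigma> ` D - {\<sigma> d}) = \<sigma> ` (B \<union> (D - {d}))"
  using assms unfolding dglue_def inj_on_def by blast+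

lemma dglue_chain:
  assumes "dglue A B a C D d" "dglue C D c E F f" "(A \<union> B) \<inter> (E \<union> F) = {}"
  shows "dglue ((A - {a}) \<union> C) (B \<union> (D - {d})) c E F f"
    and "dglue A B a ((C - {c}) \<union> E) (D \<union> (F - {f})) d"
  using assms biflags_glue[OF assms(1)] biflags_glue[OF assms(2)]
  unfolding dglue_def by blast+

lemma dglue_out:
  assumes "dglue A B a C D d" "dglue A B b E F f" "a \<noteq> b" "(C \<union> D) \<inter> (E \<union> F) = {}"
  shows "dglue ((A - {a}) \<union> C) (B \<union> (D - {d})) b E F f"
  using assms biflags_glue[OF assms(1)] unfolding dglue_def by blast

lemma dglue_in:
  assumes "dglue A B a E F f" "dglue C D c E F g" "f \<noteq> g" "(A \<union> B) \<inter> (C \<union> D) = {}"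
  shows "dglue A B a ((C - {c}) \<union> E) (D \<union> (F - {g})) f"
  using assms biflags_glue[OF assms(2)] unfolding dglue_def by blast

text \<open>The type of a term can be read off the term; \<open>dchk\<close> decides whether it is well-typed.\<close>

primrec dout :: "('k, 'g) dio_pres \<Rightarrow> ('k, 'g) dterm \<Rightarrow> nat set" where
  "dout S (DGen g) = fst (darity S g)"
| "dout S (DZero A B n) = A"
| "dout S (DAdd s t) = dout S s"
| "dout S (DScale c s) = dout S s"
| "dout S (DDiff s) = dout S s"
| "dout S (DAct \<sigma> s) = \<sigma> ` dout S s"
| "dout S (DComp a d s t) = (dout S s - {a}) \<union> dout S t"

primrec din :: "('k, 'g) dio_pres \<Rightarrow> ('k, 'g) dterm \<Rightarrow> nat set" where
  "din S (DGen g) = fst (snd (darity S g))"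
| "din S (DZero A B n) = B"
| "din S (DAdd s t) = din S s"
| "din S (DScale c s) = din S s"
| "din S (DDiff s) = din S s"
| "din S (DAct \<sigma> s) = \<sigma> ` din S s"
| "din S (DComp a d s t) = din S s \<union> (din S t - {d})"

primrec ddeg :: "('k, 'g) dio_pres \<Rightarrow> ('k, 'g) dterm \<Rightarrow> int" where
  "ddeg S (DGen g) = snd (snd (darity S g))"
| "ddeg S (DZero A B n) = n"
| "ddeg S (DAdd s t) = ddeg S s"
| "ddeg S (DScale c s) = ddeg S s"
| "ddeg S (DDiff s) = ddeg S s - 1"
| "ddeg S (DAct \<sigma> s) = ddeg S s"
| "ddeg S (DComp a d s t) = ddeg S s + ddeg S t"

primrec dchk :: "('k, 'r) ring_scheme \<Rightarrow> ('k, 'g) dio_pres \<Rightarrow> ('k, 'g) dterm \<Rightarrow> bool" where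
  "dchk K S (DGen g) \<longleftrightarrow> g \<in> dgens S \<and> biflags (fst (darity S g)) (fst (snd (darity S g)))"
| "dchk K S (DZero A B n) \<longleftrightarrow> biflags A B"
| "dchk K S (DAdd s t) \<longleftrightarrow> dchk K S s \<and> dchk K S t \<and>
     dout S t = dout S s \<and> din S t = din S s \<and> ddeg S t = ddeg S s"
| "dchk K S (DScale c s) \<longleftrightarrow> c \<in> carrier K \<and> dchk K S s"
| "dchk K S (DDiff s) \<longleftrightarrow> dchk K S s"
| "dchk K S (DAct \<sigma> s) \<longleftrightarrow> dchk K S s \<and> inj_on \<sigma> (dout S s \<union> din S s)"
| "dchk K S (DComp a d s t) \<longleftrightarrow> dchk K S s \<and> dchk K S t \<and>
     dglue (dout S s) (din S s) a (dout S t) (din S t) d"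

text \<open>A term determines its outputs, inputs and degree, so typing is a computation. With this
  the simplifier settles typing goals, without inversion of the inductive
  \<open>dwt\<close>.\<close>

lemma dwt_iff:
  "dwt K S A B n t \<longleftrightarrow> dchk K S t \<and> dout S t = A \<and> din S t = B \<and> ddeg S t = n"
proof
  show "dwt K S A B n t \<Longrightarrow> dchk K S t \<and> dout S t = A \<and> din S t = B \<and> ddeg S t = n"
    by (induction rule: dwt.induct) auto
  have "dchk K S t \<Longrightarrow> dwt K S (dout S t) (din S t) (ddeg S t) t"
    by (induction t) (auto intro!: dwt.intros)
  then show "dchk K S t \<and> dout S t = A \<and> din S t = B \<and> ddeg S t = n \<Longrightarrow> dwt K S A B n t"
    by auto
qed

lemma dwt_biflags: "dwt K S A B n t \<Longrightarrow> biflags A B"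
  by (induction rule: dwt.induct) (auto intro: biflags_image biflags_glue)

text \<open>The two sides of every rule have the same type. Work is needed only where they write a
  flag set differently, as for relabelled composites and for the two bracketings of a tree with two
  edges.\<close>

lemma deq_dwt:
  assumes "field K" "deq K S A B n s t"
  shows "dwt K S A B n s \<and> dwt K S A B n t"
proof -
  interpret field K by fact
  have [simp]: "\<ominus>\<^bsub>K\<^esub> \<one>\<^bsub>K\<^esub> \<in> carrier K" by simp
  note [simp] = dwt_iff assms(1)
  show ?thesis using assms(2)
  proof (induction rule: deq.induct)
    case (comp_act A B m s C D n t a d \<sigma>)
    then have "inj_on \<sigma> (A \<union> B)" "inj_on \<sigma> (C \<union> D)"
        "inj_on \<sigma> ((A - {a}) \<union> C \<union> (B \<union> (D - {d})))"
      by (auto elim!: inj_on_subset)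
    then show ?case
      using comp_act dglue_image[of A B a C D d \<sigma>] dglue_image_sets[of A B a C D d \<sigma>] by simp
  next
    case (comp_assoc_chain A B m s C D n t E F p u a d c f)
    then have "A - {a} \<union> C - {c} \<union> E = A - {a} \<union> (C - {c} \<union> E)"
      "B \<union> (D - {d}) \<union> (F - {f}) = B \<union> (D \<union> (F - {f}) - {d})"
      by (auto simp: dglue_def)
    then show ?case
      using comp_assoc_chain dglue_chain[of A B a C D d c E F f] by simp
  next
    case (comp_assoc_out A B m s C D n t E F p u a d b f)
    then have "A - {a} \<union> C - {b} \<union> E = A - {b} \<union> E - {a} \<union> C"
      by (auto simp: dglue_def)
    then show ?case
      using comp_assoc_out dglue_out[of A B a C D d b E F f] dglue_out[of A B b E F f a C D d]
      by (simp add: Int_commute Un_ac)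
  next
    case (comp_assoc_in A B m s C D n t E F p u a f c g)
    then have "B \<union> (D \<union> (F - {g}) - {f}) = D \<union> (B \<union> (F - {f}) - {g})"
      by (auto simp: dglue_def)
    then show ?case
      using comp_assoc_in dglue_in[of A B a E F f C D c g] dglue_in[of C D c E F g A B a f]
      by (simp add: Int_commute Un_ac)
  next
    case (act_cong A B n s \<sigma> \<tau>)
    then have "\<tau> ` A = \<sigma> ` A" "\<tau> ` B = \<sigma> ` B" "inj_on \<tau> (A \<union> B)"
      using inj_on_cong[of "A \<union> B" \<sigma> \<tau>] by (auto intro: image_cong)
    then show ?case using act_cong by simp
  next
    case (act_act A B n s \<sigma> \<tau>)
    then show ?case by (simp add: image_comp image_Un comp_inj_on)
  next
    case (add_zero A B n s)
    then show ?case using dwt_biflags[of K S A B n s] by simp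
  next
    case (add_inverse A B n s)
    then show ?case using dwt_biflags[of K S A B n s] by simp
  next
    case (diff_diff A B n s)
    then show ?case using dwt_biflags[of K S A B n s] by simp
  qed simp_all
qed

lemma deq_dwt1: "field K \<Longrightarrow> deq K S A B n s t \<Longrightarrow> dwt K S A B n s"
  and deq_dwt2: "field K \<Longrightarrow> deq K S A B n s t \<Longrightarrow> dwt K S A B n t"
  using deq_dwt by blast+

text \<open>The type is taken from the representative, so a class is named by a term alone;
  \<open>dcls_conv\<close> identifies it with the typed class that occurs in
  \<open>dio_presented\<close>.\<close>

definition dcls ::
  "('k, 'r) ring_scheme \<Rightarrow> ('k, 'g) dio_pres \<Rightarrow> ('k, 'g) dterm \<Rightarrow> ('k, 'g) dterm set" where
  "dcls K S s = {t. deq K S (dout S s) (din S s) (ddeg S s) s t}"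

lemma dcls_conv: "dwt K S A B n s \<Longrightarrow> {t. deq K S A B n s t} = dcls K S s"
  by (auto simp: dcls_def dwt_iff)

lemma dcls_eqI:
  assumes "field K" "deq K S A B n s t"
  shows "dcls K S s = dcls K S t"
proof -
  have "dwt K S A B n s" "dwt K S A B n t" using deq_dwt[OF assms] by auto
  then have "dcls K S s = {u. deq K S A B n s u}" "dcls K S t = {u. deq K S A B n t u}"
    by (auto simp: dcls_conv)
  then show ?thesis using assms(2) by (auto intro: deq.trans deq.sym)
qed

lemma dcls_mem: "t \<in> dcls K S s \<Longrightarrow> dwt K S A B n s \<Longrightarrow> deq K S A B n s t"
  by (auto simp: dcls_def dwt_iff)

lemma dcls_self: "dwt K S A B n s \<Longrightarrow> s \<in> dcls K S s"
  by (auto simp: dcls_def dwt_iff intro!: deq.refl)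

lemma dio_presented_carrier:
  "carrier (dsp (dio_presented K S) A B n) = {dcls K S s |s. dwt K S A B n s}"
  by (auto simp: dio_presented_def dcls_conv) (metis dcls_conv)

lemma dio_presented_carrierE:
  assumes "x \<in> carrier (dsp (dio_presented K S) A B n)"
  obtains s where "dwt K S A B n s" "x = dcls K S s"
  using assms by (auto simp: dio_presented_carrier)

lemma dcls_closed:
  "dwt K S A B n s \<Longrightarrow> dcls K S s \<in> carrier (dsp (dio_presented K S) A B n)"
  by (auto simp: dio_presented_carrier)

lemma dcls_zero:
  "biflags A B \<Longrightarrow> \<zero>\<^bsub>dsp (dio_presented K S) A B n\<^esub> = dcls K S (DZero A B n)"
  by (simp add: dio_presented_def dcls_conv dwt.wt_zero)

text \<open>The operations of \<open>dio_presented\<close> take the union over all representatives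
  of the argument classes. For a congruence a single representative already gives that
  union.\<close>

lemma congruence_class:
  assumes "\<And>a b. R a b \<Longrightarrow> R b a" "\<And>a b c. R a b \<Longrightarrow> R b c \<Longrightarrow> R a c"
    and "\<And>s'. s' \<in> X \<Longrightarrow> R (g s) (g s')" "s \<in> X"
  shows "{u. \<exists>s'\<in>X. R (g s') u} = {u. R (g s) u}"
  using assms by blast

lemma congruence_class2:
  assumes "\<And>a b. R a b \<Longrightarrow> R b a" "\<And>a b c. R a b \<Longrightarrow> R b c \<Longrightarrow> R a c"
    and "\<And>s' t'. s' \<in> X \<Longrightarrow> t' \<in> Y \<Longrightarrow> R (g s t) (g s' t')" "s \<in> X" "t \<in> Y"
  shows "{u. \<exists>s'\<in>X. \<exists>t'\<in>Y. R (g s' t') u} = {u. R (g s t) u}"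
  using assms by blast

lemma dcls_add:
  assumes "field K" "dwt K S A B n s" "dwt K S A B n t"
  shows "dcls K S s \<oplus>\<^bsub>dsp (dio_presented K S) A B n\<^esub> dcls K S t = dcls K S (DAdd s t)"
proof -
  have "{u. \<exists>s'\<in>dcls K S s. \<exists>t'\<in>dcls K S t. deq K S A B n (DAdd s' t') u} =
      {u. deq K S A B n (DAdd s t) u}"
    using assms
    by (intro congruence_class2) (auto intro: deq.sym deq.trans deq.cong_add dcls_mem dcls_self)
  also have "\<dots> = dcls K S (DAdd s t)"
    using assms by (intro dcls_conv dwt.intros)
  finally show ?thesis by (simp add: dio_presented_def)
qed

lemma dcls_smult:
  assumes "field K" "c \<in> carrier K" "dwt K S A B n s"
  shows "c \<odot>\<^bsub>dsp (dio_presented K S) A B n\<^esub> dcls K S s = dcls K S (DScale c s)"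
proof -
  have "{u. \<exists>s'\<in>dcls K S s. deq K S A B n (DScale c s') u} = {u. deq K S A B n (DScale c s) u}"
    using assms
    by (intro congruence_class) (auto intro: deq.sym deq.trans deq.cong_scale dcls_mem dcls_self)
  also have "\<dots> = dcls K S (DScale c s)"
    using assms by (intro dcls_conv dwt.intros)
  finally show ?thesis by (simp add: dio_presented_def)
qed

lemma dcls_diff:
  assumes "field K" "dwt K S A B n s"
  shows "ddiff (dio_presented K S) A B n (dcls K S s) = dcls K S (DDiff s)"
proof -
  have "{u. \<exists>s'\<in>dcls K S s. deq K S A B (n - 1) (DDiff s') u} =
      {u. deq K S A B (n - 1) (DDiff s) u}"
    using assms
    by (intro congruence_class) (auto intro: deq.sym deq.trans deq.cong_diff dcls_mem dcls_self)
  also have "\<dots> = dcls K S (DDiff s)"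
    using assms by (intro dcls_conv dwt.intros)
  finally show ?thesis by (simp add: dio_presented_def)
qed

lemma dcls_act:
  assumes "field K" "dwt K S A B n s" "inj_on \<sigma> (A \<union> B)"
  shows "dact (dio_presented K S) A B n \<sigma> (dcls K S s) = dcls K S (DAct \<sigma> s)"
proof -
  have "{u. \<exists>s'\<in>dcls K S s. deq K S (\<sigma> ` A) (\<sigma> ` B) n (DAct \<sigma> s') u} =
      {u. deq K S (\<sigma> ` A) (\<sigma> ` B) n (DAct \<sigma> s) u}"
    using assms
    by (intro congruence_class) (auto intro: deq.sym deq.trans deq.cong_act dcls_mem dcls_self)
  also have "\<dots> = dcls K S (DAct \<sigma> s)"
    using assms by (intro dcls_conv dwt.intros)
  finally show ?thesis by (simp add: dio_presented_def)
qed

lemma dcls_comp: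
  assumes "field K" "dwt K S A B m s" "dwt K S C D n t" "dglue A B a C D d"
  shows "dcomp (dio_presented K S) A B m a C D n d (dcls K S s) (dcls K S t) =
    dcls K S (DComp a d s t)"
proof -
  let ?Q = "deq K S ((A - {a}) \<union> C) (B \<union> (D - {d})) (m + n)"
  have "{u. \<exists>s'\<in>dcls K S s. \<exists>t'\<in>dcls K S t. ?Q (DComp a d s' t') u} = {u. ?Q (DComp a d s t) u}"
    using assms
    by (intro congruence_class2) (auto intro: deq.sym deq.trans deq.cong_comp dcls_mem dcls_self)
  also have "\<dots> = dcls K S (DComp a d s t)"
    using assms by (intro dcls_conv dwt.intros)
  finally show ?thesis by (simp add: dio_presented_def)
qed

lemma dio_presented_module:
  assumes "field K" "biflags A B"
  shows "module K (dsp (dio_presented K S) A B n)"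
proof -
  interpret field K by fact
  note [simp] = assms dcls_add dcls_smult dcls_zero dwt.intros dcls_closed
  note E = dio_presented_carrierE
  note I = dcls_eqI[OF assms(1)]
  let ?M = "dsp (dio_presented K S) A B n"
  have "abelian_group ?M"
  proof (rule abelian_groupI)
    fix x y z assume "x \<in> carrier ?M" "y \<in> carrier ?M" "z \<in> carrier ?M"
    then show "x \<oplus>\<^bsub>?M\<^esub> y \<oplus>\<^bsub>?M\<^esub> z = x \<oplus>\<^bsub>?M\<^esub> (y \<oplus>\<^bsub>?M\<^esub> z)"
      by (elim E) (simp add: I[OF deq.add_assoc])
  next
    fix x y assume "x \<in> carrier ?M" "y \<in> carrier ?M"
    then obtain s t where st: "dwt K S A B n s" "dwt K S A B n t" "x = dcls K S s" "y = dcls K S t"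
      by (elim E)
    then show "x \<oplus>\<^bsub>?M\<^esub> y \<in> carrier ?M" by simp
    show "x \<oplus>\<^bsub>?M\<^esub> y = y \<oplus>\<^bsub>?M\<^esub> x" using I[OF deq.add_commute[OF st(1,2)]] st by simp
  next
    fix x assume "x \<in> carrier ?M"
    then obtain s where s: "dwt K S A B n s" "x = dcls K S s" by (elim E)
    then show "\<zero>\<^bsub>?M\<^esub> \<oplus>\<^bsub>?M\<^esub> x = x"
      by (simp add: I[OF deq.add_zero])
    show "\<exists>y\<in>carrier ?M. y \<oplus>\<^bsub>?M\<^esub> x = \<zero>\<^bsub>?M\<^esub>"
      using s by (intro bexI[of _ "dcls K S (DScale (\<ominus>\<^bsub>K\<^esub> \<one>\<^bsub>K\<^esub>) s)"]) (simp_all add: I[OF deq.add_inverse])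
  qed auto
  then show ?thesis
  proof (intro moduleI)
    fix c e x assume "c \<in> carrier K" "e \<in> carrier K" "x \<in> carrier ?M"
    then show "(c \<oplus>\<^bsub>K\<^esub> e) \<odot>\<^bsub>?M\<^esub> x = c \<odot>\<^bsub>?M\<^esub> x \<oplus>\<^bsub>?M\<^esub> e \<odot>\<^bsub>?M\<^esub> x"
      "(c \<otimes>\<^bsub>K\<^esub> e) \<odot>\<^bsub>?M\<^esub> x = c \<odot>\<^bsub>?M\<^esub> (e \<odot>\<^bsub>?M\<^esub> x)"
      by (elim E, simp add: I[OF deq.add_scale] I[OF deq.scale_scale])+
  next
    fix c x y assume "c \<in> carrier K" "x \<in> carrier ?M" "y \<in> carrier ?M"
    then show "c \<odot>\<^bsub>?M\<^esub> (x \<oplus>\<^bsub>?M\<^esub> y) = c \<odot>\<^bsub>?M\<^esub> x \<oplus>\<^bsub>?M\<^esub> c \<odot>\<^bsub>?M\<^esub> y" "c \<odot>\<^bsub>?M\<^esub> x \<in> carrier ?M"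
      by (elim E, simp add: I[OF deq.scale_add])+
  next
    fix x assume "x \<in> carrier ?M"
    then show "\<one>\<^bsub>K\<^esub> \<odot>\<^bsub>?M\<^esub> x = x"
      by (elim E) (simp add: I[OF deq.scale_one])
  qed (auto intro: is_cring)
qed

text \<open>Each axiom is one rule of \<open>deq\<close> read on classes: \<open>E\<close> chooses
  representatives and \<open>I\<close> turns the rule into an equality of classes.\<close>

theorem dioperad_presented:
  assumes K: "field K"
  shows "dioperad K (dio_presented K S)"
proof (intro dioperad.intro dioperad_axioms.intro K)
  note [simp] = K dcls_add dcls_smult dcls_zero dcls_diff dcls_act dcls_comp dwt.intros dcls_closed
    biflags_image biflags_glue
  note E = dio_presented_carrierE
  note I = dcls_eqI[OF K]
  let ?P = "dio_presented K S"
  let ?c = "\<lambda>A B n. carrier (dsp ?P A B n)"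
  { fix A B n assume "biflags A B"
    then show "module K (dsp ?P A B n)" by (rule dio_presented_module[OF K]) }
  { fix A B n assume "biflags A B"
    then show "lin_map K (dsp ?P A B n) (dsp ?P A B (n - 1)) (ddiff ?P A B n)"
      by (auto simp: lin_map_def I[OF deq.diff_add] I[OF deq.diff_scale] elim!: E) }
  { fix A B n x assume "biflags A B" "x \<in> ?c A B n"
    then show "ddiff ?P A B (n - 1) (ddiff ?P A B n x) = \<zero>\<^bsub>dsp ?P A B (n - 2)\<^esub>"
      by (auto simp: I[OF deq.diff_diff] elim!: E) }
  { fix A B n and \<sigma> :: "nat \<Rightarrow> nat" assume "biflags A B" "inj_on \<sigma> (A \<union> B)"
    then show "lin_map K (dsp ?P A B n) (dsp ?P (\<sigma> ` A) (\<sigma> ` B) n) (dact ?P A B n \<sigma>)"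
      by (auto simp: lin_map_def I[OF deq.act_add] I[OF deq.act_scale] elim!: E) }
  { fix A B n x and \<sigma> \<tau> :: "nat \<Rightarrow> nat"
    assume *: "biflags A B" "inj_on \<sigma> (A \<union> B)" "\<And>i. i \<in> A \<union> B \<Longrightarrow> \<sigma> i = \<tau> i" "x \<in> ?c A B n"
    have "inj_on \<tau> (A \<union> B)" using inj_on_cong[of "A \<union> B" \<sigma> \<tau>] *(2,3) by auto
    then show "dact ?P A B n \<sigma> x = dact ?P A B n \<tau> x"
      using * by (elim E) (simp add: I[OF deq.act_cong]) }
  { fix A B n x assume "biflags A B" "x \<in> ?c A B n"
    then show "dact ?P A B n id x = x" by (auto simp: I[OF deq.act_id] elim!: E) }
  { fix A B n x and \<sigma> \<tau> :: "nat \<Rightarrow> nat"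
    assume "biflags A B" "inj_on \<sigma> (A \<union> B)" "inj_on \<tau> (\<sigma> ` (A \<union> B))" "x \<in> ?c A B n"
    then show "dact ?P (\<sigma> ` A) (\<sigma> ` B) n \<tau> (dact ?P A B n \<sigma> x) = dact ?P A B n (\<tau> \<circ> \<sigma>) x"
      by (elim E) (simp add: image_Un comp_inj_on I[OF deq.act_act]) }
  { fix A B n x and \<sigma> :: "nat \<Rightarrow> nat"
    assume "biflags A B" "inj_on \<sigma> (A \<union> B)" "x \<in> ?c A B n"
    then show "ddiff ?P (\<sigma> ` A) (\<sigma> ` B) n (dact ?P A B n \<sigma> x) = dact ?P A B (n - 1) \<sigma> (ddiff ?P A B n x)"
      by (elim E) (simp add: I[OF deq.act_diff]) }
  { fix A B m a C D n d assume "dglue A B a C D d"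
    then show "bilin_map K (dsp ?P A B m) (dsp ?P C D n)
         (dsp ?P ((A - {a}) \<union> C) (B \<union> (D - {d})) (m + n)) (dcomp ?P A B m a C D n d)"
      by (auto simp: bilin_map_def lin_map_def I[OF deq.comp_add_left] I[OF deq.comp_add_right]
          I[OF deq.comp_scale_left] I[OF deq.comp_scale_right] elim!: E) }
  { fix A B m a C D n d x y assume *: "dglue A B a C D d" "x \<in> ?c A B m" "y \<in> ?c C D n"
    then obtain s t where st: "dwt K S A B m s" "x = dcls K S s" "dwt K S C D n t" "y = dcls K S t"
      by (elim E)
    let ?A = "(A - {a}) \<union> C" and ?B = "B \<union> (D - {d})"
    \<comment> \<open>\<open>wt_comp\<close> assigns the degrees \<open>m - 1 + n\<close> and
      \<open>m + (n - 1)\<close> to these terms; through \<open>dwt_iff\<close> the passage to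
      \<open>m + n - 1\<close> is integer arithmetic.\<close>
    have w: "dwt K S ?A ?B (m + n - 1) (DComp a d (DDiff s) t)"
        "dwt K S ?A ?B (m + n - 1) (DComp a d s (DDiff t))"
      using * st by (auto simp: dwt_iff)
    show "ddiff ?P ?A ?B (m + n) (dcomp ?P A B m a C D n d x y) =
         dcomp ?P A B (m - 1) a C D n d (ddiff ?P A B m x) y
         \<oplus>\<^bsub>dsp ?P ?A ?B (m + n - 1)\<^esub> ksign K m \<odot>\<^bsub>dsp ?P ?A ?B (m + n - 1)\<^esub>
           dcomp ?P A B m a C D (n - 1) d x (ddiff ?P C D n y)"
      using I[OF deq.comp_diff[OF st(1,3) *(1)]] *(1) st w by simp }
  { fix A B m a C D n d x y and \<sigma> :: "nat \<Rightarrow> nat"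
    assume *: "dglue A B a C D d" "inj_on \<sigma> (A \<union> B \<union> C \<union> D)" "x \<in> ?c A B m" "y \<in> ?c C D n"
    then obtain s t where st: "dwt K S A B m s" "x = dcls K S s" "dwt K S C D n t" "y = dcls K S t"
      by (elim E)
    have i: "inj_on \<sigma> (A \<union> B)" "inj_on \<sigma> (C \<union> D)" "inj_on \<sigma> ((A - {a}) \<union> C \<union> (B \<union> (D - {d})))"
      using *(2) by (auto elim!: inj_on_subset)
    show "dact ?P ((A - {a}) \<union> C) (B \<union> (D - {d})) (m + n) \<sigma> (dcomp ?P A B m a C D n d x y) =
       dcomp ?P (\<sigma> ` A) (\<sigma> ` B) m (\<sigma> a) (\<sigma> ` C) (\<sigma> ` D) n (\<sigma> d) (dact ?P A B m \<sigma> x) (dact ?P C D n \<sigma> y)"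
      using I[OF deq.comp_act[OF st(1,3) *(1,2)]] *(1) st i dglue_image[OF *(1,2)] by simp }
  { fix A B m a C D n d c E F p f x y z
    assume *: "dglue A B a C D d" "dglue C D c E F f" "(A \<union> B) \<inter> (E \<union> F) = {}"
      "x \<in> ?c A B m" "y \<in> ?c C D n" "z \<in> ?c E F p"
    then obtain s t u where st: "dwt K S A B m s" "x = dcls K S s" "dwt K S C D n t" "y = dcls K S t"
      "dwt K S E F p u" "z = dcls K S u"
      by (elim E)
    show "dcomp ?P ((A - {a}) \<union> C) (B \<union> (D - {d})) (m + n) c E F p f (dcomp ?P A B m a C D n d x y) z =
       dcomp ?P A B m a ((C - {c}) \<union> E) (D \<union> (F - {f})) (n + p) d x (dcomp ?P C D n c E F p f y z)"
      using I[OF deq.comp_assoc_chain[OF st(1,3,5) *(1-3)]] *(1,2) st dglue_chain[OF *(1-3)]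
      by simp }
  { fix A B m a C D n d b E F p f x y z
    assume *: "dglue A B a C D d" "dglue A B b E F f" "a \<noteq> b" "(C \<union> D) \<inter> (E \<union> F) = {}"
      "x \<in> ?c A B m" "y \<in> ?c C D n" "z \<in> ?c E F p"
    then obtain s t u where st: "dwt K S A B m s" "x = dcls K S s" "dwt K S C D n t" "y = dcls K S t"
      "dwt K S E F p u" "z = dcls K S u"
      by (elim E)
    let ?A = "(((A - {a}) \<union> C) - {b}) \<union> E" and ?B = "(B \<union> (D - {d})) \<union> (F - {f})"
    have g: "dglue ((A - {b}) \<union> E) (B \<union> (F - {f})) a C D d"
      using dglue_out[OF *(2,1)] * by (auto simp: Int_commute)
    have e: "deq K S ?A ?B (m + n + p) (DComp b f (DComp a d s t) u)
        (DScale (ksign K (n * p)) (DComp a d (DComp b f s u) t))"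
      by (rule deq.comp_assoc_out[OF st(1,3,5) *(1-4)])
    \<comment> \<open>\<open>dcls_smult\<close> needs the type of the composite under the scalar. It
      is read off from the right-hand side of \<open>e\<close>, which avoids identifying the flag
      sets of the two bracketings again.\<close>
    have "dwt K S ?A ?B (m + n + p) (DComp a d (DComp b f s u) t)"
      using deq_dwt2[OF K e] by (auto simp: dwt_iff)
    then show "dcomp ?P ((A - {a}) \<union> C) (B \<union> (D - {d})) (m + n) b E F p f (dcomp ?P A B m a C D n d x y) z =
       ksign K (n * p) \<odot>\<^bsub>dsp ?P ?A ?B (m + n + p)\<^esub>
       dcomp ?P ((A - {b}) \<union> E) (B \<union> (F - {f})) (m + p) a C D n d (dcomp ?P A B m b E F p f x z) y"
      using *(1,2) st dglue_out[OF *(1-4)] g I[OF e] by simp }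
  { fix A B m a E F p f C D n c g x y z
    assume *: "dglue A B a E F f" "dglue C D c E F g" "f \<noteq> g" "(A \<union> B) \<inter> (C \<union> D) = {}"
      "x \<in> ?c A B m" "y \<in> ?c C D n" "z \<in> ?c E F p"
    then obtain s t u where st: "dwt K S A B m s" "x = dcls K S s" "dwt K S C D n t" "y = dcls K S t"
      "dwt K S E F p u" "z = dcls K S u"
      by (elim E)
    let ?A = "(A - {a}) \<union> ((C - {c}) \<union> E)" and ?B = "B \<union> ((D \<union> (F - {g})) - {f})"
    have h: "dglue C D c ((A - {a}) \<union> E) (B \<union> (F - {f})) g"
      using dglue_in[OF *(2,1)] * by (auto simp: Int_commute)
    have e: "deq K S ?A ?B (m + (n + p)) (DComp a f s (DComp c g t u))
        (DScale (ksign K (m * n)) (DComp c g t (DComp a f s u)))"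
      by (rule deq.comp_assoc_in[OF st(1,3,5) *(1-4)])
    have "dwt K S ?A ?B (m + (n + p)) (DComp c g t (DComp a f s u))"
      using deq_dwt2[OF K e] by (auto simp: dwt_iff)
    then show "dcomp ?P A B m a ((C - {c}) \<union> E) (D \<union> (F - {g})) (n + p) f x (dcomp ?P C D n c E F p g y z) =
       ksign K (m * n) \<odot>\<^bsub>dsp ?P ?A ?B (m + (n + p))\<^esub>
       dcomp ?P C D n c ((A - {a}) \<union> E) (B \<union> (F - {f})) (m + p) g y (dcomp ?P A B m a E F p f x z)"
      using *(1,2) st dglue_in[OF *(1-4)] h I[OF e] by simp }
qed

section \<open>Morphisms of dioperads\<close>

lemma dio_hom_lin: "dio_hom K P R f \<Longrightarrow> biflags A B \<Longrightarrow> lin_map K (dsp P A B n) (dsp R A B n) (f A B n)"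
  by (simp add: dio_hom_def)

lemma dio_hom_diff: "dio_hom K P R f \<Longrightarrow> biflags A B \<Longrightarrow> x \<in> carrier (dsp P A B n) \<Longrightarrow>
    f A B (n - 1) (ddiff P A B n x) = ddiff R A B n (f A B n x)"
  by (simp add: dio_hom_def)

lemma dio_hom_act:
  "dio_hom K P R f \<Longrightarrow> biflags A B \<Longrightarrow> inj_on \<sigma> (A \<union> B) \<Longrightarrow> x \<in> carrier (dsp P A B n) \<Longrightarrow>
    f (\<sigma> ` A) (\<sigma> ` B) n (dact P A B n \<sigma> x) = dact R A B n \<sigma> (f A B n x)"
  by (simp add: dio_hom_def)

lemma dio_hom_comp:
  "dio_hom K P R f \<Longrightarrow> dglue A B a C D d \<Longrightarrow>
    x \<in> carrier (dsp P A B m) \<Longrightarrow> y \<in> carrier (dsp P C D n) \<Longrightarrow>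
    f ((A - {a}) \<union> C) (B \<union> (D - {d})) (m + n) (dcomp P A B m a C D n d x y) =
    dcomp R A B m a C D n d (f A B m x) (f C D n y)"
  by (simp add: dio_hom_def)

lemma dio_hom_closed:
  "dio_hom K P R f \<Longrightarrow> biflags A B \<Longrightarrow> x \<in> carrier (dsp P A B n) \<Longrightarrow> f A B n x \<in> carrier (dsp R A B n)"
  by (rule lin_map_closed[OF dio_hom_lin])

lemma dio_hom_id: "dio_hom K P P (\<lambda>A B n x. x)"
  by (simp add: dio_hom_def lin_map_def)

lemma dglue_biflags: "dglue A B a C D d \<Longrightarrow> biflags A B \<and> biflags C D"
  by (simp add: dglue_def)

lemma dio_hom_compose:
  assumes P: "dioperad K P" and f: "dio_hom K P Q f" and g: "dio_hom K Q R g"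
  shows "dio_hom K P R (\<lambda>A B n x. g A B n (f A B n x))"
proof -
  interpret dioperad K P by fact
  show ?thesis
    unfolding dio_hom_def
  proof (intro conjI allI impI ballI)
    fix A B n assume b: "biflags A B"
    show "lin_map K (dsp P A B n) (dsp R A B n) (\<lambda>x. g A B n (f A B n x))"
      using b by (intro lin_map_comp[OF dio_hom_lin[OF f] dio_hom_lin[OF g]])
    fix x assume x: "x \<in> carrier (dsp P A B n)"
    show "g A B (n - 1) (f A B (n - 1) (ddiff P A B n x)) = ddiff R A B n (g A B n (f A B n x))"
      using b x by (simp add: dio_hom_diff[OF f] dio_hom_diff[OF g] dio_hom_closed[OF f])
  next
    fix A B n and \<sigma> :: "nat \<Rightarrow> nat" and x
    assume "biflags A B" "inj_on \<sigma> (A \<union> B)" "x \<in> carrier (dsp P A B n)"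
    then show "g (\<sigma> ` A) (\<sigma> ` B) n (f (\<sigma> ` A) (\<sigma> ` B) n (dact P A B n \<sigma> x)) =
        dact R A B n \<sigma> (g A B n (f A B n x))"
      by (simp add: dio_hom_act[OF f] dio_hom_act[OF g] dio_hom_closed[OF f])
  next
    fix A B m a C D n d x y
    assume "dglue A B a C D d" "x \<in> carrier (dsp P A B m)" "y \<in> carrier (dsp P C D n)"
    then show "g (A - {a} \<union> C) (B \<union> (D - {d})) (m + n)
        (f (A - {a} \<union> C) (B \<union> (D - {d})) (m + n) (dcomp P A B m a C D n d x y)) =
       dcomp R A B m a C D n d (g A B m (f A B m x)) (g C D n (f C D n y))"
      using dglue_biflags[of A B a C D d]
      by (simp add: dio_hom_comp[OF f] dio_hom_comp[OF g] dio_hom_closed[OF f])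
  qed
qed

section \<open>Evaluation of terms and the universal property of a presented dioperad\<close>

primrec deval :: "('k, 'g) dio_pres \<Rightarrow> ('k, 'v) dio_data \<Rightarrow> ('g \<Rightarrow> 'v) \<Rightarrow> ('k, 'g) dterm \<Rightarrow> 'v" where
  "deval S P h (DGen g) = h g"
| "deval S P h (DZero A B n) = \<zero>\<^bsub>dsp P A B n\<^esub>"
| "deval S P h (DAdd s t) = deval S P h s \<oplus>\<^bsub>dsp P (dout S s) (din S s) (ddeg S s)\<^esub> deval S P h t"
| "deval S P h (DScale c s) = c \<odot>\<^bsub>dsp P (dout S s) (din S s) (ddeg S s)\<^esub> deval S P h s"
| "deval S P h (DDiff s) = ddiff P (dout S s) (din S s) (ddeg S s) (deval S P h s)"
| "deval S P h (DAct \<sigma> s) = dact P (dout S s) (din S s) (ddeg S s) \<sigma> (deval S P h s)"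
| "deval S P h (DComp a d s t) =
     dcomp P (dout S s) (din S s) (ddeg S s) a (dout S t) (din S t) (ddeg S t) d
       (deval S P h s) (deval S P h t)"

text \<open>A model of the presentation in \<open>P\<close>. Only relations between terms of a
  common type are demanded, because only these enter \<open>deq\<close> through the rule
  \<open>rel\<close>.\<close>

definition dsat ::
  "('k, 'r) ring_scheme \<Rightarrow> ('k, 'g) dio_pres \<Rightarrow> ('k, 'v) dio_data \<Rightarrow> ('g \<Rightarrow> 'v) \<Rightarrow> bool" where
  "dsat K S P h \<longleftrightarrow>
     (\<forall>g\<in>dgens S. \<forall>A B n. darity S g = (A, B, n) \<longrightarrow> biflags A B \<longrightarrow> h g \<in> carrier (dsp P A B n)) \<and>
     (\<forall>s t. (s, t) \<in> drels S \<longrightarrow> (\<forall>A B n. dwt K S A B n s \<longrightarrow> dwt K S A B n t \<longrightarrow>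
        deval S P h s = deval S P h t))"

lemma dwt_data: "dwt K S A B n t \<Longrightarrow> dout S t = A \<and> din S t = B \<and> ddeg S t = n"
  by (simp add: dwt_iff)

context
  fixes K :: "('k, 'r) ring_scheme" and S :: "('k, 'g) dio_pres" and P :: "('k, 'v) dio_data"
    and h :: "'g \<Rightarrow> 'v"
  assumes P: "dioperad K P" and sat: "dsat K S P h"
begin

lemma deval_closed: "dwt K S A B n t \<Longrightarrow> deval S P h t \<in> carrier (dsp P A B n)"
proof (induction rule: dwt.induct)
  interpret dioperad K P by (rule P)
  { case (wt_gen g A B n) then show ?case using sat by (auto simp: dsat_def) }
  { case (wt_zero A B n)
    interpret M: module K "dsp P A B n" using wt_zero by (rule dsp_module)
    show ?case by simp }
  { case (wt_add A B n s t)
    then interpret M: module K "dsp P A B n" by (blast intro: dsp_module dwt_biflags)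
    show ?case using wt_add dwt_data[OF wt_add(1)] by simp }
  { case (wt_scale c A B n s)
    then interpret M: module K "dsp P A B n" by (blast intro: dsp_module dwt_biflags)
    show ?case using wt_scale dwt_data[OF wt_scale(2)] by simp }
  { case (wt_diff A B n s)
    then show ?case
      using dwt_data[OF wt_diff(1)] lin_map_closed[OF ddiff_linear[OF dwt_biflags[OF wt_diff(1)]]]
      by simp }
  { case (wt_act A B n s \<sigma>)
    then show ?case
      using dwt_data[OF wt_act(1)] lin_map_closed[OF dact_linear[OF dwt_biflags[OF wt_act(1)]]]
      by simp }
  { case (wt_comp A B m s C D n t a d)
    then show ?case
      using dwt_data[OF wt_comp(1)] dwt_data[OF wt_comp(2)] bilin_map_closed[OF dcomp_bilinear[OF wt_comp(3)]]
      by simp }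
qed

text \<open>Soundness: every rule of \<open>deq\<close> is a relation, which \<open>h\<close>
  satisfies, or a law of congruences, or an axiom of dioperads, which \<open>P\<close>
  satisfies.\<close>

lemma deval_deq: "deq K S A B n s t \<Longrightarrow> deval S P h s = deval S P h t"
proof (induction rule: deq.induct)
  interpret dioperad K P by (rule P)
  note [simp] = deval_closed field_axioms
  note D = dwt_data[of K S] and bf = dwt_biflags[of K S]
  note lin = lin_map_add lin_map_scale
  { case (rel s t A B n) then show ?case using sat by (auto simp: dsat_def) }
  { case (refl A B n s) show ?case .. }
  { case sym then show ?case by simp }
  { case trans then show ?case by simp }
  { case (cong_add A B n s s' t t')
    then show ?case using D[OF deq_dwt1[OF _ cong_add(1)]] D[OF deq_dwt2[OF _ cong_add(1)]] by simp }
  { case (cong_scale c A B n s s')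
    then show ?case using D[OF deq_dwt1[OF _ cong_scale(2)]] D[OF deq_dwt2[OF _ cong_scale(2)]] by simp }
  { case (cong_diff A B n s s')
    then show ?case using D[OF deq_dwt1[OF _ cong_diff(1)]] D[OF deq_dwt2[OF _ cong_diff(1)]] by simp }
  { case (cong_act A B n s s' \<sigma>)
    then show ?case using D[OF deq_dwt1[OF _ cong_act(1)]] D[OF deq_dwt2[OF _ cong_act(1)]] by simp }
  { case (cong_comp A B m s s' C D' n t t' a d)
    then show ?case using D[OF deq_dwt1[OF _ cong_comp(1)]] D[OF deq_dwt2[OF _ cong_comp(1)]]
        D[OF deq_dwt1[OF _ cong_comp(2)]] D[OF deq_dwt2[OF _ cong_comp(2)]] by simp }
  { case (add_assoc A B n s t u)
    then interpret M: module K "dsp P A B n" by (blast intro: dsp_module bf)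
    show ?case using add_assoc D[OF add_assoc(1)] D[OF add_assoc(2)] by (simp add: M.a_assoc) }
  { case (add_commute A B n s t)
    then interpret M: module K "dsp P A B n" by (blast intro: dsp_module bf)
    show ?case using add_commute D[OF add_commute(1)] D[OF add_commute(2)] by (simp add: M.a_comm) }
  { case (add_zero A B n s)
    then interpret M: module K "dsp P A B n" by (blast intro: dsp_module bf)
    show ?case using add_zero by simp }
  { case (add_inverse A B n s)
    then interpret M: module K "dsp P A B n" by (blast intro: dsp_module bf)
    show ?case using add_inverse D[OF add_inverse(1)]
      by (simp add: module_minus[OF M.module_axioms] M.l_neg) }
  { case (scale_one A B n s)
    then interpret M: module K "dsp P A B n" by (blast intro: dsp_module bf)
    show ?case using scale_one D[OF scale_one(1)] by simp }
  { case (scale_scale c e A B n s)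
    then interpret M: module K "dsp P A B n" by (blast intro: dsp_module bf)
    show ?case using scale_scale D[OF scale_scale(3)] by (simp add: M.smult_assoc1) }
  { case (scale_add c A B n s t)
    then interpret M: module K "dsp P A B n" by (blast intro: dsp_module bf)
    show ?case using scale_add D[OF scale_add(2)] D[OF scale_add(3)] by (simp add: M.smult_r_distr) }
  { case (add_scale c e A B n s)
    then interpret M: module K "dsp P A B n" by (blast intro: dsp_module bf)
    show ?case using add_scale D[OF add_scale(3)] by (simp add: M.smult_l_distr) }
  { case (diff_add A B n s t)
    then show ?case using D[OF diff_add(1)] D[OF diff_add(2)]
      by (simp add: lin_map_add[OF ddiff_linear[OF bf[OF diff_add(1)]]]) }
  { case (diff_scale c A B n s)
    then show ?case using D[OF diff_scale(2)]
      by (simp add: lin_map_scale[OF ddiff_linear[OF bf[OF diff_scale(2)]]]) }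
  { case (diff_diff A B n s)
    then show ?case using D[OF diff_diff(1)] bf[OF diff_diff(1)] by (simp add: ddiff_ddiff) }
  { case (act_add A B n s t \<sigma>)
    then show ?case using D[OF act_add(1)] D[OF act_add(2)]
      by (simp add: lin_map_add[OF dact_linear[OF bf[OF act_add(1)]]]) }
  { case (act_scale c A B n s \<sigma>)
    then show ?case using D[OF act_scale(2)]
      by (simp add: lin_map_scale[OF dact_linear[OF bf[OF act_scale(2)]]]) }
  { case (act_cong A B n s \<sigma> \<tau>)
    have "dact P A B n \<sigma> (deval S P h s) = dact P A B n \<tau> (deval S P h s)"
      using act_cong bf[OF act_cong(1)] by (intro dact_cong) auto
    then show ?case using D[OF act_cong(1)] by simp }
  { case (act_id A B n s)
    then show ?case using D[OF act_id(1)] bf[OF act_id(1)] by (simp add: dact_id) }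
  { case (act_act A B n s \<sigma> \<tau>)
    then show ?case using D[OF act_act(1)] bf[OF act_act(1)] by (simp add: dact_comp) }
  { case (act_diff A B n s \<sigma>)
    then show ?case using D[OF act_diff(1)] bf[OF act_diff(1)] by (simp add: dact_ddiff) }
  { case (comp_add_left A B m s s' C D' n t a d)
    then show ?case using D[OF comp_add_left(1)] D[OF comp_add_left(2)] D[OF comp_add_left(3)]
        lin_map_add[OF bilin_map_left[OF dcomp_bilinear[OF comp_add_left(4)]]] by simp }
  { case (comp_scale_left c A B m s C D' n t a d)
    then show ?case using D[OF comp_scale_left(2)] D[OF comp_scale_left(3)]
        lin_map_scale[OF bilin_map_left[OF dcomp_bilinear[OF comp_scale_left(4)]]] by simp }
  { case (comp_add_right A B m s C D' n t t' a d)
    then show ?case using D[OF comp_add_right(1)] D[OF comp_add_right(2)] D[OF comp_add_right(3)]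
        lin_map_add[OF bilin_map_right[OF dcomp_bilinear[OF comp_add_right(4)]]] by simp }
  { case (comp_scale_right c A B m s C D' n t a d)
    then show ?case using D[OF comp_scale_right(2)] D[OF comp_scale_right(3)]
        lin_map_scale[OF bilin_map_right[OF dcomp_bilinear[OF comp_scale_right(4)]]] by simp }
  { case (comp_diff A B m s C D' n t a d)
    then show ?case using D[OF comp_diff(1)] D[OF comp_diff(2)] dcomp_ddiff[OF comp_diff(3)]
      by (simp add: algebra_simps) }
  { case (comp_act A B m s C D' n t a d \<sigma>)
    then show ?case using D[OF comp_act(1)] D[OF comp_act(2)] dcomp_dact[OF comp_act(3,4)] by simp }
  { case (comp_assoc_chain A B m s C D' n t E F p u a d c f)
    then show ?case using D[OF comp_assoc_chain(1)] D[OF comp_assoc_chain(2)] D[OF comp_assoc_chain(3)]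
        dcomp_assoc_chain[OF comp_assoc_chain(4-6)] by simp }
  { case (comp_assoc_out A B m s C D' n t E F p u a d b f)
    \<comment> \<open>The scalar on the right of the rule acts in the module whose flag sets are
      computed from the other bracketing; these equations identify it with the module in
      \<open>dcomp_assoc_out\<close>.\<close>
    then have "A - {b} \<union> E - {a} \<union> C = A - {a} \<union> C - {b} \<union> E" by (auto simp: dglue_def)
    moreover have "B \<union> (F - {f}) \<union> (D' - {d}) = B \<union> (D' - {d}) \<union> (F - {f})"
      by auto
    ultimately show ?case using comp_assoc_out(1-3) D[OF comp_assoc_out(1)] D[OF comp_assoc_out(2)] D[OF comp_assoc_out(3)]
        dcomp_assoc_out[OF comp_assoc_out(4-7)] by (simp add: add_ac) }
  { case (comp_assoc_in A B m s C D' n t E F p u a f c g)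
    then have "D' \<union> (B \<union> (F - {f}) - {g}) = B \<union> (D' \<union> (F - {g}) - {f})" by (auto simp: dglue_def)
    moreover have "C - {c} \<union> (A - {a} \<union> E) = A - {a} \<union> (C - {c} \<union> E)"
      by auto
    ultimately show ?case using comp_assoc_in(1-3) D[OF comp_assoc_in(1)] D[OF comp_assoc_in(2)] D[OF comp_assoc_in(3)]
        dcomp_assoc_in[OF comp_assoc_in(4-7)] by (simp add: add_ac) }
qed

end

text \<open>By \<open>deval_deq\<close> the value does not depend on the chosen representative. The
  typing arguments are there only to give the shape of a morphism.\<close>

definition dio_lift ::
  "('k, 'g) dio_pres \<Rightarrow> ('k, 'v) dio_data \<Rightarrow> ('g \<Rightarrow> 'v) \<Rightarrow>
   nat set \<Rightarrow> nat set \<Rightarrow> int \<Rightarrow> ('k, 'g) dterm set \<Rightarrow> 'v" where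
  "dio_lift S P h A B n X = deval S P h (SOME t. t \<in> X)"

lemma dio_lift_dcls:
  assumes P: "dioperad K P" and sat: "dsat K S P h" and t: "dwt K S A B n t"
  shows "dio_lift S P h A' B' n' (dcls K S t) = deval S P h t"
proof -
  have "(SOME s. s \<in> dcls K S t) \<in> dcls K S t" by (rule someI, rule dcls_self[OF t])
  from deval_deq[OF P sat dcls_mem[OF this t]] show ?thesis by (simp add: dio_lift_def)
qed

text \<open>The existence half of the universal property: evaluation commutes with the operations
  because \<open>deval\<close> was defined by recursion over them.\<close>

theorem dio_lift_hom:
  assumes P: "dioperad K P" and sat: "dsat K S P h"
  shows "dio_hom K (dio_presented K S) P (dio_lift S P h)"
proof -
  interpret dioperad K P by fact
  note K = field_axioms
  note L = dio_lift_dcls[OF P sat]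
  note E = dio_presented_carrierE
  note [simp] = K dcls_add dcls_smult dcls_zero dcls_diff dcls_act dcls_comp dwt.intros deval_closed[OF P sat]
  show ?thesis
    unfolding dio_hom_def
  proof (intro conjI allI impI ballI)
    fix A B n assume b: "biflags A B"
    show "lin_map K (dsp (dio_presented K S) A B n) (dsp P A B n) (dio_lift S P h A B n)"
      unfolding lin_map_def Pi_iff
    proof (intro conjI ballI)
      fix x y assume "x \<in> carrier (dsp (dio_presented K S) A B n)" "y \<in> carrier (dsp (dio_presented K S) A B n)"
      then obtain s t where st: "dwt K S A B n s" "x = dcls K S s" "dwt K S A B n t" "y = dcls K S t"
        by (elim E)
      then show "dio_lift S P h A B n (x \<oplus>\<^bsub>dsp (dio_presented K S) A B n\<^esub> y) =
          dio_lift S P h A B n x \<oplus>\<^bsub>dsp P A B n\<^esub> dio_lift S P h A B n y"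
        using dwt_data[OF st(1)] L[of A B n s] L[of A B n t] L[of A B n "DAdd s t"] by simp
    next
      fix x assume "x \<in> carrier (dsp (dio_presented K S) A B n)"
      then obtain s where st: "dwt K S A B n s" "x = dcls K S s"
        by (elim E)
      then show "dio_lift S P h A B n x \<in> carrier (dsp P A B n)"
        using L[of A B n s] by simp
      fix c assume "c \<in> carrier K"
      then show "dio_lift S P h A B n (c \<odot>\<^bsub>dsp (dio_presented K S) A B n\<^esub> x) =
          c \<odot>\<^bsub>dsp P A B n\<^esub> dio_lift S P h A B n x"
        using st dwt_data[OF st(1)] L[of A B n s] L[of A B n "DScale c s"] by simp
    qed
  next
    fix A B n x assume "x \<in> carrier (dsp (dio_presented K S) A B n)"
    then obtain s where st: "dwt K S A B n s" "x = dcls K S s"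
      by (elim E)
    then show "dio_lift S P h A B (n - 1) (ddiff (dio_presented K S) A B n x) =
        ddiff P A B n (dio_lift S P h A B n x)"
      using dwt_data[OF st(1)] L[of A B n s] L[of A B "n - 1" "DDiff s"] by simp
  next
    fix A B n x and \<sigma> :: "nat \<Rightarrow> nat"
    assume i: "inj_on \<sigma> (A \<union> B)" and "x \<in> carrier (dsp (dio_presented K S) A B n)"
    then obtain s where st: "dwt K S A B n s" "x = dcls K S s"
      by (elim E)
    then show "dio_lift S P h (\<sigma> ` A) (\<sigma> ` B) n (dact (dio_presented K S) A B n \<sigma> x) =
        dact P A B n \<sigma> (dio_lift S P h A B n x)"
      using i dwt_data[OF st(1)] L[of A B n s] L[of "\<sigma> ` A" "\<sigma> ` B" n "DAct \<sigma> s"] by simp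
  next
    fix A B m a C D n d x y
    assume g: "dglue A B a C D d"
      and "x \<in> carrier (dsp (dio_presented K S) A B m)" "y \<in> carrier (dsp (dio_presented K S) C D n)"
    then obtain s t where st: "dwt K S A B m s" "x = dcls K S s" "dwt K S C D n t" "y = dcls K S t"
      by (elim E)
    then show "dio_lift S P h (A - {a} \<union> C) (B \<union> (D - {d})) (m + n)
        (dcomp (dio_presented K S) A B m a C D n d x y) =
       dcomp P A B m a C D n d (dio_lift S P h A B m x) (dio_lift S P h C D n y)"
      using g dwt_data[OF st(1)] dwt_data[OF st(3)] L[of A B m s] L[of C D n t]
        L[of "(A - {a}) \<union> C" "B \<union> (D - {d})" "m + n" "DComp a d s t"] by simp
  qed
qed

definition dgen_val :: "('k, 'r) ring_scheme \<Rightarrow> ('k, 'g) dio_pres \<Rightarrow>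
    (nat set \<Rightarrow> nat set \<Rightarrow> int \<Rightarrow> ('k, 'g) dterm set \<Rightarrow> 'v) \<Rightarrow> 'g \<Rightarrow> 'v" where
  "dgen_val K S f g = f (fst (darity S g)) (fst (snd (darity S g))) (snd (snd (darity S g))) (dcls K S (DGen g))"

text \<open>Conversely, a morphism out of a presented dioperad is evaluation at its own values on
  the generators, by induction over terms.\<close>

lemma dio_hom_deval:
  assumes P: "dioperad K P" and f: "dio_hom K (dio_presented K S) P f"
  shows "dwt K S A B n t \<Longrightarrow> f A B n (dcls K S t) = deval S P (dgen_val K S f) t"
proof (induction rule: dwt.induct)
  interpret dioperad K P by fact
  note K = field_axioms
  note D = dwt_data[of K S] and bf = dwt_biflags[of K S]
  note [simp] = dcls_closed K
  { case (wt_gen g A B n) then show ?case by (simp add: dgen_val_def) }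
  { case (wt_zero A B n)
    then show ?case
      using lin_map_zero[OF dio_hom_lin[OF f wt_zero] dio_presented_module[OF K wt_zero] dsp_module[OF wt_zero]]
      by (simp add: dcls_zero) }
  { case (wt_add A B n s t)
    then show ?case using lin_map_add[OF dio_hom_lin[OF f bf[OF wt_add(1)]], of "dcls K S s" n "dcls K S t"]
        D[OF wt_add(1)] by (simp add: dcls_add) }
  { case (wt_scale c A B n s)
    then show ?case using lin_map_scale[OF dio_hom_lin[OF f bf[OF wt_scale(2)]], of c "dcls K S s" n]
        D[OF wt_scale(2)] by (simp add: dcls_smult) }
  { case (wt_diff A B n s)
    then show ?case using dio_hom_diff[OF f bf[OF wt_diff(1)] dcls_closed[OF wt_diff(1)]] D[OF wt_diff(1)]
      by (simp add: dcls_diff) }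
  { case (wt_act A B n s \<sigma>)
    then show ?case using dio_hom_act[OF f bf[OF wt_act(1)] wt_act(2) dcls_closed[OF wt_act(1)]] D[OF wt_act(1)]
      by (simp add: dcls_act) }
  { case (wt_comp A B m s C D' n t a d)
    then show ?case using dio_hom_comp[OF f wt_comp(3), of "dcls K S s" m "dcls K S t" n]
        D[OF wt_comp(1)] D[OF wt_comp(2)]
      by (simp add: dcls_comp) }
qed

text \<open>The two sides of a relation are the same class, so a morphism sends them to the same
  element, which by \<open>dio_hom_deval\<close> is the value of either side.\<close>

lemma dio_hom_dsat:
  assumes P: "dioperad K P" and f: "dio_hom K (dio_presented K S) P f"
  shows "dsat K S P (dgen_val K S f)"
  unfolding dsat_def
proof (intro conjI ballI allI impI)
  interpret dioperad K P by fact
  fix g A B n assume *: "g \<in> dgens S" "darity S g = (A, B, n)" "biflags A B"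
  then have "dwt K S A B n (DGen g)" by (rule dwt.wt_gen)
  from dio_hom_closed[OF f *(3) dcls_closed[OF this]] * show "dgen_val K S f g \<in> carrier (dsp P A B n)"
    by (simp add: dgen_val_def)
next
  interpret dioperad K P by fact
  fix s t A B n assume *: "(s, t) \<in> drels S" "dwt K S A B n s" "dwt K S A B n t"
  have "dcls K S s = dcls K S t" using * by (intro dcls_eqI[OF field_axioms] deq.rel)
  then show "deval S P (dgen_val K S f) s = deval S P (dgen_val K S f) t"
    using dio_hom_deval[OF P f *(2)] dio_hom_deval[OF P f *(3)] by simp
qed

text \<open>The uniqueness half of the universal property: both morphisms are evaluations, and these
  depend only on the values at generators.\<close>

lemma dio_hom_eqI:
  assumes P: "dioperad K P" and f: "dio_hom K (dio_presented K S) P f"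
    and g: "dio_hom K (dio_presented K S) P g"
    and eq: "\<And>\<gamma> A B n. \<gamma> \<in> dgens S \<Longrightarrow> darity S \<gamma> = (A, B, n) \<Longrightarrow> biflags A B \<Longrightarrow>
      f A B n (dcls K S (DGen \<gamma>)) = g A B n (dcls K S (DGen \<gamma>))"
    and x: "x \<in> carrier (dsp (dio_presented K S) A B n)"
  shows "f A B n x = g A B n x"
proof -
  from x obtain t where t: "dwt K S A B n t" "x = dcls K S t" by (elim dio_presented_carrierE)
  have "dwt K S A B n t \<Longrightarrow> deval S P (dgen_val K S f) t = deval S P (dgen_val K S g) t"
  proof (induction rule: dwt.induct)
    case (wt_gen \<gamma> A B n) then show ?case by (simp add: dgen_val_def eq)
  qed simp_all
  then show ?thesis using t dio_hom_deval[OF P f t(1)] dio_hom_deval[OF P g t(1)] by simp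
qed

section \<open>Presented cyclic operads\<close>

lemma cglue_finite: "cglue I i J j \<Longrightarrow> finite I \<and> finite J"
  by (simp add: cglue_def)

lemma cglue_image:
  "cglue I i J j \<Longrightarrow> inj_on \<sigma> (I \<union> J) \<Longrightarrow> cglue (\<sigma> ` I) (\<sigma> i) (\<sigma> ` J) (\<sigma> j)"
  unfolding cglue_def inj_on_def by blast

lemma cglue_image_set:
  assumes "cglue I i J j" "inj_on \<sigma> (I \<union> J)"
  shows "\<sigma> ` I - {\<sigma> i} \<union> (\<sigma> ` J - {\<sigma> j}) = \<sigma> ` ((I - {i}) \<union> (J - {j}))"
  using assms unfolding cglue_def inj_on_def by blast

lemma cglue_sym: "cglue I i J j \<Longrightarrow> cglue J j I i"
  by (auto simp: cglue_def)

lemma cglue_assoc: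
  assumes "cglue I i J j" "cglue J k L l" "j \<noteq> k" "I \<inter> L = {}"
  shows "cglue ((I - {i}) \<union> (J - {j})) k L l" "cglue I i ((J - {k}) \<union> (L - {l})) j"
    "(I - {i}) \<union> (J - {j}) - {k} \<union> (L - {l}) = I - {i} \<union> ((J - {k}) \<union> (L - {l}) - {j})"
  using assms by (auto simp: cglue_def)

primrec cfl :: "('k, 'g) cyc_pres \<Rightarrow> ('k, 'g) cterm \<Rightarrow> nat set" where
  "cfl S (CGen g) = fst (carity S g)"
| "cfl S (CZero I n) = I"
| "cfl S (CAdd s t) = cfl S s"
| "cfl S (CScale c s) = cfl S s"
| "cfl S (CDiff s) = cfl S s"
| "cfl S (CAct \<sigma> s) = \<sigma> ` cfl S s"
| "cfl S (CComp i j s t) = (cfl S s - {i}) \<union> (cfl S t - {j})"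

primrec cdeg :: "('k, 'g) cyc_pres \<Rightarrow> ('k, 'g) cterm \<Rightarrow> int" where
  "cdeg S (CGen g) = snd (carity S g)"
| "cdeg S (CZero I n) = n"
| "cdeg S (CAdd s t) = cdeg S s"
| "cdeg S (CScale c s) = cdeg S s"
| "cdeg S (CDiff s) = cdeg S s - 1"
| "cdeg S (CAct \<sigma> s) = cdeg S s"
| "cdeg S (CComp i j s t) = cdeg S s + cdeg S t"

primrec cchk :: "('k, 'r) ring_scheme \<Rightarrow> ('k, 'g) cyc_pres \<Rightarrow> ('k, 'g) cterm \<Rightarrow> bool" where
  "cchk K S (CGen g) \<longleftrightarrow> g \<in> cgens S \<and> finite (fst (carity S g))"
| "cchk K S (CZero I n) \<longleftrightarrow> finite I"
| "cchk K S (CAdd s t) \<longleftrightarrow> cchk K S s \<and> cchk K S t \<and> cfl S t = cfl S s \<and> cdeg S t = cdeg S s"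
| "cchk K S (CScale c s) \<longleftrightarrow> c \<in> carrier K \<and> cchk K S s"
| "cchk K S (CDiff s) \<longleftrightarrow> cchk K S s"
| "cchk K S (CAct \<sigma> s) \<longleftrightarrow> cchk K S s \<and> inj_on \<sigma> (cfl S s)"
| "cchk K S (CComp i j s t) \<longleftrightarrow> cchk K S s \<and> cchk K S t \<and> cglue (cfl S s) i (cfl S t) j"

lemma cwt_iff: "cwt K S I n t \<longleftrightarrow> cchk K S t \<and> cfl S t = I \<and> cdeg S t = n"
proof
  show "cwt K S I n t \<Longrightarrow> cchk K S t \<and> cfl S t = I \<and> cdeg S t = n"
    by (induction rule: cwt.induct) auto
  have "cchk K S t \<Longrightarrow> cwt K S (cfl S t) (cdeg S t) t"
    by (induction t) (auto intro!: cwt.intros)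
  then show "cchk K S t \<and> cfl S t = I \<and> cdeg S t = n \<Longrightarrow> cwt K S I n t"
    by auto
qed

lemma cwt_data: "cwt K S I n t \<Longrightarrow> cfl S t = I \<and> cdeg S t = n"
  by (simp add: cwt_iff)

lemma cwt_finite: "cwt K S I n t \<Longrightarrow> finite I"
  by (induction rule: cwt.induct) (auto dest: cglue_finite)

lemma ceq_cwt:
  assumes "field K" "ceq K S I n s t"
  shows "cwt K S I n s \<and> cwt K S I n t"
proof -
  interpret field K by fact
  have [simp]: "\<ominus>\<^bsub>K\<^esub> \<one>\<^bsub>K\<^esub> \<in> carrier K" by simp
  note [simp] = cwt_iff assms(1)
  show ?thesis using assms(2)
  proof (induction rule: ceq.induct)
    case (comp_act I m s J n t i j \<sigma>)
    then have "inj_on \<sigma> I" "inj_on \<sigma> J" "inj_on \<sigma> (I - {i} \<union> (J - {j}))"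
      by (auto elim!: inj_on_subset)
    then show ?case
      using comp_act cglue_image[of I i J j \<sigma>] cglue_image_set[of I i J j \<sigma>] by simp
  next
    case (comp_assoc I m s J n t L p u i j k l)
    then show ?case using cglue_assoc[of I i J j k L l] by simp
  next
    case (comp_commute I m s J n t i j)
    then show ?case using cglue_sym[of I i J j] by (simp add: Un_ac)
  next
    case (act_cong I n s \<sigma> \<tau>)
    then have "\<tau> ` I = \<sigma> ` I" "inj_on \<tau> I"
      using inj_on_cong[of I \<sigma> \<tau>] by (auto intro: image_cong)
    then show ?case using act_cong by simp
  next
    case (act_act I n s \<sigma> \<tau>)
    then show ?case by (simp add: image_comp comp_inj_on)
  next
    case (add_zero I n s)
    then show ?case using cwt_finite[of K S I n s] by simp
  next
    case (add_inverse I n s)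
    then show ?case using cwt_finite[of K S I n s] by simp
  next
    case (diff_diff I n s)
    then show ?case using cwt_finite[of K S I n s] by simp
  qed simp_all
qed

lemma ceq_cwt1: "field K \<Longrightarrow> ceq K S I n s t \<Longrightarrow> cwt K S I n s"
  and ceq_cwt2: "field K \<Longrightarrow> ceq K S I n s t \<Longrightarrow> cwt K S I n t"
  using ceq_cwt by blast+

definition ccls ::
  "('k, 'r) ring_scheme \<Rightarrow> ('k, 'g) cyc_pres \<Rightarrow> ('k, 'g) cterm \<Rightarrow> ('k, 'g) cterm set" where
  "ccls K S s = {t. ceq K S (cfl S s) (cdeg S s) s t}"

lemma ccls_conv: "cwt K S I n s \<Longrightarrow> {t. ceq K S I n s t} = ccls K S s"
  by (auto simp: ccls_def cwt_iff)

lemma ccls_eqI: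
  assumes "field K" "ceq K S I n s t"
  shows "ccls K S s = ccls K S t"
proof -
  have "cwt K S I n s" "cwt K S I n t" using ceq_cwt[OF assms] by auto
  then have "ccls K S s = {u. ceq K S I n s u}" "ccls K S t = {u. ceq K S I n t u}"
    by (auto simp: ccls_conv)
  then show ?thesis using assms(2) by (auto intro: ceq.trans ceq.sym)
qed

lemma ccls_mem: "t \<in> ccls K S s \<Longrightarrow> cwt K S I n s \<Longrightarrow> ceq K S I n s t"
  by (auto simp: ccls_def cwt_iff)

lemma ccls_self: "cwt K S I n s \<Longrightarrow> s \<in> ccls K S s"
  by (auto simp: ccls_def cwt_iff intro!: ceq.refl)

lemma cyc_presented_carrier:
  "carrier (csp (cyc_presented K S) I n) = {ccls K S s |s. cwt K S I n s}"
  by (auto simp: cyc_presented_def ccls_conv) (metis ccls_conv)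

lemma cyc_presented_carrierE:
  assumes "x \<in> carrier (csp (cyc_presented K S) I n)"
  obtains s where "cwt K S I n s" "x = ccls K S s"
  using assms by (auto simp: cyc_presented_carrier)

lemma ccls_closed:
  "cwt K S I n s \<Longrightarrow> ccls K S s \<in> carrier (csp (cyc_presented K S) I n)"
  by (auto simp: cyc_presented_carrier)

lemma ccls_zero: "finite I \<Longrightarrow> \<zero>\<^bsub>csp (cyc_presented K S) I n\<^esub> = ccls K S (CZero I n)"
  by (simp add: cyc_presented_def ccls_conv cwt.wt_zero)

lemma ccls_add:
  assumes "field K" "cwt K S I n s" "cwt K S I n t"
  shows "ccls K S s \<oplus>\<^bsub>csp (cyc_presented K S) I n\<^esub> ccls K S t = ccls K S (CAdd s t)"
proof -
  have "{u. \<exists>s'\<in>ccls K S s. \<exists>t'\<in>ccls K S t. ceq K S I n (CAdd s' t') u} =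
      {u. ceq K S I n (CAdd s t) u}"
    using assms
    by (intro congruence_class2) (auto intro: ceq.sym ceq.trans ceq.cong_add ccls_mem ccls_self)
  also have "\<dots> = ccls K S (CAdd s t)"
    using assms by (intro ccls_conv cwt.intros)
  finally show ?thesis by (simp add: cyc_presented_def)
qed

lemma ccls_smult:
  assumes "field K" "c \<in> carrier K" "cwt K S I n s"
  shows "c \<odot>\<^bsub>csp (cyc_presented K S) I n\<^esub> ccls K S s = ccls K S (CScale c s)"
proof -
  have "{u. \<exists>s'\<in>ccls K S s. ceq K S I n (CScale c s') u} = {u. ceq K S I n (CScale c s) u}"
    using assms
    by (intro congruence_class) (auto intro: ceq.sym ceq.trans ceq.cong_scale ccls_mem ccls_self)
  also have "\<dots> = ccls K S (CScale c s)"
    using assms by (intro ccls_conv cwt.intros)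
  finally show ?thesis by (simp add: cyc_presented_def)
qed

lemma ccls_diff:
  assumes "field K" "cwt K S I n s"
  shows "cdiff (cyc_presented K S) I n (ccls K S s) = ccls K S (CDiff s)"
proof -
  have "{u. \<exists>s'\<in>ccls K S s. ceq K S I (n - 1) (CDiff s') u} =
      {u. ceq K S I (n - 1) (CDiff s) u}"
    using assms
    by (intro congruence_class) (auto intro: ceq.sym ceq.trans ceq.cong_diff ccls_mem ccls_self)
  also have "\<dots> = ccls K S (CDiff s)"
    using assms by (intro ccls_conv cwt.intros)
  finally show ?thesis by (simp add: cyc_presented_def)
qed

lemma ccls_act:
  assumes "field K" "cwt K S I n s" "inj_on \<sigma> I"
  shows "cact (cyc_presented K S) I n \<sigma> (ccls K S s) = ccls K S (CAct \<sigma> s)"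
proof -
  have "{u. \<exists>s'\<in>ccls K S s. ceq K S (\<sigma> ` I) n (CAct \<sigma> s') u} =
      {u. ceq K S (\<sigma> ` I) n (CAct \<sigma> s) u}"
    using assms
    by (intro congruence_class) (auto intro: ceq.sym ceq.trans ceq.cong_act ccls_mem ccls_self)
  also have "\<dots> = ccls K S (CAct \<sigma> s)"
    using assms by (intro ccls_conv cwt.intros)
  finally show ?thesis by (simp add: cyc_presented_def)
qed

lemma ccls_comp:
  assumes "field K" "cwt K S I m s" "cwt K S J n t" "cglue I i J j"
  shows "ccomp (cyc_presented K S) I m i J n j (ccls K S s) (ccls K S t) = ccls K S (CComp i j s t)"
proof -
  let ?Q = "ceq K S ((I - {i}) \<union> (J - {j})) (m + n)"
  have "{u. \<exists>s'\<in>ccls K S s. \<exists>t'\<in>ccls K S t. ?Q (CComp i j s' t') u} = {u. ?Q (CComp i j s t) u}"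
    using assms
    by (intro congruence_class2) (auto intro: ceq.sym ceq.trans ceq.cong_comp ccls_mem ccls_self)
  also have "\<dots> = ccls K S (CComp i j s t)"
    using assms by (intro ccls_conv cwt.intros)
  finally show ?thesis by (simp add: cyc_presented_def)
qed

lemma cyc_presented_module:
  assumes "field K" "finite I"
  shows "module K (csp (cyc_presented K S) I n)"
proof -
  interpret field K by fact
  note [simp] = assms ccls_add ccls_smult ccls_zero cwt.intros ccls_closed
  note E = cyc_presented_carrierE
  note I = ccls_eqI[OF assms(1)]
  let ?M = "csp (cyc_presented K S) I n"
  have "abelian_group ?M"
  proof (rule abelian_groupI)
    fix x y z assume "x \<in> carrier ?M" "y \<in> carrier ?M" "z \<in> carrier ?M"
    then show "x \<oplus>\<^bsub>?M\<^esub> y \<oplus>\<^bsub>?M\<^esub> z = x \<oplus>\<^bsub>?M\<^esub> (y \<oplus>\<^bsub>?M\<^esub> z)"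
      by (elim E) (simp add: I[OF ceq.add_assoc])
  next
    fix x y assume "x \<in> carrier ?M" "y \<in> carrier ?M"
    then obtain s t where st: "cwt K S I n s" "cwt K S I n t" "x = ccls K S s" "y = ccls K S t"
      by (elim E)
    then show "x \<oplus>\<^bsub>?M\<^esub> y \<in> carrier ?M" by simp
    show "x \<oplus>\<^bsub>?M\<^esub> y = y \<oplus>\<^bsub>?M\<^esub> x" using I[OF ceq.add_commute[OF st(1,2)]] st by simp
  next
    fix x assume "x \<in> carrier ?M"
    then obtain s where s: "cwt K S I n s" "x = ccls K S s" by (elim E)
    then show "\<zero>\<^bsub>?M\<^esub> \<oplus>\<^bsub>?M\<^esub> x = x"
      by (simp add: I[OF ceq.add_zero])
    show "\<exists>y\<in>carrier ?M. y \<oplus>\<^bsub>?M\<^esub> x = \<zero>\<^bsub>?M\<^esub>"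
      using s by (intro bexI[of _ "ccls K S (CScale (\<ominus>\<^bsub>K\<^esub> \<one>\<^bsub>K\<^esub>) s)"]) (simp_all add: I[OF ceq.add_inverse])
  qed auto
  then show ?thesis
  proof (intro moduleI)
    fix c e x assume "c \<in> carrier K" "e \<in> carrier K" "x \<in> carrier ?M"
    then show "(c \<oplus>\<^bsub>K\<^esub> e) \<odot>\<^bsub>?M\<^esub> x = c \<odot>\<^bsub>?M\<^esub> x \<oplus>\<^bsub>?M\<^esub> e \<odot>\<^bsub>?M\<^esub> x"
      "(c \<otimes>\<^bsub>K\<^esub> e) \<odot>\<^bsub>?M\<^esub> x = c \<odot>\<^bsub>?M\<^esub> (e \<odot>\<^bsub>?M\<^esub> x)"
      by (elim E, simp add: I[OF ceq.add_scale] I[OF ceq.scale_scale])+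
  next
    fix c x y assume "c \<in> carrier K" "x \<in> carrier ?M" "y \<in> carrier ?M"
    then show "c \<odot>\<^bsub>?M\<^esub> (x \<oplus>\<^bsub>?M\<^esub> y) = c \<odot>\<^bsub>?M\<^esub> x \<oplus>\<^bsub>?M\<^esub> c \<odot>\<^bsub>?M\<^esub> y" "c \<odot>\<^bsub>?M\<^esub> x \<in> carrier ?M"
      by (elim E, simp add: I[OF ceq.scale_add])+
  next
    fix x assume "x \<in> carrier ?M"
    then show "\<one>\<^bsub>K\<^esub> \<odot>\<^bsub>?M\<^esub> x = x"
      by (elim E) (simp add: I[OF ceq.scale_one])
  qed (auto intro: is_cring)
qed

text \<open>The axioms only provide linearity of the composition in its first argument; the other
  linearity goes through \<open>comp_commute\<close>.\<close>

theorem cyclic_operad_presented: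
  assumes K: "field K"
  shows "cyclic_operad K (cyc_presented K S)"
proof (intro cyclic_operad.intro cyclic_operad_axioms.intro K)
  note [simp] = K ccls_add ccls_smult ccls_zero ccls_diff ccls_act ccls_comp cwt.intros ccls_closed
  note E = cyc_presented_carrierE
  note I = ccls_eqI[OF K]
  let ?P = "cyc_presented K S"
  let ?c = "\<lambda>I n. carrier (csp ?P I n)"
  interpret field K by fact
  { fix I :: "nat set" and n assume "finite I"
    then show "module K (csp ?P I n)" by (rule cyc_presented_module[OF K]) }
  { fix I :: "nat set" and n assume "finite I"
    then show "lin_map K (csp ?P I n) (csp ?P I (n - 1)) (cdiff ?P I n)"
      by (auto simp: lin_map_def I[OF ceq.diff_add] I[OF ceq.diff_scale] elim!: E) }
  { fix I :: "nat set" and n x assume "finite I" "x \<in> ?c I n"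
    then show "cdiff ?P I (n - 1) (cdiff ?P I n x) = \<zero>\<^bsub>csp ?P I (n - 2)\<^esub>"
      by (auto simp: I[OF ceq.diff_diff] elim!: E) }
  { fix I n and \<sigma> :: "nat \<Rightarrow> nat" assume "finite I" "inj_on \<sigma> I"
    then show "lin_map K (csp ?P I n) (csp ?P (\<sigma> ` I) n) (cact ?P I n \<sigma>)"
      by (auto simp: lin_map_def I[OF ceq.act_add] I[OF ceq.act_scale] elim!: E) }
  { fix I n x and \<sigma> \<tau> :: "nat \<Rightarrow> nat"
    assume *: "finite I" "inj_on \<sigma> I" "\<And>i. i \<in> I \<Longrightarrow> \<sigma> i = \<tau> i" "x \<in> ?c I n"
    have "inj_on \<tau> I" using inj_on_cong[of I \<sigma> \<tau>] *(2,3) by auto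
    then show "cact ?P I n \<sigma> x = cact ?P I n \<tau> x"
      using * by (elim E) (simp add: I[OF ceq.act_cong]) }
  { fix I :: "nat set" and n x assume "finite I" "x \<in> ?c I n"
    then show "cact ?P I n id x = x" by (auto simp: I[OF ceq.act_id] elim!: E) }
  { fix I n x and \<sigma> \<tau> :: "nat \<Rightarrow> nat"
    assume "finite I" "inj_on \<sigma> I" "inj_on \<tau> (\<sigma> ` I)" "x \<in> ?c I n"
    then show "cact ?P (\<sigma> ` I) n \<tau> (cact ?P I n \<sigma> x) = cact ?P I n (\<tau> \<circ> \<sigma>) x"
      by (elim E) (simp add: comp_inj_on I[OF ceq.act_act]) }
  { fix I n x and \<sigma> :: "nat \<Rightarrow> nat"
    assume "finite I" "inj_on \<sigma> I" "x \<in> ?c I n"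
    then show "cdiff ?P (\<sigma> ` I) n (cact ?P I n \<sigma> x) = cact ?P I (n - 1) \<sigma> (cdiff ?P I n x)"
      by (elim E) (simp add: I[OF ceq.act_diff]) }
  { fix I m i J n j assume g: "cglue I i J j"
    let ?M = "csp ?P ((I - {i}) \<union> (J - {j})) (m + n)"
    interpret M: module K ?M
      using g by (intro cyc_presented_module[OF K]) (auto simp: cglue_def)
    have N: "(J - {j}) \<union> (I - {i}) = (I - {i}) \<union> (J - {j})" "n + m = m + n" by auto
    \<comment> \<open>Second arguments are moved to the front at the price of a fixed scalar. The
      swapped term acquires its flags and degree in the other order, so its type is restated in the
      original order.\<close>
    have com: "ccls K S (CComp i j s t) = ksign K (m * n) \<odot>\<^bsub>?M\<^esub> ccls K S (CComp j i t s)"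
      "cwt K S ((I - {i}) \<union> (J - {j})) (m + n) (CComp j i t s)"
      if st: "cwt K S I m s" "cwt K S J n t" for s t
    proof -
      show 1: "cwt K S ((I - {i}) \<union> (J - {j})) (m + n) (CComp j i t s)"
        using cwt.wt_comp[OF st(2,1) cglue_sym[OF g]] by (simp add: N)
      show "ccls K S (CComp i j s t) = ksign K (m * n) \<odot>\<^bsub>?M\<^esub> ccls K S (CComp j i t s)"
        using I[OF ceq.comp_commute[OF st g]] 1 by simp
    qed
    have left: "lin_map K (csp ?P I m) ?M (\<lambda>x. ccomp ?P I m i J n j x y)" if "y \<in> ?c J n" for y
      using g that by (auto simp: lin_map_def I[OF ceq.comp_add] I[OF ceq.comp_scale] elim!: E)
    have right: "lin_map K (csp ?P J n) ?M (ccomp ?P I m i J n j x)" if x: "x \<in> ?c I m" for x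
      unfolding lin_map_def Pi_iff
    proof (intro conjI ballI)
      obtain s where s: "cwt K S I m s" "x = ccls K S s" using x by (elim E)
      fix y assume "y \<in> ?c J n"
      then obtain t where t: "cwt K S J n t" "y = ccls K S t" by (elim E)
      show "ccomp ?P I m i J n j x y \<in> carrier ?M" using s t g by simp
      { fix z assume "z \<in> ?c J n"
        then obtain u where u: "cwt K S J n u" "z = ccls K S u" by (elim E)
        have "ccls K S (CComp j i (CAdd t u) s) =
            ccls K S (CComp j i t s) \<oplus>\<^bsub>?M\<^esub> ccls K S (CComp j i u s)"
          using I[OF ceq.comp_add[OF t(1) u(1) s(1) cglue_sym[OF g]]] com(2)[OF s(1) t(1)] com(2)[OF s(1) u(1)]
          by simp
        then show "ccomp ?P I m i J n j x (y \<oplus>\<^bsub>csp ?P J n\<^esub> z) =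
            ccomp ?P I m i J n j x y \<oplus>\<^bsub>?M\<^esub> ccomp ?P I m i J n j x z"
          using s t u g com(1)[OF s(1) t(1)] com(1)[OF s(1) u(1)] com(1)[OF s(1) cwt.wt_add[OF t(1) u(1)]]
            ccls_closed[OF com(2)[OF s(1) t(1)]] ccls_closed[OF com(2)[OF s(1) u(1)]]
          by (simp add: M.smult_r_distr del: ccls_smult ccls_closed) }
      { fix c assume c: "c \<in> carrier K"
        have e: "ccls K S (CComp j i (CScale c t) s) = c \<odot>\<^bsub>?M\<^esub> ccls K S (CComp j i t s)"
          using I[OF ceq.comp_scale[OF c t(1) s(1) cglue_sym[OF g]]] com(2)[OF s(1) t(1)] c by simp
        have "ccls K S (CComp i j s (CScale c t)) = c \<odot>\<^bsub>?M\<^esub> ccls K S (CComp i j s t)"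
          unfolding com(1)[OF s(1) t(1)] com(1)[OF s(1) cwt.wt_scale[OF c t(1)]] e
          using ccls_closed[OF com(2)[OF s(1) t(1)]] c
          by (simp add: M.smult_assoc1[symmetric] m_comm del: ccls_smult ccls_closed)
        moreover have "ccomp ?P I m i J n j x (c \<odot>\<^bsub>csp ?P J n\<^esub> y) = ccls K S (CComp i j s (CScale c t))"
          using s t g c by simp
        moreover have "ccomp ?P I m i J n j x y = ccls K S (CComp i j s t)"
          using s t g by simp
        ultimately show "ccomp ?P I m i J n j x (c \<odot>\<^bsub>csp ?P J n\<^esub> y) =
            c \<odot>\<^bsub>?M\<^esub> ccomp ?P I m i J n j x y"
          by simp }
    qed
    show "bilin_map K (csp ?P I m) (csp ?P J n) ?M (ccomp ?P I m i J n j)"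
      using left right by (simp add: bilin_map_def) }
  { fix I m i J n j x y assume *: "cglue I i J j" "x \<in> ?c I m" "y \<in> ?c J n"
    then obtain s t where st: "cwt K S I m s" "x = ccls K S s" "cwt K S J n t" "y = ccls K S t"
      by (elim E)
    let ?I = "(I - {i}) \<union> (J - {j})"
    have w: "cwt K S ?I (m + n - 1) (CComp i j (CDiff s) t)"
        "cwt K S ?I (m + n - 1) (CComp i j s (CDiff t))"
      using * st by (auto simp: cwt_iff)
    show "cdiff ?P ?I (m + n) (ccomp ?P I m i J n j x y) =
         ccomp ?P I (m - 1) i J n j (cdiff ?P I m x) y
         \<oplus>\<^bsub>csp ?P ?I (m + n - 1)\<^esub> ksign K m \<odot>\<^bsub>csp ?P ?I (m + n - 1)\<^esub>
           ccomp ?P I m i J (n - 1) j x (cdiff ?P J n y)"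
      using I[OF ceq.comp_diff[OF st(1,3) *(1)]] *(1) st w by simp }
  { fix I m i J n j x y and \<sigma> :: "nat \<Rightarrow> nat"
    assume *: "cglue I i J j" "inj_on \<sigma> (I \<union> J)" "x \<in> ?c I m" "y \<in> ?c J n"
    then obtain s t where st: "cwt K S I m s" "x = ccls K S s" "cwt K S J n t" "y = ccls K S t"
      by (elim E)
    have i: "inj_on \<sigma> I" "inj_on \<sigma> J" "inj_on \<sigma> (I - {i} \<union> (J - {j}))"
      using *(2) by (auto elim!: inj_on_subset)
    show "cact ?P ((I - {i}) \<union> (J - {j})) (m + n) \<sigma> (ccomp ?P I m i J n j x y) =
       ccomp ?P (\<sigma> ` I) m (\<sigma> i) (\<sigma> ` J) n (\<sigma> j) (cact ?P I m \<sigma> x) (cact ?P J n \<sigma> y)"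
      using I[OF ceq.comp_act[OF st(1,3) *(1,2)]] *(1) st i cglue_image[OF *(1,2)] by simp }
  { fix I m i J n j x y
    assume *: "cglue I i J j" "x \<in> ?c I m" "y \<in> ?c J n"
    then obtain s t where st: "cwt K S I m s" "x = ccls K S s" "cwt K S J n t" "y = ccls K S t"
      by (elim E)
    have "cwt K S ((I - {i}) \<union> (J - {j})) (m + n) (CComp j i t s)"
      using cwt.wt_comp[OF st(3,1) cglue_sym[OF *(1)]] by (simp add: Un_commute add.commute)
    then show "ccomp ?P I m i J n j x y =
       ksign K (m * n) \<odot>\<^bsub>csp ?P ((I - {i}) \<union> (J - {j})) (m + n)\<^esub> ccomp ?P J n j I m i y x"
      using I[OF ceq.comp_commute[OF st(1,3) *(1)]] *(1) cglue_sym[OF *(1)] st by simp }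
  { fix I m i J n j k L p l x y z
    assume *: "cglue I i J j" "cglue J k L l" "j \<noteq> k" "I \<inter> L = {}"
      "x \<in> ?c I m" "y \<in> ?c J n" "z \<in> ?c L p"
    then obtain s t u where st: "cwt K S I m s" "x = ccls K S s" "cwt K S J n t" "y = ccls K S t"
      "cwt K S L p u" "z = ccls K S u"
      by (elim E)
    show "ccomp ?P ((I - {i}) \<union> (J - {j})) (m + n) k L p l (ccomp ?P I m i J n j x y) z =
       ccomp ?P I m i ((J - {k}) \<union> (L - {l})) (n + p) j x (ccomp ?P J n k L p l y z)"
      using I[OF ceq.comp_assoc[OF st(1,3,5) *(1-4)]] *(1,2) st cglue_assoc(1,2)[OF *(1-4)]
      by simp }
qed

section \<open>Morphisms of cyclic operads\<close>

lemma cyc_hom_lin: "cyc_hom K P R f \<Longrightarrow> finite I \<Longrightarrow> lin_map K (csp P I n) (csp R I n) (f I n)"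
  by (simp add: cyc_hom_def)

lemma cyc_hom_diff: "cyc_hom K P R f \<Longrightarrow> finite I \<Longrightarrow> x \<in> carrier (csp P I n) \<Longrightarrow>
    f I (n - 1) (cdiff P I n x) = cdiff R I n (f I n x)"
  by (simp add: cyc_hom_def)

lemma cyc_hom_act:
  "cyc_hom K P R f \<Longrightarrow> finite I \<Longrightarrow> inj_on \<sigma> I \<Longrightarrow> x \<in> carrier (csp P I n) \<Longrightarrow>
    f (\<sigma> ` I) n (cact P I n \<sigma> x) = cact R I n \<sigma> (f I n x)"
  by (simp add: cyc_hom_def)

lemma cyc_hom_comp:
  "cyc_hom K P R f \<Longrightarrow> cglue I i J j \<Longrightarrow> x \<in> carrier (csp P I m) \<Longrightarrow> y \<in> carrier (csp P J n) \<Longrightarrow>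
    f ((I - {i}) \<union> (J - {j})) (m + n) (ccomp P I m i J n j x y) =
    ccomp R I m i J n j (f I m x) (f J n y)"
  by (simp add: cyc_hom_def)

lemma cyc_hom_closed:
  "cyc_hom K P R f \<Longrightarrow> finite I \<Longrightarrow> x \<in> carrier (csp P I n) \<Longrightarrow> f I n x \<in> carrier (csp R I n)"
  by (rule lin_map_closed[OF cyc_hom_lin])

lemma cyc_hom_compose:
  assumes f: "cyc_hom K P Q f" and g: "cyc_hom K Q R g"
  shows "cyc_hom K P R (\<lambda>I n x. g I n (f I n x))"
  unfolding cyc_hom_def
proof (intro conjI allI impI ballI)
  fix I :: "nat set" and n assume b: "finite I"
  show "lin_map K (csp P I n) (csp R I n) (\<lambda>x. g I n (f I n x))"
    using b by (intro lin_map_comp[OF cyc_hom_lin[OF f] cyc_hom_lin[OF g]])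
  fix x assume x: "x \<in> carrier (csp P I n)"
  show "g I (n - 1) (f I (n - 1) (cdiff P I n x)) = cdiff R I n (g I n (f I n x))"
    using b x by (simp add: cyc_hom_diff[OF f] cyc_hom_diff[OF g] cyc_hom_closed[OF f])
next
  fix I n and \<sigma> :: "nat \<Rightarrow> nat" and x
  assume "finite I" "inj_on \<sigma> I" "x \<in> carrier (csp P I n)"
  then show "g (\<sigma> ` I) n (f (\<sigma> ` I) n (cact P I n \<sigma> x)) = cact R I n \<sigma> (g I n (f I n x))"
    by (simp add: cyc_hom_act[OF f] cyc_hom_act[OF g] cyc_hom_closed[OF f])
next
  fix I m i J n j x y
  assume "cglue I i J j" "x \<in> carrier (csp P I m)" "y \<in> carrier (csp P J n)"
  then show "g (I - {i} \<union> (J - {j})) (m + n) (f (I - {i} \<union> (J - {j})) (m + n) (ccomp P I m i J n j x y)) =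
     ccomp R I m i J n j (g I m (f I m x)) (g J n (f J n y))"
    using cglue_finite[of I i J j]
    by (simp add: cyc_hom_comp[OF f] cyc_hom_comp[OF g] cyc_hom_closed[OF f])
qed

section \<open>Evaluation of terms and the universal property of a presented cyclic operad\<close>

primrec ceval :: "('k, 'g) cyc_pres \<Rightarrow> ('k, 'v) cyc_data \<Rightarrow> ('g \<Rightarrow> 'v) \<Rightarrow> ('k, 'g) cterm \<Rightarrow> 'v" where
  "ceval S P h (CGen g) = h g"
| "ceval S P h (CZero I n) = \<zero>\<^bsub>csp P I n\<^esub>"
| "ceval S P h (CAdd s t) = ceval S P h s \<oplus>\<^bsub>csp P (cfl S s) (cdeg S s)\<^esub> ceval S P h t"
| "ceval S P h (CScale c s) = c \<odot>\<^bsub>csp P (cfl S s) (cdeg S s)\<^esub> ceval S P h s"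
| "ceval S P h (CDiff s) = cdiff P (cfl S s) (cdeg S s) (ceval S P h s)"
| "ceval S P h (CAct \<sigma> s) = cact P (cfl S s) (cdeg S s) \<sigma> (ceval S P h s)"
| "ceval S P h (CComp i j s t) =
     ccomp P (cfl S s) (cdeg S s) i (cfl S t) (cdeg S t) j (ceval S P h s) (ceval S P h t)"

definition csat ::
  "('k, 'r) ring_scheme \<Rightarrow> ('k, 'g) cyc_pres \<Rightarrow> ('k, 'v) cyc_data \<Rightarrow> ('g \<Rightarrow> 'v) \<Rightarrow> bool" where
  "csat K S P h \<longleftrightarrow>
     (\<forall>g\<in>cgens S. \<forall>I n. carity S g = (I, n) \<longrightarrow> finite I \<longrightarrow> h g \<in> carrier (csp P I n)) \<and>
     (\<forall>s t. (s, t) \<in> crels S \<longrightarrow> (\<forall>I n. cwt K S I n s \<longrightarrow> cwt K S I n t \<longrightarrow>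
        ceval S P h s = ceval S P h t))"

context
  fixes K :: "('k, 'r) ring_scheme" and S :: "('k, 'g) cyc_pres" and P :: "('k, 'v) cyc_data"
    and h :: "'g \<Rightarrow> 'v"
  assumes P: "cyclic_operad K P" and sat: "csat K S P h"
begin

lemma ceval_closed: "cwt K S I n t \<Longrightarrow> ceval S P h t \<in> carrier (csp P I n)"
proof (induction rule: cwt.induct)
  interpret cyclic_operad K P by (rule P)
  { case (wt_gen g I n) then show ?case using sat by (auto simp: csat_def) }
  { case (wt_zero I n)
    interpret M: module K "csp P I n" using wt_zero by (rule csp_module)
    show ?case by simp }
  { case (wt_add I n s t)
    then interpret M: module K "csp P I n" by (blast intro: csp_module cwt_finite)
    show ?case using wt_add cwt_data[OF wt_add(1)] by simp }
  { case (wt_scale c I n s)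
    then interpret M: module K "csp P I n" by (blast intro: csp_module cwt_finite)
    show ?case using wt_scale cwt_data[OF wt_scale(2)] by simp }
  { case (wt_diff I n s)
    then show ?case
      using cwt_data[OF wt_diff(1)] lin_map_closed[OF cdiff_linear[OF cwt_finite[OF wt_diff(1)]]]
      by simp }
  { case (wt_act I n s \<sigma>)
    then show ?case
      using cwt_data[OF wt_act(1)] lin_map_closed[OF cact_linear[OF cwt_finite[OF wt_act(1)]]]
      by simp }
  { case (wt_comp I m s J n t i j)
    then show ?case
      using cwt_data[OF wt_comp(1)] cwt_data[OF wt_comp(2)] bilin_map_closed[OF ccomp_bilinear[OF wt_comp(3)]]
      by simp }
qed

text \<open>Soundness, as for dioperads: each rule of \<open>ceq\<close> is a law of congruences, an
  axiom of cyclic operads or a relation satisfied by \<open>h\<close>.\<close>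

lemma ceval_ceq: "ceq K S I n s t \<Longrightarrow> ceval S P h s = ceval S P h t"
proof (induction rule: ceq.induct)
  interpret cyclic_operad K P by (rule P)
  note [simp] = ceval_closed field_axioms
  note D = cwt_data[of K S] and bf = cwt_finite[of K S]
  { case (rel s t I n) then show ?case using sat by (auto simp: csat_def) }
  { case (refl I n s) show ?case .. }
  { case sym then show ?case by simp }
  { case trans then show ?case by simp }
  { case (cong_add I n s s' t t')
    then show ?case using D[OF ceq_cwt1[OF _ cong_add(1)]] D[OF ceq_cwt2[OF _ cong_add(1)]] by simp }
  { case (cong_scale c I n s s')
    then show ?case using D[OF ceq_cwt1[OF _ cong_scale(2)]] D[OF ceq_cwt2[OF _ cong_scale(2)]] by simp }
  { case (cong_diff I n s s')
    then show ?case using D[OF ceq_cwt1[OF _ cong_diff(1)]] D[OF ceq_cwt2[OF _ cong_diff(1)]] by simp }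
  { case (cong_act I n s s' \<sigma>)
    then show ?case using D[OF ceq_cwt1[OF _ cong_act(1)]] D[OF ceq_cwt2[OF _ cong_act(1)]] by simp }
  { case (cong_comp I m s s' J n t t' i j)
    then show ?case using D[OF ceq_cwt1[OF _ cong_comp(1)]] D[OF ceq_cwt2[OF _ cong_comp(1)]]
        D[OF ceq_cwt1[OF _ cong_comp(2)]] D[OF ceq_cwt2[OF _ cong_comp(2)]] by simp }
  { case (add_assoc I n s t u)
    then interpret M: module K "csp P I n" by (blast intro: csp_module bf)
    show ?case using add_assoc D[OF add_assoc(1)] D[OF add_assoc(2)] by (simp add: M.a_assoc) }
  { case (add_commute I n s t)
    then interpret M: module K "csp P I n" by (blast intro: csp_module bf)
    show ?case using add_commute D[OF add_commute(1)] D[OF add_commute(2)] by (simp add: M.a_comm) }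
  { case (add_zero I n s)
    then interpret M: module K "csp P I n" by (blast intro: csp_module bf)
    show ?case using add_zero by simp }
  { case (add_inverse I n s)
    then interpret M: module K "csp P I n" by (blast intro: csp_module bf)
    show ?case using add_inverse D[OF add_inverse(1)]
      by (simp add: module_minus[OF M.module_axioms] M.l_neg) }
  { case (scale_one I n s)
    then interpret M: module K "csp P I n" by (blast intro: csp_module bf)
    show ?case using scale_one D[OF scale_one(1)] by simp }
  { case (scale_scale c e I n s)
    then interpret M: module K "csp P I n" by (blast intro: csp_module bf)
    show ?case using scale_scale D[OF scale_scale(3)] by (simp add: M.smult_assoc1) }
  { case (scale_add c I n s t)
    then interpret M: module K "csp P I n" by (blast intro: csp_module bf)
    show ?case using scale_add D[OF scale_add(2)] D[OF scale_add(3)] by (simp add: M.smult_r_distr) }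
  { case (add_scale c e I n s)
    then interpret M: module K "csp P I n" by (blast intro: csp_module bf)
    show ?case using add_scale D[OF add_scale(3)] by (simp add: M.smult_l_distr) }
  { case (diff_add I n s t)
    then show ?case using D[OF diff_add(1)] D[OF diff_add(2)]
      by (simp add: lin_map_add[OF cdiff_linear[OF bf[OF diff_add(1)]]]) }
  { case (diff_scale c I n s)
    then show ?case using D[OF diff_scale(2)]
      by (simp add: lin_map_scale[OF cdiff_linear[OF bf[OF diff_scale(2)]]]) }
  { case (diff_diff I n s)
    then show ?case using D[OF diff_diff(1)] bf[OF diff_diff(1)] by (simp add: cdiff_cdiff) }
  { case (act_add I n s t \<sigma>)
    then show ?case using D[OF act_add(1)] D[OF act_add(2)]
      by (simp add: lin_map_add[OF cact_linear[OF bf[OF act_add(1)]]]) }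
  { case (act_scale c I n s \<sigma>)
    then show ?case using D[OF act_scale(2)]
      by (simp add: lin_map_scale[OF cact_linear[OF bf[OF act_scale(2)]]]) }
  { case (act_cong I n s \<sigma> \<tau>)
    have "cact P I n \<sigma> (ceval S P h s) = cact P I n \<tau> (ceval S P h s)"
      using act_cong bf[OF act_cong(1)] by (intro cact_cong) auto
    then show ?case using D[OF act_cong(1)] by simp }
  { case (act_id I n s)
    then show ?case using D[OF act_id(1)] bf[OF act_id(1)] by (simp add: cact_id) }
  { case (act_act I n s \<sigma> \<tau>)
    then show ?case using D[OF act_act(1)] bf[OF act_act(1)] by (simp add: cact_comp) }
  { case (act_diff I n s \<sigma>)
    then show ?case using D[OF act_diff(1)] bf[OF act_diff(1)] by (simp add: cact_cdiff) }
  { case (comp_add I m s s' J n t i j)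
    then show ?case using D[OF comp_add(1)] D[OF comp_add(2)] D[OF comp_add(3)]
        lin_map_add[OF bilin_map_left[OF ccomp_bilinear[OF comp_add(4)]]] by simp }
  { case (comp_scale c I m s J n t i j)
    then show ?case using D[OF comp_scale(2)] D[OF comp_scale(3)]
        lin_map_scale[OF bilin_map_left[OF ccomp_bilinear[OF comp_scale(4)]]] by simp }
  { case (comp_diff I m s J n t i j)
    then show ?case using D[OF comp_diff(1)] D[OF comp_diff(2)] ccomp_cdiff[OF comp_diff(3)]
      by (simp add: algebra_simps) }
  { case (comp_act I m s J n t i j \<sigma>)
    then show ?case using D[OF comp_act(1)] D[OF comp_act(2)] ccomp_cact[OF comp_act(3,4)] by simp }
  { case (comp_commute I m s J n t i j)
    then show ?case using D[OF comp_commute(1)] D[OF comp_commute(2)] ccomp_commute[OF comp_commute(3)]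
      by (simp add: Un_commute add.commute) }
  { case (comp_assoc I m s J n t L p u i j k l)
    then show ?case using D[OF comp_assoc(1)] D[OF comp_assoc(2)] D[OF comp_assoc(3)]
        ccomp_assoc[OF comp_assoc(4-7)] by simp }
qed

end

definition cyc_lift ::
  "('k, 'g) cyc_pres \<Rightarrow> ('k, 'v) cyc_data \<Rightarrow> ('g \<Rightarrow> 'v) \<Rightarrow> nat set \<Rightarrow> int \<Rightarrow> ('k, 'g) cterm set \<Rightarrow> 'v" where
  "cyc_lift S P h I n X = ceval S P h (SOME t. t \<in> X)"

lemma cyc_lift_ccls:
  assumes P: "cyclic_operad K P" and sat: "csat K S P h" and t: "cwt K S I n t"
  shows "cyc_lift S P h I' n' (ccls K S t) = ceval S P h t"
proof -
  have "(SOME s. s \<in> ccls K S t) \<in> ccls K S t" by (rule someI, rule ccls_self[OF t])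
  from ceval_ceq[OF P sat ccls_mem[OF this t]] show ?thesis by (simp add: cyc_lift_def)
qed

theorem cyc_lift_hom:
  assumes P: "cyclic_operad K P" and sat: "csat K S P h"
  shows "cyc_hom K (cyc_presented K S) P (cyc_lift S P h)"
proof -
  interpret cyclic_operad K P by fact
  note K = field_axioms
  note L = cyc_lift_ccls[OF P sat]
  note E = cyc_presented_carrierE
  note [simp] = K ccls_add ccls_smult ccls_zero ccls_diff ccls_act ccls_comp cwt.intros ceval_closed[OF P sat]
  show ?thesis
    unfolding cyc_hom_def
  proof (intro conjI allI impI ballI)
    fix I :: "nat set" and n assume b: "finite I"
    show "lin_map K (csp (cyc_presented K S) I n) (csp P I n) (cyc_lift S P h I n)"
      unfolding lin_map_def Pi_iff
    proof (intro conjI ballI)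
      fix x y assume "x \<in> carrier (csp (cyc_presented K S) I n)" "y \<in> carrier (csp (cyc_presented K S) I n)"
      then obtain s t where st: "cwt K S I n s" "x = ccls K S s" "cwt K S I n t" "y = ccls K S t"
        by (elim E)
      then show "cyc_lift S P h I n (x \<oplus>\<^bsub>csp (cyc_presented K S) I n\<^esub> y) =
          cyc_lift S P h I n x \<oplus>\<^bsub>csp P I n\<^esub> cyc_lift S P h I n y"
        using cwt_data[OF st(1)] L[of I n s] L[of I n t] L[of I n "CAdd s t"] by simp
    next
      fix x assume "x \<in> carrier (csp (cyc_presented K S) I n)"
      then obtain s where st: "cwt K S I n s" "x = ccls K S s"
        by (elim E)
      then show "cyc_lift S P h I n x \<in> carrier (csp P I n)"
        using L[of I n s] by simp
      fix c assume "c \<in> carrier K"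
      then show "cyc_lift S P h I n (c \<odot>\<^bsub>csp (cyc_presented K S) I n\<^esub> x) =
          c \<odot>\<^bsub>csp P I n\<^esub> cyc_lift S P h I n x"
        using st cwt_data[OF st(1)] L[of I n s] L[of I n "CScale c s"] by simp
    qed
  next
    fix I n x assume "x \<in> carrier (csp (cyc_presented K S) I n)"
    then obtain s where st: "cwt K S I n s" "x = ccls K S s"
      by (elim E)
    then show "cyc_lift S P h I (n - 1) (cdiff (cyc_presented K S) I n x) =
        cdiff P I n (cyc_lift S P h I n x)"
      using cwt_data[OF st(1)] L[of I n s] L[of I "n - 1" "CDiff s"] by simp
  next
    fix I n x and \<sigma> :: "nat \<Rightarrow> nat"
    assume i: "inj_on \<sigma> I" and "x \<in> carrier (csp (cyc_presented K S) I n)"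
    then obtain s where st: "cwt K S I n s" "x = ccls K S s"
      by (elim E)
    then show "cyc_lift S P h (\<sigma> ` I) n (cact (cyc_presented K S) I n \<sigma> x) =
        cact P I n \<sigma> (cyc_lift S P h I n x)"
      using i cwt_data[OF st(1)] L[of I n s] L[of "\<sigma> ` I" n "CAct \<sigma> s"] by simp
  next
    fix I m i J n j x y
    assume g: "cglue I i J j"
      and "x \<in> carrier (csp (cyc_presented K S) I m)" "y \<in> carrier (csp (cyc_presented K S) J n)"
    then obtain s t where st: "cwt K S I m s" "x = ccls K S s" "cwt K S J n t" "y = ccls K S t"
      by (elim E)
    then show "cyc_lift S P h (I - {i} \<union> (J - {j})) (m + n) (ccomp (cyc_presented K S) I m i J n j x y) =
       ccomp P I m i J n j (cyc_lift S P h I m x) (cyc_lift S P h J n y)"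
      using g cwt_data[OF st(1)] cwt_data[OF st(3)] L[of I m s] L[of J n t]
        L[of "(I - {i}) \<union> (J - {j})" "m + n" "CComp i j s t"] by simp
  qed
qed

definition cgen_val :: "('k, 'r) ring_scheme \<Rightarrow> ('k, 'g) cyc_pres \<Rightarrow>
    (nat set \<Rightarrow> int \<Rightarrow> ('k, 'g) cterm set \<Rightarrow> 'v) \<Rightarrow> 'g \<Rightarrow> 'v" where
  "cgen_val K S f g = f (fst (carity S g)) (snd (carity S g)) (ccls K S (CGen g))"

lemma cyc_hom_ceval:
  assumes P: "cyclic_operad K P" and f: "cyc_hom K (cyc_presented K S) P f"
  shows "cwt K S I n t \<Longrightarrow> f I n (ccls K S t) = ceval S P (cgen_val K S f) t"
proof (induction rule: cwt.induct)
  interpret cyclic_operad K P by fact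
  note K = field_axioms
  note D = cwt_data[of K S] and bf = cwt_finite[of K S]
  note [simp] = ccls_closed K
  { case (wt_gen g I n) then show ?case by (simp add: cgen_val_def) }
  { case (wt_zero I n)
    then show ?case
      using lin_map_zero[OF cyc_hom_lin[OF f wt_zero] cyc_presented_module[OF K wt_zero] csp_module[OF wt_zero]]
      by (simp add: ccls_zero) }
  { case (wt_add I n s t)
    then show ?case using lin_map_add[OF cyc_hom_lin[OF f bf[OF wt_add(1)]], of "ccls K S s" n "ccls K S t"]
        D[OF wt_add(1)] by (simp add: ccls_add) }
  { case (wt_scale c I n s)
    then show ?case using lin_map_scale[OF cyc_hom_lin[OF f bf[OF wt_scale(2)]], of c "ccls K S s" n]
        D[OF wt_scale(2)] by (simp add: ccls_smult) }
  { case (wt_diff I n s)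
    then show ?case using cyc_hom_diff[OF f bf[OF wt_diff(1)] ccls_closed[OF wt_diff(1)]] D[OF wt_diff(1)]
      by (simp add: ccls_diff) }
  { case (wt_act I n s \<sigma>)
    then show ?case using cyc_hom_act[OF f bf[OF wt_act(1)] wt_act(2) ccls_closed[OF wt_act(1)]] D[OF wt_act(1)]
      by (simp add: ccls_act) }
  { case (wt_comp I m s J n t i j)
    then show ?case using cyc_hom_comp[OF f wt_comp(3), of "ccls K S s" m "ccls K S t" n]
        D[OF wt_comp(1)] D[OF wt_comp(2)]
      by (simp add: ccls_comp) }
qed

lemma cyc_hom_csat:
  assumes P: "cyclic_operad K P" and f: "cyc_hom K (cyc_presented K S) P f"
  shows "csat K S P (cgen_val K S f)"
  unfolding csat_def
proof (intro conjI ballI allI impI)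
  interpret cyclic_operad K P by fact
  fix g I n assume *: "g \<in> cgens S" "carity S g = (I, n)" "finite I"
  then have "cwt K S I n (CGen g)" by (rule cwt.wt_gen)
  from cyc_hom_closed[OF f *(3) ccls_closed[OF this]] * show "cgen_val K S f g \<in> carrier (csp P I n)"
    by (simp add: cgen_val_def)
next
  interpret cyclic_operad K P by fact
  fix s t I n assume *: "(s, t) \<in> crels S" "cwt K S I n s" "cwt K S I n t"
  have "ccls K S s = ccls K S t" using * by (intro ccls_eqI[OF field_axioms] ceq.rel)
  then show "ceval S P (cgen_val K S f) s = ceval S P (cgen_val K S f) t"
    using cyc_hom_ceval[OF P f *(2)] cyc_hom_ceval[OF P f *(3)] by simp
qed

text \<open>A morphism is evaluation at its generator values, so agreement on generators propagates
  to all terms. It is used to see that an endomorphism of \<open>phi_upper\<close> fixes the whole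
  unit once it fixes the unit at the generator.\<close>

lemma cyc_hom_eqI:
  assumes P: "cyclic_operad K P" and f: "cyc_hom K (cyc_presented K S) P f"
    and g: "cyc_hom K (cyc_presented K S) P g"
    and eq: "\<And>\<gamma> I n. \<gamma> \<in> cgens S \<Longrightarrow> carity S \<gamma> = (I, n) \<Longrightarrow> finite I \<Longrightarrow>
      f I n (ccls K S (CGen \<gamma>)) = g I n (ccls K S (CGen \<gamma>))"
    and x: "x \<in> carrier (csp (cyc_presented K S) I n)"
  shows "f I n x = g I n x"
proof -
  from x obtain t where t: "cwt K S I n t" "x = ccls K S t" by (elim cyc_presented_carrierE)
  have "cwt K S I n t \<Longrightarrow> ceval S P (cgen_val K S f) t = ceval S P (cgen_val K S g) t"
  proof (induction rule: cwt.induct)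
    case (wt_gen \<gamma> I n) then show ?case by (simp add: cgen_val_def eq)
  qed simp_all
  then show ?thesis using t cyc_hom_ceval[OF P f t(1)] cyc_hom_ceval[OF P g t(1)] by simp
qed

section \<open>The cyclic operad of a dioperad\<close>

lemma splits_iff: "A \<in> splits I \<longleftrightarrow> A \<subseteq> I \<and> A \<noteq> {} \<and> I - A \<noteq> {}"
  by (auto simp: splits_def)

lemma splits_biflags: "finite I \<Longrightarrow> A \<in> splits I \<Longrightarrow> biflags A (I - A)"
  by (auto simp: splits_def biflags_def intro: finite_subset)

lemma biflags_splits: "biflags A B \<Longrightarrow> A \<in> splits (A \<union> B) \<and> (A \<union> B) - A = B"
  by (auto simp: splits_def biflags_def)

lemma splits_image: "inj_on \<sigma> I \<Longrightarrow> A \<in> splits I \<Longrightarrow> \<sigma> ` A \<in> splits (\<sigma> ` I) \<and> \<sigma> ` I - \<sigma> ` A = \<sigma> ` (I - A)"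
  unfolding splits_def inj_on_def by blast

lemma splits_image_iff: "inj_on \<sigma> I \<Longrightarrow> A \<subseteq> I \<Longrightarrow> \<sigma> ` A \<in> splits (\<sigma> ` I) \<longleftrightarrow> A \<in> splits I"
  unfolding splits_def by (auto simp: inj_on_image_eq_iff)

text \<open>Every choice of directions for relabelled flags is the image of one for the original
  flags. The last clause is the preimage by which \<open>phi_lower\<close> defines its
  relabelling.\<close>

lemma splits_imageE:
  assumes "A' \<in> splits (\<sigma> ` I)" "inj_on \<sigma> I"
  obtains A where "A \<in> splits I" "A' = \<sigma> ` A" "{i \<in> I. \<sigma> i \<in> A'} = A"
proof -
  obtain A where A: "A \<subseteq> I" "A' = \<sigma> ` A" using assms(1) by (auto simp: splits_def subset_image_iff)
  have "A \<in> splits I" using splits_image_iff[OF assms(2) A(1)] assms(1) A(2) by simp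
  moreover have "{i \<in> I. \<sigma> i \<in> A'} = A" using A assms(2) unfolding inj_on_def by auto
  ultimately show thesis using that A by blast
qed

lemma preimage_inj_on: "inj_on \<sigma> I \<Longrightarrow> A \<subseteq> I \<Longrightarrow> {i \<in> I. \<sigma> i \<in> \<sigma> ` A} = A"
  unfolding inj_on_def by auto

text \<open>The composite along the directed edge \<open>i \<rightarrow> j\<close> of corollas with flags \<open>I\<close>, \<open>J\<close> and outputs
  \<open>A\<close>, \<open>C\<close>, set to zero if one of the corollas has no output or no input.\<close>

definition dcx ::
  "('k, 'v) dio_data \<Rightarrow> nat set \<Rightarrow> nat set \<Rightarrow> int \<Rightarrow> nat \<Rightarrow> nat set \<Rightarrow> nat set \<Rightarrow> int \<Rightarrow> nat \<Rightarrow>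
   'v \<Rightarrow> 'v \<Rightarrow> 'v" where
  "dcx P I A m i J C n j x y =
     (if A \<in> splits I \<and> C \<in> splits J then dcomp P A (I - A) m i C (J - C) n j x y
      else \<zero>\<^bsub>dsp P ((A - {i}) \<union> C) ((I - A) \<union> (J - C - {j})) (m + n)\<^esub>)"

definition dirg :: "nat set \<Rightarrow> nat set \<Rightarrow> nat \<Rightarrow> nat set \<Rightarrow> nat set \<Rightarrow> nat \<Rightarrow> bool" where
  "dirg I A i J C j \<longleftrightarrow> cglue I i J j \<and> i \<in> A \<and> A \<subseteq> I \<and> C \<subseteq> J \<and> j \<notin> C"

lemma dirg_sets:
  assumes "dirg I A i J C j" "T = (A - {i}) \<union> C" "N = (I - {i}) \<union> (J - {j})"
  shows "(A - {i}) \<union> C = T" "(I - A) \<union> (J - C - {j}) = N - T" "T \<subseteq> N" "finite N"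
  using assms by (auto simp: dirg_def cglue_def)

lemma dirg_dglue:
  assumes "dirg I A i J C j" "A \<in> splits I" "C \<in> splits J"
  shows "dglue A (I - A) i C (J - C) j"
  using assms splits_biflags by (auto simp: dirg_def cglue_def dglue_def)

lemma dirg_splits:
  assumes "dirg I A i J C j" "T = (A - {i}) \<union> C" "N = (I - {i}) \<union> (J - {j})"
    "A \<in> splits I" "C \<in> splits J"
  shows "T \<in> splits N"
  using assms by (auto simp: dirg_def cglue_def splits_def)

text \<open>Membership is void for inadmissible directions. Elements of \<open>phi_lower\<close>
  have unspecified values there, and \<open>dcx\<close> never uses them.\<close>

definition cv :: "('k, 'v) dio_data \<Rightarrow> nat set \<Rightarrow> nat set \<Rightarrow> int \<Rightarrow> 'v set" where
  "cv P N T n = {x. T \<in> splits N \<longrightarrow> x \<in> carrier (dsp P T (N - T) n)}"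

section \<open>Linearity, differential and relabelling of directed composites\<close>

context dioperad
begin

abbreviation "vs N T n \<equiv> dsp P T (N - T) n"

lemma vs_module: "finite N \<Longrightarrow> T \<in> splits N \<Longrightarrow> module K (vs N T n)"
  by (intro dsp_module splits_biflags)

context
  fixes I A i J C j T N
  assumes g: "dirg I A i J C j" and T: "T = (A - {i}) \<union> C" and N: "N = (I - {i}) \<union> (J - {j})"
begin

lemma dcx_zero: "\<not> (A \<in> splits I \<and> C \<in> splits J) \<Longrightarrow> dcx P I A m i J C n j x y = \<zero>\<^bsub>vs N T (m + n)\<^esub>"
  using dirg_sets(1,2)[OF g T N] by (auto simp: dcx_def)

lemma dcx_eq:
  "A \<in> splits I \<Longrightarrow> C \<in> splits J \<Longrightarrow> dcx P I A m i J C n j = dcomp P A (I - A) m i C (J - C) n j"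
  by (intro ext) (simp add: dcx_def)

lemma dcx_bilin:
  "A \<in> splits I \<Longrightarrow> C \<in> splits J \<Longrightarrow>
   bilin_map K (vs I A m) (vs J C n) (vs N T (m + n)) (dcx P I A m i J C n j)"
  using dcomp_bilinear[OF dirg_dglue[OF g]] dirg_sets(1,2)[OF g T N] dcx_eq by simp

lemma dcx_closed:
  assumes "T \<in> splits N" "x \<in> cv P I A m" "y \<in> cv P J C n"
  shows "dcx P I A m i J C n j x y \<in> carrier (vs N T (m + n))"
proof (cases "A \<in> splits I \<and> C \<in> splits J")
  case True
  then show ?thesis using bilin_map_closed[OF dcx_bilin] assms by (auto simp: cv_def)
next
  case False
  interpret M: module K "vs N T (m + n)" using vs_module[OF dirg_sets(4)[OF g T N] assms(1)] .
  show ?thesis using dcx_zero[OF False] by simp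
qed

text \<open>The form \<open>u\<close> plus a multiple of \<open>v\<close> fits both uses: plain sums
  with scalar one, and components of a composite, which are sums with a Koszul sign. The equation
  for \<open>w\<close> is conditional since \<open>w\<close> is unspecified for inadmissible
  directions, where all composites vanish.\<close>

lemma dcx_comb_left:
  assumes "T \<in> splits N" "u \<in> cv P I A m" "v \<in> cv P I A m" "y \<in> cv P J C n" "c \<in> carrier K"
    and "A \<in> splits I \<Longrightarrow> w = u \<oplus>\<^bsub>vs I A m\<^esub> c \<odot>\<^bsub>vs I A m\<^esub> v"
  shows "dcx P I A m i J C n j w y =
    dcx P I A m i J C n j u y \<oplus>\<^bsub>vs N T (m + n)\<^esub> c \<odot>\<^bsub>vs N T (m + n)\<^esub> dcx P I A m i J C n j v y"
proof -
  interpret M: module K "vs N T (m + n)" using vs_module[OF dirg_sets(4)[OF g T N] assms(1)] .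
  show ?thesis
  proof (cases "A \<in> splits I \<and> C \<in> splits J")
    case True
    interpret I: module K "vs I A m" using vs_module True g by (auto simp: dirg_def cglue_def)
    have "lin_map K (vs I A m) (vs N T (m + n)) (\<lambda>x. dcx P I A m i J C n j x y)"
      using bilin_map_left[OF dcx_bilin] True assms(4) by (auto simp: cv_def)
    then show ?thesis using True assms by (auto simp: cv_def lin_map_def)
  next
    case False then show ?thesis using dcx_zero[OF False] assms(5) by simp
  qed
qed

lemma dcx_comb_right:
  assumes "T \<in> splits N" "x \<in> cv P I A m" "u \<in> cv P J C n" "v \<in> cv P J C n" "c \<in> carrier K"
    and "C \<in> splits J \<Longrightarrow> w = u \<oplus>\<^bsub>vs J C n\<^esub> c \<odot>\<^bsub>vs J C n\<^esub> v"
  shows "dcx P I A m i J C n j x w =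
    dcx P I A m i J C n j x u \<oplus>\<^bsub>vs N T (m + n)\<^esub> c \<odot>\<^bsub>vs N T (m + n)\<^esub> dcx P I A m i J C n j x v"
proof -
  interpret M: module K "vs N T (m + n)" using vs_module[OF dirg_sets(4)[OF g T N] assms(1)] .
  show ?thesis
  proof (cases "A \<in> splits I \<and> C \<in> splits J")
    case True
    interpret J: module K "vs J C n" using vs_module True g by (auto simp: dirg_def cglue_def)
    have "lin_map K (vs J C n) (vs N T (m + n)) (dcx P I A m i J C n j x)"
      using bilin_map_right[OF dcx_bilin] True assms(2) by (auto simp: cv_def)
    then show ?thesis using True assms by (auto simp: cv_def lin_map_def)
  next
    case False then show ?thesis using dcx_zero[OF False] assms(5) by simp
  qed
qed

lemma dcx_scale_left:
  assumes "T \<in> splits N" "v \<in> cv P I A m" "y \<in> cv P J C n" "c \<in> carrier K"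
    and "A \<in> splits I \<Longrightarrow> w = c \<odot>\<^bsub>vs I A m\<^esub> v"
  shows "dcx P I A m i J C n j w y = c \<odot>\<^bsub>vs N T (m + n)\<^esub> dcx P I A m i J C n j v y"
proof -
  interpret M: module K "vs N T (m + n)" using vs_module[OF dirg_sets(4)[OF g T N] assms(1)] .
  show ?thesis
  proof (cases "A \<in> splits I \<and> C \<in> splits J")
    case True
    have "lin_map K (vs I A m) (vs N T (m + n)) (\<lambda>x. dcx P I A m i J C n j x y)"
      using bilin_map_left[OF dcx_bilin] True assms(3) by (auto simp: cv_def)
    then show ?thesis using True assms by (auto simp: cv_def lin_map_def)
  next
    case False then show ?thesis using dcx_zero[OF False] assms(4) by simp
  qed
qed

lemma dcx_scale_right:
  assumes "T \<in> splits N" "x \<in> cv P I A m" "v \<in> cv P J C n" "c \<in> carrier K"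
    and "C \<in> splits J \<Longrightarrow> w = c \<odot>\<^bsub>vs J C n\<^esub> v"
  shows "dcx P I A m i J C n j x w = c \<odot>\<^bsub>vs N T (m + n)\<^esub> dcx P I A m i J C n j x v"
proof -
  interpret M: module K "vs N T (m + n)" using vs_module[OF dirg_sets(4)[OF g T N] assms(1)] .
  show ?thesis
  proof (cases "A \<in> splits I \<and> C \<in> splits J")
    case True
    have "lin_map K (vs J C n) (vs N T (m + n)) (dcx P I A m i J C n j x)"
      using bilin_map_right[OF dcx_bilin] True assms(2) by (auto simp: cv_def)
    then show ?thesis using True assms by (auto simp: cv_def lin_map_def)
  next
    case False then show ?thesis using dcx_zero[OF False] assms(4) by simp
  qed
qed

text \<open>Lets a vanishing inner composite kill the outer one in the degenerate cases of
  associativity.\<close>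

lemma dcx_zero_left:
  assumes "T \<in> splits N" "y \<in> cv P J C n"
  shows "dcx P I A m i J C n j \<zero>\<^bsub>vs I A m\<^esub> y = \<zero>\<^bsub>vs N T (m + n)\<^esub>"
proof (cases "A \<in> splits I \<and> C \<in> splits J")
  case True
  have "lin_map K (vs I A m) (vs N T (m + n)) (\<lambda>x. dcx P I A m i J C n j x y)"
    using bilin_map_left[OF dcx_bilin] True assms by (auto simp: cv_def)
  then show ?thesis
    using True assms g dirg_sets(4)[OF g T N] by (intro lin_map_zero) (auto simp: dirg_def cglue_def intro!: vs_module)
next
  case False then show ?thesis using dcx_zero[OF False] by simp
qed

lemma dcx_zero_right:
  assumes "T \<in> splits N" "x \<in> cv P I A m"
  shows "dcx P I A m i J C n j x \<zero>\<^bsub>vs J C n\<^esub> = \<zero>\<^bsub>vs N T (m + n)\<^esub>"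
proof (cases "A \<in> splits I \<and> C \<in> splits J")
  case True
  have "lin_map K (vs J C n) (vs N T (m + n)) (dcx P I A m i J C n j x)"
    using bilin_map_right[OF dcx_bilin] True assms by (auto simp: cv_def)
  then show ?thesis
    using True assms g dirg_sets(4)[OF g T N] by (intro lin_map_zero) (auto simp: dirg_def cglue_def intro!: vs_module)
next
  case False then show ?thesis using dcx_zero[OF False] by simp
qed

text \<open>Degeneracy depends on the flags alone, not on degrees or decorations, so in the
  degenerate case all three composites vanish together.\<close>

lemma dcx_ddiff:
  assumes "T \<in> splits N" "x \<in> cv P I A m" "y \<in> cv P J C n"
  shows "ddiff P T (N - T) (m + n) (dcx P I A m i J C n j x y) =
    dcx P I A (m - 1) i J C n j (ddiff P A (I - A) m x) y \<oplus>\<^bsub>vs N T (m + n - 1)\<^esub>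
    ksign K m \<odot>\<^bsub>vs N T (m + n - 1)\<^esub> dcx P I A m i J C (n - 1) j x (ddiff P C (J - C) n y)"
proof (cases "A \<in> splits I \<and> C \<in> splits J")
  case True
  then show ?thesis
    using dcomp_ddiff[OF dirg_dglue[OF g], of x m y n] dirg_sets(1,2)[OF g T N] dcx_eq assms
    by (simp add: cv_def)
next
  case False
  have f: "finite N" using dirg_sets(4)[OF g T N] .
  interpret M: module K "vs N T (m + n - 1)" using vs_module[OF f assms(1)] .
  have "ddiff P T (N - T) (m + n) \<zero>\<^bsub>vs N T (m + n)\<^esub> = \<zero>\<^bsub>vs N T (m + n - 1)\<^esub>"
    using assms(1) f by (intro lin_map_zero[OF ddiff_linear] splits_biflags vs_module)
  moreover have d: "m - 1 + n = m + n - 1" "m + (n - 1) = m + n - 1" by auto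
  ultimately show ?thesis unfolding dcx_zero[OF False] d using field_axioms by simp
qed

text \<open>An injective relabelling preserves admissibility of directions, so both sides are
  degenerate simultaneously.\<close>

lemma dcx_dact:
  assumes "T \<in> splits N" "x \<in> cv P I A m" "y \<in> cv P J C n" "inj_on \<sigma> (I \<union> J)"
  shows "dact P T (N - T) (m + n) \<sigma> (dcx P I A m i J C n j x y) =
    dcx P (\<sigma> ` I) (\<sigma> ` A) m (\<sigma> i) (\<sigma> ` J) (\<sigma> ` C) n (\<sigma> j)
      (dact P A (I - A) m \<sigma> x) (dact P C (J - C) n \<sigma> y)"
proof -
  have i: "inj_on \<sigma> I" "inj_on \<sigma> J" "A \<subseteq> I" "C \<subseteq> J" "i \<in> I" "j \<in> J" "I \<inter> J = {}"
    using assms(4) g by (auto simp: dirg_def cglue_def elim!: inj_on_subset)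
  show ?thesis
  proof (cases "A \<in> splits I \<and> C \<in> splits J")
    case True
    have u: "A \<union> (I - A) \<union> C \<union> (J - C) = I \<union> J" using i by auto
    show ?thesis
      using True dcomp_dact[OF dirg_dglue[OF g], of \<sigma> x m y n] dirg_sets(1,2)[OF g T N] dcx_eq assms
        splits_image[OF i(1), of A] splits_image[OF i(2), of C] u
      by (simp add: cv_def dcx_def)
  next
    case False
    have f: "finite N" using dirg_sets(4)[OF g T N] .
    have s: "\<sigma> ` A - {\<sigma> i} = \<sigma> ` (A - {i})" "\<sigma> ` I - \<sigma> ` A = \<sigma> ` (I - A)"
      "\<sigma> ` J - \<sigma> ` C - {\<sigma> j} = \<sigma> ` (J - C - {j})"
      using i unfolding inj_on_def by blast+
    have "inj_on \<sigma> N" using assms(4) N by (auto elim!: inj_on_subset)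
    with splits_image[OF this assms(1)]
    have "dact P T (N - T) (m + n) \<sigma> \<zero>\<^bsub>vs N T (m + n)\<^esub> =
        \<zero>\<^bsub>dsp P (\<sigma> ` T) (\<sigma> ` (N - T)) (m + n)\<^esub>"
      using assms(1) f vs_module[of "\<sigma> ` N" "\<sigma> ` T" "m + n"] dirg_sets(3)[OF g T N]
      by (intro lin_map_zero[OF dact_linear] splits_biflags vs_module) (auto simp: Un_absorb1)
    moreover have "\<sigma> ` A - {\<sigma> i} \<union> \<sigma> ` C = \<sigma> ` T"
      "(\<sigma> ` I - \<sigma> ` A) \<union> (\<sigma> ` J - \<sigma> ` C - {\<sigma> j}) = \<sigma> ` (N - T)"
      unfolding s dirg_sets(2)[OF g T N, symmetric] using T by auto
    ultimately show ?thesis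
      unfolding dcx_zero[OF False]
      using False splits_image_iff[OF i(1,3)] splits_image_iff[OF i(2,4)] by (auto simp: dcx_def)
  qed
qed

end

section \<open>Associativity of directed composites of three corollas, degenerate ones
  included\<close>

context
  fixes I J L X Y Z N1 N2 :: "nat set" and i j k l :: nat and m n p :: int
  assumes g1: "cglue I i J j" and g2: "cglue J k L l" and jk: "j \<noteq> k" and IL: "I \<inter> L = {}"
    and N1: "N1 = (I - {i}) \<union> (J - {j})" and N2: "N2 = (J - {k}) \<union> (L - {l})"
    and X: "X \<subseteq> I - {i}" and Y: "Y \<subseteq> J - {j, k}" and Z: "Z \<subseteq> L - {l}"
    and T: "X \<union> Y \<union> Z \<in> splits ((N1 - {k}) \<union> (L - {l}))"
begin

text \<open>The edges run from \<open>i\<close> to \<open>j\<close> and from \<open>k\<close> to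
  \<open>l\<close>; \<open>X\<close>, \<open>Y\<close>, \<open>Z\<close> are the outputs among the
  external flags of the three vertices. If all vertices are admissible this is the dioperad axiom,
  otherwise both bracketings vanish.\<close>

lemma dcx_assoc_chain:
  assumes x: "x \<in> cv P I (insert i X) m" and y: "y \<in> cv P J (insert k Y) n" and z: "z \<in> cv P L Z p"
  shows "dcx P N1 (insert k (X \<union> Y)) (m + n) k L Z p l (dcx P I (insert i X) m i J (insert k Y) n j x y) z =
    dcx P I (insert i X) m i N2 (Y \<union> Z) (n + p) j x (dcx P J (insert k Y) n k L Z p l y z)"
proof -
  let ?N = "(N1 - {k}) \<union> (L - {l})"
  have g12: "dirg I (insert i X) i J (insert k Y) j" and g23: "dirg J (insert k Y) k L Z l"
    and gl: "dirg N1 (insert k (X \<union> Y)) k L Z l" and gr: "dirg I (insert i X) i N2 (Y \<union> Z) j"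
    using g1 g2 jk IL X Y Z by (auto simp: dirg_def cglue_def N1 N2)
  have t12: "insert k (X \<union> Y) = (insert i X - {i}) \<union> insert k Y"
    and t23: "Y \<union> Z = (insert k Y - {k}) \<union> Z"
    and tl: "X \<union> Y \<union> Z = (insert k (X \<union> Y) - {k}) \<union> Z"
    and tr: "X \<union> Y \<union> Z = (insert i X - {i}) \<union> (Y \<union> Z)"
    and n: "?N = (I - {i}) \<union> (N2 - {j})"
    using g1 g2 jk IL X Y Z by (auto simp: cglue_def N1 N2)
  show ?thesis
  proof (cases "insert i X \<in> splits I \<and> insert k Y \<in> splits J \<and> Z \<in> splits L")
    case True
    note s = dirg_splits[OF g12 t12 N1] dirg_splits[OF g23 t23 N2]
    have e: "dcx P N1 (insert k (X \<union> Y)) (m + n) k L Z p l (dcx P I (insert i X) m i J (insert k Y) n j x y) z =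
      dcomp P (insert k (X \<union> Y)) (N1 - insert k (X \<union> Y)) (m + n) k Z (L - Z) p l
       (dcomp P (insert i X) (I - insert i X) m i (insert k Y) (J - insert k Y) n j x y) z"
      "dcx P I (insert i X) m i N2 (Y \<union> Z) (n + p) j x (dcx P J (insert k Y) n k L Z p l y z) =
       dcomp P (insert i X) (I - insert i X) m i (Y \<union> Z) (N2 - (Y \<union> Z)) (n + p) j x
        (dcomp P (insert k Y) (J - insert k Y) n k Z (L - Z) p l y z)"
      using True s by (simp_all add: dcx_def)
    have "(insert i X \<union> (I - insert i X)) \<inter> (Z \<union> (L - Z)) = {}"
      using IL X Z g1 g2 by (auto simp: cglue_def)
    from dcomp_assoc_chain[OF dirg_dglue[OF g12] dirg_dglue[OF g23] this, of x m y n z p] True x y z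
    show ?thesis unfolding e dirg_sets(1,2)[OF g12 t12 N1] dirg_sets(1,2)[OF g23 t23 N2]
      by (simp add: cv_def)
  next
    case False
    have xy: "dcx P I (insert i X) m i J (insert k Y) n j x y \<in> cv P N1 (insert k (X \<union> Y)) (m + n)"
      and yz: "dcx P J (insert k Y) n k L Z p l y z \<in> cv P N2 (Y \<union> Z) (n + p)"
      using dcx_closed[OF g12 t12 N1 _ x y] dcx_closed[OF g23 t23 N2 _ y z] by (auto simp: cv_def)
    \<comment> \<open>If the last vertex is degenerate, so is the outer composite. Otherwise the
      inner composite is zero, and the outer one is linear in it.\<close>
    have "dcx P N1 (insert k (X \<union> Y)) (m + n) k L Z p l (dcx P I (insert i X) m i J (insert k Y) n j x y) z =
      \<zero>\<^bsub>vs ?N (X \<union> Y \<union> Z) (m + n + p)\<^esub>"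
      using False dcx_zero[OF g12 t12 N1] dcx_zero[OF gl tl HOL.refl] dcx_zero_left[OF gl tl HOL.refl T z]
      by (cases "Z \<in> splits L") auto
    moreover have "dcx P I (insert i X) m i N2 (Y \<union> Z) (n + p) j x (dcx P J (insert k Y) n k L Z p l y z) =
      \<zero>\<^bsub>vs ?N (X \<union> Y \<union> Z) (m + (n + p))\<^esub>"
      using False dcx_zero[OF g23 t23 N2] dcx_zero[OF gr tr n] dcx_zero_right[OF gr tr n T x]
      by (cases "insert i X \<in> splits I") auto
    ultimately show ?thesis by (simp add: add.assoc)
  qed
qed

text \<open>Both edges enter the middle vertex, so neither outer vertex precedes the other;
  exchanging \<open>x\<close> and \<open>z\<close> produces the sign.\<close>

lemma dcx_assoc_in:
  assumes x: "x \<in> cv P I (insert i X) m" and y: "y \<in> cv P J Y n" and z: "z \<in> cv P L (insert l Z) p"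
  shows "dcx P I (insert i X) m i N2 (Y \<union> Z) (p + n) j x (dcx P L (insert l Z) p l J Y n k z y) =
    ksign K (m * p) \<odot>\<^bsub>vs ((N1 - {k}) \<union> (L - {l})) (X \<union> Y \<union> Z) (m + n + p)\<^esub>
    dcx P L (insert l Z) p l N1 (X \<union> Y) (m + n) k z (dcx P I (insert i X) m i J Y n j x y)"
proof -
  let ?N = "(N1 - {k}) \<union> (L - {l})"
  have g12: "dirg I (insert i X) i J Y j" and g23: "dirg L (insert l Z) l J Y k"
    and gl: "dirg L (insert l Z) l N1 (X \<union> Y) k" and gr: "dirg I (insert i X) i N2 (Y \<union> Z) j"
    using g1 g2 jk IL X Y Z by (auto simp: dirg_def cglue_def N1 N2)
  have t12: "X \<union> Y = (insert i X - {i}) \<union> Y"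
    and t23: "Y \<union> Z = (insert l Z - {l}) \<union> Y"
    and tl: "X \<union> Y \<union> Z = (insert l Z - {l}) \<union> (X \<union> Y)"
    and tr: "X \<union> Y \<union> Z = (insert i X - {i}) \<union> (Y \<union> Z)"
    and nl: "?N = (L - {l}) \<union> (N1 - {k})"
    and n: "?N = (I - {i}) \<union> (N2 - {j})"
    and N2': "N2 = (L - {l}) \<union> (J - {k})"
    using g1 g2 jk IL X Y Z by (auto simp: cglue_def N1 N2)
  \<comment> \<open>The degree is an argument of \<open>dsp\<close>, so equal sums must be brought
    to one expression before two modules can be recognised as the same.\<close>
  have d: "m + (p + n) = m + n + p" "p + (m + n) = m + n + p" by auto
  interpret M: module K "vs ?N (X \<union> Y \<union> Z) (m + n + p)"
    using T g1 g2 by (intro vs_module) (auto simp: cglue_def N1)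
  show ?thesis
  proof (cases "insert i X \<in> splits I \<and> Y \<in> splits J \<and> insert l Z \<in> splits L")
    case True
    note s = dirg_splits[OF g12 t12 N1] dirg_splits[OF g23 t23 N2']
    have e: "dcx P I (insert i X) m i N2 (Y \<union> Z) (p + n) j x (dcx P L (insert l Z) p l J Y n k z y) =
      dcomp P (insert i X) (I - insert i X) m i (Y \<union> Z) (N2 - (Y \<union> Z)) (p + n) j x
       (dcomp P (insert l Z) (L - insert l Z) p l Y (J - Y) n k z y)"
      "dcx P L (insert l Z) p l N1 (X \<union> Y) (m + n) k z (dcx P I (insert i X) m i J Y n j x y) =
       dcomp P (insert l Z) (L - insert l Z) p l (X \<union> Y) (N1 - (X \<union> Y)) (m + n) k z
        (dcomp P (insert i X) (I - insert i X) m i Y (J - Y) n j x y)"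
      using True s by (simp_all add: dcx_def)
    have q: "insert i X - {i} \<union> (Y \<union> Z) = X \<union> Y \<union> Z"
      "I - insert i X \<union> (N2 - (Y \<union> Z) - {j}) = ?N - (X \<union> Y \<union> Z)"
      using dirg_sets(1,2)[OF gr tr n] by auto
    have "(insert i X \<union> (I - insert i X)) \<inter> (insert l Z \<union> (L - insert l Z)) = {}"
      using IL X Z g1 g2 by (auto simp: cglue_def)
    from dcomp_assoc_in[OF dirg_dglue[OF g12] dirg_dglue[OF g23] jk this, of x m z p y n] True x y z
    show ?thesis unfolding e dirg_sets(1,2)[OF g12 t12 N1] dirg_sets(1,2)[OF g23 t23 N2'] q d
      by (simp add: cv_def)
  next
    case False
    have "dcx P I (insert i X) m i N2 (Y \<union> Z) (p + n) j x (dcx P L (insert l Z) p l J Y n k z y) =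
      \<zero>\<^bsub>vs ?N (X \<union> Y \<union> Z) (m + (p + n))\<^esub>"
      using False dcx_zero[OF g23 t23 N2'] dcx_zero[OF gr tr n] dcx_zero_right[OF gr tr n T x]
      by (cases "insert i X \<in> splits I") auto
    moreover have "dcx P L (insert l Z) p l N1 (X \<union> Y) (m + n) k z (dcx P I (insert i X) m i J Y n j x y) =
      \<zero>\<^bsub>vs ?N (X \<union> Y \<union> Z) (p + (m + n))\<^esub>"
      using False dcx_zero[OF g12 t12 N1] dcx_zero[OF gl tl nl] dcx_zero_right[OF gl tl nl T z]
      by (cases "insert l Z \<in> splits L") auto
    ultimately show ?thesis by (simp add: d field_axioms)
  qed
qed

text \<open>Both edges leave the middle vertex. As for two entering edges, the sign comes from
  exchanging \<open>x\<close> and \<open>z\<close>.\<close>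

lemma dcx_assoc_out:
  assumes x: "x \<in> cv P I X m" and y: "y \<in> cv P J (insert j (insert k Y)) n" and z: "z \<in> cv P L Z p"
  shows "dcx P N1 (insert k (X \<union> Y)) (n + m) k L Z p l
      (dcx P J (insert j (insert k Y)) n j I X m i y x) z =
    ksign K (m * p) \<odot>\<^bsub>vs ((N1 - {k}) \<union> (L - {l})) (X \<union> Y \<union> Z) (m + n + p)\<^esub>
    dcx P N2 (insert j (Y \<union> Z)) (n + p) j I X m i (dcx P J (insert j (insert k Y)) n k L Z p l y z) x"
proof -
  let ?N = "(N1 - {k}) \<union> (L - {l})" and ?Y = "insert j (insert k Y)"
  have g12: "dirg J ?Y j I X i" and g23: "dirg J ?Y k L Z l"
    and gl: "dirg N1 (insert k (X \<union> Y)) k L Z l" and gr: "dirg N2 (insert j (Y \<union> Z)) j I X i"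
    using g1 g2 jk IL X Y Z by (auto simp: dirg_def cglue_def N1 N2)
  have t12: "insert k (X \<union> Y) = (?Y - {j}) \<union> X"
    and t23: "insert j (Y \<union> Z) = (?Y - {k}) \<union> Z"
    and tl: "X \<union> Y \<union> Z = (insert k (X \<union> Y) - {k}) \<union> Z"
    and tr: "X \<union> Y \<union> Z = (insert j (Y \<union> Z) - {j}) \<union> X"
    and n: "?N = (N2 - {j}) \<union> (I - {i})"
    and N1': "N1 = (J - {j}) \<union> (I - {i})"
    using g1 g2 jk IL X Y Z by (auto simp: cglue_def N1 N2)
  have d: "n + m + p = m + n + p" "n + p + m = m + n + p" by auto
  interpret M: module K "vs ?N (X \<union> Y \<union> Z) (m + n + p)"
    using T g1 g2 by (intro vs_module) (auto simp: cglue_def N1)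
  show ?thesis
  proof (cases "X \<in> splits I \<and> ?Y \<in> splits J \<and> Z \<in> splits L")
    case True
    note s = dirg_splits[OF g12 t12 N1'] dirg_splits[OF g23 t23 N2]
    have e: "dcx P N1 (insert k (X \<union> Y)) (n + m) k L Z p l (dcx P J ?Y n j I X m i y x) z =
      dcomp P (insert k (X \<union> Y)) (N1 - insert k (X \<union> Y)) (n + m) k Z (L - Z) p l
       (dcomp P ?Y (J - ?Y) n j X (I - X) m i y x) z"
      "dcx P N2 (insert j (Y \<union> Z)) (n + p) j I X m i (dcx P J ?Y n k L Z p l y z) x =
       dcomp P (insert j (Y \<union> Z)) (N2 - insert j (Y \<union> Z)) (n + p) j X (I - X) m i
        (dcomp P ?Y (J - ?Y) n k Z (L - Z) p l y z) x"
      using True s by (simp_all add: dcx_def)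
    have q: "insert k (X \<union> Y) - {k} \<union> Z = X \<union> Y \<union> Z"
      "N1 - insert k (X \<union> Y) \<union> (L - Z - {l}) = ?N - (X \<union> Y \<union> Z)"
      using dirg_sets(1,2)[OF gl tl HOL.refl] by auto
    have "(X \<union> (I - X)) \<inter> (Z \<union> (L - Z)) = {}" using IL X Z by auto
    from dcomp_assoc_out[OF dirg_dglue[OF g12] dirg_dglue[OF g23] jk this, of y n x m z p] True x y z
    show ?thesis unfolding e dirg_sets(1,2)[OF g12 t12 N1'] dirg_sets(1,2)[OF g23 t23 N2] q d
      by (simp add: cv_def)
  next
    case False
    have "dcx P N1 (insert k (X \<union> Y)) (n + m) k L Z p l (dcx P J ?Y n j I X m i y x) z =
      \<zero>\<^bsub>vs ?N (X \<union> Y \<union> Z) (n + m + p)\<^esub>"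
      using False dcx_zero[OF g12 t12 N1'] dcx_zero[OF gl tl HOL.refl] dcx_zero_left[OF gl tl HOL.refl T z]
      by (cases "Z \<in> splits L") auto
    moreover have "dcx P N2 (insert j (Y \<union> Z)) (n + p) j I X m i (dcx P J ?Y n k L Z p l y z) x =
      \<zero>\<^bsub>vs ?N (X \<union> Y \<union> Z) (n + p + m)\<^esub>"
      using False dcx_zero[OF g23 t23 N2] dcx_zero[OF gr tr n] dcx_zero_left[OF gr tr n T x]
      by (cases "X \<in> splits I") auto
    ultimately show ?thesis by (simp add: d field_axioms)
  qed
qed

end

end

section \<open>The components of elements of \<open>phi_lower\<close>\<close>

lemma phi_lower_carrier:
  "f \<in> carrier (csp (phi_lower K P) I n) \<longleftrightarrow>
     f \<in> extensional (splits I) \<and> (\<forall>A\<in>splits I. f A \<in> carrier (dsp P A (I - A) n))"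
  by (auto simp: phi_lower_def PiE_iff)

lemma phi_lower_cv: "f \<in> carrier (csp (phi_lower K P) I n) \<Longrightarrow> f A \<in> cv P I A n"
  by (auto simp: phi_lower_carrier cv_def)

lemma phi_lower_simps:
  "\<zero>\<^bsub>csp (phi_lower K P) I n\<^esub> = (\<lambda>A\<in>splits I. \<zero>\<^bsub>dsp P A (I - A) n\<^esub>)"
  "f \<oplus>\<^bsub>csp (phi_lower K P) I n\<^esub> g = (\<lambda>A\<in>splits I. f A \<oplus>\<^bsub>dsp P A (I - A) n\<^esub> g A)"
  "c \<odot>\<^bsub>csp (phi_lower K P) I n\<^esub> f = (\<lambda>A\<in>splits I. c \<odot>\<^bsub>dsp P A (I - A) n\<^esub> f A)"
  "cdiff (phi_lower K P) I n f = (\<lambda>A\<in>splits I. ddiff P A (I - A) n (f A))"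
  by (simp_all add: phi_lower_def)

lemma phi_lower_ext:
  assumes "f \<in> extensional (splits I)" "g \<in> extensional (splits I)"
    "\<And>A. A \<in> splits I \<Longrightarrow> f A = g A"
  shows "f = g"
  by (rule extensionalityI[OF assms])

lemma cact_ext: "cact (phi_lower K P) I n \<sigma> f \<in> extensional (splits (\<sigma> ` I))"
  by (simp add: phi_lower_def)

text \<open>Together with \<open>splits_imageE\<close> this describes all components of a relabelled
  element, since every admissible set of outputs is an image.\<close>

lemma cact_apply:
  assumes "A \<in> splits I" "inj_on \<sigma> I"
  shows "cact (phi_lower K P) I n \<sigma> f (\<sigma> ` A) = dact P A (I - A) n \<sigma> (f A)"
proof -
  have "{i \<in> I. \<sigma> i \<in> \<sigma> ` A} = A" using assms by (intro preimage_inj_on) (auto simp: splits_def)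
  then show ?thesis using splits_image[OF assms(2,1)] by (simp add: phi_lower_def)
qed

lemma ccomp_ext:
  "ccomp (phi_lower K P) I m i J n j f g \<in> extensional (splits ((I - {i}) \<union> (J - {j})))"
  by (simp add: phi_lower_def phi_lower_comp_def)

lemma cglue_splitsE:
  assumes "T \<in> splits ((I - {i}) \<union> (J - {j}))"
  obtains X Y where "X \<subseteq> I - {i}" "Y \<subseteq> J - {j}" "T = X \<union> Y"
proof (rule that)
  show "T \<inter> (I - {i}) \<subseteq> I - {i}" "T \<inter> (J - {j}) \<subseteq> J - {j}" by auto
  show "T = T \<inter> (I - {i}) \<union> T \<inter> (J - {j})" using assms by (auto simp: splits_def)
qed

lemma cglue_dirg:
  assumes "cglue I i J j" "X \<subseteq> I - {i}" "Y \<subseteq> J - {j}"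
  shows "dirg I (insert i X) i J Y j" "dirg J (insert j Y) j I X i"
    "X \<union> Y = (insert i X - {i}) \<union> Y" "X \<union> Y = (insert j Y - {j}) \<union> X"
    "(I - {i}) \<union> (J - {j}) = (J - {j}) \<union> (I - {i})"
  using assms by (auto simp: dirg_def cglue_def)

section \<open>The cyclic operad axioms for \<open>phi_lower\<close>\<close>

context dioperad
begin

abbreviation "L \<equiv> phi_lower K P"

text \<open>Replaces the conditionals of \<open>phi_lower_comp\<close> by the total
  \<open>dcx\<close>: each component becomes a sum of two directed composites without case
  distinction, and the axioms reduce to statements about \<open>dcx\<close> and signs.\<close>

lemma ccomp_apply:
  assumes g: "cglue I i J j" and X: "X \<subseteq> I - {i}" and Y: "Y \<subseteq> J - {j}"
    and N: "N = (I - {i}) \<union> (J - {j})" and T: "X \<union> Y \<in> splits N"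
  shows "ccomp L I m i J n j a b (X \<union> Y) =
    dcx P I (insert i X) m i J Y n j (a (insert i X)) (b Y) \<oplus>\<^bsub>vs N (X \<union> Y) (m + n)\<^esub>
    ksign K (m * n) \<odot>\<^bsub>vs N (X \<union> Y) (m + n)\<^esub>
      dcx P J (insert j Y) n j I X m i (b (insert j Y)) (a X)"
proof -
  note d = cglue_dirg[OF g X Y]
  have N': "N = (J - {j}) \<union> (I - {i})" using N d(5) by simp
  have e: "(X \<union> Y) \<inter> I = X" "(X \<union> Y) \<inter> J = Y" using g X Y by (auto simp: cglue_def)
  interpret M: module K "vs N (X \<union> Y) (m + n)"
    using T g N by (intro vs_module) (auto simp: cglue_def)
  have 1: "dcx P I (insert i X) m i J Y n j x y =
      (if insert i X \<in> splits I \<and> Y \<in> splits J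
       then dcomp P (insert i X) (I - insert i X) m i Y (J - Y) n j x y else \<zero>\<^bsub>vs N (X \<union> Y) (m + n)\<^esub>)" for x y
    using dcx_zero[OF d(1,3) N] by (auto simp: dcx_def)
  have 2: "ksign K (m * n) \<odot>\<^bsub>vs N (X \<union> Y) (m + n)\<^esub> dcx P J (insert j Y) n j I X m i x y =
      (if X \<in> splits I \<and> insert j Y \<in> splits J
       then ksign K (m * n) \<odot>\<^bsub>vs N (X \<union> Y) (m + n)\<^esub>
         dcomp P (insert j Y) (J - insert j Y) n j X (I - X) m i x y else \<zero>\<^bsub>vs N (X \<union> Y) (m + n)\<^esub>)" for x y
  proof (cases "X \<in> splits I \<and> insert j Y \<in> splits J")
    case True then show ?thesis by (simp add: dcx_def)
  next
    case False
    then have "\<not> (insert j Y \<in> splits J \<and> X \<in> splits I)" by blast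
    from dcx_zero[OF d(2,4) N' this, of n m x y] show ?thesis using False by (auto simp: field_axioms add.commute)
  qed
  show ?thesis using T unfolding 1 2 unfolding N
    by (simp add: phi_lower_def phi_lower_comp_def e Let_def)
qed

lemma phi_lower_module: "finite I \<Longrightarrow> module K (csp L I n)"
proof -
  assume f: "finite I"
  note m = vs_module[OF f]
  interpret K: cring K by (rule is_cring)
  have ab: "abelian_group (vs I A n)" if "A \<in> splits I" for A
    using m[OF that, of n] by (simp add: module_def)
  note [simp] = phi_lower_simps phi_lower_carrier
  have "abelian_group (csp L I n)"
  proof (rule abelian_groupI)
    fix x y z assume "x \<in> carrier (csp L I n)" "y \<in> carrier (csp L I n)" "z \<in> carrier (csp L I n)"
    then show "x \<oplus>\<^bsub>csp L I n\<^esub> y \<oplus>\<^bsub>csp L I n\<^esub> z = x \<oplus>\<^bsub>csp L I n\<^esub> (y \<oplus>\<^bsub>csp L I n\<^esub> z)"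
      using ab by (auto intro!: restrict_ext simp: abelian_monoid.a_assoc[OF abelian_group.axioms(1)])
  next
    fix x y assume "x \<in> carrier (csp L I n)" "y \<in> carrier (csp L I n)"
    then show "x \<oplus>\<^bsub>csp L I n\<^esub> y \<in> carrier (csp L I n)" "x \<oplus>\<^bsub>csp L I n\<^esub> y = y \<oplus>\<^bsub>csp L I n\<^esub> x"
      using ab by (auto intro!: restrict_ext simp: abelian_monoid.a_closed[OF abelian_group.axioms(1)]
          abelian_monoid.a_comm[OF abelian_group.axioms(1)])
  next
    show "\<zero>\<^bsub>csp L I n\<^esub> \<in> carrier (csp L I n)"
      using ab by (auto simp: abelian_monoid.zero_closed[OF abelian_group.axioms(1)])
    fix x assume x: "x \<in> carrier (csp L I n)"
    then show "\<zero>\<^bsub>csp L I n\<^esub> \<oplus>\<^bsub>csp L I n\<^esub> x = x"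
      using ab by (intro phi_lower_ext) (auto simp: abelian_monoid.l_zero[OF abelian_group.axioms(1)])
    have "(\<lambda>A\<in>splits I. \<ominus>\<^bsub>vs I A n\<^esub> x A) \<oplus>\<^bsub>csp L I n\<^esub> x = \<zero>\<^bsub>csp L I n\<^esub>"
      using ab x by (intro phi_lower_ext) (auto simp: abelian_group.l_neg)
    moreover have "(\<lambda>A\<in>splits I. \<ominus>\<^bsub>vs I A n\<^esub> x A) \<in> carrier (csp L I n)"
      using ab x by (auto simp: abelian_group.a_inv_closed)
    ultimately show "\<exists>y\<in>carrier (csp L I n). y \<oplus>\<^bsub>csp L I n\<^esub> x = \<zero>\<^bsub>csp L I n\<^esub>" by blast
  qed
  then show ?thesis
  proof (intro moduleI)
    fix c e x assume "c \<in> carrier K" "e \<in> carrier K" "x \<in> carrier (csp L I n)"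
    then show "(c \<oplus> e) \<odot>\<^bsub>csp L I n\<^esub> x = c \<odot>\<^bsub>csp L I n\<^esub> x \<oplus>\<^bsub>csp L I n\<^esub> e \<odot>\<^bsub>csp L I n\<^esub> x"
      "(c \<otimes> e) \<odot>\<^bsub>csp L I n\<^esub> x = c \<odot>\<^bsub>csp L I n\<^esub> (e \<odot>\<^bsub>csp L I n\<^esub> x)"
      using m by (auto intro!: restrict_ext simp: module.smult_l_distr module.smult_assoc1)
  next
    fix c x y assume "c \<in> carrier K" "x \<in> carrier (csp L I n)" "y \<in> carrier (csp L I n)"
    then show "c \<odot>\<^bsub>csp L I n\<^esub> (x \<oplus>\<^bsub>csp L I n\<^esub> y) = c \<odot>\<^bsub>csp L I n\<^esub> x \<oplus>\<^bsub>csp L I n\<^esub> c \<odot>\<^bsub>csp L I n\<^esub> y"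
      "c \<odot>\<^bsub>csp L I n\<^esub> x \<in> carrier (csp L I n)"
      using m by (auto intro!: restrict_ext simp: module.smult_r_distr[OF m] module.smult_closed[OF m])
  next
    fix x assume "x \<in> carrier (csp L I n)"
    then show "\<one> \<odot>\<^bsub>csp L I n\<^esub> x = x"
      using m by (intro phi_lower_ext) (auto simp: module.smult_one[OF m])
  qed (rule is_cring)
qed

lemma ccomp_closed:
  assumes g: "cglue I i J j" and f: "f \<in> carrier (csp L I m)" and h: "h \<in> carrier (csp L J n)"
  shows "ccomp L I m i J n j f h \<in> carrier (csp L ((I - {i}) \<union> (J - {j})) (m + n))"
  unfolding phi_lower_carrier
proof (intro conjI ballI ccomp_ext)
  let ?N = "(I - {i}) \<union> (J - {j})"
  fix T assume T: "T \<in> splits ?N"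
  then obtain X Y where XY: "X \<subseteq> I - {i}" "Y \<subseteq> J - {j}" "T = X \<union> Y" by (rule cglue_splitsE)
  note d = cglue_dirg[OF g XY(1,2)]
  interpret M: module K "vs ?N T (m + n)"
    using T g by (intro vs_module) (auto simp: cglue_def)
  have nm: "n + m = m + n" by simp
  note T' = T[unfolded XY(3)]
  have "dcx P I (insert i X) m i J Y n j (f (insert i X)) (h Y) \<in> carrier (vs ?N T (m + n))"
    "dcx P J (insert j Y) n j I X m i (h (insert j Y)) (f X) \<in> carrier (vs ?N T (n + m))"
    unfolding XY(3)
    by (intro dcx_closed[OF d(1,3) HOL.refl T'] dcx_closed[OF d(2,4,5) T'] phi_lower_cv[OF f] phi_lower_cv[OF h])+
  from this[unfolded nm] show "ccomp L I m i J n j f h T \<in> carrier (vs ?N T (m + n))"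
    using ccomp_apply[OF g XY(1,2) HOL.refl T'] by (simp add: XY(3)[symmetric] field_axioms)
qed

lemma ccomp_left_linear:
  assumes g: "cglue I i J j" and h: "h \<in> carrier (csp L J n)"
  shows "lin_map K (csp L I m) (csp L ((I - {i}) \<union> (J - {j})) (m + n)) (\<lambda>f. ccomp L I m i J n j f h)"
  unfolding lin_map_def Pi_iff
proof (intro conjI ballI)
  let ?N = "(I - {i}) \<union> (J - {j})"
  have fin: "finite I" "finite J" "finite ?N" using g by (auto simp: cglue_def)
  fix f assume f: "f \<in> carrier (csp L I m)"
  then show "ccomp L I m i J n j f h \<in> carrier (csp L ?N (m + n))" using h by (rule ccomp_closed[OF g])
  note cf = phi_lower_cv[OF f] and ch = phi_lower_cv[OF h]
  { fix f' assume f': "f' \<in> carrier (csp L I m)"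
    note cf' = phi_lower_cv[OF f']
    show "ccomp L I m i J n j (f \<oplus>\<^bsub>csp L I m\<^esub> f') h =
        ccomp L I m i J n j f h \<oplus>\<^bsub>csp L ?N (m + n)\<^esub> ccomp L I m i J n j f' h"
    proof (rule phi_lower_ext[OF ccomp_ext])
      fix T assume T: "T \<in> splits ?N"
      then obtain X Y where XY: "X \<subseteq> I - {i}" "Y \<subseteq> J - {j}" "T = X \<union> Y" by (rule cglue_splitsE)
      note d = cglue_dirg[OF g XY(1,2)]
      note T' = T[unfolded XY(3)]
      interpret M: module K "vs ?N T (m + n)" using T fin(3) by (intro vs_module)
      \<comment> \<open>The summand \<open>f'\<close> is given the scalar one, so that the sum has
        the form expected by \<open>dcx_comb_left\<close> and \<open>dcx_comb_right\<close>.\<close>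
      have s: "(f \<oplus>\<^bsub>csp L I m\<^esub> f') A = f A \<oplus>\<^bsub>vs I A m\<^esub> \<one> \<odot>\<^bsub>vs I A m\<^esub> f' A" if "A \<in> splits I" for A
        using that f' module.smult_one[OF vs_module[OF fin(1) that, of m]] by (simp add: phi_lower_simps phi_lower_carrier)
      have e: "dcx P I (insert i X) m i J Y n j ((f \<oplus>\<^bsub>csp L I m\<^esub> f') (insert i X)) (h Y) =
          dcx P I (insert i X) m i J Y n j (f (insert i X)) (h Y) \<oplus>\<^bsub>vs ?N T (m + n)\<^esub> \<one> \<odot>\<^bsub>vs ?N T (m + n)\<^esub>
          dcx P I (insert i X) m i J Y n j (f' (insert i X)) (h Y)"
        unfolding XY(3) by (rule dcx_comb_left[OF d(1,3) HOL.refl T' cf cf' ch one_closed s])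
      have e': "dcx P J (insert j Y) n j I X m i (h (insert j Y)) ((f \<oplus>\<^bsub>csp L I m\<^esub> f') X) =
          dcx P J (insert j Y) n j I X m i (h (insert j Y)) (f X) \<oplus>\<^bsub>vs ?N T (n + m)\<^esub> \<one> \<odot>\<^bsub>vs ?N T (n + m)\<^esub>
          dcx P J (insert j Y) n j I X m i (h (insert j Y)) (f' X)"
        unfolding XY(3) by (rule dcx_comb_right[OF d(2,4,5) T' ch cf cf' one_closed s])
      have c: "dcx P I (insert i X) m i J Y n j (f (insert i X)) (h Y) \<in> carrier (vs ?N T (m + n))"
        "dcx P I (insert i X) m i J Y n j (f' (insert i X)) (h Y) \<in> carrier (vs ?N T (m + n))"
        "dcx P J (insert j Y) n j I X m i (h (insert j Y)) (f X) \<in> carrier (vs ?N T (n + m))"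
        "dcx P J (insert j Y) n j I X m i (h (insert j Y)) (f' X) \<in> carrier (vs ?N T (n + m))"
        unfolding XY(3) by (intro dcx_closed[OF d(1,3) HOL.refl T'] dcx_closed[OF d(2,4,5) T'] cf cf' ch)+
      have nm: "n + m = m + n" by simp
      show "ccomp L I m i J n j (f \<oplus>\<^bsub>csp L I m\<^esub> f') h T =
        (ccomp L I m i J n j f h \<oplus>\<^bsub>csp L ?N (m + n)\<^esub> ccomp L I m i J n j f' h) T"
        using T ccomp_apply[OF g XY(1,2) HOL.refl T'] e[unfolded nm] e'[unfolded nm] c[unfolded nm]
        by (simp add: phi_lower_simps XY(3)[symmetric] field_axioms M.smult_r_distr M.a_ac)
    qed (simp add: phi_lower_simps) }
  { fix c assume c: "c \<in> carrier K"
    show "ccomp L I m i J n j (c \<odot>\<^bsub>csp L I m\<^esub> f) h =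
        c \<odot>\<^bsub>csp L ?N (m + n)\<^esub> ccomp L I m i J n j f h"
    proof (rule phi_lower_ext[OF ccomp_ext])
      fix T assume T: "T \<in> splits ?N"
      then obtain X Y where XY: "X \<subseteq> I - {i}" "Y \<subseteq> J - {j}" "T = X \<union> Y" by (rule cglue_splitsE)
      note d = cglue_dirg[OF g XY(1,2)]
      note T' = T[unfolded XY(3)]
      interpret M: module K "vs ?N T (m + n)" using T fin(3) by (intro vs_module)
      have s: "(c \<odot>\<^bsub>csp L I m\<^esub> f) A = c \<odot>\<^bsub>vs I A m\<^esub> f A" if "A \<in> splits I" for A
        using that by (simp add: phi_lower_simps)
      have e: "dcx P I (insert i X) m i J Y n j ((c \<odot>\<^bsub>csp L I m\<^esub> f) (insert i X)) (h Y) =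
          c \<odot>\<^bsub>vs ?N T (m + n)\<^esub> dcx P I (insert i X) m i J Y n j (f (insert i X)) (h Y)"
        unfolding XY(3) by (rule dcx_scale_left[OF d(1,3) HOL.refl T' cf ch c s])
      have e': "dcx P J (insert j Y) n j I X m i (h (insert j Y)) ((c \<odot>\<^bsub>csp L I m\<^esub> f) X) =
          c \<odot>\<^bsub>vs ?N T (n + m)\<^esub> dcx P J (insert j Y) n j I X m i (h (insert j Y)) (f X)"
        unfolding XY(3) by (rule dcx_scale_right[OF d(2,4,5) T' ch cf c s])
      have cl: "dcx P I (insert i X) m i J Y n j (f (insert i X)) (h Y) \<in> carrier (vs ?N T (m + n))"
        "dcx P J (insert j Y) n j I X m i (h (insert j Y)) (f X) \<in> carrier (vs ?N T (n + m))"
        unfolding XY(3) by (intro dcx_closed[OF d(1,3) HOL.refl T'] dcx_closed[OF d(2,4,5) T'] cf ch)+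
      have nm: "n + m = m + n" by simp
      show "ccomp L I m i J n j (c \<odot>\<^bsub>csp L I m\<^esub> f) h T =
        (c \<odot>\<^bsub>csp L ?N (m + n)\<^esub> ccomp L I m i J n j f h) T"
        using T ccomp_apply[OF g XY(1,2) HOL.refl T'] e[unfolded nm] e'[unfolded nm] cl[unfolded nm] c
        by (simp add: phi_lower_simps XY(3)[symmetric] field_axioms M.smult_r_distr M.smult_assoc1[symmetric] m_comm)
    qed (simp add: phi_lower_simps) }
qed

text \<open>Exchanging the factors exchanges the two directions of the edge, hence the two summands
  of each component. The sign moves from one to the other because its square is one.\<close>

lemma ccomp_commute:
  assumes g: "cglue I i J j" and f: "f \<in> carrier (csp L I m)" and h: "h \<in> carrier (csp L J n)"
  shows "ccomp L I m i J n j f h =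
    ksign K (m * n) \<odot>\<^bsub>csp L ((I - {i}) \<union> (J - {j})) (m + n)\<^esub> ccomp L J n j I m i h f"
proof (rule phi_lower_ext[OF ccomp_ext])
  let ?N = "(I - {i}) \<union> (J - {j})"
  fix T assume T: "T \<in> splits ?N"
  then obtain X Y where XY: "X \<subseteq> I - {i}" "Y \<subseteq> J - {j}" "T = X \<union> Y" by (rule cglue_splitsE)
  note d = cglue_dirg[OF g XY(1,2)]
  note T' = T[unfolded XY(3)]
  interpret M: module K "vs ?N T (m + n)" using T g by (intro vs_module) (auto simp: cglue_def)
  note cf = phi_lower_cv[OF f] and ch = phi_lower_cv[OF h]
  have nm: "n + m = m + n" by simp
  have YX: "Y \<union> X = X \<union> Y" by auto
  have cl: "dcx P I (insert i X) m i J Y n j (f (insert i X)) (h Y) \<in> carrier (vs ?N T (m + n))"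
    "dcx P J (insert j Y) n j I X m i (h (insert j Y)) (f X) \<in> carrier (vs ?N T (n + m))"
    unfolding XY(3) by (intro dcx_closed[OF d(1,3) HOL.refl T'] dcx_closed[OF d(2,4,5) T'] cf ch)+
  have k: "ksign K (m * n) \<otimes> ksign K (n * m) = \<one>"
    using ksign_mult[OF field_axioms, of "m * n" "n * m"] by (simp add: ksign_def)
  show "ccomp L I m i J n j f h T =
      (ksign K (m * n) \<odot>\<^bsub>csp L ?N (m + n)\<^esub> ccomp L J n j I m i h f) T"
    using ccomp_apply[OF g XY(1,2) HOL.refl T', of m n f h]
      ccomp_apply[OF cglue_sym[OF g] XY(2,1) d(5), unfolded YX, OF T', of n m h f] cl[unfolded nm] T
    by (simp add: phi_lower_simps XY(3)[symmetric] nm field_axioms M.smult_r_distr M.smult_assoc1[symmetric] k M.a_comm)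
qed (simp add: phi_lower_simps)

end

lemma lin_map_smult:
  assumes "lin_map K M N f" "module K N" "c \<in> carrier K"
  shows "lin_map K M N (\<lambda>x. c \<odot>\<^bsub>N\<^esub> f x)"
proof -
  interpret N: module K N by fact
  show ?thesis using assms(1,3)
    by (auto simp: lin_map_def Pi_iff N.smult_r_distr N.smult_assoc1[symmetric] N.R.m_comm)
qed

lemma lin_map_cong:
  assumes "lin_map K M N f" "module K M" "\<And>x. x \<in> carrier M \<Longrightarrow> g x = f x"
  shows "lin_map K M N g"
proof -
  interpret M: module K M by fact
  show ?thesis using assms(1,3) by (auto simp: lin_map_def Pi_iff)
qed

context dioperad
begin

text \<open>Commutativity up to a sign carries linearity from the first factor to the
  second.\<close>

lemma ccomp_right_linear:
  assumes g: "cglue I i J j" and f: "f \<in> carrier (csp L I m)"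
  shows "lin_map K (csp L J n) (csp L ((I - {i}) \<union> (J - {j})) (m + n)) (ccomp L I m i J n j f)"
proof -
  let ?N = "(I - {i}) \<union> (J - {j})"
  have N: "(J - {j}) \<union> (I - {i}) = ?N" "n + m = m + n" by auto
  have "lin_map K (csp L J n) (csp L ?N (m + n)) (\<lambda>h. ccomp L J n j I m i h f)"
    using ccomp_left_linear[OF cglue_sym[OF g] f, of n] by (simp add: N)
  from lin_map_smult[OF this phi_lower_module, of "ksign K (m * n)"]
  have "lin_map K (csp L J n) (csp L ?N (m + n))
      (\<lambda>h. ksign K (m * n) \<odot>\<^bsub>csp L ?N (m + n)\<^esub> ccomp L J n j I m i h f)"
    using g field_axioms by (simp add: cglue_def)
  from lin_map_cong[OF this phi_lower_module] show ?thesis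
    using g by (simp add: cglue_def ccomp_commute[OF g f])
qed

text \<open>The Leibniz rule holds for each directed summand. In the second one the factors stand in
  reversed order, so its signs have to be converted.\<close>

lemma ccomp_cdiff:
  assumes g: "cglue I i J j" and f: "f \<in> carrier (csp L I m)" and h: "h \<in> carrier (csp L J n)"
    and N: "N = (I - {i}) \<union> (J - {j})"
  shows "cdiff L N (m + n) (ccomp L I m i J n j f h) =
    ccomp L I (m - 1) i J n j (cdiff L I m f) h \<oplus>\<^bsub>csp L N (m + n - 1)\<^esub>
    ksign K m \<odot>\<^bsub>csp L N (m + n - 1)\<^esub> ccomp L I m i J (n - 1) j f (cdiff L J n h)"
proof (rule phi_lower_ext)
  fix T assume T: "T \<in> splits N"
  then obtain X Y where XY: "X \<subseteq> I - {i}" "Y \<subseteq> J - {j}" "T = X \<union> Y" unfolding N by (rule cglue_splitsE)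
  note d = cglue_dirg[OF g XY(1,2)]
  have N': "N = J - {j} \<union> (I - {i})" using N by auto
  note T' = T[unfolded XY(3)]
  have fin: "finite I" "finite J" "finite N" using g N by (auto simp: cglue_def)
  interpret M: module K "vs N T (m + n - 1)" using T fin(3) by (intro vs_module)
  note cf = phi_lower_cv[OF f] and ch = phi_lower_cv[OF h]
  have lf: "ddiff P A (I - A) m (f A) \<in> cv P I A (m - 1)" for A
    using f lin_map_closed[OF ddiff_linear[OF splits_biflags[OF fin(1)]]] by (auto simp: cv_def phi_lower_carrier)
  have lh: "ddiff P A (J - A) n (h A) \<in> cv P J A (n - 1)" for A
    using h lin_map_closed[OF ddiff_linear[OF splits_biflags[OF fin(2)]]] by (auto simp: cv_def phi_lower_carrier)
  let ?A = "\<lambda>m f h n. dcx P I (insert i X) m i J Y n j f h"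
  let ?B = "\<lambda>n h f m. dcx P J (insert j Y) n j I X m i h f"
  have nm: "n + m = m + n" "m - 1 + n = m + n - 1" "m + (n - 1) = m + n - 1"
    "n + (m - 1) = m + n - 1" "n - 1 + m = m + n - 1" by auto
  have c0: "?A m (f (insert i X)) (h Y) n \<in> carrier (vs N T (m + n))"
      "?B n (h (insert j Y)) (f X) m \<in> carrier (vs N T (n + m))"
    unfolding XY(3) by (intro dcx_closed[OF d(1,3) N T'] dcx_closed[OF d(2,4) N' T'] cf ch)+
  have c: "?A (m - 1) (ddiff P (insert i X) (I - insert i X) m (f (insert i X))) (h Y) n \<in> carrier (vs N T (m - 1 + n))"
    "?A m (f (insert i X)) (ddiff P Y (J - Y) n (h Y)) (n - 1) \<in> carrier (vs N T (m + (n - 1)))"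
    "?B n (h (insert j Y)) (ddiff P X (I - X) m (f X)) (m - 1) \<in> carrier (vs N T (n + (m - 1)))"
    "?B (n - 1) (ddiff P (insert j Y) (J - insert j Y) n (h (insert j Y))) (f X) m \<in> carrier (vs N T (n - 1 + m))"
    unfolding XY(3) by (intro dcx_closed[OF d(1,3) N T'] dcx_closed[OF d(2,4) N' T'] cf ch lf lh)+
  have D: "ddiff P T (N - T) (m + n) (?A m (f (insert i X)) (h Y) n) =
      ?A (m - 1) (ddiff P (insert i X) (I - insert i X) m (f (insert i X))) (h Y) n \<oplus>\<^bsub>vs N T (m + n - 1)\<^esub>
      ksign K m \<odot>\<^bsub>vs N T (m + n - 1)\<^esub> ?A m (f (insert i X)) (ddiff P Y (J - Y) n (h Y)) (n - 1)"
    "ddiff P T (N - T) (n + m) (?B n (h (insert j Y)) (f X) m) =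
      ?B (n - 1) (ddiff P (insert j Y) (J - insert j Y) n (h (insert j Y))) (f X) m \<oplus>\<^bsub>vs N T (n + m - 1)\<^esub>
      ksign K n \<odot>\<^bsub>vs N T (n + m - 1)\<^esub> ?B n (h (insert j Y)) (ddiff P X (I - X) m (f X)) (m - 1)"
    unfolding XY(3) by (intro dcx_ddiff[OF d(1,3) N T'] dcx_ddiff[OF d(2,4) N' T'] cf ch)+
  note lin = ddiff_linear[OF splits_biflags[OF fin(3) T], of "m + n"]
  interpret M0: module K "vs N T (m + n)" using T fin(3) by (intro vs_module)
  have df: "dcx P I (insert i X) (m - 1) i J Y n j (cdiff L I m f (insert i X)) (h Y) =
      ?A (m - 1) (ddiff P (insert i X) (I - insert i X) m (f (insert i X))) (h Y) n"
    "dcx P J (insert j Y) n j I X (m - 1) i (h (insert j Y)) (cdiff L I m f X) =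
      ?B n (h (insert j Y)) (ddiff P X (I - X) m (f X)) (m - 1)"
    "dcx P I (insert i X) m i J Y (n - 1) j (f (insert i X)) (cdiff L J n h Y) =
      ?A m (f (insert i X)) (ddiff P Y (J - Y) n (h Y)) (n - 1)"
    "dcx P J (insert j Y) (n - 1) j I X m i (cdiff L J n h (insert j Y)) (f X) =
      ?B (n - 1) (ddiff P (insert j Y) (J - insert j Y) n (h (insert j Y))) (f X) m"
    by (simp_all add: dcx_def phi_lower_simps)
  \<comment> \<open>Parities: \<open>m * n + n\<close> agrees with \<open>(m - 1) * n\<close>, and
    \<open>m + m * (n - 1)\<close> equals \<open>m * n\<close>. These match the signs of the
    reversed summand.\<close>
  have k: "ksign K (m * n) \<otimes> ksign K n = ksign K ((m - 1) * n)"
    "ksign K m \<otimes> ksign K (m * (n - 1)) = ksign K (m * n)"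
    unfolding ksign_mult[OF field_axioms] by (rule ksign_cong, simp add: algebra_simps)+
  note a = ccomp_apply[OF g XY(1,2) N T']
  have "cdiff L N (m + n) (ccomp L I m i J n j f h) T =
      ddiff P T (N - T) (m + n) (?A m (f (insert i X)) (h Y) n \<oplus>\<^bsub>vs N T (m + n)\<^esub>
        ksign K (m * n) \<odot>\<^bsub>vs N T (m + n)\<^esub> ?B n (h (insert j Y)) (f X) m)"
    using T a by (simp add: phi_lower_simps XY(3)[symmetric])
  also have "\<dots> = ddiff P T (N - T) (m + n) (?A m (f (insert i X)) (h Y) n) \<oplus>\<^bsub>vs N T (m + n - 1)\<^esub>
        ksign K (m * n) \<odot>\<^bsub>vs N T (m + n - 1)\<^esub> ddiff P T (N - T) (m + n) (?B n (h (insert j Y)) (f X) m)"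
    using c0[unfolded nm] field_axioms by (simp add: lin_map_add[OF lin] lin_map_scale[OF lin])
  also have "\<dots> = (ccomp L I (m - 1) i J n j (cdiff L I m f) h \<oplus>\<^bsub>csp L N (m + n - 1)\<^esub>
    ksign K m \<odot>\<^bsub>csp L N (m + n - 1)\<^esub> ccomp L I m i J (n - 1) j f (cdiff L J n h)) T"
    unfolding D[unfolded nm] phi_lower_simps(2,3) restrict_apply'[OF T] a[folded XY(3)] df nm
    using c[unfolded nm] field_axioms
    by (simp add: M.smult_r_distr M.smult_assoc1[symmetric] k M.a_ac)
  finally show "cdiff L N (m + n) (ccomp L I m i J n j f h) T =
      (ccomp L I (m - 1) i J n j (cdiff L I m f) h \<oplus>\<^bsub>csp L N (m + n - 1)\<^esub>
    ksign K m \<odot>\<^bsub>csp L N (m + n - 1)\<^esub> ccomp L I m i J (n - 1) j f (cdiff L J n h)) T" .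
qed (simp_all add: phi_lower_simps)

lemma ccomp_cact:
  assumes g: "cglue I i J j" and s: "inj_on \<sigma> (I \<union> J)"
    and f: "f \<in> carrier (csp L I m)" and h: "h \<in> carrier (csp L J n)"
    and N: "N = (I - {i}) \<union> (J - {j})"
  shows "cact L N (m + n) \<sigma> (ccomp L I m i J n j f h) =
    ccomp L (\<sigma> ` I) m (\<sigma> i) (\<sigma> ` J) n (\<sigma> j) (cact L I m \<sigma> f) (cact L J n \<sigma> h)"
proof (rule phi_lower_ext[OF cact_ext])
  note g' = cglue_image[OF g s]
  have N2: "\<sigma> ` N = (\<sigma> ` I - {\<sigma> i}) \<union> (\<sigma> ` J - {\<sigma> j})" using cglue_image_set[OF g s] N by simp
  show "ccomp L (\<sigma> ` I) m (\<sigma> i) (\<sigma> ` J) n (\<sigma> j) (cact L I m \<sigma> f) (cact L J n \<sigma> h)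
      \<in> extensional (splits (\<sigma> ` N))"
    unfolding N2 by (rule ccomp_ext)
  have inj: "inj_on \<sigma> I" "inj_on \<sigma> J" "inj_on \<sigma> N" using s N by (auto elim!: inj_on_subset)
  have fin: "finite I" "finite J" "finite N" using g N by (auto simp: cglue_def)
  fix T' assume "T' \<in> splits (\<sigma> ` N)"
  then obtain T where T: "T \<in> splits N" "T' = \<sigma> ` T" using inj(3) by (rule splits_imageE)
  then obtain X Y where XY: "X \<subseteq> I - {i}" "Y \<subseteq> J - {j}" "T = X \<union> Y" unfolding N by (metis cglue_splitsE)
  note d = cglue_dirg[OF g XY(1,2)]
  have N': "N = J - {j} \<union> (I - {i})" using N by auto
  note Tu = T(1)[unfolded XY(3)]
  interpret M: module K "vs N T (m + n)" using T fin(3) by (intro vs_module)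
  note cf = phi_lower_cv[OF f] and ch = phi_lower_cv[OF h]
  have nm: "n + m = m + n" by simp
  have c0: "dcx P I (insert i X) m i J Y n j (f (insert i X)) (h Y) \<in> carrier (vs N T (m + n))"
      "dcx P J (insert j Y) n j I X m i (h (insert j Y)) (f X) \<in> carrier (vs N T (n + m))"
    unfolding XY(3) by (intro dcx_closed[OF d(1,3) N Tu] dcx_closed[OF d(2,4) N' Tu] cf ch)+
  have sX: "\<sigma> ` X \<subseteq> \<sigma> ` I - {\<sigma> i}" "\<sigma> ` Y \<subseteq> \<sigma> ` J - {\<sigma> j}" "\<sigma> ` T = \<sigma> ` X \<union> \<sigma> ` Y"
    "insert i X \<subseteq> I" "X \<subseteq> I" "insert j Y \<subseteq> J" "Y \<subseteq> J"
    using XY g inj unfolding inj_on_def cglue_def by blast+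
  have sT: "\<sigma> ` T \<in> splits (\<sigma> ` N)" "\<sigma> ` N - \<sigma> ` T = \<sigma> ` (N - T)"
    using splits_image[OF inj(3) T(1)] by auto
  have sJI: "inj_on \<sigma> (J \<union> I)" using s by (simp add: Un_commute)
  have D: "dact P T (N - T) (m + n) \<sigma> (dcx P I (insert i X) m i J Y n j (f (insert i X)) (h Y)) =
     dcx P (\<sigma> ` I) (\<sigma> ` insert i X) m (\<sigma> i) (\<sigma> ` J) (\<sigma> ` Y) n (\<sigma> j)
      (dact P (insert i X) (I - insert i X) m \<sigma> (f (insert i X))) (dact P Y (J - Y) n \<sigma> (h Y))"
    "dact P T (N - T) (n + m) \<sigma> (dcx P J (insert j Y) n j I X m i (h (insert j Y)) (f X)) =
     dcx P (\<sigma> ` J) (\<sigma> ` insert j Y) n (\<sigma> j) (\<sigma> ` I) (\<sigma> ` X) m (\<sigma> i)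
      (dact P (insert j Y) (J - insert j Y) n \<sigma> (h (insert j Y))) (dact P X (I - X) m \<sigma> (f X))"
    unfolding XY(3) by (intro dcx_dact[OF d(1,3) N Tu] dcx_dact[OF d(2,4) N' Tu] cf ch s sJI)+
  \<comment> \<open>The components of \<open>cact\<close> are known only for admissible directions.
    In the remaining cases both sides are the zero of the same module, whatever the
    decorations.\<close>
  have E: "dcx P (\<sigma> ` I) (\<sigma> ` insert i X) m (\<sigma> i) (\<sigma> ` J) (\<sigma> ` Y) n (\<sigma> j)
      (dact P (insert i X) (I - insert i X) m \<sigma> (f (insert i X))) (dact P Y (J - Y) n \<sigma> (h Y)) =
    dcx P (\<sigma> ` I) (\<sigma> ` insert i X) m (\<sigma> i) (\<sigma> ` J) (\<sigma> ` Y) n (\<sigma> j)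
      (cact L I m \<sigma> f (\<sigma> ` insert i X)) (cact L J n \<sigma> h (\<sigma> ` Y))"
    "dcx P (\<sigma> ` J) (\<sigma> ` insert j Y) n (\<sigma> j) (\<sigma> ` I) (\<sigma> ` X) m (\<sigma> i)
      (dact P (insert j Y) (J - insert j Y) n \<sigma> (h (insert j Y))) (dact P X (I - X) m \<sigma> (f X)) =
    dcx P (\<sigma> ` J) (\<sigma> ` insert j Y) n (\<sigma> j) (\<sigma> ` I) (\<sigma> ` X) m (\<sigma> i)
      (cact L J n \<sigma> h (\<sigma> ` insert j Y)) (cact L I m \<sigma> f (\<sigma> ` X))"
    unfolding dcx_def splits_image_iff[OF inj(1) sX(4)] splits_image_iff[OF inj(1) sX(5)]
      splits_image_iff[OF inj(2) sX(6)] splits_image_iff[OF inj(2) sX(7)]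
    using cact_apply[OF _ inj(1), of _ K P m f] cact_apply[OF _ inj(2), of _ K P n h] by (auto simp del: image_insert)
  have bT: "biflags T (N - T)" "inj_on \<sigma> (T \<union> (N - T))"
    using splits_biflags[OF fin(3) T(1)] inj(3) T(1) by (auto simp: splits_def Un_absorb1)
  note lin = dact_linear[OF bT, of "m + n"]
  have "cact L N (m + n) \<sigma> (ccomp L I m i J n j f h) (\<sigma> ` T) =
    dact P T (N - T) (m + n) \<sigma> (dcx P I (insert i X) m i J Y n j (f (insert i X)) (h Y) \<oplus>\<^bsub>vs N T (m + n)\<^esub>
        ksign K (m * n) \<odot>\<^bsub>vs N T (m + n)\<^esub> dcx P J (insert j Y) n j I X m i (h (insert j Y)) (f X))"
    using cact_apply[OF T(1) inj(3), of K P "m + n"] ccomp_apply[OF g XY(1,2) N Tu] XY(3) by simp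
  also have "\<dots> = dact P T (N - T) (m + n) \<sigma> (dcx P I (insert i X) m i J Y n j (f (insert i X)) (h Y))
     \<oplus>\<^bsub>vs (\<sigma> ` N) (\<sigma> ` T) (m + n)\<^esub> ksign K (m * n) \<odot>\<^bsub>vs (\<sigma> ` N) (\<sigma> ` T) (m + n)\<^esub>
     dact P T (N - T) (m + n) \<sigma> (dcx P J (insert j Y) n j I X m i (h (insert j Y)) (f X))"
    using c0[unfolded nm] field_axioms by (simp add: lin_map_add[OF lin] lin_map_scale[OF lin] sT(2))
  also have "\<dots> = ccomp L (\<sigma> ` I) m (\<sigma> i) (\<sigma> ` J) n (\<sigma> j) (cact L I m \<sigma> f) (cact L J n \<sigma> h) (\<sigma> ` T)"
    unfolding D[unfolded nm] E sX(3)
    by (subst ccomp_apply[OF g' sX(1,2) N2]) (use sT(1) sX(3) in simp_all)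
  finally show "cact L N (m + n) \<sigma> (ccomp L I m i J n j f h) T' =
    ccomp L (\<sigma> ` I) m (\<sigma> i) (\<sigma> ` J) n (\<sigma> j) (cact L I m \<sigma> f) (cact L J n \<sigma> h) T'"
    using T(2) by simp
qed

end

context dioperad
begin

lemma dcx_cv:
  assumes "dirg I A i J C j" "T = (A - {i}) \<union> C" "N = (I - {i}) \<union> (J - {j})"
    "x \<in> cv P I A m" "y \<in> cv P J C n"
  shows "dcx P I A m i J C n j x y \<in> cv P N T (m + n)"
  using dcx_closed[OF assms(1-3) _ assms(4,5)] by (simp add: cv_def)

text \<open>In each component both sides expand into four terms, one for each pair of directions of
  the two edges. The terms are matched by the two chain laws, the law for two entering edges and the
  law for two leaving edges.\<close>

lemma ccomp_assoc:
  assumes g1: "cglue I i J j" and g2: "cglue J k H l" and jk: "j \<noteq> k" and IH: "I \<inter> H = {}"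
    and f: "f \<in> carrier (csp L I m)" and g: "g \<in> carrier (csp L J n)" and h: "h \<in> carrier (csp L H p)"
    and N1: "N1 = (I - {i}) \<union> (J - {j})" and N2: "N2 = (J - {k}) \<union> (H - {l})"
  shows "ccomp L N1 (m + n) k H p l (ccomp L I m i J n j f g) h =
    ccomp L I m i N2 (n + p) j f (ccomp L J n k H p l g h)"
proof (rule phi_lower_ext[OF ccomp_ext])
  let ?N = "(N1 - {k}) \<union> (H - {l})"
  have gN1: "cglue N1 k H l" and gN2: "cglue I i N2 j" and N: "?N = (I - {i}) \<union> (N2 - {j})"
    using cglue_assoc[OF g1 g2 jk IH] N1 N2 by auto
  show "ccomp L I m i N2 (n + p) j f (ccomp L J n k H p l g h) \<in> extensional (splits ?N)"
    unfolding N by (rule ccomp_ext)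
  fix T assume T: "T \<in> splits ?N"
  then obtain X' Z where XZ: "X' \<subseteq> N1 - {k}" "Z \<subseteq> H - {l}" "T = X' \<union> Z" by (rule cglue_splitsE)
  \<comment> \<open>The outputs in \<open>T\<close> are distributed over the three vertices:
    \<open>X\<close> on \<open>I\<close>, \<open>Y\<close> on \<open>J\<close>, \<open>Z\<close> on
    \<open>H\<close>.\<close>
  define X Y where "X = X' \<inter> I" and "Y = X' \<inter> J"
  have X: "X \<subseteq> I - {i}" and Y: "Y \<subseteq> J - {j, k}" and TT: "T = X \<union> Y \<union> Z"
    using XZ g1 g2 IH unfolding X_def Y_def N1 cglue_def by auto
  note Z = XZ(2)
  have T1: "(X \<union> Y) \<union> Z \<in> splits ?N" and T2: "X \<union> (Y \<union> Z) \<in> splits ?N" and T3: "Z \<union> Y \<union> X \<in> splits ((N2 - {j}) \<union> (I - {i}))"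
    using T TT N by (simp_all add: Un_ac)
  have fin: "finite N1" "finite N2" "finite ?N" using gN1 gN2 by (auto simp: cglue_def)
  have deg: "n + m = m + n" "p + n = n + p" "m + (n + p) = m + n + p" "p + (m + n) = m + n + p"
     "n + p + m = m + n + p" by auto
  interpret M: module K "vs ?N T (m + n + p)" using T fin(3) by (intro vs_module)
  note cf = phi_lower_cv[OF f] and cg = phi_lower_cv[OF g] and ch = phi_lower_cv[OF h]
  have sub: "insert k Y \<subseteq> J - {j}" "Y \<subseteq> J - {j}" "insert j Y \<subseteq> J - {k}" "Y \<subseteq> J - {k}"
    "X \<union> Y \<subseteq> N1 - {k}" "Y \<union> Z \<subseteq> N2 - {j}"
    using X Y Z jk g1 g2 IH unfolding N1 N2 cglue_def by auto
  note k1 = cglue_dirg[OF g1 X sub(1)] and k0 = cglue_dirg[OF g1 X sub(2)]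
  note l1 = cglue_dirg[OF g2 sub(3) Z] and l0 = cglue_dirg[OF g2 sub(4) Z]
  note o1 = cglue_dirg[OF gN1 sub(5) Z] and o2 = cglue_dirg[OF gN2 X sub(6)]
  have N1': "N1 = (J - {j}) \<union> (I - {i})" and N2': "N2 = (H - {l}) \<union> (J - {k})"
    using N1 N2 by auto
  have ins: "X \<union> insert k Y = insert k (X \<union> Y)" "insert j Y \<union> Z = insert j (Y \<union> Z)"
    "insert k (insert j Y) = insert j (insert k Y)" by auto
  \<comment> \<open>The letters \<open>u\<close> and \<open>v\<close> are composites of
    \<open>I\<close> and \<open>J\<close> with the edge directed from \<open>i\<close> to
    \<open>j\<close> and from \<open>j\<close> to \<open>i\<close>; \<open>r\<close> and
    \<open>s\<close> are those of \<open>J\<close> and \<open>H\<close>, directed from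
    \<open>k\<close> to \<open>l\<close> and from \<open>l\<close> to \<open>k\<close>. The index is
    1 if the flag of \<open>J\<close> still to be glued is an output, 0 if it is an input.\<close>
  define u1 where "u1 = dcx P I (insert i X) m i J (insert k Y) n j (f (insert i X)) (g (insert k Y))"
  define v1 where "v1 = dcx P J (insert j (insert k Y)) n j I X m i (g (insert j (insert k Y))) (f X)"
  define u0 where "u0 = dcx P I (insert i X) m i J Y n j (f (insert i X)) (g Y)"
  define v0 where "v0 = dcx P J (insert j Y) n j I X m i (g (insert j Y)) (f X)"
  define r1 where "r1 = dcx P J (insert j (insert k Y)) n k H Z p l (g (insert j (insert k Y))) (h Z)"
  define s1 where "s1 = dcx P H (insert l Z) p l J (insert j Y) n k (h (insert l Z)) (g (insert j Y))"
  define r0 where "r0 = dcx P J (insert k Y) n k H Z p l (g (insert k Y)) (h Z)"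
  define s0 where "s0 = dcx P H (insert l Z) p l J Y n k (h (insert l Z)) (g Y)"
  note defs = u1_def v1_def u0_def v0_def r1_def s1_def r0_def s0_def
  have c1: "u1 \<in> cv P N1 (insert k (X \<union> Y)) (m + n)" "u0 \<in> cv P N1 (X \<union> Y) (m + n)"
    unfolding defs
    by (intro dcx_cv[OF k1(1) k1(3)[unfolded ins] N1] dcx_cv[OF k0(1,3) N1] cf cg)+
  have c2: "v1 \<in> cv P N1 (insert k (X \<union> Y)) (n + m)" "v0 \<in> cv P N1 (X \<union> Y) (n + m)"
    unfolding defs
    by (intro dcx_cv[OF k1(2) k1(4)[unfolded ins] N1'] dcx_cv[OF k0(2,4) N1'] cf cg)+
  have c3: "r1 \<in> cv P N2 (insert j (Y \<union> Z)) (n + p)" "r0 \<in> cv P N2 (Y \<union> Z) (n + p)"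
    unfolding defs
    by (intro dcx_cv[OF l1(1)[unfolded ins] l1(3)[unfolded ins] N2] dcx_cv[OF l0(1,3) N2] cg ch)+
  have c4: "s1 \<in> cv P N2 (insert j (Y \<union> Z)) (p + n)" "s0 \<in> cv P N2 (Y \<union> Z) (p + n)"
    unfolding defs
    by (intro dcx_cv[OF l1(2) l1(4)[unfolded ins] N2'] dcx_cv[OF l0(2,4) N2'] cg ch)+
  note c = c1 c2[unfolded deg] c3 c4[unfolded deg]
  let ?W = "ccomp L I m i J n j f g" and ?V = "ccomp L J n k H p l g h"
  have W1: "?W (insert k (X \<union> Y)) = u1 \<oplus>\<^bsub>vs N1 (insert k (X \<union> Y)) (m + n)\<^esub>
      ksign K (m * n) \<odot>\<^bsub>vs N1 (insert k (X \<union> Y)) (m + n)\<^esub> v1" if "insert k (X \<union> Y) \<in> splits N1"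
    using ccomp_apply[OF g1 X sub(1) N1] that by (simp add: defs)
  have W0: "?W (X \<union> Y) = u0 \<oplus>\<^bsub>vs N1 (X \<union> Y) (m + n)\<^esub>
      ksign K (m * n) \<odot>\<^bsub>vs N1 (X \<union> Y) (m + n)\<^esub> v0" if "X \<union> Y \<in> splits N1"
    using ccomp_apply[OF g1 X sub(2) N1] that by (simp add: defs)
  have V1: "?V (insert j (Y \<union> Z)) = r1 \<oplus>\<^bsub>vs N2 (insert j (Y \<union> Z)) (n + p)\<^esub>
      ksign K (n * p) \<odot>\<^bsub>vs N2 (insert j (Y \<union> Z)) (n + p)\<^esub> s1" if "insert j (Y \<union> Z) \<in> splits N2"
    using ccomp_apply[OF g2 sub(3) Z N2] that by (simp add: defs ins)
  have V0: "?V (Y \<union> Z) = r0 \<oplus>\<^bsub>vs N2 (Y \<union> Z) (n + p)\<^esub>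
      ksign K (n * p) \<odot>\<^bsub>vs N2 (Y \<union> Z) (n + p)\<^esub> s0" if "Y \<union> Z \<in> splits N2"
    using ccomp_apply[OF g2 sub(4) Z N2] that by (simp add: defs)
  \<comment> \<open>The four terms: \<open>t1\<close> is the chain from \<open>I\<close> to
    \<open>H\<close>, in \<open>t2\<close> both edges enter \<open>J\<close>, in \<open>t3\<close>
    both leave \<open>J\<close>, and \<open>t4\<close> is the chain from \<open>H\<close> to
    \<open>I\<close>.\<close>
  define t1 where "t1 = dcx P N1 (insert k (X \<union> Y)) (m + n) k H Z p l u1 (h Z)"
  define t2 where "t2 = dcx P H (insert l Z) p l N1 (X \<union> Y) (m + n) k (h (insert l Z)) u0"
  define t3 where "t3 = dcx P N2 (insert j (Y \<union> Z)) (n + p) j I X m i r1 (f X)"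
  define t4 where "t4 = dcx P H (insert l Z) p l N1 (X \<union> Y) (m + n) k (h (insert l Z)) v0"
  have ks [simp]: "ksign K q \<in> carrier K" for q by (rule ksign_closed[OF field_axioms])
  have tc: "t1 \<in> carrier (vs ?N T (m + n + p))" "t2 \<in> carrier (vs ?N T (p + (m + n)))"
    "t3 \<in> carrier (vs ?N T (n + p + m))" "t4 \<in> carrier (vs ?N T (p + (m + n)))"
    unfolding t1_def t2_def t3_def t4_def TT
    by (intro dcx_closed[OF o1(1,3) HOL.refl T1] dcx_closed[OF o1(2,4,5) T1] c cf ch
        dcx_closed[OF o2(2) o2(4)[unfolded Un_assoc[symmetric]] N[unfolded o2(5)] T1])+
  note tc = tc[unfolded deg]
  note a1 = dcx_assoc_chain[OF g1 g2 jk IH N1 N2 X Y Z T1, of "f (insert i X)" m "g (insert k Y)" n "h Z" p]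
  note a2 = dcx_assoc_in[OF g1 g2 jk IH N1 N2 X Y Z T1, of "f (insert i X)" m "g Y" n "h (insert l Z)" p]
  note a3 = dcx_assoc_out[OF g1 g2 jk IH N1 N2 X Y Z T1, of "f X" m "g (insert j (insert k Y))" n "h Z" p]
  \<comment> \<open>The reversed chain is the chain law with the roles of \<open>I\<close> and
    \<open>H\<close> interchanged.\<close>
  have HI: "H \<inter> I = {}" and Y': "Y \<subseteq> J - {k, j}" using IH Y by auto
  note a4 = dcx_assoc_chain[OF cglue_sym[OF g2] cglue_sym[OF g1] jk[symmetric] HI N2' N1' Z Y' X T3,
      of "h (insert l Z)" p "g (insert j Y)" n "f X" m]
  have e1: "dcx P I (insert i X) m i N2 (Y \<union> Z) (n + p) j (f (insert i X)) r0 = t1"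
    using a1[OF cf cg ch] by (simp add: t1_def defs)
  have e2: "dcx P I (insert i X) m i N2 (Y \<union> Z) (n + p) j (f (insert i X)) s0 =
      ksign K (m * p) \<odot>\<^bsub>vs ?N T (m + n + p)\<^esub> t2"
    using a2[OF cf cg ch] unfolding t2_def defs TT deg .
  have e3: "dcx P N1 (insert k (X \<union> Y)) (m + n) k H Z p l v1 (h Z) =
      ksign K (m * p) \<odot>\<^bsub>vs ?N T (m + n + p)\<^esub> t3"
    using a3[OF cf cg ch] unfolding t3_def defs TT deg .
  have ZY: "Z \<union> Y = Y \<union> Z" "Y \<union> X = X \<union> Y" by auto
  have e4: "dcx P N2 (insert j (Y \<union> Z)) (n + p) j I X m i s1 (f X) = t4"
    using a4[OF ch cg cf] unfolding t4_def defs deg ZY .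
  have "ccomp L N1 (m + n) k H p l ?W h T =
    dcx P N1 (insert k (X \<union> Y)) (m + n) k H Z p l (?W (insert k (X \<union> Y))) (h Z) \<oplus>\<^bsub>vs ?N T (m + n + p)\<^esub>
    ksign K ((m + n) * p) \<odot>\<^bsub>vs ?N T (m + n + p)\<^esub>
      dcx P H (insert l Z) p l N1 (X \<union> Y) (m + n) k (h (insert l Z)) (?W (X \<union> Y))"
    using ccomp_apply[OF gN1 sub(5) Z HOL.refl T1] TT by simp
  also have "dcx P N1 (insert k (X \<union> Y)) (m + n) k H Z p l (?W (insert k (X \<union> Y))) (h Z) =
      t1 \<oplus>\<^bsub>vs ?N T (m + n + p)\<^esub> ksign K (m * n) \<odot>\<^bsub>vs ?N T (m + n + p)\<^esub>
        (ksign K (m * p) \<odot>\<^bsub>vs ?N T (m + n + p)\<^esub> t3)"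
    using dcx_comb_left[OF o1(1,3) HOL.refl T1 c(1,3) ch ks W1] unfolding e3 t1_def TT .
  also have "dcx P H (insert l Z) p l N1 (X \<union> Y) (m + n) k (h (insert l Z)) (?W (X \<union> Y)) =
      t2 \<oplus>\<^bsub>vs ?N T (m + n + p)\<^esub> ksign K (m * n) \<odot>\<^bsub>vs ?N T (m + n + p)\<^esub> t4"
    using dcx_comb_right[OF o1(2,4,5) T1 ch c(2,4) ks W0] unfolding t2_def t4_def TT deg .
  finally have l: "ccomp L N1 (m + n) k H p l ?W h T =
     t1 \<oplus>\<^bsub>vs ?N T (m + n + p)\<^esub> ksign K (m * n) \<odot>\<^bsub>vs ?N T (m + n + p)\<^esub>
        (ksign K (m * p) \<odot>\<^bsub>vs ?N T (m + n + p)\<^esub> t3) \<oplus>\<^bsub>vs ?N T (m + n + p)\<^esub>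
     ksign K ((m + n) * p) \<odot>\<^bsub>vs ?N T (m + n + p)\<^esub>
      (t2 \<oplus>\<^bsub>vs ?N T (m + n + p)\<^esub> ksign K (m * n) \<odot>\<^bsub>vs ?N T (m + n + p)\<^esub> t4)" .
  have "ccomp L I m i N2 (n + p) j f ?V T =
    dcx P I (insert i X) m i N2 (Y \<union> Z) (n + p) j (f (insert i X)) (?V (Y \<union> Z)) \<oplus>\<^bsub>vs ?N T (m + n + p)\<^esub>
    ksign K (m * (n + p)) \<odot>\<^bsub>vs ?N T (m + n + p)\<^esub>
      dcx P N2 (insert j (Y \<union> Z)) (n + p) j I X m i (?V (insert j (Y \<union> Z))) (f X)"
    using ccomp_apply[OF gN2 X sub(6) N T2, of m "n + p"] unfolding TT deg Un_assoc .
  also have "dcx P I (insert i X) m i N2 (Y \<union> Z) (n + p) j (f (insert i X)) (?V (Y \<union> Z)) =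
      t1 \<oplus>\<^bsub>vs ?N T (m + n + p)\<^esub> ksign K (n * p) \<odot>\<^bsub>vs ?N T (m + n + p)\<^esub>
      (ksign K (m * p) \<odot>\<^bsub>vs ?N T (m + n + p)\<^esub> t2)"
    using dcx_comb_right[OF o2(1,3) N T2 cf c(6,8) ks V0] unfolding e1 e2 TT deg Un_assoc .
  also have "dcx P N2 (insert j (Y \<union> Z)) (n + p) j I X m i (?V (insert j (Y \<union> Z))) (f X) =
      t3 \<oplus>\<^bsub>vs ?N T (m + n + p)\<^esub> ksign K (n * p) \<odot>\<^bsub>vs ?N T (m + n + p)\<^esub> t4"
    using dcx_comb_left[OF o2(2,4) N[unfolded o2(5)] T2 c(5,7) cf ks V1] unfolding e4 t3_def TT deg Un_assoc .
  finally have r: "ccomp L I m i N2 (n + p) j f ?V T =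
      t1 \<oplus>\<^bsub>vs ?N T (m + n + p)\<^esub> ksign K (n * p) \<odot>\<^bsub>vs ?N T (m + n + p)\<^esub>
      (ksign K (m * p) \<odot>\<^bsub>vs ?N T (m + n + p)\<^esub> t2) \<oplus>\<^bsub>vs ?N T (m + n + p)\<^esub>
      ksign K (m * (n + p)) \<odot>\<^bsub>vs ?N T (m + n + p)\<^esub>
      (t3 \<oplus>\<^bsub>vs ?N T (m + n + p)\<^esub> ksign K (n * p) \<odot>\<^bsub>vs ?N T (m + n + p)\<^esub> t4)" .
  \<comment> \<open>The signs of \<open>t2\<close>, \<open>t3\<close> and \<open>t4\<close> on the
    two sides; each comparison is an identity between bilinear expressions in the degrees.\<close>
  have kk: "ksign K (n * p) \<otimes> ksign K (m * p) = ksign K ((m + n) * p)"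
    "ksign K (m * n) \<otimes> ksign K (m * p) = ksign K (m * (n + p))"
    "ksign K (m * (n + p)) \<otimes> ksign K (n * p) = ksign K ((m + n) * p) \<otimes> ksign K (m * n)"
    by (simp_all add: ksign_mult[OF field_axioms] algebra_simps)
  show "ccomp L N1 (m + n) k H p l ?W h T = ccomp L I m i N2 (n + p) j f ?V T"
    unfolding l r using tc
    by (simp add: M.smult_r_distr M.smult_assoc1[symmetric] kk M.a_ac)
qed

text \<open>The axioms not involving composition hold in each component separately; those on
  composition are collected from the preceding lemmas.\<close>

theorem phi_lower_cyclic_operad: "cyclic_operad K L"
proof (intro cyclic_operad.intro cyclic_operad_axioms.intro field_axioms)
  { fix I :: "nat set" and n assume I: "finite I"
    show "module K (csp L I n)" using I by (rule phi_lower_module)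
    note lin = ddiff_linear[OF splits_biflags[OF I]]
    show "lin_map K (csp L I n) (csp L I (n - 1)) (cdiff L I n)"
      unfolding lin_map_def Pi_iff
    proof (intro conjI ballI)
      fix x assume x: "x \<in> carrier (csp L I n)"
      then show "cdiff L I n x \<in> carrier (csp L I (n - 1))"
        using lin_map_closed[OF lin] by (auto simp: phi_lower_carrier phi_lower_simps)
      { fix y assume "y \<in> carrier (csp L I n)"
        then show "cdiff L I n (x \<oplus>\<^bsub>csp L I n\<^esub> y) = cdiff L I n x \<oplus>\<^bsub>csp L I (n - 1)\<^esub> cdiff L I n y"
          using x lin_map_add[OF lin] by (intro phi_lower_ext[of _ I]) (auto simp: phi_lower_carrier phi_lower_simps) }
      { fix c assume "c \<in> carrier K"
        then show "cdiff L I n (c \<odot>\<^bsub>csp L I n\<^esub> x) = c \<odot>\<^bsub>csp L I (n - 1)\<^esub> cdiff L I n x"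
          using x lin_map_scale[OF lin] by (intro phi_lower_ext[of _ I]) (auto simp: phi_lower_carrier phi_lower_simps) }
    qed }
  { fix I :: "nat set" and n x assume I: "finite I" and x: "x \<in> carrier (csp L I n)"
    then show "cdiff L I (n - 1) (cdiff L I n x) = \<zero>\<^bsub>csp L I (n - 2)\<^esub>"
      using ddiff_ddiff[OF splits_biflags[OF I]]
      by (intro phi_lower_ext[of _ I]) (auto simp: phi_lower_carrier phi_lower_simps)
    show "cact L I n id x = x"
    proof (rule phi_lower_ext[of _ I])
      show "cact L I n id x \<in> extensional (splits I)" using cact_ext[where \<sigma>=id and I=I] by simp
      fix A assume A: "A \<in> splits I"
      then show "cact L I n id x A = x A"
        using cact_apply[OF A inj_on_id, of K P n x] dact_id[OF splits_biflags[OF I A], of "x A" n] x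
        by (simp add: phi_lower_carrier)
    qed (use x in \<open>simp add: phi_lower_carrier\<close>) }
  { fix I n and \<sigma> :: "nat \<Rightarrow> nat" assume I: "finite I" and s: "inj_on \<sigma> I"
    have lin: "lin_map K (vs I A n) (vs (\<sigma> ` I) (\<sigma> ` A) n) (dact P A (I - A) n \<sigma>)" if "A \<in> splits I" for A
    proof -
      have "A \<union> (I - A) = I" using that by (auto simp: splits_def)
      then show ?thesis
        using dact_linear[OF splits_biflags[OF I that], of \<sigma> n] s splits_image[OF s that] by simp
    qed
    note ap = cact_apply[OF _ s, of _ K P n]
    show "lin_map K (csp L I n) (csp L (\<sigma> ` I) n) (cact L I n \<sigma>)"
      unfolding lin_map_def Pi_iff
    proof (intro conjI ballI)
      fix x assume x: "x \<in> carrier (csp L I n)"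
      show "cact L I n \<sigma> x \<in> carrier (csp L (\<sigma> ` I) n)"
        unfolding phi_lower_carrier
      proof (intro conjI ballI cact_ext)
        fix A' assume "A' \<in> splits (\<sigma> ` I)"
        then obtain A where A: "A \<in> splits I" "A' = \<sigma> ` A" using s by (rule splits_imageE)
        then show "cact L I n \<sigma> x A' \<in> carrier (vs (\<sigma> ` I) A' n)"
          using x ap[OF A(1)] lin_map_closed[OF lin[OF A(1)]] by (simp add: phi_lower_carrier)
      qed
      { fix y assume y: "y \<in> carrier (csp L I n)"
        show "cact L I n \<sigma> (x \<oplus>\<^bsub>csp L I n\<^esub> y) = cact L I n \<sigma> x \<oplus>\<^bsub>csp L (\<sigma> ` I) n\<^esub> cact L I n \<sigma> y"
        proof (rule phi_lower_ext[OF cact_ext])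
          fix A' assume A': "A' \<in> splits (\<sigma> ` I)"
          then obtain A where A: "A \<in> splits I" "A' = \<sigma> ` A" using s by (rule splits_imageE)
          then show "cact L I n \<sigma> (x \<oplus>\<^bsub>csp L I n\<^esub> y) A' = (cact L I n \<sigma> x \<oplus>\<^bsub>csp L (\<sigma> ` I) n\<^esub> cact L I n \<sigma> y) A'"
            using x y A' ap[OF A(1)] lin_map_add[OF lin[OF A(1)]] by (simp add: phi_lower_carrier phi_lower_simps)
        qed (simp add: phi_lower_simps) }
      { fix c assume c: "c \<in> carrier K"
        show "cact L I n \<sigma> (c \<odot>\<^bsub>csp L I n\<^esub> x) = c \<odot>\<^bsub>csp L (\<sigma> ` I) n\<^esub> cact L I n \<sigma> x"
        proof (rule phi_lower_ext[OF cact_ext])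
          fix A' assume A': "A' \<in> splits (\<sigma> ` I)"
          then obtain A where A: "A \<in> splits I" "A' = \<sigma> ` A" using s by (rule splits_imageE)
          then show "cact L I n \<sigma> (c \<odot>\<^bsub>csp L I n\<^esub> x) A' = (c \<odot>\<^bsub>csp L (\<sigma> ` I) n\<^esub> cact L I n \<sigma> x) A'"
            using x c A' ap[OF A(1)] lin_map_scale[OF lin[OF A(1)]] by (simp add: phi_lower_carrier phi_lower_simps)
        qed (simp add: phi_lower_simps) }
    qed
    fix x assume x: "x \<in> carrier (csp L I n)"
    { fix \<tau> :: "nat \<Rightarrow> nat" assume eq: "\<And>i. i \<in> I \<Longrightarrow> \<sigma> i = \<tau> i"
      then have t: "inj_on \<tau> I" "\<tau> ` I = \<sigma> ` I"
        using s inj_on_cong[of I \<sigma> \<tau>] by (auto intro: image_cong)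
      show "cact L I n \<sigma> x = cact L I n \<tau> x"
      proof (rule phi_lower_ext[OF cact_ext])
        show "cact L I n \<tau> x \<in> extensional (splits (\<sigma> ` I))" using cact_ext[where I=I and \<sigma>=\<tau>] t by simp
        fix A' assume "A' \<in> splits (\<sigma> ` I)"
        then obtain A where A: "A \<in> splits I" "A' = \<sigma> ` A" using s by (rule splits_imageE)
        have AI: "A \<union> (I - A) = I" using A(1) by (auto simp: splits_def)
        have "\<sigma> ` A = \<tau> ` A" by (rule image_cong) (use A(1) eq in \<open>auto simp: splits_def\<close>)
        with A(2) have "A' = \<tau> ` A" by simp
        then show "cact L I n \<sigma> x A' = cact L I n \<tau> x A'"
          using ap[OF A(1), of x] cact_apply[OF A(1) t(1), of K P n x] A
            dact_cong[OF splits_biflags[OF I A(1)], unfolded AI, OF s eq, of "x A" n] x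
          by (simp add: phi_lower_carrier)
      qed }
    { fix \<tau> :: "nat \<Rightarrow> nat" assume t: "inj_on \<tau> (\<sigma> ` I)"
      show "cact L (\<sigma> ` I) n \<tau> (cact L I n \<sigma> x) = cact L I n (\<tau> \<circ> \<sigma>) x"
      proof (rule phi_lower_ext[OF cact_ext])
        show "cact L I n (\<tau> \<circ> \<sigma>) x \<in> extensional (splits (\<tau> ` \<sigma> ` I))"
          using cact_ext[where I=I and \<sigma>="\<tau> \<circ> \<sigma>"] by (simp add: image_comp)
        fix A'' assume "A'' \<in> splits (\<tau> ` \<sigma> ` I)"
        then obtain A' where A': "A' \<in> splits (\<sigma> ` I)" "A'' = \<tau> ` A'" using t by (rule splits_imageE)
        then obtain A where A: "A \<in> splits I" "A' = \<sigma> ` A" by (metis splits_imageE s)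
        have AI: "A \<union> (I - A) = I" using A(1) by (auto simp: splits_def)
        show "cact L (\<sigma> ` I) n \<tau> (cact L I n \<sigma> x) A'' = cact L I n (\<tau> \<circ> \<sigma>) x A''"
          using ap[OF A(1), of x] cact_apply[OF A'(1) t, of K P n] A A'
            cact_apply[OF A(1) comp_inj_on[OF s t], of K P n x] splits_image[OF s A(1)]
            dact_comp[OF splits_biflags[OF I A(1)], of \<sigma> \<tau> "x A" n] s t x AI
          by (simp add: phi_lower_carrier image_comp)
      qed }
    show "cdiff L (\<sigma> ` I) n (cact L I n \<sigma> x) = cact L I (n - 1) \<sigma> (cdiff L I n x)"
    proof (rule phi_lower_ext[OF _ cact_ext])
      fix A' assume A': "A' \<in> splits (\<sigma> ` I)"
      then obtain A where A: "A \<in> splits I" "A' = \<sigma> ` A" using s by (rule splits_imageE)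
      have AI: "A \<union> (I - A) = I" using A(1) by (auto simp: splits_def)
      show "cdiff L (\<sigma> ` I) n (cact L I n \<sigma> x) A' = cact L I (n - 1) \<sigma> (cdiff L I n x) A'"
        using ap[OF A(1), of x] cact_apply[OF A(1) s, of K P "n - 1"] A A' x AI s
          dact_ddiff[OF splits_biflags[OF I A(1)], of \<sigma> "x A" n] splits_image[OF s A(1)]
        by (simp add: phi_lower_carrier phi_lower_simps)
    qed (simp add: phi_lower_simps) }
  { fix I m i J n j assume g: "cglue I i J j"
    show "bilin_map K (csp L I m) (csp L J n) (csp L (I - {i} \<union> (J - {j})) (m + n)) (ccomp L I m i J n j)"
      unfolding bilin_map_def using ccomp_left_linear[OF g] ccomp_right_linear[OF g] by blast
    fix x y assume xy: "x \<in> carrier (csp L I m)" "y \<in> carrier (csp L J n)"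
    show "cdiff L (I - {i} \<union> (J - {j})) (m + n) (ccomp L I m i J n j x y) =
       ccomp L I (m - 1) i J n j (cdiff L I m x) y \<oplus>\<^bsub>csp L (I - {i} \<union> (J - {j})) (m + n - 1)\<^esub>
       ksign K m \<odot>\<^bsub>csp L (I - {i} \<union> (J - {j})) (m + n - 1)\<^esub> ccomp L I m i J (n - 1) j x (cdiff L J n y)"
      by (rule ccomp_cdiff[OF g xy HOL.refl])
    show "ccomp L I m i J n j x y = ksign K (m * n) \<odot>\<^bsub>csp L (I - {i} \<union> (J - {j})) (m + n)\<^esub> ccomp L J n j I m i y x"
      by (rule ccomp_commute[OF g xy])
    { fix \<sigma> :: "nat \<Rightarrow> nat" assume "inj_on \<sigma> (I \<union> J)"
      then show "cact L (I - {i} \<union> (J - {j})) (m + n) \<sigma> (ccomp L I m i J n j x y) =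
         ccomp L (\<sigma> ` I) m (\<sigma> i) (\<sigma> ` J) n (\<sigma> j) (cact L I m \<sigma> x) (cact L J n \<sigma> y)"
        by (rule ccomp_cact[OF g _ xy HOL.refl]) }
    { fix k H p l z assume "cglue J k H l" "j \<noteq> k" "I \<inter> H = {}" "z \<in> carrier (csp L H p)"
      then show "ccomp L (I - {i} \<union> (J - {j})) (m + n) k H p l (ccomp L I m i J n j x y) z =
         ccomp L I m i (J - {k} \<union> (H - {l})) (n + p) j x (ccomp L J n k H p l y z)"
        by (intro ccomp_assoc[OF g _ _ _ xy _ HOL.refl HOL.refl]) } }
qed

end

section \<open>The left adjoint\<close>

lemma splits_Un: "A \<in> splits I \<Longrightarrow> A \<union> (I - A) = I"
  by (auto simp: splits_def)

lemma phi_upper_dwt: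
  assumes "finite I" "A \<in> splits I" "x \<in> carrier (csp Q I n)"
  shows "dwt K (phi_upper_pres K Q) A (I - A) n (DGen (A, I - A, n, x))"
  using assms splits_Un[OF assms(2)] splits_biflags[OF assms(1,2)]
  by (intro dwt.wt_gen) (auto simp: phi_upper_pres_def)

lemma phi_unit_apply:
  assumes "finite I" "A \<in> splits I" "x \<in> carrier (csp Q I n)"
  shows "phi_unit K Q I n x A = dcls K (phi_upper_pres K Q) (DGen (A, I - A, n, x))"
  using dcls_conv[OF phi_upper_dwt[OF assms]] assms(2) by (simp add: phi_unit_def)

lemma phi_unit_ext: "phi_unit K Q I n x \<in> extensional (splits I)"
  by (simp add: phi_unit_def)

lemma deq_phi_upper:
  assumes "field K" "(s, t) \<in> phi_upper_rels K Q" "dwt K (phi_upper_pres K Q) A B n s"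
    "dwt K (phi_upper_pres K Q) A B n t"
  shows "dcls K (phi_upper_pres K Q) s = dcls K (phi_upper_pres K Q) t"
  using assms by (intro dcls_eqI[OF _ deq.rel]) (auto simp: phi_upper_pres_def)

theorem dioperad_phi_upper: "field K \<Longrightarrow> dioperad K (phi_upper K Q)"
  unfolding phi_upper_def by (rule dioperad_presented)

section \<open>The unit of the adjunction\<close>

context cyclic_operad
begin

abbreviation "U \<equiv> phi_upper K Q"
abbreviation "US \<equiv> phi_upper_pres K Q"

lemma U_def: "U = dio_presented K US"
  by (simp add: phi_upper_def)

lemma phi_unit_closed:
  "finite I \<Longrightarrow> x \<in> carrier (csp Q I n) \<Longrightarrow> phi_unit K Q I n x \<in> carrier (csp (phi_lower K U) I n)"
  unfolding phi_lower_carrier U_def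
  by (auto simp: phi_unit_ext phi_unit_apply intro: dcls_closed[OF phi_upper_dwt])

text \<open>Each family in \<open>phi_upper_rels\<close> is one clause of \<open>cyc_hom\<close> for
  the unit, read component by component.\<close>

theorem phi_unit_hom: "cyc_hom K Q (phi_lower K U) (phi_unit K Q)"
  unfolding cyc_hom_def
proof (intro conjI allI impI ballI)
  note F = field_axioms
  fix I :: "nat set" and n assume I: "finite I"
  interpret M: module K "csp Q I n" using I by (rule csp_module)
  note w = phi_upper_dwt[OF I] and a = phi_unit_apply[OF I] and e = deq_phi_upper[OF F]
  show "lin_map K (csp Q I n) (csp (phi_lower K U) I n) (phi_unit K Q I n)"
    unfolding lin_map_def Pi_iff
  proof (intro conjI ballI)
    fix x assume x: "x \<in> carrier (csp Q I n)"
    then show "phi_unit K Q I n x \<in> carrier (csp (phi_lower K U) I n)" by (rule phi_unit_closed[OF I])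
    { fix y assume y: "y \<in> carrier (csp Q I n)"
      show "phi_unit K Q I n (x \<oplus>\<^bsub>csp Q I n\<^esub> y) =
        phi_unit K Q I n x \<oplus>\<^bsub>csp (phi_lower K U) I n\<^esub> phi_unit K Q I n y"
      proof (rule phi_lower_ext[OF phi_unit_ext])
        fix A assume A: "A \<in> splits I"
        have "(DGen (A, I - A, n, x \<oplus>\<^bsub>csp Q I n\<^esub> y), DAdd (DGen (A, I - A, n, x)) (DGen (A, I - A, n, y)))
            \<in> phi_upper_rels K Q"
          using phi_upper_rels.rel_add[OF splits_biflags[OF I A], of x Q n y K] x y splits_Un[OF A] by simp
        from e[OF this w[OF A] dwt.wt_add[OF w[OF A x] w[OF A y]]]
        show "phi_unit K Q I n (x \<oplus>\<^bsub>csp Q I n\<^esub> y) A =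
          (phi_unit K Q I n x \<oplus>\<^bsub>csp (phi_lower K U) I n\<^esub> phi_unit K Q I n y) A"
          using A x y by (simp add: phi_lower_simps a U_def dcls_add[OF F w[OF A x] w[OF A y]])
      qed (simp add: phi_lower_simps) }
    { fix c assume c: "c \<in> carrier K"
      show "phi_unit K Q I n (c \<odot>\<^bsub>csp Q I n\<^esub> x) = c \<odot>\<^bsub>csp (phi_lower K U) I n\<^esub> phi_unit K Q I n x"
      proof (rule phi_lower_ext[OF phi_unit_ext])
        fix A assume A: "A \<in> splits I"
        have "(DGen (A, I - A, n, c \<odot>\<^bsub>csp Q I n\<^esub> x), DScale c (DGen (A, I - A, n, x))) \<in> phi_upper_rels K Q"
          using phi_upper_rels.rel_scale[OF splits_biflags[OF I A] c, of x Q n] x splits_Un[OF A] by simp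
        from e[OF this w[OF A] dwt.wt_scale[OF c w[OF A x]]]
        show "phi_unit K Q I n (c \<odot>\<^bsub>csp Q I n\<^esub> x) A =
          (c \<odot>\<^bsub>csp (phi_lower K U) I n\<^esub> phi_unit K Q I n x) A"
          using A x c by (simp add: phi_lower_simps a U_def dcls_smult[OF F c w[OF A x]])
      qed (simp add: phi_lower_simps) }
  qed
  fix x assume x: "x \<in> carrier (csp Q I n)"
  have dx: "cdiff Q I n x \<in> carrier (csp Q I (n - 1))" using lin_map_closed[OF cdiff_linear[OF I] x] .
  show "phi_unit K Q I (n - 1) (cdiff Q I n x) = cdiff (phi_lower K U) I n (phi_unit K Q I n x)"
  proof (rule phi_lower_ext[OF phi_unit_ext])
    fix A assume A: "A \<in> splits I"
    have "(DGen (A, I - A, n - 1, cdiff Q I n x), DDiff (DGen (A, I - A, n, x))) \<in> phi_upper_rels K Q"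
      using phi_upper_rels.rel_diff[OF splits_biflags[OF I A], of x Q n K] x splits_Un[OF A] by simp
    from e[OF this w[OF A dx] dwt.wt_diff[OF w[OF A x]]]
    show "phi_unit K Q I (n - 1) (cdiff Q I n x) A = cdiff (phi_lower K U) I n (phi_unit K Q I n x) A"
      using A x dx by (simp add: phi_lower_simps a U_def dcls_diff[OF F w[OF A x]])
  qed (simp add: phi_lower_simps)
next
  note F = field_axioms
  fix I n and \<sigma> :: "nat \<Rightarrow> nat" and x
  assume I: "finite I" and s: "inj_on \<sigma> I" and x: "x \<in> carrier (csp Q I n)"
  have sI: "finite (\<sigma> ` I)" using I by simp
  have sx: "cact Q I n \<sigma> x \<in> carrier (csp Q (\<sigma> ` I) n)" using lin_map_closed[OF cact_linear[OF I s] x] .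
  show "phi_unit K Q (\<sigma> ` I) n (cact Q I n \<sigma> x) = cact (phi_lower K U) I n \<sigma> (phi_unit K Q I n x)"
  proof (rule phi_lower_ext[OF phi_unit_ext cact_ext])
    fix A' assume "A' \<in> splits (\<sigma> ` I)"
    then obtain A where A: "A \<in> splits I" "A' = \<sigma> ` A" using s by (rule splits_imageE)
    note sA = splits_image[OF s A(1)]
    have s': "inj_on \<sigma> (A \<union> (I - A))" using s splits_Un[OF A(1)] by simp
    have "(DGen (\<sigma> ` A, \<sigma> ` (I - A), n, cact Q I n \<sigma> x), DAct \<sigma> (DGen (A, I - A, n, x))) \<in> phi_upper_rels K Q"
      using phi_upper_rels.rel_act[OF splits_biflags[OF I A(1)] s', of x Q n K] x splits_Un[OF A(1)] by simp
    from deq_phi_upper[OF F this] phi_upper_dwt[OF sI conjunct1[OF sA] sx, of K]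
      dwt.wt_act[OF phi_upper_dwt[OF I A(1) x] s', of K]
    show "phi_unit K Q (\<sigma> ` I) n (cact Q I n \<sigma> x) A' = cact (phi_lower K U) I n \<sigma> (phi_unit K Q I n x) A'"
      unfolding A(2) cact_apply[OF A(1) s] phi_unit_apply[OF I A(1) x] phi_unit_apply[OF sI conjunct1[OF sA] sx] U_def
        dcls_act[OF F phi_upper_dwt[OF I A(1) x] s']
      by (simp add: sA)
  qed
next
  note F = field_axioms
  fix I m i J n j x y
  assume g: "cglue I i J j" and x: "x \<in> carrier (csp Q I m)" and y: "y \<in> carrier (csp Q J n)"
  let ?N = "I - {i} \<union> (J - {j})"
  have fin: "finite I" "finite J" "finite ?N" using g by (auto simp: cglue_def)
  have xy: "ccomp Q I m i J n j x y \<in> carrier (csp Q ?N (m + n))"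
    by (rule bilin_map_closed[OF ccomp_bilinear[OF g] x y])
  show "phi_unit K Q ?N (m + n) (ccomp Q I m i J n j x y) =
       ccomp (phi_lower K U) I m i J n j (phi_unit K Q I m x) (phi_unit K Q J n y)"
  proof (rule phi_lower_ext[OF phi_unit_ext ccomp_ext])
    fix T assume T: "T \<in> splits ?N"
    define X Y where "X = T \<inter> I" and "Y = T \<inter> J"
    have XY: "X \<subseteq> I - {i}" "Y \<subseteq> J - {j}" "T = X \<union> Y"
      using T g by (auto simp: X_def Y_def splits_def cglue_def)
    note d = cglue_dirg[OF g XY(1,2)]
    let ?s = "DComp i j (DGen (insert i X, I - insert i X, m, x)) (DGen (Y, J - Y, n, y))"
    let ?t = "DComp j i (DGen (insert j Y, J - insert j Y, n, y)) (DGen (X, I - X, m, x))"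
    let ?z = "DZero T (?N - T) (m + n)"
    let ?c = "insert i X \<in> splits I \<and> Y \<in> splits J" and ?d = "X \<in> splits I \<and> insert j Y \<in> splits J"
    have z: "dwt K US T (?N - T) (m + n) ?z" by (intro dwt.wt_zero splits_biflags[OF fin(3) T])
    have s: "dwt K US T (?N - T) (m + n) ?s" if ?c
      using dwt.wt_comp[OF phi_upper_dwt[OF fin(1) _ x] phi_upper_dwt[OF fin(2) _ y] dirg_dglue[OF d(1)]]
        that dirg_sets(1,2)[OF d(1,3) HOL.refl] XY(3) by simp
    have t: "dwt K US T (?N - T) (m + n) ?t" if ?d
      using dwt.wt_comp[OF phi_upper_dwt[OF fin(2) _ y] phi_upper_dwt[OF fin(1) _ x] dirg_dglue[OF d(2)]]
        that dirg_sets(1,2)[OF d(2,4,5)] XY(3) by (simp add: add.commute)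
    have w1: "dwt K US T (?N - T) (m + n) (if ?c then ?s else ?z)" using s z by simp
    have w2: "dwt K US T (?N - T) (m + n) (if ?d then DScale (ksign K (m * n)) ?t else ?z)"
      using t z by (cases ?d) (auto intro!: dwt.wt_scale ksign_closed[OF F])
    have "(DGen (T, ?N - T, m + n, ccomp Q I m i J n j x y), DAdd (if ?c then ?s else ?z)
        (if ?d then DScale (ksign K (m * n)) ?t else ?z)) \<in> phi_upper_rels K Q"
      by (rule phi_upper_rels.rel_comp[OF g x y HOL.refl T X_def Y_def])
    note 1 = deq_phi_upper[OF F this phi_upper_dwt[OF fin(3) T xy] dwt.wt_add[OF w1 w2]]
    have zz: "\<zero>\<^bsub>dsp U T (?N - T) (m + n)\<^esub> = dcls K US ?z"
      unfolding U_def by (intro dcls_zero splits_biflags[OF fin(3) T])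
    have 2: "(if ?c then dcomp U (insert i X) (I - insert i X) m i Y (J - Y) n j
        (phi_unit K Q I m x (insert i X)) (phi_unit K Q J n y Y) else \<zero>\<^bsub>dsp U T (?N - T) (m + n)\<^esub>) =
        dcls K US (if ?c then ?s else ?z)"
      using dcls_comp[OF F phi_upper_dwt[OF fin(1) _ x] phi_upper_dwt[OF fin(2) _ y] dirg_dglue[OF d(1)]]
      by (simp add: zz) (simp add: U_def phi_unit_apply[OF fin(1) _ x] phi_unit_apply[OF fin(2) _ y])
    have 3: "(if ?d then ksign K (m * n) \<odot>\<^bsub>dsp U T (?N - T) (m + n)\<^esub> dcomp U (insert j Y) (J - insert j Y) n j X (I - X) m i
        (phi_unit K Q J n y (insert j Y)) (phi_unit K Q I m x X) else \<zero>\<^bsub>dsp U T (?N - T) (m + n)\<^esub>) =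
        dcls K US (if ?d then DScale (ksign K (m * n)) ?t else ?z)"
    proof (cases ?d)
      case True
      have "dcomp U (insert j Y) (J - insert j Y) n j X (I - X) m i
        (phi_unit K Q J n y (insert j Y)) (phi_unit K Q I m x X) = dcls K US ?t"
        using True dcls_comp[OF F phi_upper_dwt[OF fin(2) _ y] phi_upper_dwt[OF fin(1) _ x] dirg_dglue[OF d(2)]]
        by (simp add: U_def phi_unit_apply[OF fin(1) _ x] phi_unit_apply[OF fin(2) _ y])
      then show ?thesis using True dcls_smult[OF F ksign_closed[OF F] t[OF True]] by (simp add: U_def)
    qed (use zz in auto)
    \<comment> \<open>No passage to \<open>dcx\<close> is made: \<open>rel_comp\<close> and
      \<open>phi_lower_comp\<close> contain the same conditionals, so unfolding matches their
      summands one by one.\<close>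
    show "phi_unit K Q ?N (m + n) (ccomp Q I m i J n j x y) T =
       ccomp (phi_lower K U) I m i J n j (phi_unit K Q I m x) (phi_unit K Q J n y) T"
      unfolding phi_unit_apply[OF fin(3) T xy] 1 phi_lower_def cyc_data.simps phi_lower_comp_def restrict_apply'[OF T]
        Let_def X_def[symmetric] Y_def[symmetric] 2 3
      unfolding U_def by (rule dcls_add[OF F w1 w2, symmetric])
  qed
qed

section \<open>The transpose of a morphism and the universal property\<close>

context
  fixes P :: "('k, 'u) dio_data" and f :: "nat set \<Rightarrow> int \<Rightarrow> 'v \<Rightarrow> nat set \<Rightarrow> 'u"
  assumes P: "dioperad K P" and f: "cyc_hom K Q (phi_lower K P) f"
begin

text \<open>The adjoint transpose on generators: a decorated corolla directed by \<open>A\<close>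
  goes to the component of \<open>f\<close> at \<open>A\<close>.\<close>

definition transpose_val :: "nat set \<times> nat set \<times> int \<times> 'v \<Rightarrow> 'u" where
  "transpose_val = (\<lambda>(A, B, n, x). f (A \<union> B) n x A)"

text \<open>Case by case, a relation of \<open>phi_upper\<close> is a clause of \<open>f\<close>
  being a morphism, evaluated at one component.\<close>

lemma transpose_dsat: "dsat K US P transpose_val"
  unfolding dsat_def
proof (intro conjI ballI allI impI)
  fix g A B n assume *: "g \<in> dgens US" "darity US g = (A, B, n)" "biflags A B"
  then obtain x where g: "g = (A, B, n, x)" "x \<in> carrier (csp Q (A \<union> B) n)"
    by (auto simp: phi_upper_pres_def)
  have "f (A \<union> B) n x \<in> carrier (csp (phi_lower K P) (A \<union> B) n)"
    using cyc_hom_closed[OF f _ g(2)] *(3) by (simp add: biflags_def)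
  then show "transpose_val g \<in> carrier (dsp P A B n)"
    using biflags_splits[OF *(3)] by (auto simp: transpose_val_def g(1) phi_lower_carrier)
next
  fix s t A B n assume st: "(s, t) \<in> drels US" and w: "dwt K US A B n s" "dwt K US A B n t"
  have fin: "finite (A \<union> B)" if "biflags A B" for A B :: "nat set" using that by (simp add: biflags_def)
  have st': "(s, t) \<in> phi_upper_rels K Q" using st by (simp add: phi_upper_pres_def)
  from st' show "deval US P transpose_val s = deval US P transpose_val t"
  proof cases
    case (rel_add A B x n y)
    then show ?thesis using lin_map_add[OF cyc_hom_lin[OF f fin[OF rel_add(3)]]] biflags_splits[OF rel_add(3)]
      by (simp add: transpose_val_def phi_upper_pres_def phi_lower_simps)
  next
    case (rel_scale A B c x n)
    then show ?thesis using lin_map_scale[OF cyc_hom_lin[OF f fin[OF rel_scale(3)]]] biflags_splits[OF rel_scale(3)]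
      by (simp add: transpose_val_def phi_upper_pres_def phi_lower_simps)
  next
    case (rel_diff A B x n)
    then show ?thesis using cyc_hom_diff[OF f fin[OF rel_diff(3)]] biflags_splits[OF rel_diff(3)]
      by (simp add: transpose_val_def phi_upper_pres_def phi_lower_simps)
  next
    case (rel_act A B \<sigma> x n)
    have A: "A \<in> splits (A \<union> B)" "A \<union> B - A = B" using biflags_splits[OF rel_act(3)] by auto
    have "f (\<sigma> ` (A \<union> B)) n (cact Q (A \<union> B) n \<sigma> x) = cact (phi_lower K P) (A \<union> B) n \<sigma> (f (A \<union> B) n x)"
      by (rule cyc_hom_act[OF f fin[OF rel_act(3)] rel_act(4,5)])
    then show ?thesis
      using rel_act cact_apply[OF A(1) rel_act(4), of K P n "f (A \<union> B) n x"] A(2)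
      by (simp add: transpose_val_def phi_upper_pres_def image_Un)
  next
    case (rel_comp I i J j x m y n N T X Y)
    have XY: "X \<subseteq> I - {i}" "Y \<subseteq> J - {j}" "T = X \<union> Y"
      using rel_comp(3,6-9) by (auto simp: splits_def cglue_def)
    note d = cglue_dirg[OF rel_comp(3) XY(1,2)]
    let ?c = "insert i X \<in> splits I \<and> Y \<in> splits J" and ?d = "X \<in> splits I \<and> insert j Y \<in> splits J"
    have NT: "T \<union> (N - T) = N" using rel_comp(7) by (auto simp: splits_def)
    have u: "insert i X \<union> (I - insert i X) = I" "Y \<union> (J - Y) = J" "insert j Y \<union> (J - insert j Y) = J" "X \<union> (I - X) = I"
      using XY rel_comp(3) by (auto simp: cglue_def)
    have v: "transpose_val (insert i X, I - insert i X, m, x) = f I m x (insert i X)"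
      "transpose_val (X, I - X, m, x) = f I m x X"
      "transpose_val (insert j Y, J - insert j Y, n, y) = f J n y (insert j Y)"
      "transpose_val (Y, J - Y, n, y) = f J n y Y"
      unfolding transpose_val_def prod.case u by simp_all
    have ar: "darity US (A, B, n, z) = (A, B, n)" for A B n z by (simp add: phi_upper_pres_def)
    let ?s = "DComp i j (DGen (insert i X, I - insert i X, m, x)) (DGen (Y, J - Y, n, y))"
    let ?t = "DComp j i (DGen (insert j Y, J - insert j Y, n, y)) (DGen (X, I - X, m, x))"
    let ?z = "DZero T (N - T) (m + n)"
    have s1: "dout US ?s = T" "din US ?s = N - T" "ddeg US ?s = m + n"
      using dirg_sets(1,2)[OF d(1,3) rel_comp(6)] XY(3) by (simp_all add: ar)
    have s2: "dout US ?t = T" "din US ?t = N - T" "ddeg US ?t = m + n"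
      using dirg_sets(1,2)[OF d(2,4) rel_comp(6)[unfolded d(5)]] XY(3) by (simp_all add: ar)
    \<comment> \<open>A sum is evaluated in the module read off its first summand. This summand may
      be the formal zero, so both branches must be shown to have the same type.\<close>
    have ty: "dout US (if ?c then ?s else ?z) = T" "din US (if ?c then ?s else ?z) = N - T"
      "ddeg US (if ?c then ?s else ?z) = m + n"
      using s1 by (simp_all split: if_split)
    have v1: "deval US P transpose_val (if ?c then ?s else ?z) =
       (if ?c then dcomp P (insert i X) (I - insert i X) m i Y (J - Y) n j (f I m x (insert i X)) (f J n y Y)
        else \<zero>\<^bsub>dsp P T (N - T) (m + n)\<^esub>)"
      by (simp add: ar v)
    have v2: "deval US P transpose_val (if ?d then DScale (ksign K (m * n)) ?t else ?z) =
       (if ?d then ksign K (m * n) \<odot>\<^bsub>dsp P T (N - T) (m + n)\<^esub>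
         dcomp P (insert j Y) (J - insert j Y) n j X (I - X) m i (f J n y (insert j Y)) (f I m x X)
        else \<zero>\<^bsub>dsp P T (N - T) (m + n)\<^esub>)"
      unfolding if_distrib[of "deval US P transpose_val"] deval.simps(4) s2 by (simp add: ar v)
    have "transpose_val (T, N - T, m + n, ccomp Q I m i J n j x y) = f N (m + n) (ccomp Q I m i J n j x y) T"
      by (simp only: transpose_val_def prod.case NT)
    also have "\<dots> = phi_lower_comp K P I m i J n j (f I m x) (f J n y) T"
      using cyc_hom_comp[OF f rel_comp(3-5)] rel_comp(6) by (simp add: phi_lower_def)
    also have "\<dots> = deval US P transpose_val t"
      unfolding rel_comp(2) deval.simps(3) ty v1 v2 phi_lower_comp_def Let_def rel_comp(6)[symmetric]
        restrict_apply'[OF rel_comp(7)] rel_comp(8,9)[symmetric] ..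
    finally show ?thesis unfolding rel_comp(1) by simp
  qed
qed

theorem phi_upper_universal_exists:
  "\<exists>g. dio_hom K U P g \<and> (\<forall>I n. finite I \<longrightarrow> (\<forall>x\<in>carrier (csp Q I n).
     phi_lower_map g I n (phi_unit K Q I n x) = f I n x))"
proof (intro exI[of _ "dio_lift US P transpose_val"] conjI allI impI ballI)
  show "dio_hom K U P (dio_lift US P transpose_val)"
    unfolding U_def by (rule dio_lift_hom[OF P transpose_dsat])
  fix I :: "nat set" and n x assume I: "finite I" and x: "x \<in> carrier (csp Q I n)"
  show "phi_lower_map (dio_lift US P transpose_val) I n (phi_unit K Q I n x) = f I n x"
  proof (rule phi_lower_ext[of _ I])
    show "f I n x \<in> extensional (splits I)"
      using cyc_hom_closed[OF f I x] by (simp add: phi_lower_carrier)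
    fix A assume A: "A \<in> splits I"
    show "phi_lower_map (dio_lift US P transpose_val) I n (phi_unit K Q I n x) A = f I n x A"
      using dio_lift_dcls[OF P transpose_dsat phi_upper_dwt[OF I A x]] A splits_Un[OF A]
      by (simp add: phi_lower_map_def phi_unit_apply[OF I A x] transpose_val_def)
  qed (simp add: phi_lower_map_def)
qed

end

text \<open>A generator of \<open>U\<close> is a component of the unit at its decoration. Agreement
  after composition with the unit is thus agreement on generators, and \<open>dio_hom_eqI\<close>
  applies.\<close>

theorem phi_upper_universal_unique:
  assumes P: "dioperad K P" and g: "dio_hom K U P g" and h: "dio_hom K U P h"
    and eq: "\<And>I n x. finite I \<Longrightarrow> x \<in> carrier (csp Q I n) \<Longrightarrow>
      phi_lower_map g I n (phi_unit K Q I n x) = phi_lower_map h I n (phi_unit K Q I n x)"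
    and x: "x \<in> carrier (dsp U A B n)"
  shows "g A B n x = h A B n x"
proof (rule dio_hom_eqI[OF P g[unfolded U_def] h[unfolded U_def] _ x[unfolded U_def]])
  fix \<gamma> A B n assume *: "\<gamma> \<in> dgens US" "darity US \<gamma> = (A, B, n)" "biflags A B"
  then obtain z where z: "\<gamma> = (A, B, n, z)" "z \<in> carrier (csp Q (A \<union> B) n)"
    by (auto simp: phi_upper_pres_def)
  have fin: "finite (A \<union> B)" and A: "A \<in> splits (A \<union> B)" "A \<union> B - A = B"
    using *(3) biflags_splits[OF *(3)] by (auto simp: biflags_def)
  show "g A B n (dcls K US (DGen \<gamma>)) = h A B n (dcls K US (DGen \<gamma>))"
    using fun_cong[OF eq[OF fin z(2)], of A] A phi_unit_apply[OF fin A(1) z(2), of K]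
    by (simp add: phi_lower_map_def z(1))
qed

theorem phi_upper_universal:
  assumes "dioperad K P"
  shows "universal_for K Q U (phi_unit K Q) P"
  unfolding universal_for_def Let_def
  using phi_upper_universal_exists[OF assms] phi_upper_universal_unique[OF assms] by auto

end

section \<open>Ternary operations\<close>

lemma lab3_simps [simp]: "lab3 i j k 0 = i" "lab3 i j k (Suc 0) = j" "lab3 i j k 1 = j" "lab3 i j k 2 = k"
  by (simp_all add: lab3_def)

lemma lab3_image: "lab3 i j k ` {0, 1, 2} = {i, j, k}"
  by auto

lemma lab3_comp: "\<sigma> \<circ> lab3 i j k = lab3 (\<sigma> i) (\<sigma> j) (\<sigma> k)"
  by (auto simp: lab3_def)

lemma lab3_inj: "distinct [i, j, k] \<Longrightarrow> inj_on (lab3 i j k) {0, 1, 2}"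
  by (auto simp: inj_on_def)

lemma distinct_inj: "distinct xs \<Longrightarrow> inj_on \<sigma> (set xs) \<Longrightarrow> distinct (map \<sigma> xs)"
  by (simp add: distinct_map)

text \<open>Any list of distinct flags can be renamed to any other of the same length. This moves
  relations between the numerals of a presentation and those occurring in a composite.\<close>

lemma relabelling:
  assumes "distinct xs" "distinct ys" "length xs = length ys"
  obtains \<sigma> where "inj_on \<sigma> (set xs)" "map \<sigma> xs = ys"
proof -
  let ?\<sigma> = "\<lambda>x. the (map_of (zip xs ys) x)"
  have m: "map ?\<sigma> xs = ys"
  proof (rule nth_equalityI)
    fix n assume "n < length (map ?\<sigma> xs)"
    then show "map ?\<sigma> xs ! n = ys ! n"
      using assms map_of_zip_nth[of xs ys n] by simp
  qed (use assms in simp)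
  have "inj_on ?\<sigma> (set xs)" using assms(2) m by (metis distinct_map)
  with m show thesis using that by blast
qed

section \<open>Products, coproducts and their composites with one edge\<close>

context dioperad
begin

abbreviation pr :: "'v \<Rightarrow> nat \<Rightarrow> nat \<Rightarrow> nat \<Rightarrow> 'v" where
  "pr p k i j \<equiv> dact P {0} {1, 2} 0 (lab3 k i j) p"

abbreviation co :: "'v \<Rightarrow> nat \<Rightarrow> nat \<Rightarrow> nat \<Rightarrow> 'v" where
  "co c k i j \<equiv> dact P {1, 2} {0} 0 (lab3 k i j) c"

abbreviation "dprods \<equiv> carrier (dsp P {0} {1, 2} 0)"
abbreviation "dcoprods \<equiv> carrier (dsp P {1, 2} {0} 0)"

lemma biflags_ternary: "distinct [k, i, j] \<Longrightarrow> biflags {k} {i, j} \<and> biflags {i, j} {k}"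
  by (auto simp: biflags_def)

lemma lab3_inj': "distinct [k, i, j] \<Longrightarrow> inj_on (lab3 k i j) ({0} \<union> {1, 2})"
  "distinct [k, i, j] \<Longrightarrow> inj_on (lab3 k i j) ({1, 2} \<union> {0})"
  by (auto simp: inj_on_def)

lemma pr_closed: "p \<in> dprods \<Longrightarrow> distinct [k, i, j] \<Longrightarrow> pr p k i j \<in> carrier (dsp P {k} {i, j} 0)"
  using lin_map_closed[OF dact_linear[OF conjunct1[OF biflags_ternary[of 0 1 2]] lab3_inj'(1)[of k i j]], of p 0]
  by simp

lemma co_closed: "c \<in> dcoprods \<Longrightarrow> distinct [k, i, j] \<Longrightarrow> co c k i j \<in> carrier (dsp P {i, j} {k} 0)"
  using lin_map_closed[OF dact_linear[OF conjunct2[OF biflags_ternary[of 0 1 2]] lab3_inj'(2)[of k i j]], of c 0]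
  by simp

lemma pr_act:
  "p \<in> dprods \<Longrightarrow> distinct [k, i, j] \<Longrightarrow> inj_on \<sigma> {k, i, j} \<Longrightarrow>
   dact P {k} {i, j} 0 \<sigma> (pr p k i j) = pr p (\<sigma> k) (\<sigma> i) (\<sigma> j)"
  using dact_comp[OF conjunct1[OF biflags_ternary[of 0 1 2]] lab3_inj'(1)[of k i j], of \<sigma> p 0]
  by (simp add: lab3_comp)

lemma co_act:
  "c \<in> dcoprods \<Longrightarrow> distinct [k, i, j] \<Longrightarrow> inj_on \<sigma> {k, i, j} \<Longrightarrow>
   dact P {i, j} {k} 0 \<sigma> (co c k i j) = co c (\<sigma> k) (\<sigma> i) (\<sigma> j)"
  using dact_comp[OF conjunct2[OF biflags_ternary[of 0 1 2]] lab3_inj'(2)[of k i j], of \<sigma> c 0]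
  by (simp add: lab3_comp insert_commute)

lemma dact_fix:
  assumes "biflags A B" "x \<in> carrier (dsp P A B n)" "\<And>i. i \<in> A \<union> B \<Longrightarrow> \<sigma> i = i"
  shows "dact P A B n \<sigma> x = x"
proof -
  have "inj_on \<sigma> (A \<union> B)" using assms(3) by (simp add: inj_on_def)
  then have "dact P A B n \<sigma> x = dact P A B n id x"
    using assms by (intro dact_cong) auto
  then show ?thesis using assms dact_id by simp
qed

lemma pr_id: "p \<in> dprods \<Longrightarrow> pr p 0 1 2 = p"
  by (rule dact_fix) (auto simp: biflags_def lab3_def)

lemma co_id: "c \<in> dcoprods \<Longrightarrow> co c 0 1 2 = c"
  by (rule dact_fix) (auto simp: biflags_def lab3_def)

text \<open>All composites run along an edge from \<open>e\<close> to \<open>f\<close>. The letter Q stands for two products,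
  C for two coproducts, PC for a product followed by a coproduct, and M for a coproduct followed
  by a product; the variants differ in the order of the inputs and outputs.\<close>

definition "QA p e f k i j l = dcomp P {e} {i, j} 0 e {k} {f, l} 0 f (pr p e i j) (pr p k f l)"
definition "QB p e f k i j l = dcomp P {e} {i, j} 0 e {k} {f, l} 0 f (pr p e i j) (pr p k l f)"
definition "CA c e f k i j l = dcomp P {e, l} {k} 0 e {i, j} {f} 0 f (co c k e l) (co c f i j)"
definition "CB c e f k i j l = dcomp P {e, l} {k} 0 e {i, j} {f} 0 f (co c k l e) (co c f i j)"
definition "PC p c e f i j k l = dcomp P {e} {i, j} 0 e {k, l} {f} 0 f (pr p e i j) (co c f k l)"
definition "M1 p c e f i k l j = dcomp P {e, k} {i} 0 e {l} {f, j} 0 f (co c i e k) (pr p l f j)"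
definition "M2 p c e f i k l j = dcomp P {e, k} {i} 0 e {l} {f, j} 0 f (co c i e k) (pr p l j f)"
definition "M3 p c e f i k l j = dcomp P {e, k} {i} 0 e {l} {f, j} 0 f (co c i k e) (pr p l f j)"
definition "M4 p c e f i k l j = dcomp P {e, k} {i} 0 e {l} {f, j} 0 f (co c i k e) (pr p l j f)"

text \<open>The resulting flag sets are named \<open>S\<close> and \<open>T\<close>, so that
  explicit sets can be substituted for the differences and unions produced by gluing.\<close>

lemma composite:
  assumes "dglue A B e C D f" "x \<in> carrier (dsp P A B 0)" "y \<in> carrier (dsp P C D 0)"
    "S = A - {e} \<union> C" "T = B \<union> (D - {f})"
  shows "dcomp P A B 0 e C D 0 f x y \<in> carrier (dsp P S T 0)"
    and "inj_on \<sigma> (A \<union> B \<union> C \<union> D) \<Longrightarrow> dact P S T 0 \<sigma> (dcomp P A B 0 e C D 0 f x y) =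
      dcomp P (\<sigma> ` A) (\<sigma> ` B) 0 (\<sigma> e) (\<sigma> ` C) (\<sigma> ` D) 0 (\<sigma> f) (dact P A B 0 \<sigma> x) (dact P C D 0 \<sigma> y)"
  using bilin_map_closed[OF dcomp_bilinear[OF assms(1), of 0 0] assms(2,3)] dcomp_dact[OF assms(1) _ assms(2,3)]
    assms(4,5) by simp_all

context
  fixes p c and e f i j k l :: nat
  assumes p: "p \<in> dprods" and c: "c \<in> dcoprods" and d: "distinct [e, f, i, j, k, l]"
begin

lemma d': "distinct [l, k, j, i, f, e]"
  using d by auto

lemma dglue_ternary:
  "dglue {e} {i, j} e {k} {f, l} f" "dglue {e, l} {k} e {i, j} {f} f"
  "dglue {e} {i, j} e {k, l} {f} f" "dglue {e, k} {i} e {l} {f, j} f"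
  using d by (auto simp: dglue_def biflags_def)

lemma composite_sets:
  "{k} = {e} - {e} \<union> {k}" "{i, j, l} = {i, j} \<union> ({f, l} - {f})"
  "{i, j, l} = {e, l} - {e} \<union> {i, j}" "{k} = {k} \<union> ({f} - {f})"
  "{k, l} = {e} - {e} \<union> {k, l}" "{i, j} = {i, j} \<union> ({f} - {f})"
  "{k, l} = {e, k} - {e} \<union> {l}" "{i, j} = {i} \<union> ({f, j} - {f})"
  using d by auto

lemmas shape1 = composite[OF dglue_ternary(1) _ _ composite_sets(1,2)]
lemmas shape2 = composite[OF dglue_ternary(2) _ _ composite_sets(3,4)]
lemmas shape3 = composite[OF dglue_ternary(3) _ _ composite_sets(5,6)]
lemmas shape4 = composite[OF dglue_ternary(4) _ _ composite_sets(7,8)]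

lemma vertices:
  "pr p e i j \<in> carrier (dsp P {e} {i, j} 0)" "pr p k f l \<in> carrier (dsp P {k} {f, l} 0)"
  "pr p k l f \<in> carrier (dsp P {k} {f, l} 0)" "co c k e l \<in> carrier (dsp P {e, l} {k} 0)"
  "co c k l e \<in> carrier (dsp P {e, l} {k} 0)" "co c f i j \<in> carrier (dsp P {i, j} {f} 0)"
  "co c f k l \<in> carrier (dsp P {k, l} {f} 0)" "co c i e k \<in> carrier (dsp P {e, k} {i} 0)"
  "co c i k e \<in> carrier (dsp P {e, k} {i} 0)" "pr p l f j \<in> carrier (dsp P {l} {f, j} 0)"
  "pr p l j f \<in> carrier (dsp P {l} {f, j} 0)"
  using pr_closed[OF p, of e i j] pr_closed[OF p, of k f l] pr_closed[OF p, of k l f]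
    co_closed[OF c, of k e l] co_closed[OF c, of k l e] co_closed[OF c, of f i j] co_closed[OF c, of f k l]
    co_closed[OF c, of i e k] co_closed[OF c, of i k e] pr_closed[OF p, of l f j] pr_closed[OF p, of l j f] d d'
  by (simp_all add: insert_commute)

lemma composites_closed:
  "QA p e f k i j l \<in> carrier (dsp P {k} {i, j, l} 0)"
  "QB p e f k i j l \<in> carrier (dsp P {k} {i, j, l} 0)"
  "CA c e f k i j l \<in> carrier (dsp P {i, j, l} {k} 0)"
  "CB c e f k i j l \<in> carrier (dsp P {i, j, l} {k} 0)"
  "PC p c e f i j k l \<in> carrier (dsp P {k, l} {i, j} 0)"
  "M1 p c e f i k l j \<in> carrier (dsp P {k, l} {i, j} 0)"
  "M2 p c e f i k l j \<in> carrier (dsp P {k, l} {i, j} 0)"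
  "M3 p c e f i k l j \<in> carrier (dsp P {k, l} {i, j} 0)"
  "M4 p c e f i k l j \<in> carrier (dsp P {k, l} {i, j} 0)"
  unfolding QA_def QB_def CA_def CB_def PC_def M1_def M2_def M3_def M4_def
  by (rule shape1(1) shape2(1) shape3(1) shape4(1); rule vertices)+

lemma vertices_act:
  assumes s: "inj_on \<sigma> (set [e, f, i, j, k, l])"
  shows
  "dact P {e} {i, j} 0 \<sigma> (pr p e i j) = pr p (\<sigma> e) (\<sigma> i) (\<sigma> j)"
  "dact P {k} {f, l} 0 \<sigma> (pr p k f l) = pr p (\<sigma> k) (\<sigma> f) (\<sigma> l)"
  "dact P {k} {f, l} 0 \<sigma> (pr p k l f) = pr p (\<sigma> k) (\<sigma> l) (\<sigma> f)"
  "dact P {e, l} {k} 0 \<sigma> (co c k e l) = co c (\<sigma> k) (\<sigma> e) (\<sigma> l)"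
  "dact P {e, l} {k} 0 \<sigma> (co c k l e) = co c (\<sigma> k) (\<sigma> l) (\<sigma> e)"
  "dact P {i, j} {f} 0 \<sigma> (co c f i j) = co c (\<sigma> f) (\<sigma> i) (\<sigma> j)"
  "dact P {k, l} {f} 0 \<sigma> (co c f k l) = co c (\<sigma> f) (\<sigma> k) (\<sigma> l)"
  "dact P {e, k} {i} 0 \<sigma> (co c i e k) = co c (\<sigma> i) (\<sigma> e) (\<sigma> k)"
  "dact P {e, k} {i} 0 \<sigma> (co c i k e) = co c (\<sigma> i) (\<sigma> k) (\<sigma> e)"
  "dact P {l} {f, j} 0 \<sigma> (pr p l f j) = pr p (\<sigma> l) (\<sigma> f) (\<sigma> j)"
  "dact P {l} {f, j} 0 \<sigma> (pr p l j f) = pr p (\<sigma> l) (\<sigma> j) (\<sigma> f)"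
proof -
  have A: "dact P {x} {y, z} 0 \<sigma> (pr p x y z) = pr p (\<sigma> x) (\<sigma> y) (\<sigma> z)"
    "dact P {y, z} {x} 0 \<sigma> (co c x y z) = co c (\<sigma> x) (\<sigma> y) (\<sigma> z)"
    if "distinct [x, y, z]" "{x, y, z} \<subseteq> set [e, f, i, j, k, l]" for x y z
    using pr_act[OF p that(1) inj_on_subset[OF s that(2)]] co_act[OF c that(1) inj_on_subset[OF s that(2)]] by simp_all
  have B: "dact P {z} {y, x} 0 \<sigma> (pr p z x y) = pr p (\<sigma> z) (\<sigma> x) (\<sigma> y)"
    "dact P {y, x} {z} 0 \<sigma> (co c z x y) = co c (\<sigma> z) (\<sigma> x) (\<sigma> y)"
    if "distinct [z, x, y]" "{z, x, y} \<subseteq> set [e, f, i, j, k, l]" for x y z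
    using A[OF that] by (simp_all add: insert_commute)
  show
  "dact P {e} {i, j} 0 \<sigma> (pr p e i j) = pr p (\<sigma> e) (\<sigma> i) (\<sigma> j)"
  "dact P {k} {f, l} 0 \<sigma> (pr p k f l) = pr p (\<sigma> k) (\<sigma> f) (\<sigma> l)"
  "dact P {k} {f, l} 0 \<sigma> (pr p k l f) = pr p (\<sigma> k) (\<sigma> l) (\<sigma> f)"
  "dact P {e, l} {k} 0 \<sigma> (co c k e l) = co c (\<sigma> k) (\<sigma> e) (\<sigma> l)"
  "dact P {e, l} {k} 0 \<sigma> (co c k l e) = co c (\<sigma> k) (\<sigma> l) (\<sigma> e)"
  "dact P {i, j} {f} 0 \<sigma> (co c f i j) = co c (\<sigma> f) (\<sigma> i) (\<sigma> j)"
  "dact P {k, l} {f} 0 \<sigma> (co c f k l) = co c (\<sigma> f) (\<sigma> k) (\<sigma> l)"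
  "dact P {e, k} {i} 0 \<sigma> (co c i e k) = co c (\<sigma> i) (\<sigma> e) (\<sigma> k)"
  "dact P {e, k} {i} 0 \<sigma> (co c i k e) = co c (\<sigma> i) (\<sigma> k) (\<sigma> e)"
  "dact P {l} {f, j} 0 \<sigma> (pr p l f j) = pr p (\<sigma> l) (\<sigma> f) (\<sigma> j)"
  "dact P {l} {f, j} 0 \<sigma> (pr p l j f) = pr p (\<sigma> l) (\<sigma> j) (\<sigma> f)"
    using d d' by (intro A B; simp)+
qed

lemma composites_act:
  assumes s: "inj_on \<sigma> (set [e, f, i, j, k, l])"
  shows
  "dact P {k} {i, j, l} 0 \<sigma> (QA p e f k i j l) = QA p (\<sigma> e) (\<sigma> f) (\<sigma> k) (\<sigma> i) (\<sigma> j) (\<sigma> l)"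
  "dact P {k} {i, j, l} 0 \<sigma> (QB p e f k i j l) = QB p (\<sigma> e) (\<sigma> f) (\<sigma> k) (\<sigma> i) (\<sigma> j) (\<sigma> l)"
  "dact P {i, j, l} {k} 0 \<sigma> (CA c e f k i j l) = CA c (\<sigma> e) (\<sigma> f) (\<sigma> k) (\<sigma> i) (\<sigma> j) (\<sigma> l)"
  "dact P {i, j, l} {k} 0 \<sigma> (CB c e f k i j l) = CB c (\<sigma> e) (\<sigma> f) (\<sigma> k) (\<sigma> i) (\<sigma> j) (\<sigma> l)"
  "dact P {k, l} {i, j} 0 \<sigma> (PC p c e f i j k l) = PC p c (\<sigma> e) (\<sigma> f) (\<sigma> i) (\<sigma> j) (\<sigma> k) (\<sigma> l)"
  "dact P {k, l} {i, j} 0 \<sigma> (M1 p c e f i k l j) = M1 p c (\<sigma> e) (\<sigma> f) (\<sigma> i) (\<sigma> k) (\<sigma> l) (\<sigma> j)"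
  "dact P {k, l} {i, j} 0 \<sigma> (M2 p c e f i k l j) = M2 p c (\<sigma> e) (\<sigma> f) (\<sigma> i) (\<sigma> k) (\<sigma> l) (\<sigma> j)"
  "dact P {k, l} {i, j} 0 \<sigma> (M3 p c e f i k l j) = M3 p c (\<sigma> e) (\<sigma> f) (\<sigma> i) (\<sigma> k) (\<sigma> l) (\<sigma> j)"
  "dact P {k, l} {i, j} 0 \<sigma> (M4 p c e f i k l j) = M4 p c (\<sigma> e) (\<sigma> f) (\<sigma> i) (\<sigma> k) (\<sigma> l) (\<sigma> j)"
proof -
  have i1: "inj_on \<sigma> ({e} \<union> {i, j} \<union> {k} \<union> {f, l})" "inj_on \<sigma> ({e, l} \<union> {k} \<union> {i, j} \<union> {f})"
     "inj_on \<sigma> ({e} \<union> {i, j} \<union> {k, l} \<union> {f})" "inj_on \<sigma> ({e, k} \<union> {i} \<union> {l} \<union> {f, j})"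
    by (rule inj_on_subset[OF s]; simp)+
  note sh = shape1(2)[OF _ _ i1(1)] shape2(2)[OF _ _ i1(2)] shape3(2)[OF _ _ i1(3)] shape4(2)[OF _ _ i1(4)]
  show
  "dact P {k} {i, j, l} 0 \<sigma> (QA p e f k i j l) = QA p (\<sigma> e) (\<sigma> f) (\<sigma> k) (\<sigma> i) (\<sigma> j) (\<sigma> l)"
  "dact P {k} {i, j, l} 0 \<sigma> (QB p e f k i j l) = QB p (\<sigma> e) (\<sigma> f) (\<sigma> k) (\<sigma> i) (\<sigma> j) (\<sigma> l)"
  "dact P {i, j, l} {k} 0 \<sigma> (CA c e f k i j l) = CA c (\<sigma> e) (\<sigma> f) (\<sigma> k) (\<sigma> i) (\<sigma> j) (\<sigma> l)"
  "dact P {i, j, l} {k} 0 \<sigma> (CB c e f k i j l) = CB c (\<sigma> e) (\<sigma> f) (\<sigma> k) (\<sigma> i) (\<sigma> j) (\<sigma> l)"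
  "dact P {k, l} {i, j} 0 \<sigma> (PC p c e f i j k l) = PC p c (\<sigma> e) (\<sigma> f) (\<sigma> i) (\<sigma> j) (\<sigma> k) (\<sigma> l)"
  "dact P {k, l} {i, j} 0 \<sigma> (M1 p c e f i k l j) = M1 p c (\<sigma> e) (\<sigma> f) (\<sigma> i) (\<sigma> k) (\<sigma> l) (\<sigma> j)"
  "dact P {k, l} {i, j} 0 \<sigma> (M2 p c e f i k l j) = M2 p c (\<sigma> e) (\<sigma> f) (\<sigma> i) (\<sigma> k) (\<sigma> l) (\<sigma> j)"
  "dact P {k, l} {i, j} 0 \<sigma> (M3 p c e f i k l j) = M3 p c (\<sigma> e) (\<sigma> f) (\<sigma> i) (\<sigma> k) (\<sigma> l) (\<sigma> j)"
  "dact P {k, l} {i, j} 0 \<sigma> (M4 p c e f i k l j) = M4 p c (\<sigma> e) (\<sigma> f) (\<sigma> i) (\<sigma> k) (\<sigma> l) (\<sigma> j)"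
    unfolding QA_def QB_def CA_def CB_def PC_def M1_def M2_def M3_def M4_def
      sh(1)[OF vertices(1,2)] sh(1)[OF vertices(1,3)] sh(2)[OF vertices(4,6)] sh(2)[OF vertices(5,6)]
      sh(3)[OF vertices(1,7)] sh(4)[OF vertices(8,10)] sh(4)[OF vertices(8,11)] sh(4)[OF vertices(9,10)]
      sh(4)[OF vertices(9,11)] vertices_act[OF s]
    by simp_all
qed

text \<open>The two names of the edge are bound. The transposition of \<open>e\<close> and
  \<open>f\<close> fixes all external flags, hence acts trivially on the composite, but it also
  interchanges the names inside.\<close>

lemma composites_edge:
  "CA c f e k i j l = CA c e f k i j l"
  "CB c f e k i j l = CB c e f k i j l"
  "M1 p c f e i k l j = M1 p c e f i k l j"
  "M2 p c f e i k l j = M2 p c e f i k l j"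
  "M3 p c f e i k l j = M3 p c e f i k l j"
  "M4 p c f e i k l j = M4 p c e f i k l j"
proof -
  define \<sigma> where "\<sigma> = id(e := f, f := e)"
  have s: "\<sigma> e = f" "\<sigma> f = e" "\<sigma> i = i" "\<sigma> j = j" "\<sigma> k = k" "\<sigma> l = l"
    using d by (auto simp: \<sigma>_def)
  have inj: "inj_on \<sigma> (set [e, f, i, j, k, l])" using d s by (auto simp: inj_on_def)
  have b: "biflags {i, j, l} {k}" "biflags {k, l} {i, j}" using d by (auto simp: biflags_def)
  have fx: "q \<in> {i, j, l} \<union> {k} \<Longrightarrow> \<sigma> q = q" "q \<in> {k, l} \<union> {i, j} \<Longrightarrow> \<sigma> q = q" for q
    using s by auto
  note a = composites_act[OF inj, unfolded s]
  show "CA c f e k i j l = CA c e f k i j l" "CB c f e k i j l = CB c e f k i j l"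
    "M1 p c f e i k l j = M1 p c e f i k l j" "M2 p c f e i k l j = M2 p c e f i k l j"
    "M3 p c f e i k l j = M3 p c e f i k l j" "M4 p c f e i k l j = M4 p c e f i k l j"
    unfolding a(3,4,6-9)[symmetric]
    by (rule dact_fix[OF b(1) _ fx(1)] dact_fix[OF b(2) _ fx(2)], rule composites_closed, assumption)+
qed

end

end

section \<open>Cyclically invariant ternary elements and their composites\<close>

context dioperad
begin

abbreviation gg :: "(nat set \<Rightarrow> 'v) \<Rightarrow> nat \<Rightarrow> nat \<Rightarrow> nat \<Rightarrow> nat set \<Rightarrow> 'v" where
  "gg v i j k \<equiv> cact L {0, 1, 2} 0 (lab3 i j k) v"

text \<open>A cyclically invariant element of arity three amounts to an operation with two inputs
  and one with two outputs, its components with one and with two outgoing flags.\<close>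

definition tri :: "(nat set \<Rightarrow> 'v) \<Rightarrow> 'v \<Rightarrow> 'v \<Rightarrow> bool" where
  "tri v p c \<longleftrightarrow> v \<in> carrier (csp L {0, 1, 2} 0) \<and> gg v 1 2 0 = gg v 0 1 2 \<and>
     p = gg v 1 2 0 {0} \<and> c = gg v 2 1 0 {1, 2}"

lemma cyclic_operad_L: "cyclic_operad K L"
  by (rule phi_lower_cyclic_operad)

lemma gg_closed:
  assumes "v \<in> carrier (csp L {0, 1, 2} 0)" "distinct [i, j, k]"
  shows "gg v i j k \<in> carrier (csp L {i, j, k} 0)"
  using lin_map_closed[OF cyclic_operad.cact_linear[OF cyclic_operad_L _ lab3_inj[OF assms(2)]] assms(1)] by simp

lemma gg_act:
  assumes "v \<in> carrier (csp L {0, 1, 2} 0)" "distinct [i, j, k]" "inj_on \<sigma> {i, j, k}"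
  shows "cact L {i, j, k} 0 \<sigma> (gg v i j k) = gg v (\<sigma> i) (\<sigma> j) (\<sigma> k)"
  using cyclic_operad.cact_comp[OF cyclic_operad_L _ lab3_inj[OF assms(2)] _ assms(1), of \<sigma>] assms(3)
  by (simp add: lab3_comp)

lemma gg_id: "v \<in> carrier (csp L {0, 1, 2} 0) \<Longrightarrow> gg v 0 1 2 = v"
proof -
  assume v: "v \<in> carrier (csp L {0, 1, 2} 0)"
  have "gg v 0 1 2 = cact L {0, 1, 2} 0 id v"
    by (rule cyclic_operad.cact_cong[OF cyclic_operad_L _ _ _ v]) (auto simp: lab3_def inj_on_def)
  then show ?thesis using cyclic_operad.cact_id[OF cyclic_operad_L _ v] by simp
qed

lemma splits3:
  assumes "distinct [i, j, k]"
  shows "{i} \<in> splits {i, j, k}" "{j} \<in> splits {i, j, k}" "{k} \<in> splits {i, j, k}"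
    "{i, j} \<in> splits {i, j, k}" "{j, k} \<in> splits {i, j, k}" "{i, k} \<in> splits {i, j, k}"
    "{i, j, k} - {i} = {j, k}" "{i, j, k} - {j} = {i, k}" "{i, j, k} - {k} = {i, j}"
    "{i, j, k} - {i, j} = {k}" "{i, j, k} - {j, k} = {i}" "{i, j, k} - {i, k} = {j}"
  using assms by (auto simp: splits_iff)

lemma splits3_cases:
  assumes "A \<in> splits {i, j, k}"
  shows "A \<in> {{i}, {j}, {k}, {i, j}, {j, k}, {i, k}}"
proof -
  have "A \<in> Pow {i, j, k}" "A \<noteq> {}" "A \<noteq> {i, j, k}" using assms by (auto simp: splits_def)
  then show ?thesis by (simp add: Pow_insert) metis
qed

context
  fixes v p c
  assumes tri: "tri v p c"
begin

lemma tri_closed: "v \<in> carrier (csp L {0, 1, 2} 0)"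
  using tri by (simp add: tri_def)

lemma p_closed: "p \<in> dprods" and c_closed: "c \<in> dcoprods"
proof -
  have d: "distinct [1, 2, 0 :: nat]" "distinct [2, 1, 0 :: nat]" by auto
  have q: "x A \<in> carrier (vs I A 0)" if "x \<in> carrier (csp L I 0)" "A \<in> splits I" for x I A
    using that by (simp add: phi_lower_carrier)
  have e: "{2, 1} = {1, 2::nat}" "{2, 1, 0} - {1, 2} = {0::nat}" by auto
  show "p \<in> dprods"
    using q[OF gg_closed[OF tri_closed d(1)] splits3(3)[OF d(1)]] tri unfolding splits3(9)[OF d(1)] tri_def by metis
  show "c \<in> dcoprods"
    using q[OF gg_closed[OF tri_closed d(2)] splits3(4)[OF d(2)]] tri unfolding tri_def e by metis
qed

text \<open>Invariance is assumed for one labelling; relabelling both sides extends it to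
  all.\<close>

lemma gg_rot: "distinct [i, j, k] \<Longrightarrow> gg v j k i = gg v i j k"
proof -
  assume d: "distinct [i, j, k]"
  have "cact L {1, 2, 0} 0 (lab3 i j k) (gg v 1 2 0) = gg v j k i"
    using gg_act[OF tri_closed, of 1 2 0 "lab3 i j k"] lab3_inj[OF d] by (simp add: insert_commute)
  moreover have "cact L {0, 1, 2} 0 (lab3 i j k) (gg v 0 1 2) = gg v i j k"
    using gg_act[OF tri_closed, of 0 1 2 "lab3 i j k"] lab3_inj[OF d] by simp
  moreover have "{1, 2, 0} = {0, 1, 2::nat}" by auto
  ultimately show "gg v j k i = gg v i j k" using tri by (simp add: tri_def)
qed

lemma gg_prod: assumes d: "distinct [i, j, k]" shows "gg v i j k {k} = pr p k i j"
proof -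
  let ?s = "lab3 k i j"
  have i: "inj_on ?s {1, 2, 0}" using d by (auto simp: inj_on_def)
  have "gg v i j k (?s ` {0}) = dact P {0} ({1, 2, 0} - {0}) 0 ?s (gg v 1 2 0 {0})"
    using cact_apply[of "{0}" "{1, 2, 0}" ?s K P 0 "gg v 1 2 0"] i gg_act[OF tri_closed, of 1 2 0 ?s]
      splits3[of 1 2 0] by simp
  also have "{1, 2, 0} - {0} = {1, 2::nat}" by auto
  finally show ?thesis using tri by (simp add: tri_def)
qed

text \<open>The outputs appear in reversed order because \<open>tri\<close> takes the coproduct from
  \<open>gg v 2 1 0\<close>. With this convention \<open>assoc_equiv\<close> produces the relations
  of \<open>Bal\<close> for \<open>c\<close> itself and not for its opposite.\<close>

lemma gg_coprod: assumes d: "distinct [i, j, k]" shows "gg v i j k {i, j} = co c k j i"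
proof -
  let ?s = "lab3 k j i"
  have i: "inj_on ?s {2, 1, 0}" using d by (auto simp: inj_on_def)
  have "gg v i j k (?s ` {2, 1}) = dact P {2, 1} ({2, 1, 0} - {2, 1}) 0 ?s (gg v 2 1 0 {2, 1})"
    using cact_apply[of "{2, 1}" "{2, 1, 0}" ?s K P 0 "gg v 2 1 0"] i gg_act[OF tri_closed, of 2 1 0 ?s]
      splits3[of 2 1 0] by simp
  also have "{2, 1, 0} - {2, 1} = {0::nat}" by auto
  also have "{2, 1} = {1, 2::nat}" by auto
  finally show ?thesis using tri by (simp add: tri_def insert_commute)
qed

lemma gg_comps:
  assumes d: "distinct [i, j, k]"
  shows "gg v i j k {k} = pr p k i j" "gg v i j k {i} = pr p i j k" "gg v i j k {j} = pr p j k i"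
    "gg v i j k {i, j} = co c k j i" "gg v i j k {j, k} = co c i k j" "gg v i j k {i, k} = co c j i k"
proof -
  have d': "distinct [j, k, i]" "distinct [k, i, j]" using d by auto
  show "gg v i j k {k} = pr p k i j" "gg v i j k {i, j} = co c k j i" by (rule gg_prod gg_coprod d)+
  show "gg v i j k {i} = pr p i j k" "gg v i j k {j, k} = co c i k j"
    using gg_prod[OF d'(1)] gg_coprod[OF d'(1)] gg_rot[OF d] by simp_all
  show "gg v i j k {j} = pr p j k i" "gg v i j k {i, k} = co c j i k"
    using gg_prod[OF d'(2)] gg_coprod[OF d'(2)] gg_rot[OF d] gg_rot[OF d'(1)]
    by (simp_all add: insert_commute)
qed

text \<open>The composite with cyclically ordered flags \<open>i, j | k, l\<close>; it is invariant under
  exchanging the two pairs.\<close>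

definition glued :: "nat \<Rightarrow> nat \<Rightarrow> nat \<Rightarrow> nat \<Rightarrow> nat \<Rightarrow> nat \<Rightarrow> nat set \<Rightarrow> 'v" where
  "glued e f i j k l = ccomp L {i, j, e} 0 e {f, k, l} 0 f (gg v i j e) (gg v f k l)"

context
  fixes e f i j k l :: nat
  assumes d: "distinct [e, f, i, j, k, l]"
begin

lemma dd: "distinct [i, j, e]" "distinct [f, k, l]"
  using d by auto

lemma glued_closed: "glued e f i j k l \<in> carrier (csp L {i, j, k, l} 0)"
proof -
  have "cglue {i, j, e} e {f, k, l} f" using d by (auto simp: cglue_def)
  from ccomp_closed[OF this gg_closed[OF tri_closed dd(1)] gg_closed[OF tri_closed dd(2)]]
  have "glued e f i j k l \<in> carrier (csp L ({i, j, e} - {e} \<union> ({f, k, l} - {f})) (0 + 0))"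
    unfolding glued_def .
  moreover have "{i, j, e} - {e} \<union> ({f, k, l} - {f}) = {i, j, k, l}" using d by auto
  ultimately show ?thesis by simp
qed

text \<open>\<open>A\<close> and \<open>B\<close> are the outputs within the two pairs. The edge
  from \<open>e\<close> to \<open>f\<close> leaves the first vertex without inputs exactly if
  \<open>A\<close> is the whole pair, and the second without outputs exactly if \<open>B\<close> is
  empty; symmetrically for the other direction. All degrees are zero, so no sign occurs.\<close>

lemma glued_apply:
  assumes "A \<subseteq> {i, j}" "B \<subseteq> {k, l}" "A \<union> B \<in> splits {i, j, k, l}"
    and "T = A \<union> B" "T' = {i, j, k, l} - T"
  shows "glued e f i j k l T =
    (if A \<noteq> {i, j} \<and> B \<noteq> {} then
       dcomp P (insert e A) ({i, j} - A) 0 e B ({f, k, l} - B) 0 f (gg v i j e (insert e A)) (gg v f k l B)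
     else \<zero>\<^bsub>dsp P T T' 0\<^esub>) \<oplus>\<^bsub>dsp P T T' 0\<^esub>
    (if B \<noteq> {k, l} \<and> A \<noteq> {} then
       dcomp P (insert f B) ({k, l} - B) 0 f A ({i, j, e} - A) 0 e (gg v f k l (insert f B)) (gg v i j e A)
     else \<zero>\<^bsub>dsp P T T' 0\<^esub>)"
proof -
  have N: "{i, j, e} - {e} \<union> ({f, k, l} - {f}) = {i, j, k, l}" using d by auto
  have g: "cglue {i, j, e} e {f, k, l} f" using d by (auto simp: cglue_def)
  have s: "A \<subseteq> {i, j, e} - {e}" "B \<subseteq> {f, k, l} - {f}" using assms(1,2) d by auto
  note q = cglue_dirg[OF g s]
  have e1: "{i, j, e} - insert e A = {i, j} - A" "{f, k, l} - insert f B = {k, l} - B"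
    using assms(1,2) d by auto
  have e2: "insert e A \<in> splits {i, j, e} \<and> B \<in> splits {f, k, l} \<longleftrightarrow> A \<noteq> {i, j} \<and> B \<noteq> {}"
    "insert f B \<in> splits {f, k, l} \<and> A \<in> splits {i, j, e} \<longleftrightarrow> B \<noteq> {k, l} \<and> A \<noteq> {}"
    using assms(1,2) d by (auto simp: splits_def)
  have e3: "(A \<union> B) \<inter> {i, j, e} = A" "(A \<union> B) \<inter> {f, k, l} = B" using assms(1,2) d by auto
  interpret M: module K "dsp P T T' 0" using assms(3) unfolding assms(4,5) by (intro vs_module) auto
  have cl: "dcx P {f, k, l} (insert f B) 0 f {i, j, e} A 0 e (gg v f k l (insert f B)) (gg v i j e A)
      \<in> carrier (dsp P T T' 0)"
    unfolding assms(4,5) using dcx_closed[OF q(2,4) q(5)[unfolded N] assms(3), of _ 0 _ 0]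
    by (simp add: phi_lower_cv[OF gg_closed[OF tri_closed dd(1)], simplified]
        phi_lower_cv[OF gg_closed[OF tri_closed dd(2)], simplified])
  have z: "dcx P {i, j, e} (insert e A) 0 e {f, k, l} B 0 f x y = \<zero>\<^bsub>dsp P T T' 0\<^esub>"
    if "\<not> (A \<noteq> {i, j} \<and> B \<noteq> {})" for x y
    using dcx_zero[OF q(1,3) N[symmetric], of 0 0] that unfolding e2 assms(4,5) by simp
  have z': "dcx P {f, k, l} (insert f B) 0 f {i, j, e} A 0 e x y = \<zero>\<^bsub>dsp P T T' 0\<^esub>"
    if "\<not> (B \<noteq> {k, l} \<and> A \<noteq> {})" for x y
    using dcx_zero[OF q(2,4) q(5)[unfolded N], of 0 0] that unfolding e2 assms(4,5) by simp
  have "glued e f i j k l T = dcx P {i, j, e} (insert e A) 0 e {f, k, l} B 0 f (gg v i j e (insert e A)) (gg v f k l B)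
     \<oplus>\<^bsub>dsp P T T' 0\<^esub> dcx P {f, k, l} (insert f B) 0 f {i, j, e} A 0 e (gg v f k l (insert f B)) (gg v i j e A)"
    using ccomp_apply[OF g s N[symmetric] assms(3), of 0 0] M.smult_one[OF cl] unfolding glued_def assms(4,5) by simp
  also have "dcx P {i, j, e} (insert e A) 0 e {f, k, l} B 0 f (gg v i j e (insert e A)) (gg v f k l B) =
    (if A \<noteq> {i, j} \<and> B \<noteq> {} then
       dcomp P (insert e A) ({i, j} - A) 0 e B ({f, k, l} - B) 0 f (gg v i j e (insert e A)) (gg v f k l B)
     else \<zero>\<^bsub>dsp P T T' 0\<^esub>)"
    by (cases "A \<noteq> {i, j} \<and> B \<noteq> {}") (simp add: dcx_def e2 e1, simp only: if_False, rule z)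
  also have "dcx P {f, k, l} (insert f B) 0 f {i, j, e} A 0 e (gg v f k l (insert f B)) (gg v i j e A) =
    (if B \<noteq> {k, l} \<and> A \<noteq> {} then
       dcomp P (insert f B) ({k, l} - B) 0 f A ({i, j, e} - A) 0 e (gg v f k l (insert f B)) (gg v i j e A)
     else \<zero>\<^bsub>dsp P T T' 0\<^esub>)"
    by (cases "B \<noteq> {k, l} \<and> A \<noteq> {}") (simp add: dcx_def e2 e1, simp only: if_False, rule z')
  finally show ?thesis .
qed

lemma glued_sets:
  "{i, j, k, l} - {l} = {i, j, k}" "{i, j, k, l} - {k} = {i, j, l}"
  "{i, j, k, l} - {i, j, k} = {l}" "{i, j, k, l} - {i, j, l} = {k}" "{i, j, k, l} - {k, l} = {i, j}"
  "{i, j, k, l} - {j, l} = {i, k}" "{i, j, k, l} - {i, l} = {j, k}"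
  "{i, j, k, l} - {j, k} = {i, l}" "{i, j, k, l} - {i, k} = {j, l}"
  using d by auto

lemma glued_splits:
  "{l} \<in> splits {i, j, k, l}" "{k} \<in> splits {i, j, k, l}" "{i, j, k} \<in> splits {i, j, k, l}"
  "{i, j, l} \<in> splits {i, j, k, l}" "{k, l} \<in> splits {i, j, k, l}" "{j, l} \<in> splits {i, j, k, l}"
  "{i, l} \<in> splits {i, j, k, l}" "{j, k} \<in> splits {i, j, k, l}" "{i, k} \<in> splits {i, j, k, l}"
  unfolding splits_iff glued_sets by auto

lemma glued_small:
  "{i, j} - {i} = {j}" "{i, j} - {j} = {i}" "{k, l} - {k} = {l}" "{k, l} - {l} = {k}"
  "{f, k, l} - {k} = {f, l}" "{f, k, l} - {l} = {f, k}" "{f, k, l} - {k, l} = {f}"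
  "{i, j, e} - {i} = {e, j}" "{i, j, e} - {j} = {e, i}" "{i, j, e} - {i, j} = {e}"
  "{i} \<noteq> {i, j}" "{j} \<noteq> {i, j}" "{k} \<noteq> {k, l}" "{l} \<noteq> {k, l}" "{} \<noteq> {i, j}" "{} \<noteq> {k, l}"
  using d by auto

lemma glued_gg:
  "gg v i j e {e} = pr p e i j" "gg v i j e {i} = pr p i j e" "gg v i j e {j} = pr p j e i"
  "gg v i j e {i, j} = co c e j i" "gg v i j e {e, j} = co c i e j" "gg v i j e {e, i} = co c j i e"
  "gg v f k l {l} = pr p l f k" "gg v f k l {k} = pr p k l f" "gg v f k l {f, k} = co c l k f"
  "gg v f k l {k, l} = co c f l k" "gg v f k l {f, l} = co c k f l"
  using gg_comps[OF dd(1)] gg_comps[OF dd(2)] by (simp_all add: insert_commute)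

lemma glued_zero:
  assumes "T \<in> splits {i, j, k, l}" "T' = {i, j, k, l} - T" "x \<in> carrier (dsp P T T' 0)"
  shows "x \<oplus>\<^bsub>dsp P T T' 0\<^esub> \<zero>\<^bsub>dsp P T T' 0\<^esub> = x" "\<zero>\<^bsub>dsp P T T' 0\<^esub> \<oplus>\<^bsub>dsp P T T' 0\<^esub> x = x"
proof -
  interpret M: module K "dsp P T T' 0" using assms(1) unfolding assms(2) by (intro vs_module) auto
  show "x \<oplus>\<^bsub>dsp P T T' 0\<^esub> \<zero>\<^bsub>dsp P T T' 0\<^esub> = x" "\<zero>\<^bsub>dsp P T T' 0\<^esub> \<oplus>\<^bsub>dsp P T T' 0\<^esub> x = x"
    using assms(3) by simp_all
qed

lemma perms:
  "distinct [e, f, i, j, l, k]" "distinct [e, f, j, i, l, k]" "distinct [e, f, k, l, j, i]" "distinct [e, f, k, i, j, l]"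
  "distinct [f, e, j, i, l, k]" "distinct [f, e, j, i, k, l]" "distinct [f, e, k, i, l, j]"
  "distinct [f, e, l, i, k, j]" "distinct [f, e, k, j, l, i]" "distinct [f, e, l, j, k, i]"
  using d by auto

text \<open>With one output, three outputs, or both outputs in one pair, only one direction of the
  edge is possible and a single composite remains. With one output in each pair both directions
  contribute, whence the sums.\<close>

lemma glued_comps:
  "glued e f i j k l {l} = QA p e f l i j k"
  "glued e f i j k l {k} = QB p e f k i j l"
  "glued e f i j k l {i, j, k} = CB c e f l j i k"
  "glued e f i j k l {i, j, l} = CA c e f k j i l"
  "glued e f i j k l {k, l} = PC p c e f i j l k"
  "glued e f i j k l {j, l} = M1 p c e f i j l k \<oplus>\<^bsub>dsp P {j, l} {i, k} 0\<^esub> M1 p c e f k l j i"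
  "glued e f i j k l {i, l} = M3 p c e f j i l k \<oplus>\<^bsub>dsp P {i, l} {j, k} 0\<^esub> M2 p c e f k l i j"
  "glued e f i j k l {j, k} = M2 p c e f i j k l \<oplus>\<^bsub>dsp P {j, k} {i, l} 0\<^esub> M3 p c e f l k j i"
  "glued e f i j k l {i, k} = M4 p c e f j i k l \<oplus>\<^bsub>dsp P {i, k} {j, l} 0\<^esub> M4 p c e f l k i j"
proof -
  note C = composites_closed[OF p_closed c_closed]
  note E = composites_edge[OF p_closed c_closed]
  note S = glued_sets glued_small glued_gg
  have u: "{i, j} \<union> {k} = {i, j, k}" "{i, j} \<union> {l} = {i, j, l}" "{j} \<union> {l} = {j, l}"
    "{i} \<union> {l} = {i, l}" "{j} \<union> {k} = {j, k}" "{i} \<union> {k} = {i, k}" by auto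
  note z = glued_zero
  have n: "k \<noteq> l" "l \<noteq> k" "i \<noteq> j" "j \<noteq> i" using d by auto
  have h: "{j, i, k} = {i, j, k}" "{j, i, l} = {i, j, l}" "{j, i} = {i, j}" "{l, k} = {k, l}" by auto
  note [simp del] = One_nat_def
  show "glued e f i j k l {l} = QA p e f l i j k"
    using glued_apply[of "{}" "{l}"] z(1)[OF glued_splits(1) glued_sets(1)[symmetric] C(1)[OF perms(1)]] glued_splits(1)
    by (simp add: n S QA_def)
  show "glued e f i j k l {k} = QB p e f k i j l"
    using glued_apply[of "{}" "{k}"] z(1)[OF glued_splits(2) glued_sets(2)[symmetric] C(2)[OF d]] glued_splits(2)
    by (simp add: n S QB_def)
  have "CB c f e l j i k \<in> carrier (dsp P {i, j, k} {l} 0)"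
    using C(4)[OF perms(5)] by (simp add: h)
  from z(2)[OF glued_splits(3) glued_sets(3)[symmetric] this]
  have "glued e f i j k l {i, j, k} = CB c f e l j i k"
    using glued_apply[OF _ _ glued_splits(3)[folded u] u(1)[symmetric] HOL.refl]
    by (simp add: S CB_def h n)
  then show "glued e f i j k l {i, j, k} = CB c e f l j i k" using E(2)[OF perms(2)] by simp
  have "CA c f e k j i l \<in> carrier (dsp P {i, j, l} {k} 0)"
    using C(3)[OF perms(6)] by (simp add: h)
  from z(2)[OF glued_splits(4) glued_sets(4)[symmetric] this]
  have "glued e f i j k l {i, j, l} = CA c f e k j i l"
    using glued_apply[OF _ _ glued_splits(4)[folded u] u(2)[symmetric] HOL.refl]
    by (simp add: S CA_def h n)
  then show "glued e f i j k l {i, j, l} = CA c e f k j i l" using E(1)[of e f j i k l] d by auto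
  have "PC p c e f i j l k \<in> carrier (dsp P {k, l} {i, j} 0)"
    using C(5)[OF perms(1)] by (simp add: h)
  from z(1)[OF glued_splits(5) glued_sets(5)[symmetric] this]
  show "glued e f i j k l {k, l} = PC p c e f i j l k"
    using glued_apply[of "{}" "{k, l}"] glued_splits(5) by (simp add: S PC_def h n)
  \<comment> \<open>The second summand has its edge directed from \<open>f\<close> to
    \<open>e\<close>; the edge names are exchanged so that all composites are written with
    \<open>e\<close> before \<open>f\<close>.\<close>
  have x: "M1 p c f e k l j i = M1 p c e f k l j i" "M2 p c f e k l i j = M2 p c e f k l i j"
    "M3 p c f e l k j i = M3 p c e f l k j i" "M4 p c f e l k i j = M4 p c e f l k i j"
    using E(3)[of e f k i l j] E(4)[of e f k j l i] E(5)[of e f l i k j] E(6)[of e f l j k i] d by auto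
  show "glued e f i j k l {j, l} = M1 p c e f i j l k \<oplus>\<^bsub>dsp P {j, l} {i, k} 0\<^esub> M1 p c e f k l j i"
    using glued_apply[OF _ _ glued_splits(6)[folded u] u(3)[symmetric] glued_sets(6)[symmetric]] unfolding x(1)[symmetric]
    by (simp add: n S M1_def)
  show "glued e f i j k l {i, l} = M3 p c e f j i l k \<oplus>\<^bsub>dsp P {i, l} {j, k} 0\<^esub> M2 p c e f k l i j"
    using glued_apply[OF _ _ glued_splits(7)[folded u] u(4)[symmetric] glued_sets(7)[symmetric]] unfolding x(2)[symmetric]
    by (simp add: n S M2_def M3_def)
  show "glued e f i j k l {j, k} = M2 p c e f i j k l \<oplus>\<^bsub>dsp P {j, k} {i, l} 0\<^esub> M3 p c e f l k j i"
    using glued_apply[OF _ _ glued_splits(8)[folded u] u(5)[symmetric] glued_sets(8)[symmetric]] unfolding x(3)[symmetric]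
    by (simp add: n S M2_def M3_def)
  show "glued e f i j k l {i, k} = M4 p c e f j i k l \<oplus>\<^bsub>dsp P {i, k} {j, l} 0\<^esub> M4 p c e f l k i j"
    using glued_apply[OF _ _ glued_splits(9)[folded u] u(6)[symmetric] glued_sets(9)[symmetric]] unfolding x(4)[symmetric]
    by (simp add: n S M4_def)
qed

end

end

end

section \<open>The relations between products and coproducts under renaming of flags\<close>

context dioperad
begin

text \<open>The relations of \<open>BiLie\<close> and \<open>Bal\<close> with arbitrary flags. They do not depend on the choice of
  flags, which allows comparing the components of a relation in arity four with them.\<close>

definition "jacR p e f l i j k \<longleftrightarrow> QA p e f l i j k \<oplus>\<^bsub>dsp P {l} {i, j, k} 0\<^esub>
  (QA p e f l j k i \<oplus>\<^bsub>dsp P {l} {i, j, k} 0\<^esub> QA p e f l k i j) = \<zero>\<^bsub>dsp P {l} {i, j, k} 0\<^esub>"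

definition "cojR c e f l i j k \<longleftrightarrow> CA c e f l i j k \<oplus>\<^bsub>dsp P {i, j, k} {l} 0\<^esub>
  (CA c e f l j k i \<oplus>\<^bsub>dsp P {i, j, k} {l} 0\<^esub> CA c e f l k i j) = \<zero>\<^bsub>dsp P {i, j, k} {l} 0\<^esub>"

definition "cocR p c e f i j k l \<longleftrightarrow> PC p c e f i j k l =
  (M2 p c e f j l k i \<oplus>\<^bsub>dsp P {k, l} {i, j} 0\<^esub> M4 p c e f j k l i) \<oplus>\<^bsub>dsp P {k, l} {i, j} 0\<^esub>
  ((\<ominus> \<one>) \<odot>\<^bsub>dsp P {k, l} {i, j} 0\<^esub> M2 p c e f i l k j \<oplus>\<^bsub>dsp P {k, l} {i, j} 0\<^esub>
   (\<ominus> \<one>) \<odot>\<^bsub>dsp P {k, l} {i, j} 0\<^esub> M4 p c e f i k l j)"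

definition "assR p e f l i j k \<longleftrightarrow> QA p e f l i j k = QB p e f l j k i"

definition "coaR c e f l i j k \<longleftrightarrow> CA c e f l i j k = CB c e f l j k i"

definition "comR p c e f i j k l \<longleftrightarrow> PC p c e f i j k l =
  M2 p c e f j l k i \<oplus>\<^bsub>dsp P {k, l} {i, j} 0\<^esub> M3 p c e f i k l j"

definition "balR p c e f i j k l \<longleftrightarrow>
  (M4 p c e f j l k i \<oplus>\<^bsub>dsp P {k, l} {i, j} 0\<^esub>
   (\<ominus> \<one>) \<odot>\<^bsub>dsp P {k, l} {i, j} 0\<^esub> M1 p c e f j k l i) \<oplus>\<^bsub>dsp P {k, l} {i, j} 0\<^esub>
  (M4 p c e f i k l j \<oplus>\<^bsub>dsp P {k, l} {i, j} 0\<^esub>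
   (\<ominus> \<one>) \<odot>\<^bsub>dsp P {k, l} {i, j} 0\<^esub> M1 p c e f i l k j) = \<zero>\<^bsub>dsp P {k, l} {i, j} 0\<^esub>"

definition "pskR p k i j \<longleftrightarrow> pr p k j i = (\<ominus> \<one>) \<odot>\<^bsub>dsp P {k} {i, j} 0\<^esub> pr p k i j"
definition "cskR c k i j \<longleftrightarrow> co c k j i = (\<ominus> \<one>) \<odot>\<^bsub>dsp P {i, j} {k} 0\<^esub> co c k i j"

context
  fixes p c and e f i j k l :: nat
  assumes p: "p \<in> dprods" and c: "c \<in> dcoprods" and d: "distinct [e, f, i, j, k, l]"
begin

lemma cyc_sets: "{j, k, i} = {i, j, k}" "{k, i, j} = {i, j, k}" "{l, k} = {k, l}" "{j, i} = {i, j}"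
  by auto

lemma cyc_perms:
  "distinct [e, f, i, j, l, k]" "distinct [e, f, j, k, l, i]" "distinct [e, f, k, i, l, j]"
  "distinct [e, f, j, i, l, k]" "distinct [e, f, j, i, k, l]" "distinct [e, f, i, j, k, l]"
  using d by auto

lemma composites_closed':
  "QA p e f l i j k \<in> carrier (dsp P {l} {i, j, k} 0)" "QA p e f l j k i \<in> carrier (dsp P {l} {i, j, k} 0)"
  "QA p e f l k i j \<in> carrier (dsp P {l} {i, j, k} 0)" "QB p e f l j k i \<in> carrier (dsp P {l} {i, j, k} 0)"
  "CA c e f l i j k \<in> carrier (dsp P {i, j, k} {l} 0)" "CA c e f l j k i \<in> carrier (dsp P {i, j, k} {l} 0)"
  "CA c e f l k i j \<in> carrier (dsp P {i, j, k} {l} 0)" "CB c e f l j k i \<in> carrier (dsp P {i, j, k} {l} 0)"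
  "PC p c e f i j k l \<in> carrier (dsp P {k, l} {i, j} 0)"
  "M2 p c e f j l k i \<in> carrier (dsp P {k, l} {i, j} 0)" "M4 p c e f j k l i \<in> carrier (dsp P {k, l} {i, j} 0)"
  "M2 p c e f i l k j \<in> carrier (dsp P {k, l} {i, j} 0)" "M4 p c e f i k l j \<in> carrier (dsp P {k, l} {i, j} 0)"
  "M3 p c e f i k l j \<in> carrier (dsp P {k, l} {i, j} 0)" "M4 p c e f j l k i \<in> carrier (dsp P {k, l} {i, j} 0)"
  "M1 p c e f j k l i \<in> carrier (dsp P {k, l} {i, j} 0)" "M1 p c e f i l k j \<in> carrier (dsp P {k, l} {i, j} 0)"
  using composites_closed[OF p c cyc_perms(1)] composites_closed[OF p c cyc_perms(2)]
    composites_closed[OF p c cyc_perms(3)] composites_closed[OF p c cyc_perms(4)]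
    composites_closed[OF p c cyc_perms(5)] composites_closed[OF p c cyc_perms(6)]
  unfolding cyc_sets by blast+

context
  fixes \<sigma> :: "nat \<Rightarrow> nat"
  assumes s: "inj_on \<sigma> (set [e, f, i, j, k, l])"
begin

lemma composites_act':
  "dact P {l} {i, j, k} 0 \<sigma> (QA p e f l i j k) = QA p (\<sigma> e) (\<sigma> f) (\<sigma> l) (\<sigma> i) (\<sigma> j) (\<sigma> k)"
  "dact P {l} {i, j, k} 0 \<sigma> (QA p e f l j k i) = QA p (\<sigma> e) (\<sigma> f) (\<sigma> l) (\<sigma> j) (\<sigma> k) (\<sigma> i)"
  "dact P {l} {i, j, k} 0 \<sigma> (QA p e f l k i j) = QA p (\<sigma> e) (\<sigma> f) (\<sigma> l) (\<sigma> k) (\<sigma> i) (\<sigma> j)"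
  "dact P {l} {i, j, k} 0 \<sigma> (QB p e f l j k i) = QB p (\<sigma> e) (\<sigma> f) (\<sigma> l) (\<sigma> j) (\<sigma> k) (\<sigma> i)"
  "dact P {i, j, k} {l} 0 \<sigma> (CA c e f l i j k) = CA c (\<sigma> e) (\<sigma> f) (\<sigma> l) (\<sigma> i) (\<sigma> j) (\<sigma> k)"
  "dact P {i, j, k} {l} 0 \<sigma> (CA c e f l j k i) = CA c (\<sigma> e) (\<sigma> f) (\<sigma> l) (\<sigma> j) (\<sigma> k) (\<sigma> i)"
  "dact P {i, j, k} {l} 0 \<sigma> (CA c e f l k i j) = CA c (\<sigma> e) (\<sigma> f) (\<sigma> l) (\<sigma> k) (\<sigma> i) (\<sigma> j)"
  "dact P {i, j, k} {l} 0 \<sigma> (CB c e f l j k i) = CB c (\<sigma> e) (\<sigma> f) (\<sigma> l) (\<sigma> j) (\<sigma> k) (\<sigma> i)"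
  "dact P {k, l} {i, j} 0 \<sigma> (PC p c e f i j k l) = PC p c (\<sigma> e) (\<sigma> f) (\<sigma> i) (\<sigma> j) (\<sigma> k) (\<sigma> l)"
  "dact P {k, l} {i, j} 0 \<sigma> (M2 p c e f j l k i) = M2 p c (\<sigma> e) (\<sigma> f) (\<sigma> j) (\<sigma> l) (\<sigma> k) (\<sigma> i)"
  "dact P {k, l} {i, j} 0 \<sigma> (M4 p c e f j k l i) = M4 p c (\<sigma> e) (\<sigma> f) (\<sigma> j) (\<sigma> k) (\<sigma> l) (\<sigma> i)"
  "dact P {k, l} {i, j} 0 \<sigma> (M2 p c e f i l k j) = M2 p c (\<sigma> e) (\<sigma> f) (\<sigma> i) (\<sigma> l) (\<sigma> k) (\<sigma> j)"
  "dact P {k, l} {i, j} 0 \<sigma> (M4 p c e f i k l j) = M4 p c (\<sigma> e) (\<sigma> f) (\<sigma> i) (\<sigma> k) (\<sigma> l) (\<sigma> j)"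
  "dact P {k, l} {i, j} 0 \<sigma> (M3 p c e f i k l j) = M3 p c (\<sigma> e) (\<sigma> f) (\<sigma> i) (\<sigma> k) (\<sigma> l) (\<sigma> j)"
  "dact P {k, l} {i, j} 0 \<sigma> (M4 p c e f j l k i) = M4 p c (\<sigma> e) (\<sigma> f) (\<sigma> j) (\<sigma> l) (\<sigma> k) (\<sigma> i)"
  "dact P {k, l} {i, j} 0 \<sigma> (M1 p c e f j k l i) = M1 p c (\<sigma> e) (\<sigma> f) (\<sigma> j) (\<sigma> k) (\<sigma> l) (\<sigma> i)"
  "dact P {k, l} {i, j} 0 \<sigma> (M1 p c e f i l k j) = M1 p c (\<sigma> e) (\<sigma> f) (\<sigma> i) (\<sigma> l) (\<sigma> k) (\<sigma> j)"
proof -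
  have s': "inj_on \<sigma> (set [e, f, i, j, l, k])" "inj_on \<sigma> (set [e, f, j, k, l, i])"
    "inj_on \<sigma> (set [e, f, k, i, l, j])" "inj_on \<sigma> (set [e, f, j, i, l, k])"
    "inj_on \<sigma> (set [e, f, j, i, k, l])" "inj_on \<sigma> (set [e, f, i, j, k, l])"
    by (rule inj_on_subset[OF s], force)+
  note a = composites_act[OF p c]
  note A = a[OF cyc_perms(1) s'(1), unfolded cyc_sets] a[OF cyc_perms(2) s'(2), unfolded cyc_sets]
    a[OF cyc_perms(3) s'(3), unfolded cyc_sets] a[OF cyc_perms(4) s'(4), unfolded cyc_sets]
    a[OF cyc_perms(5) s'(5), unfolded cyc_sets] a[OF cyc_perms(6) s'(6), unfolded cyc_sets]
  show
  "dact P {l} {i, j, k} 0 \<sigma> (QA p e f l i j k) = QA p (\<sigma> e) (\<sigma> f) (\<sigma> l) (\<sigma> i) (\<sigma> j) (\<sigma> k)"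
  "dact P {l} {i, j, k} 0 \<sigma> (QA p e f l j k i) = QA p (\<sigma> e) (\<sigma> f) (\<sigma> l) (\<sigma> j) (\<sigma> k) (\<sigma> i)"
  "dact P {l} {i, j, k} 0 \<sigma> (QA p e f l k i j) = QA p (\<sigma> e) (\<sigma> f) (\<sigma> l) (\<sigma> k) (\<sigma> i) (\<sigma> j)"
  "dact P {l} {i, j, k} 0 \<sigma> (QB p e f l j k i) = QB p (\<sigma> e) (\<sigma> f) (\<sigma> l) (\<sigma> j) (\<sigma> k) (\<sigma> i)"
  "dact P {i, j, k} {l} 0 \<sigma> (CA c e f l i j k) = CA c (\<sigma> e) (\<sigma> f) (\<sigma> l) (\<sigma> i) (\<sigma> j) (\<sigma> k)"
  "dact P {i, j, k} {l} 0 \<sigma> (CA c e f l j k i) = CA c (\<sigma> e) (\<sigma> f) (\<sigma> l) (\<sigma> j) (\<sigma> k) (\<sigma> i)"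
  "dact P {i, j, k} {l} 0 \<sigma> (CA c e f l k i j) = CA c (\<sigma> e) (\<sigma> f) (\<sigma> l) (\<sigma> k) (\<sigma> i) (\<sigma> j)"
  "dact P {i, j, k} {l} 0 \<sigma> (CB c e f l j k i) = CB c (\<sigma> e) (\<sigma> f) (\<sigma> l) (\<sigma> j) (\<sigma> k) (\<sigma> i)"
  "dact P {k, l} {i, j} 0 \<sigma> (PC p c e f i j k l) = PC p c (\<sigma> e) (\<sigma> f) (\<sigma> i) (\<sigma> j) (\<sigma> k) (\<sigma> l)"
  "dact P {k, l} {i, j} 0 \<sigma> (M2 p c e f j l k i) = M2 p c (\<sigma> e) (\<sigma> f) (\<sigma> j) (\<sigma> l) (\<sigma> k) (\<sigma> i)"
  "dact P {k, l} {i, j} 0 \<sigma> (M4 p c e f j k l i) = M4 p c (\<sigma> e) (\<sigma> f) (\<sigma> j) (\<sigma> k) (\<sigma> l) (\<sigma> i)"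
  "dact P {k, l} {i, j} 0 \<sigma> (M2 p c e f i l k j) = M2 p c (\<sigma> e) (\<sigma> f) (\<sigma> i) (\<sigma> l) (\<sigma> k) (\<sigma> j)"
  "dact P {k, l} {i, j} 0 \<sigma> (M4 p c e f i k l j) = M4 p c (\<sigma> e) (\<sigma> f) (\<sigma> i) (\<sigma> k) (\<sigma> l) (\<sigma> j)"
  "dact P {k, l} {i, j} 0 \<sigma> (M3 p c e f i k l j) = M3 p c (\<sigma> e) (\<sigma> f) (\<sigma> i) (\<sigma> k) (\<sigma> l) (\<sigma> j)"
  "dact P {k, l} {i, j} 0 \<sigma> (M4 p c e f j l k i) = M4 p c (\<sigma> e) (\<sigma> f) (\<sigma> j) (\<sigma> l) (\<sigma> k) (\<sigma> i)"
  "dact P {k, l} {i, j} 0 \<sigma> (M1 p c e f j k l i) = M1 p c (\<sigma> e) (\<sigma> f) (\<sigma> j) (\<sigma> k) (\<sigma> l) (\<sigma> i)"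
  "dact P {k, l} {i, j} 0 \<sigma> (M1 p c e f i l k j) = M1 p c (\<sigma> e) (\<sigma> f) (\<sigma> i) (\<sigma> l) (\<sigma> k) (\<sigma> j)"
    by (rule A)+
qed

lemma biflags4: "biflags {l} {i, j, k}" "biflags {i, j, k} {l}" "biflags {k, l} {i, j}"
  using d by (auto simp: biflags_def)

lemma lin4:
  "lin_map K (dsp P {l} {i, j, k} 0) (dsp P {\<sigma> l} {\<sigma> i, \<sigma> j, \<sigma> k} 0) (dact P {l} {i, j, k} 0 \<sigma>)"
  "lin_map K (dsp P {i, j, k} {l} 0) (dsp P {\<sigma> i, \<sigma> j, \<sigma> k} {\<sigma> l} 0) (dact P {i, j, k} {l} 0 \<sigma>)"
  "lin_map K (dsp P {k, l} {i, j} 0) (dsp P {\<sigma> k, \<sigma> l} {\<sigma> i, \<sigma> j} 0) (dact P {k, l} {i, j} 0 \<sigma>)"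
proof -
  have "inj_on \<sigma> ({l} \<union> {i, j, k})" "inj_on \<sigma> ({i, j, k} \<union> {l})" "inj_on \<sigma> ({k, l} \<union> {i, j})"
    by (rule inj_on_subset[OF s], force)+
  from dact_linear[OF biflags4(1) this(1)] dact_linear[OF biflags4(2) this(2)] dact_linear[OF biflags4(3) this(3)]
  show
  "lin_map K (dsp P {l} {i, j, k} 0) (dsp P {\<sigma> l} {\<sigma> i, \<sigma> j, \<sigma> k} 0) (dact P {l} {i, j, k} 0 \<sigma>)"
  "lin_map K (dsp P {i, j, k} {l} 0) (dsp P {\<sigma> i, \<sigma> j, \<sigma> k} {\<sigma> l} 0) (dact P {i, j, k} {l} 0 \<sigma>)"
  "lin_map K (dsp P {k, l} {i, j} 0) (dsp P {\<sigma> k, \<sigma> l} {\<sigma> i, \<sigma> j} 0) (dact P {k, l} {i, j} 0 \<sigma>)"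
    by simp_all
qed

lemma biflags4': "biflags {\<sigma> l} {\<sigma> i, \<sigma> j, \<sigma> k}" "biflags {\<sigma> i, \<sigma> j, \<sigma> k} {\<sigma> l}"
    "biflags {\<sigma> k, \<sigma> l} {\<sigma> i, \<sigma> j}"
proof -
  have "distinct (map \<sigma> [e, f, i, j, k, l])" using d s by (rule distinct_inj)
  then show "biflags {\<sigma> l} {\<sigma> i, \<sigma> j, \<sigma> k}" "biflags {\<sigma> i, \<sigma> j, \<sigma> k} {\<sigma> l}"
    "biflags {\<sigma> k, \<sigma> l} {\<sigma> i, \<sigma> j}"
    by (auto simp: biflags_def)
qed

text \<open>A relation is an equation between linear combinations of composites. Relabelling is
  linear and acts on a composite by renaming its flags.\<close>

lemma relations_act:
  "jacR p e f l i j k \<Longrightarrow> jacR p (\<sigma> e) (\<sigma> f) (\<sigma> l) (\<sigma> i) (\<sigma> j) (\<sigma> k)"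
  "cojR c e f l i j k \<Longrightarrow> cojR c (\<sigma> e) (\<sigma> f) (\<sigma> l) (\<sigma> i) (\<sigma> j) (\<sigma> k)"
  "cocR p c e f i j k l \<Longrightarrow> cocR p c (\<sigma> e) (\<sigma> f) (\<sigma> i) (\<sigma> j) (\<sigma> k) (\<sigma> l)"
  "assR p e f l i j k \<Longrightarrow> assR p (\<sigma> e) (\<sigma> f) (\<sigma> l) (\<sigma> i) (\<sigma> j) (\<sigma> k)"
  "coaR c e f l i j k \<Longrightarrow> coaR c (\<sigma> e) (\<sigma> f) (\<sigma> l) (\<sigma> i) (\<sigma> j) (\<sigma> k)"
  "comR p c e f i j k l \<Longrightarrow> comR p c (\<sigma> e) (\<sigma> f) (\<sigma> i) (\<sigma> j) (\<sigma> k) (\<sigma> l)"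
  "balR p c e f i j k l \<Longrightarrow> balR p c (\<sigma> e) (\<sigma> f) (\<sigma> i) (\<sigma> j) (\<sigma> k) (\<sigma> l)"
proof -
  interpret A: module K "dsp P {l} {i, j, k} 0" by (rule dsp_module[OF biflags4(1)])
  interpret B: module K "dsp P {i, j, k} {l} 0" by (rule dsp_module[OF biflags4(2)])
  interpret C: module K "dsp P {k, l} {i, j} 0" by (rule dsp_module[OF biflags4(3)])
  note z = lin_map_zero[OF lin4(1) A.module_axioms dsp_module[OF biflags4'(1)]]
    lin_map_zero[OF lin4(2) B.module_axioms dsp_module[OF biflags4'(2)]]
    lin_map_zero[OF lin4(3) C.module_axioms dsp_module[OF biflags4'(3)]]
  note [simp] = composites_closed' composites_act' lin_map_add[OF lin4(1)] lin_map_add[OF lin4(2)]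
    lin_map_add[OF lin4(3)] lin_map_scale[OF lin4(3)] z
  show "jacR p e f l i j k \<Longrightarrow> jacR p (\<sigma> e) (\<sigma> f) (\<sigma> l) (\<sigma> i) (\<sigma> j) (\<sigma> k)"
    unfolding jacR_def by (drule arg_cong[where f="dact P {l} {i, j, k} 0 \<sigma>"]) simp
  show "cojR c e f l i j k \<Longrightarrow> cojR c (\<sigma> e) (\<sigma> f) (\<sigma> l) (\<sigma> i) (\<sigma> j) (\<sigma> k)"
    unfolding cojR_def by (drule arg_cong[where f="dact P {i, j, k} {l} 0 \<sigma>"]) simp
  show "cocR p c e f i j k l \<Longrightarrow> cocR p c (\<sigma> e) (\<sigma> f) (\<sigma> i) (\<sigma> j) (\<sigma> k) (\<sigma> l)"
    unfolding cocR_def by (drule arg_cong[where f="dact P {k, l} {i, j} 0 \<sigma>"]) simp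
  show "assR p e f l i j k \<Longrightarrow> assR p (\<sigma> e) (\<sigma> f) (\<sigma> l) (\<sigma> i) (\<sigma> j) (\<sigma> k)"
    unfolding assR_def by (drule arg_cong[where f="dact P {l} {i, j, k} 0 \<sigma>"]) simp
  show "coaR c e f l i j k \<Longrightarrow> coaR c (\<sigma> e) (\<sigma> f) (\<sigma> l) (\<sigma> i) (\<sigma> j) (\<sigma> k)"
    unfolding coaR_def by (drule arg_cong[where f="dact P {i, j, k} {l} 0 \<sigma>"]) simp
  show "comR p c e f i j k l \<Longrightarrow> comR p c (\<sigma> e) (\<sigma> f) (\<sigma> i) (\<sigma> j) (\<sigma> k) (\<sigma> l)"
    unfolding comR_def by (drule arg_cong[where f="dact P {k, l} {i, j} 0 \<sigma>"]) simp
  show "balR p c e f i j k l \<Longrightarrow> balR p c (\<sigma> e) (\<sigma> f) (\<sigma> i) (\<sigma> j) (\<sigma> k) (\<sigma> l)"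
    unfolding balR_def by (drule arg_cong[where f="dact P {k, l} {i, j} 0 \<sigma>"]) simp
qed

end

end

text \<open>A relation that holds for one choice of distinct flags holds for every choice, since
  some injection carries the first names to the second.\<close>

lemma relations_relabel:
  assumes p: "p \<in> dprods" and c: "c \<in> dcoprods" and d: "distinct [e, f, i, j, k, l]"
    and d': "distinct [e', f', i', j', k', l']"
  shows
  "jacR p e f l i j k \<Longrightarrow> jacR p e' f' l' i' j' k'"
  "cojR c e f l i j k \<Longrightarrow> cojR c e' f' l' i' j' k'"
  "cocR p c e f i j k l \<Longrightarrow> cocR p c e' f' i' j' k' l'"
  "assR p e f l i j k \<Longrightarrow> assR p e' f' l' i' j' k'"
  "coaR c e f l i j k \<Longrightarrow> coaR c e' f' l' i' j' k'"
  "comR p c e f i j k l \<Longrightarrow> comR p c e' f' i' j' k' l'"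
  "balR p c e f i j k l \<Longrightarrow> balR p c e' f' i' j' k' l'"
proof -
  obtain \<sigma> where s: "inj_on \<sigma> (set [e, f, i, j, k, l])" and m: "map \<sigma> [e, f, i, j, k, l] = [e', f', i', j', k', l']"
    using d d' by (rule relabelling) simp
  from m have m: "\<sigma> e = e'" "\<sigma> f = f'" "\<sigma> i = i'" "\<sigma> j = j'" "\<sigma> k = k'" "\<sigma> l = l'" by simp_all
  note r = relations_act[OF p c d s, unfolded m]
  show
  "jacR p e f l i j k \<Longrightarrow> jacR p e' f' l' i' j' k'"
  "cojR c e f l i j k \<Longrightarrow> cojR c e' f' l' i' j' k'"
  "cocR p c e f i j k l \<Longrightarrow> cocR p c e' f' i' j' k' l'"
  "assR p e f l i j k \<Longrightarrow> assR p e' f' l' i' j' k'"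
  "coaR c e f l i j k \<Longrightarrow> coaR c e' f' l' i' j' k'"
  "comR p c e f i j k l \<Longrightarrow> comR p c e' f' i' j' k' l'"
  "balR p c e f i j k l \<Longrightarrow> balR p c e' f' i' j' k' l'"
    by (rule r; assumption)+
qed

lemma skew_relabel:
  assumes p: "p \<in> dprods" and c: "c \<in> dcoprods" and d: "distinct [k, i, j]" and d': "distinct [k', i', j']"
  shows "pskR p k i j \<Longrightarrow> pskR p k' i' j'" "cskR c k i j \<Longrightarrow> cskR c k' i' j'"
proof -
  obtain \<sigma> where s: "inj_on \<sigma> (set [k, i, j])" and m: "map \<sigma> [k, i, j] = [k', i', j']"
    using d d' by (rule relabelling) simp
  from m have m: "\<sigma> k = k'" "\<sigma> i = i'" "\<sigma> j = j'" by simp_all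
  have s2: "inj_on \<sigma> {k, i, j}" "inj_on \<sigma> {k, j, i}" "inj_on \<sigma> ({k} \<union> {i, j})" "inj_on \<sigma> ({i, j} \<union> {k})"
    by (rule inj_on_subset[OF s], force)+
  have d2: "distinct [k, j, i]" using d by auto
  have h: "{j, i} = {i, j}" by auto
  note b = biflags_ternary[OF d]
  note lin = dact_linear[OF conjunct1[OF b] s2(3), of 0] dact_linear[OF conjunct2[OF b] s2(4), of 0]
  show "pskR p k i j \<Longrightarrow> pskR p k' i' j'"
    unfolding pskR_def using pr_act[OF p d s2(1)] pr_act[OF p d2 s2(2)] lin_map_scale[OF lin(1) _ pr_closed[OF p d], of "\<ominus> \<one>"]
    by (simp add: m h)
  show "cskR c k i j \<Longrightarrow> cskR c k' i' j'"
    unfolding cskR_def using co_act[OF c d s2(1)] co_act[OF c d2 s2(2)] lin_map_scale[OF lin(2) _ co_closed[OF c d], of "\<ominus> \<one>"]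
    by (simp add: m h)
qed

end

lemma (in abelian_group) diff_zero_iff:
  assumes "x \<in> carrier G" "y \<in> carrier G"
  shows "x \<oplus> \<ominus> y = \<zero> \<longleftrightarrow> x = y"
  using assms minus_equality[of x "\<ominus> y"] by (auto simp: r_neg)

lemma splits4_cases:
  assumes "A \<in> splits {i, j, k, l}"
  shows "A \<in> {{i}, {j}, {k}, {l}, {i, j, k}, {i, j, l}, {i, k, l}, {j, k, l},
    {i, j}, {j, k}, {k, l}, {i, l}, {i, k}, {j, l}}"
proof -
  have "A \<in> Pow {i, j, k, l}" "A \<noteq> {}" "A \<noteq> {i, j, k, l}" using assms by (auto simp: splits_def)
  then show ?thesis by (simp add: Pow_insert) metis
qed

section \<open>Associativity and the relations of \<open>Bal\<close>\<close>

context dioperad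
begin

context
  fixes v p c
  assumes tri: "tri v p c"
begin

text \<open>Interchanging \<open>e\<close> and \<open>f\<close> fixes the external flags. After this
  renaming, rotating both vertices and commuting the two factors of degree zero turns one composite
  into the other.\<close>

lemma glued_swap:
  assumes d: "distinct [e, f, i, j, k, l]"
  shows "glued v e f k l i j = glued v e f i j k l"
proof -
  define \<sigma> where "\<sigma> = id(e := f, f := e)"
  have s: "\<sigma> e = f" "\<sigma> f = e" "\<sigma> i = i" "\<sigma> j = j" "\<sigma> k = k" "\<sigma> l = l"
    using d by (auto simp: \<sigma>_def)
  note cl = tri_closed[OF tri]
  have D: "distinct [i, j, e]" "distinct [f, k, l]" "distinct [k, l, e]" "distinct [f, i, j]"
    "distinct [f, k, l]" "distinct [e, i, j]" "distinct [e, f, k, l, i, j]"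
    using d by auto
  have inj: "inj_on \<sigma> {k, l, e}" "inj_on \<sigma> {f, i, j}" "inj_on \<sigma> ({k, l, e} \<union> {f, i, j})"
    using d s by (auto simp: inj_on_def)
  have g: "cglue {i, j, e} e {f, k, l} f" "cglue {k, l, e} e {f, i, j} f" using d by (auto simp: cglue_def)
  have N: "{k, l, e} - {e} \<union> ({f, i, j} - {f}) = {k, l, i, j}" "{i, j, e} - {e} \<union> ({f, k, l} - {f}) = {k, l, i, j}"
    using d by auto
  note h = gg_closed[OF cl D(1)] gg_closed[OF cl D(2)] gg_closed[OF cl D(3)] gg_closed[OF cl D(4)]
  have X: "glued v e f k l i j \<in> carrier (csp L {k, l, i, j} 0)" by (rule glued_closed[OF tri D(7)])
  have "glued v e f k l i j = cact L {k, l, i, j} 0 id (glued v e f k l i j)"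
    by (rule cyclic_operad.cact_id[OF cyclic_operad_L _ X, symmetric]) simp
  also have "\<dots> = cact L {k, l, i, j} 0 \<sigma> (glued v e f k l i j)"
    by (rule cyclic_operad.cact_cong[OF cyclic_operad_L _ _ _ X]) (auto simp: s)
  also have "\<dots> = ccomp L (\<sigma> ` {k, l, e}) 0 (\<sigma> e) (\<sigma> ` {f, i, j}) 0 (\<sigma> f)
      (cact L {k, l, e} 0 \<sigma> (gg v k l e)) (cact L {f, i, j} 0 \<sigma> (gg v f i j))"
    using ccomp_cact[OF g(2) inj(3) h(3,4) N(1)[symmetric]] by (simp add: glued_def[OF tri])
  also have "\<dots> = ccomp L {k, l, f} 0 f {e, i, j} 0 e (gg v k l f) (gg v e i j)"
    using gg_act[OF cl D(3) inj(1)] gg_act[OF cl D(4) inj(2)] by (simp add: s)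
  also have "\<dots> = ccomp L {f, k, l} 0 f {i, j, e} 0 e (gg v f k l) (gg v i j e)"
    using gg_rot[OF tri D(2)] gg_rot[OF tri D(6)] by (simp add: insert_commute)
  also have "\<dots> = glued v e f i j k l"
  proof -
    interpret M: module K "csp L {k, l, i, j} 0" by (rule phi_lower_module) simp
    have "ccomp L {f, k, l} 0 f {i, j, e} 0 e (gg v f k l) (gg v i j e) \<in> carrier (csp L {k, l, i, j} 0)"
      using ccomp_closed[OF cglue_sym[OF g(1)] h(2,1)] N(2) by (simp add: Un_commute)
    then show ?thesis
      using ccomp_commute[OF g(1) h(1,2)] unfolding glued_def[OF tri] N(2) by simp
  qed
  finally show ?thesis .
qed

text \<open>The two composites are the two ways to cut the cyclic word \<open>i j k l\<close> into
  pairs of neighbours. One component of each kind is treated here; the others arise by rotating the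
  word.\<close>

lemma assoc_comps:
  assumes d: "distinct [e, f, i, j, k, l]"
  shows "glued v e f i j k l {l} = glued v e f j k l i {l} \<longleftrightarrow> assR p e f l i j k"
    "glued v e f i j k l {i, j, k} = glued v e f j k l i {i, j, k} \<longleftrightarrow> coaR c e f l k j i"
    "glued v e f i j k l {k, l} = glued v e f j k l i {k, l} \<longleftrightarrow> comR p c e f i j l k"
    "glued v e f i j k l {j, l} = glued v e f j k l i {j, l} \<longleftrightarrow> balR p c e f i k l j"
proof -
  have d2: "distinct [e, f, j, k, l, i]" using d by auto
  note x = glued_comps[OF tri d] and y = glued_comps[OF tri d2]
  have h: "{j, k, i} = {i, j, k}" "{l, k} = {k, l}" "{j, i} = {i, j}" "{l, j} = {j, l}" "{k, i} = {i, k}" by auto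
  note y4 = y(4)[unfolded h(1)]
  note y = y[unfolded h]
  show "glued v e f i j k l {l} = glued v e f j k l i {l} \<longleftrightarrow> assR p e f l i j k"
    unfolding x(1) y(2) assR_def ..
  show "glued v e f i j k l {i, j, k} = glued v e f j k l i {i, j, k} \<longleftrightarrow> coaR c e f l k j i"
    unfolding x(3) y4 coaR_def by (rule eq_commute)
  show "glued v e f i j k l {k, l} = glued v e f j k l i {k, l} \<longleftrightarrow> comR p c e f i j l k"
    unfolding x(5) y(8) comR_def h ..
  have b: "biflags {j, l} {i, k}" using d by (auto simp: biflags_def)
  interpret M: module K "dsp P {j, l} {i, k} 0" by (rule dsp_module[OF b])
  have d3: "distinct [e, f, i, k, l, j]" using d by auto
  \<comment> \<open>Equality of two sums is rearranged into the vanishing sum of differences by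
    which the balanceator is stated.\<close>
  have a: "a \<oplus>\<^bsub>M\<^esub> b = c \<oplus>\<^bsub>M\<^esub> d \<longleftrightarrow>
      (c \<oplus>\<^bsub>M\<^esub> (\<ominus> \<one>) \<odot>\<^bsub>M\<^esub> b) \<oplus>\<^bsub>M\<^esub> (d \<oplus>\<^bsub>M\<^esub> (\<ominus> \<one>) \<odot>\<^bsub>M\<^esub> a) = \<zero>\<^bsub>M\<^esub>"
    if M: "module K M" and m: "a \<in> carrier M" "b \<in> carrier M" "c \<in> carrier M" "d \<in> carrier M" for M :: "('k, 'v) module" and a b c d
  proof -
    interpret M: module K M by fact
    have "(c \<oplus>\<^bsub>M\<^esub> \<ominus>\<^bsub>M\<^esub> b) \<oplus>\<^bsub>M\<^esub> (d \<oplus>\<^bsub>M\<^esub> \<ominus>\<^bsub>M\<^esub> a) = (c \<oplus>\<^bsub>M\<^esub> d) \<oplus>\<^bsub>M\<^esub> \<ominus>\<^bsub>M\<^esub> (a \<oplus>\<^bsub>M\<^esub> b)"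
      using m by (simp add: M.a_ac M.minus_add)
    then show ?thesis using m by (auto simp: module_minus[OF M] M.diff_zero_iff)
  qed
  show "glued v e f i j k l {j, l} = glued v e f j k l i {j, l} \<longleftrightarrow> balR p c e f i k l j"
    unfolding x(6) y(9) balR_def h
    using composites_closed'[OF p_closed[OF tri] c_closed[OF tri] d3] unfolding h
    by (intro a M.module_axioms)
qed

text \<open>From left to right, one component of each kind and a change of names suffice. Conversely
  the relations give every component for all four rotations, which are instances of the same
  equation.\<close>

theorem assoc_equiv:
  "glued v 4 5 1 2 3 0 = glued v 4 5 2 3 0 1 \<longleftrightarrow>
    assR p 5 6 0 1 2 3 \<and> coaR c 5 6 0 1 2 3 \<and> comR p c 5 6 1 2 3 4 \<and> balR p c 5 6 1 2 3 4"
  (is "?l \<longleftrightarrow> ?r")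
proof
  note pc = p_closed[OF tri] c_closed[OF tri]
  note rel = relations_relabel[OF pc]
  { assume eq: ?l
    have d: "distinct [4, 5, 1, 2, 3, 0 :: nat]" by simp
    note c = assoc_comps[OF d, THEN iffD1, OF arg_cong[where f="\<lambda>F. F _", OF eq]]
    show ?r
      using rel(4)[OF _ _ c(1), of 5 6 1 2 3 0] rel(5)[OF _ _ c(2), of 5 6 1 2 3 0]
        rel(6)[OF _ _ c(3), of 5 6 1 2 3 4] rel(7)[OF _ _ c(4), of 5 6 1 2 3 4] by simp }
  { assume r: ?r
    have c: "assR p 4 5 l i j k" "coaR c 4 5 l k j i" "comR p c 4 5 i j l k" "balR p c 4 5 i k l j"
      if "distinct [4, 5, i, j, k, l]" for i j k l
      using r that rel(4)[of 5 6 1 2 3 0 4 5 i j k l] rel(5)[of 5 6 1 2 3 0 4 5 k j i l]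
        rel(6)[of 5 6 1 2 3 4 4 5 i j l k] rel(7)[of 5 6 1 2 3 4 4 5 i k l j] by auto
    note E = assoc_comps(1)[THEN iffD2, OF _ c(1)] assoc_comps(2)[THEN iffD2, OF _ c(2)]
      assoc_comps(3)[THEN iffD2, OF _ c(3)] assoc_comps(4)[THEN iffD2, OF _ c(4)]
    have d: "distinct [4, 5, 1, 2, 3, 0 :: nat]" "distinct [4, 5, 2, 3, 0, 1 :: nat]"
      "distinct [4, 5, 3, 0, 1, 2 :: nat]" "distinct [4, 5, 0, 1, 2, 3 :: nat]" by simp_all
    \<comment> \<open>Rotating by two places exchanges the pairs and gives back the same composite,
      so each rotation compares the same two composites. One, three or two adjacent outputs need
      four rotations each, two opposite outputs need two: fourteen components.\<close>
    have sw: "glued v 4 5 3 0 1 2 = glued v 4 5 1 2 3 0" "glued v 4 5 0 1 2 3 = glued v 4 5 2 3 0 1"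
      using glued_swap[OF d(1)] glued_swap[OF d(2)] by simp_all
    show ?l
    proof (rule phi_lower_ext[of _ "{1, 2, 3, 0}"])
      show "glued v 4 5 1 2 3 0 \<in> extensional (splits {1, 2, 3, 0})"
        using glued_closed[OF tri d(1)] by (simp add: phi_lower_carrier)
      have "{1, 2, 3, 0} = {2, 3, 0, 1::nat}" by auto
      then show "glued v 4 5 2 3 0 1 \<in> extensional (splits {1, 2, 3, 0})"
        using glued_closed[OF tri d(2)] by (simp add: phi_lower_carrier)
      fix A assume "A \<in> splits {1, 2, 3, 0 :: nat}"
      from splits4_cases[OF this] show "glued v 4 5 1 2 3 0 A = glued v 4 5 2 3 0 1 A"
        using E(1)[OF d(1) d(1)] E(1)[OF d(2) d(2)] E(1)[OF d(3) d(3)] E(1)[OF d(4) d(4)]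
          E(2)[OF d(1) d(1)] E(2)[OF d(2) d(2)] E(2)[OF d(3) d(3)] E(2)[OF d(4) d(4)]
          E(3)[OF d(1) d(1)] E(3)[OF d(2) d(2)] E(3)[OF d(3) d(3)] E(3)[OF d(4) d(4)]
          E(4)[OF d(1) d(1)] E(4)[OF d(2) d(2)]
        unfolding sw by (auto simp: insert_commute simp del: One_nat_def)
    qed }
qed

end

end

section \<open>The Jacobi identity and the relations of \<open>BiLie\<close>\<close>

context dioperad
begin

text \<open>Each vertex with reversed arguments costs a sign. \<open>M4\<close> has two of them, so
  its signs cancel. All composites with the same flags are thereby reduced to \<open>CA\<close> or
  \<open>M1\<close>.\<close>

lemma skew_composites:
  assumes p: "p \<in> dprods" and c: "c \<in> dcoprods" and d: "distinct [e, f, i, j, k, l]"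
    and ps: "pskR p 0 1 2" and cs: "cskR c 0 1 2"
  shows "CB c e f k i j l = (\<ominus> \<one>) \<odot>\<^bsub>dsp P {i, j, l} {k} 0\<^esub> CA c e f k i j l"
    "M2 p c e f i k l j = (\<ominus> \<one>) \<odot>\<^bsub>dsp P {k, l} {i, j} 0\<^esub> M1 p c e f i k l j"
    "M3 p c e f i k l j = (\<ominus> \<one>) \<odot>\<^bsub>dsp P {k, l} {i, j} 0\<^esub> M1 p c e f i k l j"
    "M4 p c e f i k l j = M1 p c e f i k l j"
proof -
  note g = dglue_ternary[OF p c d]
  note v = vertices[OF p c d]
  note st = composite_sets[OF p c d]
  have d0: "distinct [0, 1, 2::nat]" and ds: "distinct [k, e, l]" "distinct [i, e, k]" "distinct [l, f, j]"
    using d by auto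
  have c1: "co c k l e = (\<ominus> \<one>) \<odot>\<^bsub>dsp P {e, l} {k} 0\<^esub> co c k e l"
    and c2: "co c i k e = (\<ominus> \<one>) \<odot>\<^bsub>dsp P {e, k} {i} 0\<^esub> co c i e k"
    and p1: "pr p l j f = (\<ominus> \<one>) \<odot>\<^bsub>dsp P {l} {f, j} 0\<^esub> pr p l f j"
    using skew_relabel(2)[OF p c d0 ds(1) cs] skew_relabel(2)[OF p c d0 ds(2) cs]
      skew_relabel(1)[OF p c d0 ds(3) ps] by (simp_all add: pskR_def cskR_def)
  note b2 = dcomp_bilinear[OF g(2), of 0 0, folded st(3,4)]
  note b4 = dcomp_bilinear[OF g(4), of 0 0, folded st(7,8)]
  have n: "\<ominus> \<one> \<in> carrier K" by simp
  note [simp del] = One_nat_def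
  show "CB c e f k i j l = (\<ominus> \<one>) \<odot>\<^bsub>dsp P {i, j, l} {k} 0\<^esub> CA c e f k i j l"
    using lin_map_scale[OF bilin_map_left[OF b2 v(6)] n v(4)] by (simp add: CB_def CA_def c1)
  show m2: "M2 p c e f i k l j = (\<ominus> \<one>) \<odot>\<^bsub>dsp P {k, l} {i, j} 0\<^esub> M1 p c e f i k l j"
    using lin_map_scale[OF bilin_map_right[OF b4 v(8)] n v(10)] by (simp add: M1_def M2_def p1)
  show "M3 p c e f i k l j = (\<ominus> \<one>) \<odot>\<^bsub>dsp P {k, l} {i, j} 0\<^esub> M1 p c e f i k l j"
    using lin_map_scale[OF bilin_map_left[OF b4 v(10)] n v(8)] by (simp add: M1_def M3_def c2)
  have m4: "M4 p c e f i k l j = (\<ominus> \<one>) \<odot>\<^bsub>dsp P {k, l} {i, j} 0\<^esub> M2 p c e f i k l j"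
    using lin_map_scale[OF bilin_map_left[OF b4 v(11)] n v(8)] by (simp add: M4_def M2_def c2)
  have "biflags {k, l} {i, j}" using d by (auto simp: biflags_def)
  then interpret M: module K "dsp P {k, l} {i, j} 0" by (rule dsp_module)
  show "M4 p c e f i k l j = M1 p c e f i k l j"
    using composites_closed(6)[OF p c d] unfolding m4 m2
    by (simp add: module_minus[OF M.module_axioms])
qed

context
  fixes v p c
  assumes tri: "tri v p c"
begin

lemma skew_iff:
  "gg v 1 0 2 = (\<ominus> \<one>) \<odot>\<^bsub>csp L {0, 1, 2} 0\<^esub> gg v 0 1 2 \<longleftrightarrow> pskR p 0 1 2 \<and> cskR c 0 1 2"
  (is "?l \<longleftrightarrow> ?r")
proof
  note P = p_closed[OF tri] and C = c_closed[OF tri]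
  have d0: "distinct [0, 1, 2::nat]" "distinct [1, 0, 2::nat]" "distinct [2, 0, 1 :: nat]" by auto
  note g = gg_comps[OF tri d0(1)] and g' = gg_comps[OF tri d0(2)]
  note s = splits3[OF d0(1)]
  have h: "{1, 0} = {0, 1::nat}" by auto
  note [simp del] = One_nat_def
  { assume eq: ?l
    \<comment> \<open>The transposed flags lie on the same side in the components \<open>{2}\<close>
      and \<open>{0, 1}\<close>, as the two inputs and the two outputs; there the equation is
      antisymmetry of product and coproduct.\<close>
    have "pskR p 2 0 1" "cskR c 2 1 0"
      using fun_cong[OF eq, of "{2}"] fun_cong[OF eq, of "{0, 1}"] g g' s
      by (simp_all add: pskR_def cskR_def phi_lower_simps h)
    then show ?r
      using skew_relabel[OF P C d0(3) d0(1)] skew_relabel[OF P C _ d0(1), of 2 1 0] by simp }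
  { assume r: ?r
    have ps: "pskR p k i j" "cskR c k i j" if "distinct [k, i, j]" for k i j
      using r skew_relabel[OF P C d0(1) that] by auto
    show ?l
    proof (rule phi_lower_ext[of _ "{0, 1, 2}"])
      have "{1, 0, 2} = {0, 1, 2::nat}" by auto
      then show "gg v 1 0 2 \<in> extensional (splits {0, 1, 2})"
        using gg_closed[OF tri_closed[OF tri] d0(2)] by (simp add: phi_lower_carrier)
      fix A assume "A \<in> splits {0, 1, 2 :: nat}"
      have h': "{2, 0} = {0, 2::nat}" "{2, 1} = {1, 2::nat}" by auto
      note q = ps(1)[of 2 0 1] ps(1)[of 1 2 0] ps(1)[of 0 1 2] ps(2)[of 2 1 0] ps(2)[of 1 0 2] ps(2)[of 0 2 1]
      from splits3_cases[OF \<open>A \<in> splits {0, 1, 2}\<close>]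
      show "gg v 1 0 2 A = ((\<ominus> \<one>) \<odot>\<^bsub>csp L {0, 1, 2} 0\<^esub> gg v 0 1 2) A"
        using q unfolding pskR_def cskR_def
        by (elim insertE emptyE; simp add: phi_lower_simps h h' g g'[unfolded h] s)
    qed (simp add: phi_lower_simps) }
qed

text \<open>The cyclic word \<open>i, j, k\<close> is summed over with \<open>l\<close> kept last;
  that \<open>l\<close> is not really distinguished is the content of
  \<open>jacobiator_swap\<close>.\<close>

definition jacobiator :: "nat \<Rightarrow> nat \<Rightarrow> nat \<Rightarrow> nat \<Rightarrow> nat \<Rightarrow> nat \<Rightarrow> nat set \<Rightarrow> 'v" where
  "jacobiator e f i j k l = glued v e f i j k l \<oplus>\<^bsub>csp L {i, j, k, l} 0\<^esub>
    (glued v e f j k i l \<oplus>\<^bsub>csp L {i, j, k, l} 0\<^esub> glued v e f k i j l)"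

lemma jacobiator_cyc:
  assumes d: "distinct [e, f, i, j, k, l]"
  shows "jacobiator e f j k i l = jacobiator e f i j k l"
proof -
  have h: "{j, k, i, l} = {i, j, k, l}" "{k, i, j, l} = {i, j, k, l}" by auto
  interpret M: module K "csp L {i, j, k, l} 0" by (rule phi_lower_module) simp
  have D: "distinct [e, f, j, k, i, l]" "distinct [e, f, k, i, j, l]" using d by auto
  note X = glued_closed[OF tri d] glued_closed[OF tri D(1)] glued_closed[OF tri D(2)]
  show ?thesis using X unfolding jacobiator_def h by (simp add: M.a_ac)
qed

text \<open>Antisymmetry is assumed because gluing yields composites of all four mixed shapes and
  \<open>CB\<close>, whereas the relations of \<open>BiLie\<close> use a fixed selection of
  shapes.\<close>

lemma jacobiator_comps:
  assumes d: "distinct [e, f, i, j, k, l]" and ps: "pskR p 0 1 2" and cs: "cskR c 0 1 2"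
  shows "jacobiator e f i j k l {l} = \<zero>\<^bsub>dsp P {l} {i, j, k} 0\<^esub> \<longleftrightarrow> jacR p e f l i j k"
    "jacobiator e f i j k l {i, j, k} = \<zero>\<^bsub>dsp P {i, j, k} {l} 0\<^esub> \<longleftrightarrow> cojR c e f l j i k"
    "jacobiator e f i j k l {k, l} = \<zero>\<^bsub>dsp P {k, l} {i, j} 0\<^esub> \<longleftrightarrow> cocR p c e f i j l k"
proof -
  note pc = p_closed[OF tri] c_closed[OF tri]
  have D: "distinct [e, f, j, k, i, l]" "distinct [e, f, k, i, j, l]" using d by auto
  note x = glued_comps[OF tri d] and y = glued_comps[OF tri D(1)] and z = glued_comps[OF tri D(2)]
  note S = glued_splits[OF tri d] glued_sets[OF tri d]
  have J: "jacobiator e f i j k l A = glued v e f i j k l A \<oplus>\<^bsub>vs {i, j, k, l} A 0\<^esub>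
    (glued v e f j k i l A \<oplus>\<^bsub>vs {i, j, k, l} A 0\<^esub> glued v e f k i j l A)" if "A \<in> splits {i, j, k, l}" for A
    using that unfolding jacobiator_def by (simp add: phi_lower_simps)
  show "jacobiator e f i j k l {l} = \<zero>\<^bsub>dsp P {l} {i, j, k} 0\<^esub> \<longleftrightarrow> jacR p e f l i j k"
    unfolding J[OF S(1)] x(1) y(1) z(1) S(10) jacR_def ..
  have h3: "{j, k, i} = {i, j, k}" "{k, i, j} = {i, j, k}" by auto
  have b: "biflags {i, j, k} {l}" "biflags {k, l} {i, j}" using d by (auto simp: biflags_def)
  interpret B: module K "dsp P {i, j, k} {l} 0" by (rule dsp_module[OF b(1)])
  interpret C: module K "dsp P {k, l} {i, j} 0" by (rule dsp_module[OF b(2)])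
  have E: "distinct [e, f, j, i, l, k]" "distinct [e, f, k, j, l, i]" "distinct [e, f, i, k, l, j]" using d by auto
  note sk = skew_composites[OF pc _ ps cs]
  have h: "{j, i, k} = {i, j, k}" "{k, j, i} = {i, j, k}" "{i, k, j} = {i, j, k}" by auto
  have Cc: "CA c e f l j i k \<in> carrier (dsp P {i, j, k} {l} 0)" "CA c e f l k j i \<in> carrier (dsp P {i, j, k} {l} 0)"
    "CA c e f l i k j \<in> carrier (dsp P {i, j, k} {l} 0)"
    using composites_closed(3)[OF pc E(1)] composites_closed(3)[OF pc E(2)] composites_closed(3)[OF pc E(3)]
    unfolding h by auto
  \<comment> \<open>The components with three outputs carry a minus sign each, and their cyclic sum
    runs in the opposite order; neither affects vanishing.\<close>
  have e: "\<ominus>\<^bsub>M\<^esub> a \<oplus>\<^bsub>M\<^esub> (\<ominus>\<^bsub>M\<^esub> b \<oplus>\<^bsub>M\<^esub> \<ominus>\<^bsub>M\<^esub> c) = \<zero>\<^bsub>M\<^esub> \<longleftrightarrow> a \<oplus>\<^bsub>M\<^esub> (c \<oplus>\<^bsub>M\<^esub> b) = \<zero>\<^bsub>M\<^esub>"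
    if M: "module K M" and m: "a \<in> carrier M" "b \<in> carrier M" "c \<in> carrier M" for M :: "('k, 'v) module" and a b c
  proof -
    interpret M: module K M by fact
    have "\<ominus>\<^bsub>M\<^esub> a \<oplus>\<^bsub>M\<^esub> (\<ominus>\<^bsub>M\<^esub> b \<oplus>\<^bsub>M\<^esub> \<ominus>\<^bsub>M\<^esub> c) = \<zero>\<^bsub>M\<^esub> \<oplus>\<^bsub>M\<^esub> \<ominus>\<^bsub>M\<^esub> (a \<oplus>\<^bsub>M\<^esub> (c \<oplus>\<^bsub>M\<^esub> b))"
      using m by (simp add: M.a_ac M.minus_add)
    then show ?thesis using m M.diff_zero_iff[of "\<zero>\<^bsub>M\<^esub>" "a \<oplus>\<^bsub>M\<^esub> (c \<oplus>\<^bsub>M\<^esub> b)"] by auto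
  qed
  show "jacobiator e f i j k l {i, j, k} = \<zero>\<^bsub>dsp P {i, j, k} {l} 0\<^esub> \<longleftrightarrow> cojR c e f l j i k"
    unfolding J[OF S(3)] x(3) y(3)[unfolded h3] z(3)[unfolded h3] S(12) cojR_def
      sk(1)[OF E(1), unfolded h] sk(1)[OF E(2), unfolded h] sk(1)[OF E(3), unfolded h] h
      module_minus[OF B.module_axioms Cc(1)] module_minus[OF B.module_axioms Cc(2)] module_minus[OF B.module_axioms Cc(3)]
    by (rule e[OF B.module_axioms Cc])
  have F: "distinct [e, f, j, i, k, l]" "distinct [e, f, i, j, l, k]" "distinct [e, f, i, j, k, l]"
     "distinct [e, f, j, i, l, k]" using d by auto
  have hh: "{l, k} = {k, l}" "{j, i} = {i, j}" by auto
  note c1 = composites_closed[OF pc F(1), unfolded hh] and c2 = composites_closed[OF pc F(2), unfolded hh]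
    and c3 = composites_closed[OF pc F(3), unfolded hh] and c4 = composites_closed[OF pc F(4), unfolded hh]
  note s1 = sk[OF F(1), unfolded hh] and s2 = sk[OF F(2), unfolded hh]
    and s3 = sk[OF F(3), unfolded hh] and s4 = sk[OF F(4), unfolded hh]
  note mm = module_minus[OF C.module_axioms]
  \<comment> \<open>Solves the vanishing sum for the composite of product and coproduct. The double
    negation stems from the shape \<open>M2\<close>, which is minus \<open>M1\<close> and enters
    \<open>cocR\<close> with a minus sign.\<close>
  have e2: "q \<oplus>\<^bsub>M\<^esub> ((a \<oplus>\<^bsub>M\<^esub> b) \<oplus>\<^bsub>M\<^esub> (\<ominus>\<^bsub>M\<^esub> c \<oplus>\<^bsub>M\<^esub> \<ominus>\<^bsub>M\<^esub> d)) = \<zero>\<^bsub>M\<^esub> \<longleftrightarrow>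
      q = (\<ominus>\<^bsub>M\<^esub> a \<oplus>\<^bsub>M\<^esub> d) \<oplus>\<^bsub>M\<^esub> (\<ominus>\<^bsub>M\<^esub> (\<ominus>\<^bsub>M\<^esub> c) \<oplus>\<^bsub>M\<^esub> \<ominus>\<^bsub>M\<^esub> b)"
    if M: "module K M" and m: "q \<in> carrier M" "a \<in> carrier M" "b \<in> carrier M" "c \<in> carrier M" "d \<in> carrier M"
    for M :: "('k, 'v) module" and q a b c d
  proof -
    interpret M: module K M by fact
    have "q \<oplus>\<^bsub>M\<^esub> ((a \<oplus>\<^bsub>M\<^esub> b) \<oplus>\<^bsub>M\<^esub> (\<ominus>\<^bsub>M\<^esub> c \<oplus>\<^bsub>M\<^esub> \<ominus>\<^bsub>M\<^esub> d)) =
        q \<oplus>\<^bsub>M\<^esub> \<ominus>\<^bsub>M\<^esub> ((\<ominus>\<^bsub>M\<^esub> a \<oplus>\<^bsub>M\<^esub> d) \<oplus>\<^bsub>M\<^esub> (\<ominus>\<^bsub>M\<^esub> (\<ominus>\<^bsub>M\<^esub> c) \<oplus>\<^bsub>M\<^esub> \<ominus>\<^bsub>M\<^esub> b))"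
      using m by (simp add: M.a_ac M.minus_add)
    then show ?thesis using m M.diff_zero_iff[of q] by auto
  qed
  have y6: "glued v e f j k i l {k, l} = M1 p c e f j k l i \<oplus>\<^bsub>dsp P {k, l} {i, j} 0\<^esub> M1 p c e f i l k j"
    using y(6) unfolding hh .
  have z7: "glued v e f k i j l {k, l} = M3 p c e f i k l j \<oplus>\<^bsub>dsp P {k, l} {i, j} 0\<^esub> M2 p c e f j l k i"
    using z(7) unfolding hh .
  show "jacobiator e f i j k l {k, l} = \<zero>\<^bsub>dsp P {k, l} {i, j} 0\<^esub> \<longleftrightarrow> cocR p c e f i j l k"
    unfolding J[OF S(5)] x(5) y6 z7 S(14) cocR_def hh s1(2-4) s2(2-4) s3(2-4) s4(2-4)
      mm[OF c1(6)] mm[OF c2(6)] mm[OF c3(6)] mm[OF c4(6)] mm[OF C.a_inv_closed[OF c3(6)]]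
    by (rule e2[OF C.module_axioms c2(5) c1(6) c2(6) c3(6) c4(6)])
qed

end

end

context dioperad
begin

context
  fixes v p c
  assumes tri: "tri v p c"
    and skew: "gg v 1 0 2 = (\<ominus> \<one>) \<odot>\<^bsub>csp L {0, 1, 2} 0\<^esub> gg v 0 1 2"
begin

lemma gg_skew:
  assumes d: "distinct [i, j, k]"
  shows "gg v j i k = (\<ominus> \<one>) \<odot>\<^bsub>csp L {i, j, k} 0\<^esub> gg v i j k"
proof -
  note cl = tri_closed[OF tri]
  have i: "inj_on (lab3 i j k) {0, 1, 2}" by (rule lab3_inj[OF d])
  have h: "{1, 0, 2} = {0, 1, 2::nat}" by auto
  have i': "inj_on (lab3 i j k) {1, 0, 2}" using i unfolding h .
  have n: "\<ominus> \<one> \<in> carrier K" by simp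
  have g: "gg v 0 1 2 \<in> carrier (csp L {0, 1, 2} 0)" by (rule gg_closed[OF cl]) simp
  have "gg v j i k = cact L {1, 0, 2} 0 (lab3 i j k) (gg v 1 0 2)"
    using gg_act[OF cl _ i'] by simp
  also have "\<dots> = cact L {0, 1, 2} 0 (lab3 i j k) ((\<ominus> \<one>) \<odot>\<^bsub>csp L {0, 1, 2} 0\<^esub> gg v 0 1 2)"
    unfolding h skew ..
  also have "\<dots> = (\<ominus> \<one>) \<odot>\<^bsub>csp L (lab3 i j k ` {0, 1, 2}) 0\<^esub> cact L {0, 1, 2} 0 (lab3 i j k) (gg v 0 1 2)"
    by (rule lin_map_scale[OF cyclic_operad.cact_linear[OF cyclic_operad_L _ i] n g]) simp
  also have "cact L {0, 1, 2} 0 (lab3 i j k) (gg v 0 1 2) = gg v i j k"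
    using gg_act[OF cl _ i] by simp
  finally show ?thesis unfolding lab3_image .
qed

lemma glued_skew:
  assumes d: "distinct [e, f, i, j, k, l]"
  shows "glued v e f j i k l = (\<ominus> \<one>) \<odot>\<^bsub>csp L {i, j, k, l} 0\<^esub> glued v e f i j k l"
    "glued v e f i j l k = (\<ominus> \<one>) \<odot>\<^bsub>csp L {i, j, k, l} 0\<^esub> glued v e f i j k l"
proof -
  have 1: "glued v e f j i k l = (\<ominus> \<one>) \<odot>\<^bsub>csp L {i, j, k, l} 0\<^esub> glued v e f i j k l"
    if d: "distinct [e, f, i, j, k, l]" for i j k l
  proof -
    have D: "distinct [i, j, e]" "distinct [f, k, l]" using d by auto
    have g: "cglue {i, j, e} e {f, k, l} f" using d by (auto simp: cglue_def)
    have N: "{i, j, e} - {e} \<union> ({f, k, l} - {f}) = {i, j, k, l}" using d by auto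
    have h: "{j, i, e} = {i, j, e}" by auto
    note cl = gg_closed[OF tri_closed[OF tri]]
    have n: "\<ominus> \<one> \<in> carrier K" by simp
    show ?thesis
      using lin_map_scale[OF ccomp_left_linear[OF g cl[OF D(2)]] n cl[OF D(1)]]
      unfolding glued_def[OF tri] gg_skew[OF D(1)] h N by simp
  qed
  show "glued v e f j i k l = (\<ominus> \<one>) \<odot>\<^bsub>csp L {i, j, k, l} 0\<^esub> glued v e f i j k l" by (rule 1[OF d])
  have D: "distinct [e, f, i, j, l, k]" "distinct [e, f, k, l, i, j]" using d by auto
  have h: "{k, l, i, j} = {i, j, k, l}" by auto
  show "glued v e f i j l k = (\<ominus> \<one>) \<odot>\<^bsub>csp L {i, j, k, l} 0\<^esub> glued v e f i j k l"
    using glued_swap[OF tri D(1)] 1[OF D(2)] glued_swap[OF tri d] unfolding h by simp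
qed

text \<open>By antisymmetry at a vertex and \<open>glued_swap\<close>, exchanging \<open>k\<close>
  and \<open>l\<close> permutes the three summands up to a common sign. Combined with cyclic shifts,
  any flag can be brought to the last place.\<close>

lemma jacobiator_swap:
  assumes d: "distinct [e, f, i, j, k, l]"
  shows "jacobiator v e f i j l k = (\<ominus> \<one>) \<odot>\<^bsub>csp L {i, j, k, l} 0\<^esub> jacobiator v e f i j k l"
proof -
  have D: "distinct [e, f, j, k, i, l]" "distinct [e, f, k, i, j, l]" "distinct [e, f, i, k, j, l]"
    "distinct [e, f, j, k, l, i]" "distinct [e, f, j, l, i, k]" "distinct [e, f, l, i, j, k]"
    using d by auto
  have h: "{i, j, l, k} = {i, j, k, l}" "{k, i, j, l} = {i, j, k, l}" "{j, k, i, l} = {i, j, k, l}" by auto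
  interpret M: module K "csp L {i, j, k, l} 0" by (rule phi_lower_module) simp
  note X = glued_closed[OF tri d] glued_closed[OF tri D(1), unfolded h] glued_closed[OF tri D(2), unfolded h]
  have n: "\<ominus> \<one> \<in> carrier K" by simp
  \<comment> \<open>Exchange the two pairs, then transpose the first pair.\<close>
  have a: "glued v e f j l i k = (\<ominus> \<one>) \<odot>\<^bsub>csp L {i, j, k, l} 0\<^esub> glued v e f k i j l"
    using glued_swap[OF tri D(5)] glued_skew(1)[OF D(2)] unfolding h by simp
  have b: "glued v e f l i j k = (\<ominus> \<one>) \<odot>\<^bsub>csp L {i, j, k, l} 0\<^esub> glued v e f j k i l"
    using glued_swap[OF tri D(6)] glued_skew(2)[OF D(1)] unfolding h by simp
  show ?thesis
    unfolding jacobiator_def[OF tri] h glued_skew(2)[OF d] a b using X n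
    by (simp add: M.smult_r_distr M.a_ac)
qed

text \<open>Three components of the Jacobi identity are the three relations. The others follow
  because, up to sign, the Jacobiator does not depend on the order of its four flags.\<close>

theorem lie_equiv:
  assumes ps: "pskR p 0 1 2" and cs: "cskR c 0 1 2"
  shows "jacobiator v 4 5 1 2 3 0 = \<zero>\<^bsub>csp L {1, 2, 3, 0} 0\<^esub> \<longleftrightarrow>
    jacR p 5 6 0 1 2 3 \<and> cojR c 5 6 0 1 2 3 \<and> cocR p c 5 6 1 2 3 4"
    (is "?l \<longleftrightarrow> ?r")
proof
  note pc = p_closed[OF tri] c_closed[OF tri]
  note rel = relations_relabel[OF pc]
  note comps = jacobiator_comps[OF tri _ ps cs]
  { assume eq: ?l
    have d: "distinct [4, 5, 1, 2, 3, 0 :: nat]" by simp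
    have z: "jacobiator v 4 5 1 2 3 0 A = \<zero>\<^bsub>vs {1, 2, 3, 0} A 0\<^esub>" if "A \<in> splits {1, 2, 3, 0}" for A
      using that unfolding eq phi_lower_simps by simp
    note S = glued_splits[OF tri d] glued_sets[OF tri d]
    note c = comps(1)[OF d, THEN iffD1, OF z[OF S(1), unfolded S(10)]]
      comps(2)[OF d, THEN iffD1, OF z[OF S(3), unfolded S(12)]]
      comps(3)[OF d, THEN iffD1, OF z[OF S(5), unfolded S(14)]]
    show ?r
      using rel(1)[OF _ _ c(1), of 5 6 1 2 3 0] rel(2)[OF _ _ c(2), of 5 6 1 2 3 0]
        rel(3)[OF _ _ c(3), of 5 6 1 2 3 4] by simp }
  { assume r: ?r
    \<comment> \<open>Vanishing of one component for one order of the flags. The component is always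
      taken in the flag set \<open>{1, 2, 3, 0}\<close>, so statements for different orders are
      comparable.\<close>
    define Z where "Z A i j k l \<longleftrightarrow> jacobiator v 4 5 i j k l A = \<zero>\<^bsub>vs {1, 2, 3, 0} A 0\<^esub>" for A i j k l
    have std: "Z {l} i j k l" "Z {i, j, k} i j k l" "Z {k, l} i j k l"
      if d: "distinct [4, 5, i, j, k, l]" and h: "{i, j, k, l} = {1, 2, 3, 0}" for i j k l
    proof -
      note S = glued_sets[OF tri d, unfolded h]
      have "jacR p 4 5 l i j k" "cojR c 4 5 l j i k" "cocR p c 4 5 i j l k"
        using r d rel(1)[of 5 6 1 2 3 0 4 5 i j k l] rel(2)[of 5 6 1 2 3 0 4 5 j i k l]
          rel(3)[of 5 6 1 2 3 4 4 5 i j l k] by auto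
      then show "Z {l} i j k l" "Z {i, j, k} i j k l" "Z {k, l} i j k l"
        unfolding Z_def S(1,3,5) by (simp_all only: comps[OF d])
    qed
    have cyc: "Z A i j k l \<Longrightarrow> Z A j k i l" if "distinct [4, 5, i, j, k, l]" for A i j k l
      unfolding Z_def jacobiator_cyc[OF tri that] .
    have swap: "Z A i j k l \<Longrightarrow> Z A i j l k"
      if "distinct [4, 5, i, j, k, l]" "{i, j, k, l} = {1, 2, 3, 0}" "A \<in> splits {1, 2, 3, 0}" for A i j k l
      using module.smult_r_null[OF vs_module[OF _ that(3)], of "\<ominus> \<one>" 0] that(3)
      unfolding Z_def jacobiator_swap[OF that(1)] that(2) by (simp add: phi_lower_simps)
    have D: "distinct [4, 5, 1, 2, 3, 0 :: nat]" "distinct [4, 5, 2, 3, 0, 1 :: nat]"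
      "distinct [4, 5, 3, 1, 0, 2 :: nat]" "distinct [4, 5, 1, 2, 0, 3 :: nat]"
      "distinct [4, 5, 2, 3, 1, 0 :: nat]" "distinct [4, 5, 3, 1, 2, 0 :: nat]"
      "distinct [4, 5, 2, 0, 1, 3 :: nat]" "distinct [4, 5, 0, 1, 2, 3 :: nat]"
      "distinct [4, 5, 3, 0, 2, 1 :: nat]"
      by simp_all
    have H: "{1, 2, 3, 0} = {1, 2, 3, 0::nat}" "{2, 3, 0, 1} = {1, 2, 3, 0::nat}" "{3, 1, 0, 2} = {1, 2, 3, 0::nat}"
      "{1, 2, 0, 3} = {1, 2, 3, 0::nat}" "{2, 3, 1, 0} = {1, 2, 3, 0::nat}" "{3, 1, 2, 0} = {1, 2, 3, 0::nat}"
      "{2, 0, 1, 3} = {1, 2, 3, 0::nat}" "{0, 1, 2, 3} = {1, 2, 3, 0::nat}" "{3, 0, 2, 1} = {1, 2, 3, 0::nat}"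
      by auto
    \<comment> \<open>These facts carry vanishing from each order of flags used below back to
      \<open>1 2 3 0\<close>, by cyclic shifts of the first three places and exchange of the last
      two.\<close>
    have m0: "Z A 1 2 3 0" if "Z A 2 3 1 0 \<or> Z A 3 1 2 0" for A
      using that jacobiator_cyc[OF tri D(1)] jacobiator_cyc[OF tri D(5)] unfolding Z_def by auto
    have m1: "Z A 1 2 3 0" if "Z A 2 3 0 1" "A \<in> splits {1, 2, 3, 0}" for A
      using swap[OF D(2) H(2) that(2,1)] m0 by blast
    have m2: "Z A 1 2 3 0" if "Z A 3 1 0 2" "A \<in> splits {1, 2, 3, 0}" for A
      using swap[OF D(3) H(3) that(2,1)] m0 by blast
    have m3: "Z A 1 2 3 0" if "Z A 1 2 0 3" "A \<in> splits {1, 2, 3, 0}" for A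
      by (rule swap[OF D(4) H(4) that(2,1)])
    have m4: "Z A 1 2 3 0" if "Z A 2 0 1 3 \<or> Z A 0 1 2 3" "A \<in> splits {1, 2, 3, 0}" for A
    proof (rule m3[OF _ that(2)])
      show "Z A 1 2 0 3" using that(1) jacobiator_cyc[OF tri D(8)] jacobiator_cyc[OF tri D(4)] unfolding Z_def by auto
    qed
    have m5: "Z A 1 2 3 0" if "Z A 3 0 2 1" "A \<in> splits {1, 2, 3, 0}" for A
    proof (rule m1[OF _ that(2)])
      show "Z A 2 3 0 1" using that(1) jacobiator_cyc[OF tri D(2)] unfolding Z_def by simp
    qed
    show ?l
    proof (rule phi_lower_ext[of _ "{1, 2, 3, 0}"])
      interpret M: module K "csp L {1, 2, 3, 0} 0" by (rule phi_lower_module) simp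
      have h: "{2, 3, 1, 0} = {1, 2, 3, 0::nat}" "{3, 1, 2, 0} = {1, 2, 3, 0::nat}" by auto
      show "jacobiator v 4 5 1 2 3 0 \<in> extensional (splits {1, 2, 3, 0})"
        unfolding jacobiator_def[OF tri] phi_lower_simps by simp
      fix A assume A: "A \<in> splits {1, 2, 3, 0 :: nat}"
      have hs: "{1, 3, 0} = {3, 1, 0::nat}" "{1, 2} = {2, 1::nat}" by auto
      \<comment> \<open>All fourteen directions, each with an order of flags in which it is the last
        flag, the first three flags or the last two flags, as required by
        \<open>std\<close>.\<close>
      have W: "Z {0} 1 2 3 0" "Z {1} 2 3 0 1" "Z {2} 3 1 0 2" "Z {3} 1 2 0 3"
        "Z {1, 2, 3} 1 2 3 0" "Z {1, 2, 0} 1 2 0 3" "Z {1, 3, 0} 3 1 0 2" "Z {2, 3, 0} 2 3 0 1"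
        "Z {1, 2} 3 0 2 1" "Z {2, 3} 0 1 2 3" "Z {3, 0} 1 2 3 0" "Z {1, 0} 2 3 1 0"
        "Z {1, 3} 2 0 1 3" "Z {2, 0} 3 1 2 0"
        unfolding hs by (rule std D H)+
      from splits4_cases[OF A] have "Z A 1 2 3 0"
        using W m0[of A] m1[OF _ A] m2[OF _ A] m3[OF _ A] m4[OF _ A] m5[OF _ A]
        by (elim insertE emptyE; simp)
      then show "jacobiator v 4 5 1 2 3 0 A = \<zero>\<^bsub>csp L {1, 2, 3, 0} 0\<^esub> A"
        using A unfolding Z_def phi_lower_simps by simp
    qed (simp add: phi_lower_simps) }
qed

end

end

section \<open>Functoriality of \<open>phi_lower\<close>\<close>

lemma dcx_hom:
  assumes P: "dioperad K P" and R: "dioperad K R" and F: "dio_hom K P R F"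
    and g: "dirg I A i J C j" and T: "T = (A - {i}) \<union> C" and N: "N = (I - {i}) \<union> (J - {j})" and s: "T \<in> splits N"
    and x: "x \<in> cv P I A m" and y: "y \<in> cv P J C n"
  shows "F T (N - T) (m + n) (dcx P I A m i J C n j x y) =
    dcx R I A m i J C n j (F A (I - A) m x) (F C (J - C) n y)"
proof -
  interpret P: dioperad K P by fact
  interpret R: dioperad K R by fact
  note e = dirg_sets[OF g T N]
  show ?thesis
  proof (cases "A \<in> splits I \<and> C \<in> splits J")
    case True
    then show ?thesis
      using dio_hom_comp[OF F dirg_dglue[OF g], unfolded e(1,2)] x y by (simp add: dcx_def cv_def)
  next
    case False
    have "F T (N - T) (m + n) \<zero>\<^bsub>dsp P T (N - T) (m + n)\<^esub> = \<zero>\<^bsub>dsp R T (N - T) (m + n)\<^esub>"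
      using s e(4) by (intro lin_map_zero[OF dio_hom_lin[OF F]] splits_biflags P.vs_module R.vs_module)
    then show ?thesis unfolding P.dcx_zero[OF g T N False] R.dcx_zero[OF g T N False] .
  qed
qed

text \<open>A morphism of dioperads preserves each directed composite and the zeros that replace the
  missing ones. This is what allows ternary elements to be compared along morphisms.\<close>

theorem phi_lower_map_hom:
  assumes P: "dioperad K P" and R: "dioperad K R" and F: "dio_hom K P R F"
  shows "cyc_hom K (phi_lower K P) (phi_lower K R) (phi_lower_map F)"
  unfolding cyc_hom_def
proof (intro conjI allI impI ballI)
  interpret P: dioperad K P by fact
  interpret R: dioperad K R by fact
  have ap: "phi_lower_map F I n x A = F A (I - A) n (x A)" if "A \<in> splits I" for I n x A
    using that by (simp add: phi_lower_map_def)
  have ex: "phi_lower_map F I n x \<in> extensional (splits I)" for I n x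
    by (simp add: phi_lower_map_def)
  { fix I :: "nat set" and n assume I: "finite I"
    note lin = dio_hom_lin[OF F splits_biflags[OF I]]
    show "lin_map K (csp (phi_lower K P) I n) (csp (phi_lower K R) I n) (phi_lower_map F I n)"
      unfolding lin_map_def Pi_iff
    proof (intro conjI ballI)
      fix x assume x: "x \<in> carrier (csp (phi_lower K P) I n)"
      then show "phi_lower_map F I n x \<in> carrier (csp (phi_lower K R) I n)"
        using lin_map_closed[OF lin] ex by (simp add: phi_lower_carrier ap)
      { fix y assume y: "y \<in> carrier (csp (phi_lower K P) I n)"
        show "phi_lower_map F I n (x \<oplus>\<^bsub>csp (phi_lower K P) I n\<^esub> y) =
          phi_lower_map F I n x \<oplus>\<^bsub>csp (phi_lower K R) I n\<^esub> phi_lower_map F I n y"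
          using x y lin_map_add[OF lin]
          by (intro phi_lower_ext[of _ I]) (simp_all add: ex ap phi_lower_simps phi_lower_carrier) }
      { fix a assume a: "a \<in> carrier K"
        show "phi_lower_map F I n (a \<odot>\<^bsub>csp (phi_lower K P) I n\<^esub> x) =
          a \<odot>\<^bsub>csp (phi_lower K R) I n\<^esub> phi_lower_map F I n x"
          using x a lin_map_scale[OF lin]
          by (intro phi_lower_ext[of _ I]) (simp_all add: ex ap phi_lower_simps phi_lower_carrier) }
    qed
    fix x assume x: "x \<in> carrier (csp (phi_lower K P) I n)"
    show "phi_lower_map F I (n - 1) (cdiff (phi_lower K P) I n x) =
        cdiff (phi_lower K R) I n (phi_lower_map F I n x)"
      using x dio_hom_diff[OF F splits_biflags[OF I]]
      by (intro phi_lower_ext[of _ I]) (simp_all add: ex ap phi_lower_simps phi_lower_carrier)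
    fix \<sigma> :: "nat \<Rightarrow> nat" assume s: "inj_on \<sigma> I"
    show "phi_lower_map F (\<sigma> ` I) n (cact (phi_lower K P) I n \<sigma> x) =
        cact (phi_lower K R) I n \<sigma> (phi_lower_map F I n x)"
    proof (rule phi_lower_ext[OF ex cact_ext])
      fix A' assume A': "A' \<in> splits (\<sigma> ` I)"
      then obtain A where A: "A \<in> splits I" "A' = \<sigma> ` A" using s by (rule splits_imageE)
      note sA = splits_image[OF s A(1)]
      have "inj_on \<sigma> (A \<union> (I - A))" using s splits_Un[OF A(1)] by simp
      from dio_hom_act[OF F splits_biflags[OF I A(1)] this] x A(1) sA
      show "phi_lower_map F (\<sigma> ` I) n (cact (phi_lower K P) I n \<sigma> x) A' =
          cact (phi_lower K R) I n \<sigma> (phi_lower_map F I n x) A'"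
        unfolding A(2) by (simp add: ap cact_apply[OF A(1) s] phi_lower_carrier)
    qed }
  { fix I m i J n j x y
    assume g: "cglue I i J j" and x: "x \<in> carrier (csp (phi_lower K P) I m)"
      and y: "y \<in> carrier (csp (phi_lower K P) J n)"
    let ?N = "I - {i} \<union> (J - {j})"
    show "phi_lower_map F ?N (m + n) (ccomp (phi_lower K P) I m i J n j x y) =
        ccomp (phi_lower K R) I m i J n j (phi_lower_map F I m x) (phi_lower_map F J n y)"
    proof (rule phi_lower_ext[OF ex ccomp_ext])
      fix T assume T: "T \<in> splits ?N"
      then obtain X Y where XY: "X \<subseteq> I - {i}" "Y \<subseteq> J - {j}" "T = X \<union> Y" by (rule cglue_splitsE)
      note d = cglue_dirg[OF g XY(1,2)]
      note T' = T[unfolded XY(3)]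
      have fN: "finite ?N" using g by (auto simp: cglue_def)
      note cx = phi_lower_cv[OF x] and cy = phi_lower_cv[OF y]
      have nm: "n + m = m + n" by simp
      have c: "dcx P I (insert i X) m i J Y n j (x (insert i X)) (y Y) \<in> carrier (dsp P T (?N - T) (m + n))"
        "dcx P J (insert j Y) n j I X m i (y (insert j Y)) (x X) \<in> carrier (dsp P T (?N - T) (n + m))"
        unfolding XY(3) by (intro P.dcx_closed[OF d(1,3) HOL.refl T'] P.dcx_closed[OF d(2,4,5) T'] cx cy)+
      have e: "F T (?N - T) (m + n) (dcx P I (insert i X) m i J Y n j (x (insert i X)) (y Y)) =
          dcx R I (insert i X) m i J Y n j (F (insert i X) (I - insert i X) m (x (insert i X))) (F Y (J - Y) n (y Y))"
        "F T (?N - T) (n + m) (dcx P J (insert j Y) n j I X m i (y (insert j Y)) (x X)) =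
          dcx R J (insert j Y) n j I X m i (F (insert j Y) (J - insert j Y) n (y (insert j Y))) (F X (I - X) m (x X))"
        unfolding XY(3) by (intro dcx_hom[OF P R F d(1,3) HOL.refl T'] dcx_hom[OF P R F d(2,4,5) T'] cx cy)+
      have q: "dcx R I (insert i X) m i J Y n j (F (insert i X) (I - insert i X) m (x (insert i X))) (F Y (J - Y) n (y Y)) =
          dcx R I (insert i X) m i J Y n j (phi_lower_map F I m x (insert i X)) (phi_lower_map F J n y Y)"
        "dcx R J (insert j Y) n j I X m i (F (insert j Y) (J - insert j Y) n (y (insert j Y))) (F X (I - X) m (x X)) =
          dcx R J (insert j Y) n j I X m i (phi_lower_map F J n y (insert j Y)) (phi_lower_map F I m x X)"
        by (auto simp: dcx_def ap)
      note lin = dio_hom_lin[OF F splits_biflags[OF fN T], of "m + n"]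
      interpret M: module K "dsp P T (?N - T) (m + n)" by (rule P.vs_module[OF fN T])
      have k: "ksign K (m * n) \<in> carrier K" by (rule ksign_closed[OF P.field_axioms])
      have "phi_lower_map F ?N (m + n) (ccomp (phi_lower K P) I m i J n j x y) T =
        F T (?N - T) (m + n) (dcx P I (insert i X) m i J Y n j (x (insert i X)) (y Y) \<oplus>\<^bsub>dsp P T (?N - T) (m + n)\<^esub>
          ksign K (m * n) \<odot>\<^bsub>dsp P T (?N - T) (m + n)\<^esub> dcx P J (insert j Y) n j I X m i (y (insert j Y)) (x X))"
        using P.ccomp_apply[OF g XY(1,2) HOL.refl T'] XY(3) T by (simp add: ap)
      also have "\<dots> = ccomp (phi_lower K R) I m i J n j (phi_lower_map F I m x) (phi_lower_map F J n y) T"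
        using R.ccomp_apply[OF g XY(1,2) HOL.refl T'] c[unfolded nm] e[unfolded nm] k
        by (simp add: lin_map_add[OF lin] lin_map_scale[OF lin] q XY(3)[symmetric])
      finally show "phi_lower_map F ?N (m + n) (ccomp (phi_lower K P) I m i J n j x y) T =
        ccomp (phi_lower K R) I m i J n j (phi_lower_map F I m x) (phi_lower_map F J n y) T" .
    qed }
qed

section \<open>Existence, uniqueness and naturality of the ternary element\<close>

context dioperad
begin

text \<open>Rotations reach all six components from one product and one coproduct, so
  \<open>p\<close> and \<open>c\<close> determine the element.\<close>

lemma tri_unique:
  assumes "tri v p c" "tri w p c"
  shows "v = w"
proof (rule phi_lower_ext[of _ "{0, 1, 2}"])
  note cl = tri_closed[OF assms(1)] tri_closed[OF assms(2)]
  show "v \<in> extensional (splits {0, 1, 2})" "w \<in> extensional (splits {0, 1, 2})"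
    using cl by (simp_all add: phi_lower_carrier)
  fix A assume "A \<in> splits {0, 1, 2 :: nat}"
  from splits3_cases[OF this] show "v A = w A"
    using gg_comps[OF assms(1), of 0 1 2] gg_comps[OF assms(2), of 0 1 2] gg_id[OF cl(1)] gg_id[OF cl(2)]
    by (elim insertE emptyE; simp del: One_nat_def)
qed

lemma tri_exists:
  assumes p: "p \<in> dprods" and c: "c \<in> dcoprods"
  shows "\<exists>v. tri v p c"
proof -
  note [simp del] = One_nat_def
  \<comment> \<open>The six values are forced: they are the ones in \<open>gg_comps\<close> for the
    flags 0, 1, 2.\<close>
  define v where "v = (\<lambda>A\<in>splits {0, 1, 2 :: nat}.
    if A = {0} then pr p 0 1 2 else if A = {1} then pr p 1 2 0 else if A = {2} then pr p 2 0 1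
    else if A = {0, 1} then co c 2 1 0 else if A = {1, 2} then co c 0 2 1 else co c 1 0 2)"
  have d: "distinct [0, 1, 2::nat]" by simp
  note s = splits3[OF d]
  have ne: "{0, 1} \<noteq> {1, 2::nat}" "{0, 2} \<noteq> {1, 2::nat}" "{0, 2} \<noteq> {0, 1::nat}" "{1, 2} \<noteq> {0, 1::nat}"
    by (simp_all add: doubleton_eq_iff)
  have v: "v {0} = pr p 0 1 2" "v {1} = pr p 1 2 0" "v {2} = pr p 2 0 1"
    "v {0, 1} = co c 2 1 0" "v {1, 2} = co c 0 2 1" "v {0, 2} = co c 1 0 2"
    using s(1-6) ne unfolding v_def by simp_all
  have h: "{2, 0} = {0, 2::nat}" "{1, 0} = {0, 1::nat}" "{2, 1} = {1, 2::nat}" by auto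
  have cl: "v \<in> carrier (csp L {0, 1, 2} 0)"
    unfolding phi_lower_carrier
  proof (intro conjI ballI)
    show "v \<in> extensional (splits {0, 1, 2})" by (simp add: v_def)
    fix A assume "A \<in> splits {0, 1, 2 :: nat}"
    from splits3_cases[OF this] show "v A \<in> carrier (vs {0, 1, 2} A 0)"
      using pr_closed[OF p, of 0 1 2] pr_closed[OF p, of 1 2 0] pr_closed[OF p, of 2 0 1]
        co_closed[OF c, of 2 1 0] co_closed[OF c, of 0 2 1] co_closed[OF c, of 1 0 2]
      by (elim insertE emptyE; simp add: v s(7-12) h)
  qed
  let ?s = "lab3 1 2 (0::nat)"
  have i: "inj_on ?s {0, 1, 2}" by (rule lab3_inj) simp
  have i': "inj_on ?s A" if "A \<subseteq> {0, 1, 2}" for A using i that by (rule inj_on_subset)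
  \<comment> \<open>The rotation permutes the three components with one output among themselves, and
    likewise the three with two outputs.\<close>
  have rot: "gg v 1 2 0 = v"
  proof (rule phi_lower_ext[of _ "{0, 1, 2}"])
    have "{1, 2, 0} = {0, 1, 2::nat}" by auto
    then show "gg v 1 2 0 \<in> extensional (splits {0, 1, 2})"
      using gg_closed[OF cl, of 1 2 0] by (simp add: phi_lower_carrier)
    show "v \<in> extensional (splits {0, 1, 2})" by (simp add: v_def)
    note ap = cact_apply[OF _ i, of _ K P 0 v]
    have e: "gg v 1 2 0 {1} = v {1}" "gg v 1 2 0 {2} = v {2}" "gg v 1 2 0 {0} = v {0}"
      "gg v 1 2 0 {1, 2} = v {1, 2}" "gg v 1 2 0 {0, 2} = v {0, 2}" "gg v 1 2 0 {0, 1} = v {0, 1}"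
      using ap[OF s(1)] ap[OF s(2)] ap[OF s(3)] ap[OF s(4)] ap[OF s(5)] ap[OF s(6)]
        pr_act[OF p _ i', of 0 1 2] pr_act[OF p _ i', of 1 2 0] pr_act[OF p _ i', of 2 0 1]
        co_act[OF c _ i', of 2 1 0] co_act[OF c _ i', of 0 2 1] co_act[OF c _ i', of 1 0 2]
      by (simp_all add: v s(7-12) h)
    fix A assume "A \<in> splits {0, 1, 2 :: nat}"
    from splits3_cases[OF this] show "gg v 1 2 0 A = v A"
      by (elim insertE emptyE; simp only: e)
  qed
  let ?t = "lab3 2 1 (0::nat)"
  have j: "inj_on ?t {0, 1, 2}" by (rule lab3_inj) simp
  have j': "inj_on ?t A" if "A \<subseteq> {0, 1, 2}" for A using j that by (rule inj_on_subset)
  have "gg v 2 1 0 {1, 2} = co c 0 1 2"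
    using cact_apply[OF s(4) j, of K P 0 v] co_act[OF c _ j', of 2 1 0] by (simp add: v s(7-12) h)
  moreover have "gg v 1 2 0 {0} = pr p 0 1 2" unfolding rot v ..
  ultimately have "tri v p c"
    unfolding tri_def using cl rot gg_id[OF cl] pr_id[OF p] co_id[OF c] by simp
  then show ?thesis by (rule exI[of _ v])
qed

text \<open>The differential acts on each component and commutes with relabelling, and every
  component is a relabelling of \<open>p\<close> or of \<open>c\<close>.\<close>

lemma tri_diff:
  assumes tri: "tri v p c"
  shows "cdiff L {0, 1, 2} 0 v = \<zero>\<^bsub>csp L {0, 1, 2} (- 1)\<^esub> \<longleftrightarrow>
    ddiff P {0} {1, 2} 0 p = \<zero>\<^bsub>dsp P {0} {1, 2} (- 1)\<^esub> \<and>
    ddiff P {1, 2} {0} 0 c = \<zero>\<^bsub>dsp P {1, 2} {0} (- 1)\<^esub>"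
  (is "?l \<longleftrightarrow> ?r")
proof
  note [simp del] = One_nat_def
  note cl = tri_closed[OF tri] and P = p_closed[OF tri] and C = c_closed[OF tri]
  have b: "biflags {0} {1, 2}" "biflags {1, 2} {0}" by (auto simp: biflags_def)
  have d: "distinct [0, 1, 2::nat]" by simp
  note s = splits3[OF d]
  { assume eq: ?l
    have z: "cdiff L {i, j, k} 0 (gg v i j k) A = \<zero>\<^bsub>vs {i, j, k} A (- 1)\<^esub>"
      if D: "distinct [i, j, k]" "A \<in> splits {i, j, k}" for i j k A
    proof -
      note i = lab3_inj[OF D(1)]
      have "cdiff L {i, j, k} 0 (gg v i j k) = cact L {0, 1, 2} (- 1) (lab3 i j k) (cdiff L {0, 1, 2} 0 v)"
        using cyclic_operad.cact_cdiff[OF cyclic_operad_L _ i cl] by (simp add: lab3_image)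
      also have "\<dots> = \<zero>\<^bsub>csp L {i, j, k} (- 1)\<^esub>"
        unfolding eq using lin_map_zero[OF cyclic_operad.cact_linear[OF cyclic_operad_L _ i, of "- 1"]
          phi_lower_module phi_lower_module] by (simp add: lab3_image)
      finally show ?thesis using D(2) by (simp add: phi_lower_simps)
    qed
    have D: "distinct [1, 2, 0::nat]" "distinct [2, 1, 0::nat]" by auto
    have h: "{2, 1} = {1, 2::nat}" "{1, 2, 0} - {0} = {1, 2::nat}" "{2, 1, 0} - {1, 2} = {0::nat}" by auto
    show ?r
      using z[OF D(1) splits3(3)[OF D(1)]] z[OF D(2) splits3(4)[OF D(2)]] splits3(3)[OF D(1)] splits3(4)[OF D(2)] tri
      unfolding h tri_def by (simp add: phi_lower_simps h) }
  { assume r: ?r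
    have act: "ddiff P {k} {i, j} 0 (pr p k i j) = \<zero>\<^bsub>dsp P {k} {i, j} (- 1)\<^esub>"
        "ddiff P {i, j} {k} 0 (co c k i j) = \<zero>\<^bsub>dsp P {i, j} {k} (- 1)\<^esub>"
      if D: "distinct [k, i, j]" for k i j
    proof -
      note i = lab3_inj'[OF D]
      note b' = biflags_ternary[OF D]
      have m: "module K (dsp P {0} {1, 2} (- 1))" "module K (dsp P {1, 2} {0} (- 1))"
        "module K (dsp P {k} {i, j} (- 1))" "module K (dsp P {i, j} {k} (- 1))"
        using b b' by (auto intro: dsp_module)
      show "ddiff P {k} {i, j} 0 (pr p k i j) = \<zero>\<^bsub>dsp P {k} {i, j} (- 1)\<^esub>"
        using dact_ddiff[OF b(1) i(1) P] r lin_map_zero[OF dact_linear[OF b(1) i(1), of "- 1"]] m by simp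
      show "ddiff P {i, j} {k} 0 (co c k i j) = \<zero>\<^bsub>dsp P {i, j} {k} (- 1)\<^esub>"
        using dact_ddiff[OF b(2) i(2) C] r lin_map_zero[OF dact_linear[OF b(2) i(2), of "- 1"]] m by simp
    qed
    have h: "{2, 0} = {0, 2::nat}" "{1, 0} = {0, 1::nat}" "{2, 1} = {1, 2::nat}" by auto
    show ?l
    proof (rule phi_lower_ext[of _ "{0, 1, 2}"])
      fix A assume A: "A \<in> splits {0, 1, 2 :: nat}"
      from splits3_cases[OF A] A
      show "cdiff L {0, 1, 2} 0 v A = \<zero>\<^bsub>csp L {0, 1, 2} (- 1)\<^esub> A"
        using gg_comps[OF tri d] gg_id[OF cl] act[of 0 1 2] act[of 1 2 0] act[of 2 0 1] act[of 0 2 1] act[of 1 0 2] act[of 2 1 0]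
        by (elim insertE emptyE; simp add: phi_lower_simps s h)
    qed (simp_all add: phi_lower_simps) }
qed

end

text \<open>\<open>phi_lower_map F\<close> commutes with relabelling, so the product and coproduct
  of the image are the images under \<open>F\<close>.\<close>

lemma tri_natural:
  assumes P: "dioperad K P" and R: "dioperad K R" and F: "dio_hom K P R F"
    and tri: "dioperad.tri K P v p c"
  shows "dioperad.tri K R (phi_lower_map F {0, 1, 2} 0 v) (F {0} {1, 2} 0 p) (F {1, 2} {0} 0 c)"
proof -
  interpret P: dioperad K P by fact
  interpret R: dioperad K R by fact
  note H = phi_lower_map_hom[OF P R F]
  note [simp del] = One_nat_def
  let ?v = "phi_lower_map F {0, 1, 2} 0 v"
  note cl = P.tri_closed[OF tri]
  have v: "?v \<in> carrier (csp (phi_lower K R) {0, 1, 2} 0)"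
    by (rule cyc_hom_closed[OF H _ cl]) simp
  have gg: "R.gg ?v i j k = phi_lower_map F {i, j, k} 0 (P.gg v i j k)" if "distinct [i, j, k]" for i j k
    using cyc_hom_act[OF H _ lab3_inj[OF that] cl] by (simp add: lab3_image)
  have D: "distinct [0, 1, 2::nat]" "distinct [1, 2, 0::nat]" "distinct [2, 1, 0::nat]" by auto
  have h: "{1, 2, 0} = {0, 1, 2::nat}" "{2, 1} = {1, 2::nat}" by auto
  have h': "{1, 2, 0} - {0} = {1, 2::nat}" "{2, 1, 0} - {1, 2} = {0::nat}" by auto
  have rot: "R.gg ?v 1 2 0 = R.gg ?v 0 1 2"
    using tri unfolding gg[OF D(1)] gg[OF D(2)] h P.tri_def by simp
  have pc: "p = P.gg v 1 2 0 {0}" "c = P.gg v 2 1 0 {1, 2}" using tri unfolding P.tri_def by auto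
  have p: "F {0} {1, 2} 0 p = R.gg ?v 1 2 0 {0}"
    unfolding gg[OF D(2)] using P.splits3(3)[OF D(2)] pc(1) by (simp add: phi_lower_map_def h')
  have c: "F {1, 2} {0} 0 c = R.gg ?v 2 1 0 {1, 2}"
    unfolding gg[OF D(3)] using P.splits3(4)[OF D(3), unfolded h(2)] pc(2) by (simp add: phi_lower_map_def h')
  show ?thesis unfolding R.tri_def using v rot p c by blast
qed

section \<open>The presentations\<close>

text \<open>Gives a name to the presentation inlined in \<open>Lie\<close>, so that its typing and
  its models can be discussed; the next three definitions do the same.\<close>

definition Lie_pres :: "('k, 'r) ring_scheme \<Rightarrow> ('k, unit) cyc_pres" where
  "Lie_pres K =
     \<lparr>cgens = {()},
      carity = (\<lambda>_. ({0, 1, 2}, 0)),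
      crels =
       {(CDiff (CGen ()), CZero {0, 1, 2} (-1)),
        (cop3 1 0 2, CScale (\<ominus>\<^bsub>K\<^esub> \<one>\<^bsub>K\<^esub>) (cop3 0 1 2)),
        (cop3 0 2 1, CScale (\<ominus>\<^bsub>K\<^esub> \<one>\<^bsub>K\<^esub>) (cop3 0 1 2)),
        (CAdd (CComp 4 5 (cop3 1 2 4) (cop3 5 3 0))
           (CAdd (CComp 4 5 (cop3 2 3 4) (cop3 5 1 0))
                 (CComp 4 5 (cop3 3 1 4) (cop3 5 2 0))),
         CZero {0, 1, 2, 3} 0)}\<rparr>"

definition As_pres :: "('k, 'r) ring_scheme \<Rightarrow> ('k, unit) cyc_pres" where
  "As_pres K =
     \<lparr>cgens = {()},
      carity = (\<lambda>_. ({0, 1, 2}, 0)),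
      crels =
       {(CDiff (CGen ()), CZero {0, 1, 2} (-1)),
        (cop3 1 2 0, cop3 0 1 2),
        (CComp 4 5 (cop3 1 2 4) (cop3 5 3 0), CComp 4 5 (cop3 2 3 4) (cop3 1 5 0))}\<rparr>"

definition BiLie_pres :: "('k, 'r) ring_scheme \<Rightarrow> ('k, biop) dio_pres" where
  "BiLie_pres K =
     \<lparr>dgens = {BProd, BCoprod},
      darity = bi_arity,
      drels = bi_diff_rels \<union>
       {(dprod 0 2 1, dneg K (dprod 0 1 2)),
        (dcoprod 0 2 1, dneg K (dcoprod 0 1 2)),
        (DAdd (dthen (dprod 5 1 2) (dprod 0 6 3))
           (DAdd (dthen (dprod 5 2 3) (dprod 0 6 1))
                 (dthen (dprod 5 3 1) (dprod 0 6 2))),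
         DZero {0} {1, 2, 3} 0),
        (DAdd (dthen (dcoprod 0 5 3) (dcoprod 6 1 2))
           (DAdd (dthen (dcoprod 0 5 1) (dcoprod 6 2 3))
                 (dthen (dcoprod 0 5 2) (dcoprod 6 3 1))),
         DZero {1, 2, 3} {0} 0),
        (dthen (dprod 5 1 2) (dcoprod 6 3 4),
         DAdd (DAdd (dthen (dcoprod 2 5 4) (dprod 3 1 6))
                    (dthen (dcoprod 2 3 5) (dprod 4 1 6)))
              (DAdd (dneg K (dthen (dcoprod 1 5 4) (dprod 3 2 6)))
                    (dneg K (dthen (dcoprod 1 3 5) (dprod 4 2 6)))))}\<rparr>"

definition Bal_pres :: "('k, 'r) ring_scheme \<Rightarrow> ('k, biop) dio_pres" where
  "Bal_pres K =
     \<lparr>dgens = {BProd, BCoprod},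
      darity = bi_arity,
      drels = bi_diff_rels \<union>
       {(dthen (dprod 5 1 2) (dprod 0 6 3), dthen (dprod 5 2 3) (dprod 0 1 6)),
        (dthen (dcoprod 0 5 3) (dcoprod 6 1 2), dthen (dcoprod 0 1 5) (dcoprod 6 2 3)),
        (dthen (dprod 5 1 2) (dcoprod 6 3 4),
         DAdd (dthen (dcoprod 2 5 4) (dprod 3 1 6)) (dthen (dcoprod 1 3 5) (dprod 4 6 2))),
        (DAdd (DAdd (dthen (dcoprod 2 4 5) (dprod 3 1 6))
                    (dneg K (dthen (dcoprod 2 5 3) (dprod 4 6 1))))
              (DAdd (dthen (dcoprod 1 3 5) (dprod 4 2 6))
                    (dneg K (dthen (dcoprod 1 5 4) (dprod 3 6 2)))),
         DZero {3, 4} {1, 2} 0)}\<rparr>"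

lemma Lie_eq: "Lie K = cyc_presented K (Lie_pres K)"
  by (simp add: Lie_def Lie_pres_def)

lemma As_eq: "As K = cyc_presented K (As_pres K)"
  by (simp add: As_def As_pres_def)

lemma BiLie_eq: "BiLie K = dio_presented K (BiLie_pres K)"
  by (simp add: BiLie_def BiLie_pres_def)

lemma Bal_eq: "Bal K = dio_presented K (Bal_pres K)"
  by (simp add: Bal_def Bal_pres_def)

lemma csat_iff:
  assumes "\<And>s t. (s, t) \<in> crels S \<Longrightarrow> cchk K S s \<and> cchk K S t \<and> cfl S s = cfl S t \<and> cdeg S s = cdeg S t"
  shows "csat K S P h \<longleftrightarrow>
     (\<forall>g\<in>cgens S. \<forall>I n. carity S g = (I, n) \<longrightarrow> finite I \<longrightarrow> h g \<in> carrier (csp P I n)) \<and>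
     (\<forall>(s, t)\<in>crels S. ceval S P h s = ceval S P h t)"
  unfolding csat_def cwt_iff using assms by auto

lemma dsat_iff:
  assumes "\<And>s t. (s, t) \<in> drels S \<Longrightarrow> dchk K S s \<and> dchk K S t \<and>
    dout S s = dout S t \<and> din S s = din S t \<and> ddeg S s = ddeg S t"
  shows "dsat K S P h \<longleftrightarrow>
     (\<forall>g\<in>dgens S. \<forall>A B n. darity S g = (A, B, n) \<longrightarrow> biflags A B \<longrightarrow> h g \<in> carrier (dsp P A B n)) \<and>
     (\<forall>(s, t)\<in>drels S. deval S P h s = deval S P h t)"
  unfolding dsat_def dwt_iff using assms by auto

section \<open>Typing and evaluation of the generating operations\<close>

lemma cop3_type:
  assumes "cgens S = {()}" "carity S () = ({0, 1, 2}, 0)"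
  shows "cfl S (cop3 i j k) = {i, j, k}" "cdeg S (cop3 i j k) = 0"
    "distinct [i, j, k] \<Longrightarrow> cchk K S (cop3 i j k)"
    "ceval S P h (cop3 i j k) = cact P {0, 1, 2} 0 (lab3 i j k) (h ())"
  using assms lab3_image[of i j k] lab3_inj[of i j k] by (simp_all add: cop3_def)

lemma dprod_type:
  assumes "dgens S = {BProd, BCoprod}" "darity S = bi_arity"
  shows "dout S (dprod k i j) = {k}" "din S (dprod k i j) = {i, j}" "ddeg S (dprod k i j) = 0"
    "distinct [k, i, j] \<Longrightarrow> dchk K S (dprod k i j)"
    "deval S P h (dprod k i j) = dact P {0} {1, 2} 0 (lab3 k i j) (h BProd)"
  using assms by (auto simp: dprod_def bi_arity_def biflags_def inj_on_def)

lemma dcoprod_type: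
  assumes "dgens S = {BProd, BCoprod}" "darity S = bi_arity"
  shows "dout S (dcoprod k i j) = {i, j}" "din S (dcoprod k i j) = {k}" "ddeg S (dcoprod k i j) = 0"
    "distinct [k, i, j] \<Longrightarrow> dchk K S (dcoprod k i j)"
    "deval S P h (dcoprod k i j) = dact P {1, 2} {0} 0 (lab3 k i j) (h BCoprod)"
  using assms by (auto simp: dcoprod_def bi_arity_def biflags_def inj_on_def)

lemma pres_simps:
  "cgens (Lie_pres K) = {()}" "carity (Lie_pres K) () = ({0, 1, 2}, 0)"
  "cgens (As_pres K) = {()}" "carity (As_pres K) () = ({0, 1, 2}, 0)"
  "dgens (BiLie_pres K) = {BProd, BCoprod}" "darity (BiLie_pres K) = bi_arity"
  "dgens (Bal_pres K) = {BProd, BCoprod}" "darity (Bal_pres K) = bi_arity"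
  by (simp_all add: Lie_pres_def As_pres_def BiLie_pres_def Bal_pres_def)

lemma Lie_pres_typed:
  assumes "field K" "(s, t) \<in> crels (Lie_pres K)"
  shows "cchk K (Lie_pres K) s \<and> cchk K (Lie_pres K) t \<and> cfl (Lie_pres K) s = cfl (Lie_pres K) t \<and>
    cdeg (Lie_pres K) s = cdeg (Lie_pres K) t"
proof -
  interpret field K by fact
  have n: "\<ominus>\<^bsub>K\<^esub> \<one>\<^bsub>K\<^esub> \<in> carrier K" by simp
  note T = cop3_type[of "Lie_pres K", OF pres_simps(1,2)]
  from assms(2) n show ?thesis
    by (subst (asm) Lie_pres_def) (auto simp: T pres_simps cglue_def)
qed

lemma As_pres_typed:
  assumes "(s, t) \<in> crels (As_pres K)"
  shows "cchk K (As_pres K) s \<and> cchk K (As_pres K) t \<and> cfl (As_pres K) s = cfl (As_pres K) t \<and>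
    cdeg (As_pres K) s = cdeg (As_pres K) t"
proof -
  note T = cop3_type[of "As_pres K", OF pres_simps(3,4)]
  from assms show ?thesis
    by (subst (asm) As_pres_def) (auto simp: T pres_simps cglue_def)
qed

lemma BiLie_pres_typed:
  assumes "field K" "(s, t) \<in> drels (BiLie_pres K)"
  shows "dchk K (BiLie_pres K) s \<and> dchk K (BiLie_pres K) t \<and> dout (BiLie_pres K) s = dout (BiLie_pres K) t \<and>
    din (BiLie_pres K) s = din (BiLie_pres K) t \<and> ddeg (BiLie_pres K) s = ddeg (BiLie_pres K) t"
proof -
  interpret field K by fact
  have n: "\<ominus>\<^bsub>K\<^esub> \<one>\<^bsub>K\<^esub> \<in> carrier K" by simp
  note T = dprod_type[of "BiLie_pres K", OF pres_simps(5,6)] dcoprod_type[of "BiLie_pres K", OF pres_simps(5,6)]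
  from assms(2) n show ?thesis
    by (subst (asm) BiLie_pres_def)
      (auto simp: T pres_simps dglue_def biflags_def dthen_def dneg_def bi_diff_rels_def bi_arity_def)
qed

lemma Bal_pres_typed:
  assumes "field K" "(s, t) \<in> drels (Bal_pres K)"
  shows "dchk K (Bal_pres K) s \<and> dchk K (Bal_pres K) t \<and> dout (Bal_pres K) s = dout (Bal_pres K) t \<and>
    din (Bal_pres K) s = din (Bal_pres K) t \<and> ddeg (Bal_pres K) s = ddeg (Bal_pres K) t"
proof -
  interpret field K by fact
  have n: "\<ominus>\<^bsub>K\<^esub> \<one>\<^bsub>K\<^esub> \<in> carrier K" by simp
  note T = dprod_type[of "Bal_pres K", OF pres_simps(7,8)] dcoprod_type[of "Bal_pres K", OF pres_simps(7,8)]
  from assms(2) n show ?thesis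
    by (subst (asm) Bal_pres_def)
      (auto simp: T pres_simps dglue_def biflags_def dthen_def dneg_def bi_diff_rels_def bi_arity_def)
qed

lemma ball_pairs:
  "(\<forall>(s, t)\<in>insert (a, b) B. R s t) \<longleftrightarrow> R a b \<and> (\<forall>(s, t)\<in>B. R s t)"
  "(\<forall>(s, t)\<in>{}. R s t) \<longleftrightarrow> True"
  "(\<forall>(s, t)\<in>B \<union> C. R s t) \<longleftrightarrow> (\<forall>(s, t)\<in>B. R s t) \<and> (\<forall>(s, t)\<in>C. R s t)"
  by auto

section \<open>The relations evaluated in \<open>phi_lower\<close> and in a dioperad\<close>

context dioperad
begin

lemma csat_Lie:
  "csat K (Lie_pres K) L h \<longleftrightarrow> h () \<in> carrier (csp L {0, 1, 2} 0) \<and>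
    cdiff L {0, 1, 2} 0 (h ()) = \<zero>\<^bsub>csp L {0, 1, 2} (- 1)\<^esub> \<and>
    gg (h ()) 1 0 2 = (\<ominus> \<one>) \<odot>\<^bsub>csp L {0, 1, 2} 0\<^esub> gg (h ()) 0 1 2 \<and>
    gg (h ()) 0 2 1 = (\<ominus> \<one>) \<odot>\<^bsub>csp L {0, 1, 2} 0\<^esub> gg (h ()) 0 1 2 \<and>
    ccomp L {1, 2, 4} 0 4 {5, 3, 0} 0 5 (gg (h ()) 1 2 4) (gg (h ()) 5 3 0) \<oplus>\<^bsub>csp L {1, 2, 3, 0} 0\<^esub>
    (ccomp L {2, 3, 4} 0 4 {5, 1, 0} 0 5 (gg (h ()) 2 3 4) (gg (h ()) 5 1 0) \<oplus>\<^bsub>csp L {1, 2, 3, 0} 0\<^esub>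
     ccomp L {3, 1, 4} 0 4 {5, 2, 0} 0 5 (gg (h ()) 3 1 4) (gg (h ()) 5 2 0)) = \<zero>\<^bsub>csp L {1, 2, 3, 0} 0\<^esub>"
proof -
  note T = cop3_type[of "Lie_pres K", OF pres_simps(1,2)]
  note [simp del] = One_nat_def
  have h: "{0, 1, 2, 3} = {1, 2, 3, 0::nat}" "{2, 3, 1, 0} = {1, 2, 3, 0::nat}" by auto
  have r: "crels (Lie_pres K) = {(CDiff (CGen ()), CZero {0, 1, 2} (-1)),
        (cop3 1 0 2, CScale (\<ominus> \<one>) (cop3 0 1 2)), (cop3 0 2 1, CScale (\<ominus> \<one>) (cop3 0 1 2)),
        (CAdd (CComp 4 5 (cop3 1 2 4) (cop3 5 3 0))
           (CAdd (CComp 4 5 (cop3 2 3 4) (cop3 5 1 0)) (CComp 4 5 (cop3 3 1 4) (cop3 5 2 0))),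
         CZero {0, 1, 2, 3} 0)}"
    by (simp add: Lie_pres_def)
  have g: "(\<forall>g\<in>{()}. \<forall>I n. carity (Lie_pres K) g = (I, n) \<longrightarrow> finite I \<longrightarrow> h g \<in> carrier (csp L I n)) \<longleftrightarrow>
      h () \<in> carrier (csp L {0, 1, 2} 0)"
    by (auto simp: Lie_pres_def)
  have u: "{1, 2, 4} - {4} \<union> ({5, 3, 0} - {5}) = {1, 2, 3, 0::nat}"
    "{2, 3, 4} - {4} \<union> ({5, 1, 0} - {5}) = {1, 2, 3, 0::nat}"
    by auto
  have c: "carity (Lie_pres K) () = ({0, 1, 2}, 0)" by (simp add: Lie_pres_def)
  show ?thesis
    by (subst csat_iff[OF Lie_pres_typed[OF field_axioms]], assumption, unfold r pres_simps(1) g ball_pairs)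
      (simp only: T ceval.simps cfl.simps cdeg.simps simp_thms u c fst_conv snd_conv h add_0_right prod.case)
qed

lemma csat_As:
  "csat K (As_pres K) L h \<longleftrightarrow> h () \<in> carrier (csp L {0, 1, 2} 0) \<and>
    cdiff L {0, 1, 2} 0 (h ()) = \<zero>\<^bsub>csp L {0, 1, 2} (- 1)\<^esub> \<and>
    gg (h ()) 1 2 0 = gg (h ()) 0 1 2 \<and>
    ccomp L {1, 2, 4} 0 4 {5, 3, 0} 0 5 (gg (h ()) 1 2 4) (gg (h ()) 5 3 0) =
    ccomp L {2, 3, 4} 0 4 {1, 5, 0} 0 5 (gg (h ()) 2 3 4) (gg (h ()) 1 5 0)"
proof -
  note T = cop3_type[of "As_pres K", OF pres_simps(3,4)]
  note [simp del] = One_nat_def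
  have r: "crels (As_pres K) = {(CDiff (CGen ()), CZero {0, 1, 2} (-1)), (cop3 1 2 0, cop3 0 1 2),
        (CComp 4 5 (cop3 1 2 4) (cop3 5 3 0), CComp 4 5 (cop3 2 3 4) (cop3 1 5 0))}"
    by (simp add: As_pres_def)
  have g: "(\<forall>g\<in>{()}. \<forall>I n. carity (As_pres K) g = (I, n) \<longrightarrow> finite I \<longrightarrow> h g \<in> carrier (csp L I n)) \<longleftrightarrow>
      h () \<in> carrier (csp L {0, 1, 2} 0)"
    by (auto simp: As_pres_def)
  have c: "carity (As_pres K) () = ({0, 1, 2}, 0)" by (simp add: As_pres_def)
  show ?thesis
    by (subst csat_iff[OF As_pres_typed], assumption, unfold r pres_simps(3) g ball_pairs)
      (simp only: T ceval.simps cfl.simps cdeg.simps simp_thms c fst_conv snd_conv prod.case)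
qed

lemma label_sets:
  "{2, 1} = {1, 2::nat}" "{2, 3, 1} = {1, 2, 3::nat}" "{3, 1, 2} = {1, 2, 3::nat}" "{4, 3} = {3, 4::nat}"
  "{1, 6} = {6, 1::nat}" "{2, 6} = {6, 2::nat}" "{3, 5} = {5, 3::nat}" "{4, 5} = {5, 4::nat}"
  "{1, 5} = {5, 1::nat}"
  by auto

lemma dsat_BiLie:
  "dsat K (BiLie_pres K) P h \<longleftrightarrow> h BProd \<in> dprods \<and> h BCoprod \<in> dcoprods \<and>
    ddiff P {0} {1, 2} 0 (h BProd) = \<zero>\<^bsub>dsp P {0} {1, 2} (- 1)\<^esub> \<and>
    ddiff P {1, 2} {0} 0 (h BCoprod) = \<zero>\<^bsub>dsp P {1, 2} {0} (- 1)\<^esub> \<and>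
    pskR (h BProd) 0 1 2 \<and> cskR (h BCoprod) 0 1 2 \<and> jacR (h BProd) 5 6 0 1 2 3 \<and>
    cojR (h BCoprod) 5 6 0 1 2 3 \<and> cocR (h BProd) (h BCoprod) 5 6 1 2 3 4"
proof -
  note T = dprod_type[of "BiLie_pres K", OF pres_simps(5,6)] dcoprod_type[of "BiLie_pres K", OF pres_simps(5,6)]
  note [simp del] = One_nat_def
  have r: "drels (BiLie_pres K) = bi_diff_rels \<union>
       {(dprod 0 2 1, dneg K (dprod 0 1 2)),
        (dcoprod 0 2 1, dneg K (dcoprod 0 1 2)),
        (DAdd (dthen (dprod 5 1 2) (dprod 0 6 3))
           (DAdd (dthen (dprod 5 2 3) (dprod 0 6 1))
                 (dthen (dprod 5 3 1) (dprod 0 6 2))),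
         DZero {0} {1, 2, 3} 0),
        (DAdd (dthen (dcoprod 0 5 3) (dcoprod 6 1 2))
           (DAdd (dthen (dcoprod 0 5 1) (dcoprod 6 2 3))
                 (dthen (dcoprod 0 5 2) (dcoprod 6 3 1))),
         DZero {1, 2, 3} {0} 0),
        (dthen (dprod 5 1 2) (dcoprod 6 3 4),
         DAdd (DAdd (dthen (dcoprod 2 5 4) (dprod 3 1 6))
                    (dthen (dcoprod 2 3 5) (dprod 4 1 6)))
              (DAdd (dneg K (dthen (dcoprod 1 5 4) (dprod 3 2 6)))
                    (dneg K (dthen (dcoprod 1 3 5) (dprod 4 2 6)))))}"
    by (simp add: BiLie_pres_def)
  have b: "biflags {0} {1, 2}" "biflags {1, 2} {0}" by (auto simp: biflags_def)
  have g: "(\<forall>g\<in>{BProd, BCoprod}. \<forall>A B n. bi_arity g = (A, B, n) \<longrightarrow> biflags A B \<longrightarrow> h g \<in> carrier (dsp P A B n)) \<longleftrightarrow>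
    h BProd \<in> dprods \<and> h BCoprod \<in> dcoprods"
    using b by (auto simp: bi_arity_def)
  show ?thesis
    by (subst dsat_iff[OF BiLie_pres_typed[OF field_axioms]], assumption, unfold r pres_simps g bi_diff_rels_def ball_pairs)
      (simp add: T pres_simps insert_Diff_if bi_arity_def dneg_def dthen_def label_sets
        pskR_def cskR_def jacR_def cojR_def cocR_def QA_def CA_def PC_def M2_def M4_def)
qed

lemma dsat_Bal:
  "dsat K (Bal_pres K) P h \<longleftrightarrow> h BProd \<in> dprods \<and> h BCoprod \<in> dcoprods \<and>
    ddiff P {0} {1, 2} 0 (h BProd) = \<zero>\<^bsub>dsp P {0} {1, 2} (- 1)\<^esub> \<and>
    ddiff P {1, 2} {0} 0 (h BCoprod) = \<zero>\<^bsub>dsp P {1, 2} {0} (- 1)\<^esub> \<and>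
    assR (h BProd) 5 6 0 1 2 3 \<and> coaR (h BCoprod) 5 6 0 1 2 3 \<and>
    comR (h BProd) (h BCoprod) 5 6 1 2 3 4 \<and> balR (h BProd) (h BCoprod) 5 6 1 2 3 4"
proof -
  note T = dprod_type[of "Bal_pres K", OF pres_simps(7,8)] dcoprod_type[of "Bal_pres K", OF pres_simps(7,8)]
  note [simp del] = One_nat_def
  have r: "drels (Bal_pres K) = bi_diff_rels \<union>
       {(dthen (dprod 5 1 2) (dprod 0 6 3), dthen (dprod 5 2 3) (dprod 0 1 6)),
        (dthen (dcoprod 0 5 3) (dcoprod 6 1 2), dthen (dcoprod 0 1 5) (dcoprod 6 2 3)),
        (dthen (dprod 5 1 2) (dcoprod 6 3 4),
         DAdd (dthen (dcoprod 2 5 4) (dprod 3 1 6)) (dthen (dcoprod 1 3 5) (dprod 4 6 2))),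
        (DAdd (DAdd (dthen (dcoprod 2 4 5) (dprod 3 1 6))
                    (dneg K (dthen (dcoprod 2 5 3) (dprod 4 6 1))))
              (DAdd (dthen (dcoprod 1 3 5) (dprod 4 2 6))
                    (dneg K (dthen (dcoprod 1 5 4) (dprod 3 6 2)))),
         DZero {3, 4} {1, 2} 0)}"
    by (simp add: Bal_pres_def)
  have b: "biflags {0} {1, 2}" "biflags {1, 2} {0}" by (auto simp: biflags_def)
  have g: "(\<forall>g\<in>{BProd, BCoprod}. \<forall>A B n. bi_arity g = (A, B, n) \<longrightarrow> biflags A B \<longrightarrow> h g \<in> carrier (dsp P A B n)) \<longleftrightarrow>
    h BProd \<in> dprods \<and> h BCoprod \<in> dcoprods"
    using b by (auto simp: bi_arity_def)
  show ?thesis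
    by (subst dsat_iff[OF Bal_pres_typed[OF field_axioms]], assumption, unfold r pres_simps g bi_diff_rels_def ball_pairs)
      (simp add: T pres_simps insert_Diff_if bi_arity_def dneg_def dthen_def label_sets
        assR_def coaR_def comR_def balR_def QA_def QB_def CA_def CB_def PC_def M1_def M2_def M3_def M4_def)
qed

lemma As_tri:
  assumes "csat K (As_pres K) L h"
  shows "tri (h ()) (gg (h ()) 1 2 0 {0}) (gg (h ()) 2 1 0 {1, 2})"
  using assms unfolding csat_As tri_def by simp

text \<open>The rotation is a product of two transpositions, each of which acts by minus one. An
  antisymmetric element is therefore cyclically invariant.\<close>

lemma Lie_tri:
  assumes "csat K (Lie_pres K) L h"
  shows "tri (h ()) (gg (h ()) 1 2 0 {0}) (gg (h ()) 2 1 0 {1, 2})"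
proof -
  let ?v = "h ()"
  let ?n = "\<lambda>x. (\<ominus> \<one>) \<odot>\<^bsub>csp L {0, 1, 2} 0\<^esub> x"
  have cl: "?v \<in> carrier (csp L {0, 1, 2} 0)" and s1: "gg ?v 1 0 2 = ?n (gg ?v 0 1 2)"
    and s2: "gg ?v 0 2 1 = ?n (gg ?v 0 1 2)"
    using assms unfolding csat_Lie by blast+
  interpret M: module K "csp L {0, 1, 2} 0" by (rule phi_lower_module) simp
  have h: "{0, 2, 1} = {0, 1, 2::nat}" "{1, 0, 2} = {0, 1, 2::nat}" by auto
  have d: "distinct [1, 0, 2::nat]" "distinct [0, 2, 1::nat]" "distinct [0, 1, 2::nat]" by auto
  have n: "\<ominus> \<one> \<in> carrier K" by simp
  note i = lab3_inj[OF d(1)]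
  note g = gg_closed[OF cl d(3)]
  note [simp del] = One_nat_def
  have "gg ?v 1 2 0 = cact L {0, 1, 2} 0 (lab3 1 0 2) (gg ?v 0 2 1)"
    using gg_act[OF cl d(2), unfolded h, OF i] by simp
  also have "\<dots> = ?n (cact L {0, 1, 2} 0 (lab3 1 0 2) (gg ?v 0 1 2))"
    unfolding s2
    using lin_map_scale[OF cyclic_operad.cact_linear[OF cyclic_operad_L _ i] n g] by (simp add: lab3_image h)
  also have "cact L {0, 1, 2} 0 (lab3 1 0 2) (gg ?v 0 1 2) = gg ?v 1 0 2"
    using gg_act[OF cl d(3) i] by simp
  also have "?n (gg ?v 1 0 2) = gg ?v 0 1 2"
    unfolding s1 using g by (simp add: module_minus[OF M.module_axioms])
  finally show ?thesis using cl by (simp add: tri_def)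
qed

text \<open>\<open>lie_equiv\<close> presupposes antisymmetry, which is available on either side
  through \<open>skew_iff\<close>; \<open>tri_diff\<close> handles the differential.\<close>

theorem Lie_BiLie:
  assumes "tri v (h BProd) (h BCoprod)"
  shows "csat K (Lie_pres K) L (\<lambda>_. v) \<longleftrightarrow> dsat K (BiLie_pres K) P h"
proof -
  \<comment> \<open>By cyclic invariance the second antisymmetry relation of \<open>Lie\<close>
    coincides with the first.\<close>
  have rot: "gg v 0 2 1 = gg v 1 0 2" by (rule gg_rot[OF assms]) auto
  have J: "ccomp L {1, 2, 4} 0 4 {5, 3, 0} 0 5 (gg v 1 2 4) (gg v 5 3 0) \<oplus>\<^bsub>csp L {1, 2, 3, 0} 0\<^esub>
    (ccomp L {2, 3, 4} 0 4 {5, 1, 0} 0 5 (gg v 2 3 4) (gg v 5 1 0) \<oplus>\<^bsub>csp L {1, 2, 3, 0} 0\<^esub>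
     ccomp L {3, 1, 4} 0 4 {5, 2, 0} 0 5 (gg v 3 1 4) (gg v 5 2 0)) = jacobiator v 4 5 1 2 3 0"
    unfolding jacobiator_def[OF assms] glued_def[OF assms] ..
  show ?thesis
    unfolding csat_Lie dsat_BiLie rot J skew_iff[OF assms] tri_diff[OF assms]
    using tri_closed[OF assms] p_closed[OF assms] c_closed[OF assms] lie_equiv[OF assms] skew_iff[OF assms] by blast
qed

text \<open>Cyclic invariance is part of \<open>tri\<close>, so only the differential and
  associativity have to be translated. The second composite in the associativity relation is first
  rotated into the form of \<open>glued\<close>.\<close>

theorem As_Bal:
  assumes "tri v (h BProd) (h BCoprod)"
  shows "csat K (As_pres K) L (\<lambda>_. v) \<longleftrightarrow> dsat K (Bal_pres K) P h"
proof -
  have "gg v 1 5 0 = gg v 5 0 1" using gg_rot[OF assms, of 1 5 0] by simp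
  moreover have "{1, 5, 0} = {5, 0, 1::nat}" by auto
  ultimately have J: "ccomp L {2, 3, 4} 0 4 {1, 5, 0} 0 5 (gg v 2 3 4) (gg v 1 5 0) = glued v 4 5 2 3 0 1"
    unfolding glued_def[OF assms] by simp
  have J': "ccomp L {1, 2, 4} 0 4 {5, 3, 0} 0 5 (gg v 1 2 4) (gg v 5 3 0) = glued v 4 5 1 2 3 0"
    unfolding glued_def[OF assms] ..
  show ?thesis
    unfolding csat_As dsat_Bal J J' assoc_equiv[OF assms] tri_diff[OF assms]
    using tri_closed[OF assms] p_closed[OF assms] c_closed[OF assms] assms unfolding tri_def by blast
qed

end

section \<open>The isomorphisms\<close>

text \<open>
  A morphism from a cyclic operad generated by one ternary operation of degree 0 to \<open>phi_lower P\<close>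
  amounts to a product and a coproduct in \<open>P\<close>. If the relations correspond under this bijection,
  then the presented dioperad has the universal property of \<open>phi_upper\<close>.
\<close>

lemma phi_upper_iso_presented:
  fixes K :: "('k, 'r) ring_scheme" and Sc :: "('k, unit) cyc_pres" and Sd :: "('k, biop) dio_pres"
  defines "Q \<equiv> cyc_presented K Sc" and "D \<equiv> dio_presented K Sd"
  defines "U \<equiv> phi_upper K Q"
  assumes K: "field K"
    and Sc: "cgens Sc = {()}" "carity Sc () = ({0, 1, 2}, 0)"
    and Sd: "dgens Sd = {BProd, BCoprod}" "darity Sd = bi_arity"
    and sat_D: "\<And>v h. dioperad.tri K D v (h BProd) (h BCoprod) \<Longrightarrow>
      csat K Sc (phi_lower K D) (\<lambda>_. v) \<longleftrightarrow> dsat K Sd D h"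
    and sat_U: "\<And>v h. dioperad.tri K U v (h BProd) (h BCoprod) \<Longrightarrow>
      csat K Sc (phi_lower K U) (\<lambda>_. v) \<longleftrightarrow> dsat K Sd U h"
    and tri_U: "\<And>h. csat K Sc (phi_lower K U) h \<Longrightarrow> \<exists>p c. dioperad.tri K U (h ()) p c"
  shows "dio_iso K U D"
proof -
  note [simp del] = One_nat_def
  interpret Q: cyclic_operad K Q unfolding Q_def by (rule cyclic_operad_presented[OF K])
  interpret D: dioperad K D unfolding D_def by (rule dioperad_presented[OF K])
  interpret U: dioperad K U unfolding U_def by (rule dioperad_phi_upper[OF K])
  note LD = D.phi_lower_cyclic_operad and LU = U.phi_lower_cyclic_operad
  have PD: "dioperad K D" and PU: "dioperad K U" by unfold_locales
  have b: "biflags {0} {1, 2}" "biflags {1, 2} {0}" by (auto simp: biflags_def)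
  have gen_c: "cwt K Sc {0, 1, 2} 0 (CGen ())" by (rule cwt.wt_gen) (simp_all add: Sc)
  have gen_d: "dwt K Sd {0} {1, 2} 0 (DGen BProd)" "dwt K Sd {1, 2} {0} 0 (DGen BCoprod)"
    using b by (auto intro!: dwt.wt_gen simp: Sd bi_arity_def)
  define \<gamma> where "\<gamma> = ccls K Sc (CGen ())"
  have \<gamma>: "\<gamma> \<in> carrier (csp Q {0, 1, 2} 0)"
    unfolding Q_def \<gamma>_def by (rule ccls_closed[OF gen_c])
  \<comment> \<open>The generators of \<open>D\<close>, regarded as values of the identity morphism,
    form a model of its own presentation.\<close>
  define h0 where "h0 = dgen_val K Sd (\<lambda>A B n x :: ('k, biop) dterm set. x)"
  have h0: "h0 BProd = dcls K Sd (DGen BProd)" "h0 BCoprod = dcls K Sd (DGen BCoprod)"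
    by (simp_all add: h0_def dgen_val_def)
  have sat0: "dsat K Sd D h0"
    unfolding h0_def by (rule dio_hom_dsat[OF PD]) (unfold D_def, rule dio_hom_id)
  have "h0 BProd \<in> D.dprods" "h0 BCoprod \<in> D.dcoprods"
    unfolding h0 D_def by (rule dcls_closed[OF gen_d(1)], rule dcls_closed[OF gen_d(2)])
  then obtain v where v: "D.tri v (h0 BProd) (h0 BCoprod)" using D.tri_exists by blast
  then have sat_v: "csat K Sc (phi_lower K D) (\<lambda>_. v)" using sat_D sat0 by blast
  \<comment> \<open>The morphism from \<open>Q\<close> to \<open>phi_lower D\<close> with the
    generating product and coproduct of \<open>D\<close> as components; \<open>sat_D\<close> makes
    \<open>v\<close> a model of the relations of \<open>Q\<close>.\<close>
  define f where "f = cyc_lift Sc (phi_lower K D) (\<lambda>_. v)"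
  have f: "cyc_hom K Q (phi_lower K D) f"
    unfolding Q_def f_def by (rule cyc_lift_hom[OF LD sat_v])
  have f_gen: "f {0, 1, 2} 0 \<gamma> = v"
    unfolding f_def \<gamma>_def by (simp add: cyc_lift_ccls[OF LD sat_v gen_c])
  have unit: "cyc_hom K Q (phi_lower K U) (phi_unit K Q)"
    unfolding U_def by (rule Q.phi_unit_hom)
  define u where "u = phi_unit K Q {0, 1, 2} 0 \<gamma>"
  have u: "cgen_val K Sc (phi_unit K Q) = (\<lambda>_. u)"
    by (rule ext) (simp add: cgen_val_def u_def \<gamma>_def Sc)
  \<comment> \<open>The unit is a morphism, so its value at the generator satisfies the relations of
    \<open>Q\<close>. By \<open>sat_U\<close> its product \<open>p\<close> and coproduct
    \<open>c\<close> then satisfy those of \<open>D\<close>, which gives \<open>G\<close>.\<close>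
  have sat_u: "csat K Sc (phi_lower K U) (\<lambda>_. u)"
    using cyc_hom_csat[OF LU unit[unfolded Q_def], folded Q_def] unfolding u .
  from tri_U[OF this] obtain p c where pc: "U.tri u p c" by blast
  define h where "h = (\<lambda>g. case g of BProd \<Rightarrow> p | BCoprod \<Rightarrow> c)"
  have "dsat K Sd U h" using sat_U[of u h] pc sat_u by (simp add: h_def)
  note h = this
  define G where "G = dio_lift Sd U h"
  have G: "dio_hom K D U G" unfolding G_def D_def by (rule dio_lift_hom[OF PU h])
  have G_gen: "G A B n (h0 BProd) = p" "G A B n (h0 BCoprod) = c" for A B n
    using dio_lift_dcls[OF PU h gen_d(1)] dio_lift_dcls[OF PU h gen_d(2)] by (simp_all add: G_def h0 h_def)
  obtain F where F: "dio_hom K U D F"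
    and F_unit: "\<And>I n x. finite I \<Longrightarrow> x \<in> carrier (csp Q I n) \<Longrightarrow>
      phi_lower_map F I n (phi_unit K Q I n x) = f I n x"
    using Q.phi_upper_universal_exists[OF PD f] unfolding U_def by blast
  \<comment> \<open>Naturality: \<open>F\<close> carries the ternary element \<open>u\<close> to
    \<open>v\<close>, hence the product and coproduct of \<open>u\<close> to the generators of
    \<open>D\<close>.\<close>
  have "D.tri v (F {0} {1, 2} 0 p) (F {1, 2} {0} 0 c)"
    using tri_natural[OF PU PD F pc] F_unit[OF _ \<gamma>] f_gen by (simp add: u_def)
  with v have F_gen: "F {0} {1, 2} 0 p = h0 BProd" "F {1, 2} {0} 0 c = h0 BCoprod"
    unfolding D.tri_def by simp_all
  define GF where "GF = (\<lambda>A B n x. G A B n (F A B n x))"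
  have GF: "dio_hom K U U GF" unfolding GF_def by (rule dio_hom_compose[OF PU F G])
  have "U.tri (phi_lower_map GF {0, 1, 2} 0 u) p c"
    using tri_natural[OF PU PU GF pc] by (simp add: GF_def F_gen G_gen)
  \<comment> \<open>\<open>GF\<close> fixes \<open>p\<close> and \<open>c\<close>, and these
    determine \<open>u\<close>.\<close>
  then have GF_u: "phi_lower_map GF {0, 1, 2} 0 u = u" by (rule U.tri_unique[OF _ pc])
  \<comment> \<open>Two morphisms out of the presented \<open>Q\<close> that agree at its generator
    agree everywhere.\<close>
  have unit_GF: "phi_lower_map GF I n (phi_unit K Q I n x) = phi_unit K Q I n x"
    if "x \<in> carrier (csp Q I n)" for I n x
  proof (rule cyc_hom_eqI[OF LU _ unit[unfolded Q_def] _ that[unfolded Q_def], folded Q_def])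
    show "cyc_hom K Q (phi_lower K U) (\<lambda>I n x. phi_lower_map GF I n (phi_unit K Q I n x))"
      by (rule cyc_hom_compose[OF unit phi_lower_map_hom[OF PU PU GF]])
    fix g :: unit and I :: "nat set" and n :: int
    assume "carity Sc g = (I, n)"
    then show "phi_lower_map GF I n (phi_unit K Q I n (ccls K Sc (CGen g))) = phi_unit K Q I n (ccls K Sc (CGen g))"
      using GF_u by (simp add: Sc u_def \<gamma>_def)
  qed
  have map_id: "phi_lower_map (\<lambda>A B n x. x) I n y = y" if "y \<in> carrier (csp (phi_lower K U) I n)" for I n y
    using that by (auto simp: phi_lower_map_def phi_lower_carrier fun_eq_iff extensional_def restrict_def)
  have inv_U: "G A B n (F A B n x) = x" if "x \<in> carrier (dsp U A B n)" for A B n x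
  proof -
    \<comment> \<open>\<open>GF\<close> and the identity have the same composite with the unit, so
      the uniqueness part of the universal property identifies them.\<close>
    have "GF A B n x = (\<lambda>A B n x. x) A B n x"
    proof (rule Q.phi_upper_universal_unique[OF PU, folded U_def])
      show "dio_hom K U U GF" "dio_hom K U U (\<lambda>A B n x. x)" by (rule GF, rule dio_hom_id)
      show "x \<in> carrier (dsp U A B n)" by (rule that)
      fix I n y assume I: "finite I" and y: "y \<in> carrier (csp Q I n)"
      show "phi_lower_map GF I n (phi_unit K Q I n y) =
        phi_lower_map (\<lambda>A B n x. x) I n (phi_unit K Q I n y)"
        using unit_GF[OF y] map_id[OF cyc_hom_closed[OF unit I y]] by simp
    qed
    then show ?thesis by (simp add: GF_def)
  qed
  have inv_D: "F A B n (G A B n x) = x" if "x \<in> carrier (dsp D A B n)" for A B n x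
  \<comment> \<open>In the other order it suffices to test the generators of \<open>D\<close>, which
    \<open>G\<close> sends to \<open>p\<close> and \<open>c\<close> and \<open>F\<close> sends
    back.\<close>
  proof (rule dio_hom_eqI[OF PD _ _ _ that[unfolded D_def]])
    show "dio_hom K (dio_presented K Sd) D (\<lambda>A B n x. F A B n (G A B n x))"
      using dio_hom_compose[OF PD G F] by (simp add: D_def)
    show "dio_hom K (dio_presented K Sd) D (\<lambda>A B n x. x)"
      unfolding D_def by (rule dio_hom_id)
    fix g A B n assume "g \<in> dgens Sd" "darity Sd g = (A, B, n)"
    then show "F A B n (G A B n (dcls K Sd (DGen g))) = dcls K Sd (DGen g)"
      using F_gen G_gen by (cases g) (auto simp: Sd bi_arity_def h0)
  qed
  show ?thesis
    unfolding dio_iso_def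
  proof (intro exI[of _ F] conjI allI impI)
    show "dio_hom K U D F" by (rule F)
    fix A B :: "nat set" and n :: int assume AB: "biflags A B"
    show "bij_betw (F A B n) (carrier (dsp U A B n)) (carrier (dsp D A B n))"
      by (rule bij_betwI[where g = "G A B n"])
        (auto intro: dio_hom_closed[OF F AB] dio_hom_closed[OF G AB] simp: inv_U inv_D)
  qed
qed

theorem phi_upper_Lie:
  assumes "field K"
  shows "dio_iso K (phi_upper K (Lie K)) (BiLie K)"
  unfolding Lie_eq BiLie_eq
  using dioperad.Lie_BiLie[OF dioperad_presented[OF assms]] dioperad.Lie_BiLie[OF dioperad_phi_upper[OF assms]]
    dioperad.Lie_tri[OF dioperad_phi_upper[OF assms]]
  by (intro phi_upper_iso_presented assms pres_simps) blast+

theorem phi_upper_As: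
  assumes "field K"
  shows "dio_iso K (phi_upper K (As K)) (Bal K)"
  unfolding As_eq Bal_eq
  using dioperad.As_Bal[OF dioperad_presented[OF assms]] dioperad.As_Bal[OF dioperad_phi_upper[OF assms]]
    dioperad.As_tri[OF dioperad_phi_upper[OF assms]]
  by (intro phi_upper_iso_presented assms pres_simps) blast+

text \<open>The type variables \<open>'u\<close> and \<open>'c\<close> can be instantiated freely in
  the finished theorem, so the universal property may be tested on dioperads over any carrier type,
  in particular on \<open>BiLie K\<close> and \<open>Bal K\<close>.\<close>

theorem lemma9p6:
  fixes K :: "('k, 'r) ring_scheme"
  assumes "field K" and "char_zero K"
  shows "(\<forall>P :: ('k, 'u) dio_data. dioperad K P \<longrightarrow> cyclic_operad K (phi_lower K P)) \<and>
    (\<forall>Q :: ('k, 'c) cyc_data. cyclic_operad K Q \<longrightarrow>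
       dioperad K (phi_upper K Q) \<and>
       cyc_hom K Q (phi_lower K (phi_upper K Q)) (phi_unit K Q) \<and>
       (\<forall>P :: ('k, 'u) dio_data. dioperad K P \<longrightarrow>
          universal_for K Q (phi_upper K Q) (phi_unit K Q) P)) \<and>
    (cyclic_operad K (Lie K) \<and> dioperad K (BiLie K) \<and>
     dio_iso K (phi_upper K (Lie K)) (BiLie K)) \<and>
    (cyclic_operad K (As K) \<and> dioperad K (Bal K) \<and>
     dio_iso K (phi_upper K (As K)) (Bal K))"
proof (intro conjI allI impI)
  show "dio_iso K (phi_upper K (Lie K)) (BiLie K)" "dio_iso K (phi_upper K (As K)) (Bal K)"
    by (rule phi_upper_Lie[OF assms(1)], rule phi_upper_As[OF assms(1)])
  show "cyclic_operad K (Lie K)" "cyclic_operad K (As K)"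
    unfolding Lie_eq As_eq by (rule cyclic_operad_presented[OF assms(1)])+
  show "dioperad K (BiLie K)" "dioperad K (Bal K)"
    unfolding BiLie_eq Bal_eq by (rule dioperad_presented[OF assms(1)])+
qed (rule dioperad.phi_lower_cyclic_operad dioperad_phi_upper[OF assms(1)]
    cyclic_operad.phi_unit_hom cyclic_operad.phi_upper_universal; assumption)+

end
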